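(* Let $T>0$ and let the weight functions $\phi$, $\theta$, $s=\lambda\theta$ (depending on parameters $\lambda>1$, $\mu>1$, $0<\delta<\frac12$) be as in the context. There exists a positive constant $\mu_0$ such that for any $\mu>\mu_0$ one can find constants $\varepsilon_0$ with $0<\varepsilon_0\le1$, $h_0>0$, a sufficiently large $\lambda_0\ge1$, and a constant $C>0$ (all independent of $\lambda,h,\delta,w,f,g$), such that for all $\lambda\ge\lambda_0$, all $0<\delta<\frac12$ and all $h=1/(N+1)\le h_0$ with $\lambda h(\delta T^2)^{-1}\le\varepsilon_0$, it holds that $$\begin{aligned} &\mathbb{E}\int_0^T\!\!\int_{\mathcal{M}}s^3e^{2s\phi}w^2\,dt+\mathbb{E}\int_0^T\!\!\int_{\mathcal{M}^*}s\,e^{2s\phi}|D_hw|^2\,dt\\ &\le C\Big(\mathbb{E}\int_0^T\!\!\int_{\omega\cap\mathcal{M}}s^3e^{2s\phi}w^2\,dt+\mathbb{E}\int_0^T\!\!\int_{\mathcal{M}}s^2e^{2s\phi}|g|^2\,dt+\mathbb{E}\int_0^T\!\!\int_{\mathcal{M}}e^{2s\phi}|f|^2\,dt\\ &\qquad+h^{-2}\,\mathbb{E}\int_{\mathcal{M}}e^{2s\phi}|w|^2\Big|_{t=0}+h^{-2}\,\mathbb{E}\int_{\mathcal{M}}e^{2s\phi}|w|^2\Big|_{t=T}\Big) \end{aligned}$$ for all $w\in L^2_{\mathbb{F}}(\Omega;C([0,T];L^2_h(\overline{\mathcal{M}})))$ satisfying $dw+D_h^2w\,dt=f\,dt+g\,dB(t)$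 on $\mathcal{M}\times(0,T)$, with $f,g\in L^2_{\mathbb{F}}(0,T;L^2_h(\mathcal{M}))$, and $w=0$ on $\partial\mathcal{M}=\{0,1\}$.
   Context: **Probability.** $(\Omega,\mathcal{F},\{\mathcal{F}_t\}_{t\ge0},\mathcal{P})$ is a complete filtered probability space carrying a one-dimensional standard Brownian motion $B(\cdot)$, and $\{\mathcal{F}_t\}$ is the natural filtration of $B$ augmented by the $\mathcal{P}$-null sets. For a Banach space $\mathcal{H}$, $L^2_{\mathbb{F}}(0,T;\mathcal{H})$ is the space of $\mathcal{H}$-valued adapted processes $X$ with $\mathbb{E}|X|^2_{L^2(0,T;\mathcal{H})}<\infty$, and $L^2_{\mathbb{F}}(\Omega;C([0,T];\mathcal{H}))$ is the space of $\mathcal{H}$-valued adapted continuous processes with $\mathbb{E}|X|^2_{C([0,T];\mathcal{H})}<\infty$. **Mesh.** For $N\in\mathbb{N}$, $h=1/(N+1)$, $x_i=ih$ ($i=0,\dots,N+1$), $\mathcal{M}=\{x_1,\dots,x_N\}$, $\overline{\mathcal{M}}=\{x_0,\dots,x_{N+1}\}$, $\partial\mathcal{M}=\{0,1\}$, and the dual mesh is $\mathcal{M}^*=\{x_i+\frac h2: i=0,\dots,N\}$. For $w$ on $\overline{\mathcal{M}}$, $D_hw(x)=h^{-1}\big(w(x+\frac h2)-w(x-\frac h2)\big)$ for $x\in\mathcal{M}^*$, and $D_h^2w(x)=h^{-2}\big(w(x+h)-2w(x)+w(x-h)\big)$ for $x\in\mathcal{M}$. For a finite set $\mathcal{W}$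 of points, $\int_{\mathcal{W}}u:=h\sum_{x\in\mathcal{W}}u(x)$, and $L^2_h(\mathcal{W})$ is the space of real functions on $\mathcal{W}$ with inner product $\int_{\mathcal{W}}uv$. **Weights.** $\omega\subset(0,1)$ is a given nonempty open set, $\omega_0$ is a nonempty open set with $\overline{\omega_0}\subseteq\omega$, $\widetilde G$ is a smooth open connected neighborhood of $[0,1]$, and $\psi\in C^p(\widetilde G)$ ($p$ sufficiently large) is a fixed function with $$\psi>0\ \text{in }\widetilde G,\qquad|\partial_x\psi|>0\ \text{in }\widetilde G\setminus\omega_0,\qquad(\partial_x\psi)(0)>0,\qquad(\partial_x\psi)(1)<0$$ (such $\psi$ exists). For $\lambda>1$, $\mu>1$, $0<\delta<\frac12$, set $$\phi(x)=e^{\mu\psi(x)}-e^{2\mu|\psi|_\infty},\qquad\theta(t)=\frac{1}{(t+\delta T)(T+\delta T-t)},\qquad s(t)=\lambda\theta(t),$$ where $|\psi|_\infty$ is the sup norm of $\psi$. *)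

theory Defs
  imports "HOL-Probability.Probability"
begin

section \<open>Brownian motion and its augmented natural filtration\<close>

locale standard_brownian_motion = prob_space M for M :: "'a measure" +
  fixes B :: "real \<Rightarrow> 'a \<Rightarrow> real"
  assumes random_variable_B: "\<And>t. 0 \<le> t \<Longrightarrow> B t \<in> borel_measurable M"
    and B_zero: "AE \<omega> in M. B 0 \<omega> = 0"
    and continuous_paths: "AE \<omega> in M. continuous_on {0..} (\<lambda>t. B t \<omega>)"
    and normal_increments: "\<And>s t. 0 \<le> s \<Longrightarrow> s < t \<Longrightarrow>
      distributed M lborel (\<lambda>\<omega>. B t \<omega> - B s \<omega>) (normal_density 0 (sqrt (t - s)))"
    and indep_increments: "\<And>(\<tau> :: nat \<Rightarrow> real) n. 0 \<le> \<tau> 0 \<Longrightarrow> (\<And>k. k < n \<Longrightarrow> \<tau> k < \<tau> (Suc k)) \<Longrightarrow>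
      indep_vars (\<lambda>_. borel) (\<lambda>k \<omega>. B (\<tau> (Suc k)) \<omega> - B (\<tau> k) \<omega>) {..<n}"

text \<open>Only the \<open>\<sigma>\<close>-algebra of \<open>augmented_filtration M B t\<close> is relevant; it carries no
  measure. \<open>M\<close> is assumed complete wherever this is used, so \<open>null_sets M\<close> contains
  every negligible set.\<close>

definition augmented_filtration :: "'a measure \<Rightarrow> (real \<Rightarrow> 'a \<Rightarrow> real) \<Rightarrow> real \<Rightarrow> 'a measure" where
  "augmented_filtration M B t = sigma (space M)
     ({B r -` A \<inter> space M | r A. 0 \<le> r \<and> r \<le> t \<and> A \<in> sets borel} \<union> null_sets M)"

section \<open>The Ito integral\<close>

text \<open>The simple process \<open>\<Sum>k<n. \<xi> k * 1_(\<tau> k, \<tau> (k+1)]\<close> is represented by \<open>n\<close>, \<open>\<tau>\<close> and \<open>\<xi>\<close>.\<close>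

definition simple_adapted ::
  "'a measure \<Rightarrow> (real \<Rightarrow> 'a \<Rightarrow> real) \<Rightarrow> real \<Rightarrow> nat \<Rightarrow> (nat \<Rightarrow> real) \<Rightarrow> (nat \<Rightarrow> 'a \<Rightarrow> real) \<Rightarrow> bool" where
  "simple_adapted M B T n \<tau> \<xi> \<longleftrightarrow>
     0 \<le> \<tau> 0 \<and> \<tau> n \<le> T \<and> (\<forall>k<n. \<tau> k \<le> \<tau> (Suc k)) \<and>
     (\<forall>k<n. \<xi> k \<in> borel_measurable (augmented_filtration M B (\<tau> k)) \<and> bounded (\<xi> k ` space M))"

definition simple_process :: "nat \<Rightarrow> (nat \<Rightarrow> real) \<Rightarrow> (nat \<Rightarrow> 'a \<Rightarrow> real) \<Rightarrow> real \<Rightarrow> 'a \<Rightarrow> real" where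
  "simple_process n \<tau> \<xi> t \<omega> = (\<Sum>k<n. \<xi> k \<omega> * indicator {\<tau> k<..\<tau> (Suc k)} t)"

definition simple_ito ::
  "(real \<Rightarrow> 'a \<Rightarrow> real) \<Rightarrow> nat \<Rightarrow> (nat \<Rightarrow> real) \<Rightarrow> (nat \<Rightarrow> 'a \<Rightarrow> real) \<Rightarrow> real \<Rightarrow> 'a \<Rightarrow> real" where
  "simple_ito B n \<tau> \<xi> t \<omega> = (\<Sum>k<n. \<xi> k \<omega> * (B (min t (\<tau> (Suc k))) \<omega> - B (min t (\<tau> k)) \<omega>))"

text \<open>\<open>has_ito_integral M B T g J\<close>: for every \<open>t\<close> in \<open>[0,T]\<close>, \<open>J t\<close> is (a version of) the Ito
  integral of \<open>g\<close> over \<open>[0,t]\<close>, that is, the limit in \<open>L\<^sup>2(\<Omega>)\<close> of the integrals of simple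
  processes that converge to \<open>g\<close> in \<open>L\<^sup>2(\<Omega> \<times> (0,T))\<close>. By the Ito isometry \<open>J t\<close> is
  almost surely unique and independent of the approximating sequence.\<close>

definition has_ito_integral ::
  "'a measure \<Rightarrow> (real \<Rightarrow> 'a \<Rightarrow> real) \<Rightarrow> real \<Rightarrow> (real \<Rightarrow> 'a \<Rightarrow> real) \<Rightarrow> (real \<Rightarrow> 'a \<Rightarrow> real) \<Rightarrow> bool" where
  "has_ito_integral M B T g J \<longleftrightarrow>
     (\<forall>t\<in>{0..T}. J t \<in> borel_measurable M) \<and>
     (\<exists>(n :: nat \<Rightarrow> nat) (\<tau> :: nat \<Rightarrow> nat \<Rightarrow> real) (\<xi> :: nat \<Rightarrow> nat \<Rightarrow> 'a \<Rightarrow> real).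
        (\<forall>m. simple_adapted M B T (n m) (\<tau> m) (\<xi> m)) \<and>
        (\<lambda>m. \<integral>\<^sup>+\<omega>. (\<integral>\<^sup>+t\<in>{0..T}. ennreal ((simple_process (n m) (\<tau> m) (\<xi> m) t \<omega> - g t \<omega>)\<^sup>2) \<partial>lborel) \<partial>M)
           \<longlonglongrightarrow> 0 \<and>
        (\<forall>t\<in>{0..T}.
           (\<lambda>m. \<integral>\<^sup>+\<omega>. ennreal ((simple_ito B (n m) (\<tau> m) (\<xi> m) t \<omega> - J t \<omega>)\<^sup>2) \<partial>M) \<longlonglongrightarrow> 0))"

section \<open>The mesh and the difference operators\<close>

definition mesh_size :: "nat \<Rightarrow> real" where
  "mesh_size N = 1 / (real N + 1)"

definition mesh :: "nat \<Rightarrow> real set" where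
  "mesh N = (\<lambda>i. real i * mesh_size N) ` {1..N}"

definition closed_mesh :: "nat \<Rightarrow> real set" where
  "closed_mesh N = (\<lambda>i. real i * mesh_size N) ` {0..N + 1}"

definition dual_mesh :: "nat \<Rightarrow> real set" where
  "dual_mesh N = (\<lambda>i. real i * mesh_size N + mesh_size N / 2) ` {0..N}"

definition Dh :: "real \<Rightarrow> (real \<Rightarrow> real) \<Rightarrow> real \<Rightarrow> real" where
  "Dh h u x = (u (x + h / 2) - u (x - h / 2)) / h"

definition Dh2 :: "real \<Rightarrow> (real \<Rightarrow> real) \<Rightarrow> real \<Rightarrow> real" where
  "Dh2 h u x = (u (x + h) - 2 * u x + u (x - h)) / h\<^sup>2"

definition mesh_integral :: "real \<Rightarrow> real set \<Rightarrow> (real \<Rightarrow> real) \<Rightarrow> real" where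
  "mesh_integral h W u = h * (\<Sum>x\<in>W. u x)"

section \<open>Spaces of processes\<close>

text \<open>A process with values in the functions on a finite set \<open>W\<close> of points is a function
  \<open>X t \<omega> x\<close>, of which only the values at \<open>x \<in> W\<close> matter. Since the state space is finite
  dimensional, measurability and path continuity are componentwise.\<close>

definition L2F ::
  "'a measure \<Rightarrow> (real \<Rightarrow> 'a \<Rightarrow> real) \<Rightarrow> real \<Rightarrow> real \<Rightarrow> real set \<Rightarrow> (real \<Rightarrow> 'a \<Rightarrow> real \<Rightarrow> real) set" where
  "L2F M B T h W = {X.
     (\<forall>x\<in>W. (\<lambda>(t, \<omega>). X t \<omega> x) \<in> borel_measurable (restrict_space borel {0..T} \<Otimes>\<^sub>M M)) \<and>
     (\<forall>x\<in>W. \<forall>t\<in>{0..T}. (\<lambda>\<omega>. X t \<omega> x) \<in> borel_measurable (augmented_filtration M B t)) \<and>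
     (\<integral>\<^sup>+\<omega>. (\<integral>\<^sup>+t\<in>{0..T}. ennreal (mesh_integral h W (\<lambda>x. (X t \<omega> x)\<^sup>2)) \<partial>lborel) \<partial>M) < \<infinity>}"

definition L2F_C ::
  "'a measure \<Rightarrow> (real \<Rightarrow> 'a \<Rightarrow> real) \<Rightarrow> real \<Rightarrow> real \<Rightarrow> real set \<Rightarrow> (real \<Rightarrow> 'a \<Rightarrow> real \<Rightarrow> real) set" where
  "L2F_C M B T h W = {X.
     (\<forall>x\<in>W. \<forall>t\<in>{0..T}. (\<lambda>\<omega>. X t \<omega> x) \<in> borel_measurable (augmented_filtration M B t)) \<and>
     (AE \<omega> in M. \<forall>x\<in>W. continuous_on {0..T} (\<lambda>t. X t \<omega> x)) \<and>
     (\<integral>\<^sup>+\<omega>. (SUP t\<in>{0..T}. ennreal (mesh_integral h W (\<lambda>x. (X t \<omega> x)\<^sup>2))) \<partial>M) < \<infinity>}"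

section \<open>The semi-discrete stochastic equation\<close>

text \<open>\<open>dw + D\<^sub>h\<^sup>2 w dt = f dt + g dB\<close> at every interior mesh point, in integrated form.\<close>

definition solves_equation ::
  "'a measure \<Rightarrow> (real \<Rightarrow> 'a \<Rightarrow> real) \<Rightarrow> real \<Rightarrow> nat \<Rightarrow>
   (real \<Rightarrow> 'a \<Rightarrow> real \<Rightarrow> real) \<Rightarrow> (real \<Rightarrow> 'a \<Rightarrow> real \<Rightarrow> real) \<Rightarrow> (real \<Rightarrow> 'a \<Rightarrow> real \<Rightarrow> real) \<Rightarrow> bool" where
  "solves_equation M B T N w f g \<longleftrightarrow>
     (\<forall>x\<in>mesh N. \<exists>J. has_ito_integral M B T (\<lambda>t \<omega>. g t \<omega> x) J \<and>
        (\<forall>t\<in>{0..T}. AE \<omega> in M.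
           w t \<omega> x = w 0 \<omega> x + (LINT r:{0..t}|lborel. f r \<omega> x - Dh2 (mesh_size N) (w r \<omega>) x) + J t \<omega>))"

definition expected_time_integral ::
  "'a measure \<Rightarrow> real \<Rightarrow> (real \<Rightarrow> 'a \<Rightarrow> real) \<Rightarrow> real" where
  "expected_time_integral M T F = (\<integral>\<omega>. (LINT t:{0..T}|lborel. F t \<omega>) \<partial>M)"

section \<open>The weights\<close>

text \<open>For open \<open>S\<close>, this is \<open>f \<in> C\<^sup>p(S)\<close>.\<close>

definition Cp_on :: "nat \<Rightarrow> (real \<Rightarrow> real) \<Rightarrow> real set \<Rightarrow> bool" where
  "Cp_on p f S \<longleftrightarrow>
     (\<forall>k<p. (deriv ^^ k) f differentiable_on S) \<and> continuous_on S ((deriv ^^ p) f)"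

text \<open>Boundedness of \<open>\<psi>\<close> on \<open>G\<close> is what makes the sup norm occurring in \<open>phi\<close> finite. An open
  connected subset of the line is an interval, so smoothness of \<open>G\<close> is automatic.\<close>

definition admissible_psi :: "nat \<Rightarrow> real set \<Rightarrow> real set \<Rightarrow> (real \<Rightarrow> real) \<Rightarrow> bool" where
  "admissible_psi p U0 G \<psi> \<longleftrightarrow>
     open G \<and> connected G \<and> {0..1} \<subseteq> G \<and>
     Cp_on p \<psi> G \<and> bounded (\<psi> ` G) \<and>
     (\<forall>x\<in>G. \<psi> x > 0) \<and> (\<forall>x\<in>G - U0. \<bar>deriv \<psi> x\<bar> > 0) \<and>
     deriv \<psi> 0 > 0 \<and> deriv \<psi> 1 < 0"

definition phi :: "real set \<Rightarrow> (real \<Rightarrow> real) \<Rightarrow> real \<Rightarrow> real \<Rightarrow> real" where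
  "phi G \<psi> \<mu> x = exp (\<mu> * \<psi> x) - exp (2 * \<mu> * (SUP y\<in>G. \<bar>\<psi> y\<bar>))"

definition theta :: "real \<Rightarrow> real \<Rightarrow> real \<Rightarrow> real" where
  "theta T \<delta> t = 1 / ((t + \<delta> * T) * (T + \<delta> * T - t))"

end

(* Write r = exp (s phi), v = r w, and let S and A be the symmetric and the antisymmetric part of the
   conjugated operator r D_h^2 (1/r) - s' phi. Since the conjugation has entries exp (-s q) and exp (s q), where q
   is the increment of phi over an edge, S and A have the entries cosh (s q) / h^2 and -sinh (s q) / h^2. The
   product rule applied to <S v, v> gives
     E <S v, v> at T - E <S v, v> at 0 = E int (<S' v, v> + 2 <S v, r f> - 2 |S v|^2 - 2 <S v, A v> + <S (r g), r g>).
   The commutator 2 <S v, A v> equals 4 s^3 phi_x^2 phi_xx v^2 + 4 s phi_xx |D_h v|^2 up to lower order terms. It is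
   positive off omega_0 for large mu; on omega_0 the gradient is recovered from |S v|^2 and the local v^2 by a cutoff.
   The endpoint terms cost h^(-2) because S is bounded by a multiple of h^(-2), and <S y, y> <= C s^2 |y|^2 yields
   the g term. As <S v, v> is a quadratic form with C^1 deterministic coefficients, the only stochastic calculus
   required is the equation satisfied by the second moments E (w_i w_j). *)
theory Submission
  imports Defs
begin

section \<open>Hyperbolic functions and summation by parts\<close>

text \<open>On the mesh the product s h is small but never zero, so its powers cannot be discarded
  as in a continuum expansion. The conjugation is therefore kept exact: addition theorems for sinh
  and cosh replace the Leibniz rule, and analysis enters only through the sizes of the first three
  differences of phi. All smallness is measured by one number \<open>\<eta>\<close> built from K and
  c0: h, s h and 1/s are at most \<open>\<eta>\<close>, while s' and s'' are at most
  \<open>\<eta>\<close> s^2 and \<open>\<eta>\<close> s^3. The deterministic inequality is proved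
  for one time and one path, where the solution is a finite sequence of numbers. Of the two copies
  of |S v|^2 in the energy identity, one absorbs the source f; the other pays for the gradient on
  omega_0 and for the discretisation errors. On the stochastic side the Ito integral is given only
  through L^2 limits at single times, with no joint measurability in time and path. Under time
  integrals it is therefore replaced by the remainder of the equation, which is jointly
  measurable.\<close>

lemma sinh_ge_self: "(x::real) \<le> sinh x" if "0 \<le> x"
proof -
  have "(\<lambda>x. sinh x - x) 0 \<le> (\<lambda>x. sinh x - x) x"
    using that
    by (intro deriv_nonneg_imp_mono[of 0 x "\<lambda>x. sinh x - x" "\<lambda>x. cosh x - 1"])
       (auto intro!: derivative_eq_intros simp: cosh_real_ge_1)
  then show ?thesis by simp
qed

lemma cosh_le_2: "cosh (x::real) \<le> 2" if "\<bar>x\<bar> \<le> 1"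
proof -
  have "exp \<bar>x\<bar> \<le> exp 1" using that by simp
  also have "exp (1::real) \<le> 3" by (rule exp_le)
  finally have "exp \<bar>x\<bar> + exp (-\<bar>x\<bar>) \<le> 3 + 1" by (intro add_mono) auto
  moreover have "2 * cosh x = exp \<bar>x\<bar> + exp (- \<bar>x\<bar>)" using cosh_field_def[of "\<bar>x\<bar>"] by simp
  ultimately show ?thesis by simp
qed

lemma abs_sinh_diff_le: "\<bar>sinh x - sinh y\<bar> \<le> 2 * \<bar>x - y\<bar>" if "\<bar>x\<bar> \<le> 1" "\<bar>y\<bar> \<le> 1" for x y :: real
proof -
  have "norm (sinh x - sinh y) \<le> 2 * norm (x - y)"
    by (rule field_differentiable_bound[of "{-1..1}" sinh cosh])
       (use that cosh_le_2 in \<open>auto intro!: derivative_eq_intros simp: abs_le_iff\<close>)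
  then show ?thesis by simp
qed

lemma abs_sinh_le: "\<bar>sinh x\<bar> \<le> 2 * \<bar>x\<bar>" if "\<bar>x\<bar> \<le> 1" for x :: real
  using abs_sinh_diff_le[of x 0] that by simp

text \<open>The half-angle form reduces the upper and the lower bound on cosh - 1 to linear bounds
  on sinh.\<close>

lemma cosh_minus_1_eq: "cosh x - 1 = 2 * (sinh (x / 2))\<^sup>2" for x :: real
  using cosh_double_cosh[of "x/2"] by (simp add: cosh_square_eq)

lemma cosh_minus_1_ge: "x\<^sup>2 / 2 \<le> cosh x - 1" for x :: real
proof -
  have "\<bar>x / 2\<bar> \<le> \<bar>sinh (x/2)\<bar>"
    using sinh_ge_self[of "\<bar>x / 2\<bar>"] by (metis abs_ge_zero sinh_real_abs)
  then have "(x/2)\<^sup>2 \<le> (sinh (x/2))\<^sup>2" by (simp only: abs_le_square_iff)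
  then show ?thesis by (simp add: cosh_minus_1_eq power2_eq_square)
qed

lemma cosh_minus_1_le: "cosh x - 1 \<le> 2 * x\<^sup>2" if "\<bar>x\<bar> \<le> 1" for x :: real
proof -
  have "\<bar>sinh (x/2)\<bar> \<le> \<bar>x\<bar>" using abs_sinh_le[of "x/2"] that by simp
  then have "(sinh (x/2))\<^sup>2 \<le> x\<^sup>2" by (simp only: abs_le_square_iff)
  then show ?thesis unfolding cosh_minus_1_eq by simp
qed

section \<open>Index shifts and exact discrete identities\<close>

lemma sum_shift_left:
  fixes a :: "nat \<Rightarrow> real" shows "(\<Sum>i<N. a (Suc i)) = (\<Sum>i\<le>N. a i) - a 0"
  by (induction N) simp_all

lemma sum_shift_right:
  fixes a :: "nat \<Rightarrow> real" shows "(\<Sum>i<N. a i) = (\<Sum>i\<le>N. a i) - a N"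
  by (simp flip: lessThan_Suc_atMost)

text \<open>\<open>e\<close> lives on interior nodes and \<open>D\<close> on edges, of which there
  is one more; hence the end values of \<open>e\<close> remain as boundary coefficients.\<close>

lemma summation_by_parts_Suc:
  fixes e D :: "nat \<Rightarrow> real"
  shows "(\<Sum>i<Suc n. e i * (D (Suc i) - D i)) =
    e n * D (Suc n) - e 0 * D 0 - (\<Sum>i<n. (e (Suc i) - e i) * D (Suc i))"
  by (induction n) (simp_all add: algebra_simps)

text \<open>After division by h^4 the left side is twice the pairing of the cosh part with the
  antisymmetric part. Squares are shifted to a common node, and v_{i+2} v_i is left with coefficient
  -2 e_i. If d and d' are the two differences of v adjacent to node i+1 and D is the difference of
  v^2 over an edge, then 2 v_{i+2} v_i = 2 v_{i+1}^2 + (D_{i+1} - D_i) - 2 (d^2 + d'^2) + (d -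
  d')^2. This produces the gradient term with the coefficient e, a second-difference term to be
  treated as an error, and a term that allows summation by parts.\<close>

lemma commutator_identity:
  fixes c \<sigma> e v :: "nat \<Rightarrow> real"
  assumes v0: "v 0 = 0" and vN: "v (Suc N) = 0" and N: "N = Suc n"
    and e: "\<And>i. i < N \<Longrightarrow> e i = c i * \<sigma> (Suc i) - c (Suc i) * \<sigma> i"
  shows "- 2 * (\<Sum>i<N. (c (Suc i) * v (i+2) + c i * v i) * (\<sigma> (Suc i) * v (i+2) - \<sigma> i * v i)) =
     (\<Sum>i<N. (2 * (c (Suc i) * \<sigma> (Suc i) - c i * \<sigma> i) - 2 * e i) * (v (Suc i))\<^sup>2)
   + 2 * c 0 * \<sigma> 0 * (v 1)\<^sup>2 - 2 * c N * \<sigma> N * (v N)\<^sup>2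
   + (\<Sum>i<N. 2 * e i * ((v (i+2) - v (Suc i))\<^sup>2 + (v (Suc i) - v i)\<^sup>2))
   - (\<Sum>i<N. e i * ((v (i+2) - v (Suc i)) - (v (Suc i) - v i))\<^sup>2)
   + (\<Sum>i<n. (e (Suc i) - e i) * ((v (i+2) + v (Suc i)) * (v (i+2) - v (Suc i))))
   + e 0 * (v 1)\<^sup>2 + e n * (v N)\<^sup>2"
proof -
  have 1: "(\<Sum>i<N. c (Suc i) * \<sigma> (Suc i) * (v (i+2))\<^sup>2) = (\<Sum>i<N. c i * \<sigma> i * (v (Suc i))\<^sup>2) - c 0 * \<sigma> 0 * (v 1)\<^sup>2"
    using sum_shift_left[of "\<lambda>i. c i * \<sigma> i * (v (Suc i))\<^sup>2" N] sum_shift_right[of "\<lambda>i. c i * \<sigma> i * (v (Suc i))\<^sup>2" N] vN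
    by simp
  have 2: "(\<Sum>i<N. c i * \<sigma> i * (v i)\<^sup>2) = (\<Sum>i<N. c (Suc i) * \<sigma> (Suc i) * (v (Suc i))\<^sup>2) - c N * \<sigma> N * (v N)\<^sup>2"
    using sum_shift_left[of "\<lambda>i. c i * \<sigma> i * (v i)\<^sup>2" N] sum_shift_right[of "\<lambda>i. c i * \<sigma> i * (v i)\<^sup>2" N] v0
    by simp
  define D where "D i = (v (Suc i))\<^sup>2 - (v i)\<^sup>2" for i
  \<comment> \<open>The difference moves from \<open>D\<close> to \<open>e\<close>, which gains one
    power of h because e is Lipschitz along the mesh; D factors into sum times difference of
    v.\<close>
  have 3: "(\<Sum>i<N. e i * (D (Suc i) - D i)) =
      - e n * (v N)\<^sup>2 - e 0 * (v 1)\<^sup>2 - (\<Sum>i<n. (e (Suc i) - e i) * ((v (i+2) + v (Suc i)) * (v (i+2) - v (Suc i))))"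
    unfolding N summation_by_parts_Suc
    using v0 vN by (simp add: D_def N power2_eq_square algebra_simps)
  have "- 2 * (\<Sum>i<N. (c (Suc i) * v (i+2) + c i * v i) * (\<sigma> (Suc i) * v (i+2) - \<sigma> i * v i))
     = (\<Sum>i<N. - 2 * (c (Suc i) * \<sigma> (Suc i) * (v (i+2))\<^sup>2) + 2 * (c i * \<sigma> i * (v i)\<^sup>2)
           - 2 * e i * (v (Suc i))\<^sup>2
           + 2 * e i * ((v (i+2) - v (Suc i))\<^sup>2 + (v (Suc i) - v i)\<^sup>2)
           - e i * ((v (i+2) - v (Suc i)) - (v (Suc i) - v i))\<^sup>2
           - e i * (D (Suc i) - D i))"
    unfolding sum_distrib_left
  proof (rule sum.cong)
    fix i assume "i \<in> {..<N}"
    then show "- 2 * ((c (Suc i) * v (i+2) + c i * v i) * (\<sigma> (Suc i) * v (i+2) - \<sigma> i * v i)) =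
      - 2 * (c (Suc i) * \<sigma> (Suc i) * (v (i+2))\<^sup>2) + 2 * (c i * \<sigma> i * (v i)\<^sup>2)
           - 2 * e i * (v (Suc i))\<^sup>2
           + 2 * e i * ((v (i+2) - v (Suc i))\<^sup>2 + (v (Suc i) - v i)\<^sup>2)
           - e i * ((v (i+2) - v (Suc i)) - (v (Suc i) - v i))\<^sup>2
           - e i * (D (Suc i) - D i)"
      by (simp add: e D_def power2_eq_square algebra_simps)
  qed simp
  also have "\<dots> = - 2 * (\<Sum>i<N. c (Suc i) * \<sigma> (Suc i) * (v (i+2))\<^sup>2) + 2 * (\<Sum>i<N. c i * \<sigma> i * (v i)\<^sup>2)
      - (\<Sum>i<N. 2 * e i * (v (Suc i))\<^sup>2)
      + (\<Sum>i<N. 2 * e i * ((v (i+2) - v (Suc i))\<^sup>2 + (v (Suc i) - v i)\<^sup>2))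
      - (\<Sum>i<N. e i * ((v (i+2) - v (Suc i)) - (v (Suc i) - v i))\<^sup>2)
      - (\<Sum>i<N. e i * (D (Suc i) - D i))"
    by (simp only: sum.distrib sum_subtractf sum_distrib_left)
  finally show ?thesis
    unfolding 1 2 3
    by (simp add: sum_subtractf left_diff_distrib sum_distrib_left mult.assoc)
qed

text \<open>This is the multiplier \<open>\<zeta>\<close> v tested against the discrete Laplacian.
  On each edge 2 (\<zeta>_i v_i - \<zeta>_{i+1} v_{i+1}) splits into a part with the mean of the
  cutoff, giving the localized gradient, and a part with its difference, which is controlled by the
  Lipschitz constant.\<close>

lemma local_gradient_identity:
  fixes \<zeta> v :: "nat \<Rightarrow> real"
  assumes v0: "v 0 = 0" and vN: "v (Suc N) = 0"
  shows "2 * (\<Sum>i<N. \<zeta> (Suc i) * v (Suc i) * ((v (i+2) - v (Suc i)) - (v (Suc i) - v i))) =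
    - (\<Sum>i\<le>N. (\<zeta> i + \<zeta> (Suc i)) * (v (Suc i) - v i)\<^sup>2)
    - (\<Sum>i\<le>N. (\<zeta> (Suc i) - \<zeta> i) * ((v (Suc i) + v i) * (v (Suc i) - v i)))"
proof -
  define a where "a i = \<zeta> i * v i * (v (Suc i) - v i)" for i
  define b where "b i = \<zeta> (Suc i) * v (Suc i) * (v (Suc i) - v i)" for i
  have a: "(\<Sum>i<N. a (Suc i)) = (\<Sum>i\<le>N. a i)"
    using sum_shift_left[of a N] v0 by (simp add: a_def)
  have b: "(\<Sum>i<N. b i) = (\<Sum>i\<le>N. b i)"
    using sum_shift_right[of b N] vN by (simp add: b_def)
  have "2 * (\<Sum>i<N. \<zeta> (Suc i) * v (Suc i) * ((v (i+2) - v (Suc i)) - (v (Suc i) - v i)))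
     = 2 * ((\<Sum>i<N. a (Suc i)) - (\<Sum>i<N. b i))"
    by (simp add: a_def b_def algebra_simps flip: sum_subtractf)
  also have "\<dots> = (\<Sum>i\<le>N. 2 * (a i - b i))"
    by (simp add: a b sum_subtractf sum_distrib_left)
  also have "\<dots> = (\<Sum>i\<le>N. - ((\<zeta> i + \<zeta> (Suc i)) * (v (Suc i) - v i)\<^sup>2)
      - (\<zeta> (Suc i) - \<zeta> i) * ((v (Suc i) + v i) * (v (Suc i) - v i)))"
    by (intro sum.cong) (simp_all add: a_def b_def power2_eq_square algebra_simps)
  finally show ?thesis by (simp add: sum_subtractf sum_negf)
qed

section \<open>Pointwise Carleman inequality\<close>

lemma sum_nodes_eq:
  fixes v :: "nat \<Rightarrow> real"
  assumes v0: "v 0 = 0" and vN: "v (Suc N) = 0"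
  shows "(\<Sum>i\<le>N. (v i)\<^sup>2) = (\<Sum>i<N. (v (Suc i))\<^sup>2)" "(\<Sum>i\<le>N. (v (Suc i))\<^sup>2) = (\<Sum>i<N. (v (Suc i))\<^sup>2)"
  using sum_shift_left[of "\<lambda>i. (v i)\<^sup>2" N] sum_shift_right[of "\<lambda>i. (v (Suc i))\<^sup>2" N] assms
  by simp_all

text \<open>The situation at one fixed time: \<open>s\<close>, \<open>s1\<close>, \<open>s2\<close>
  are the values of s, s', s'', while \<open>\<phi>\<close> and \<open>\<zeta>\<close> are sampled
  at the nodes. The number 700 in \<open>eta_le\<close> is dictated by the final absorption in
  \<open>pointwise_carleman\<close>. \<open>positivity\<close> is a dichotomy: at an interior node
  either the cutoff equals 1, so that a bad sign can be charged to the local integral, or phi has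
  second difference bounded below and slope bounded away from zero. The sign conditions at the two
  ends make every boundary term of the commutator favourable; they come from the slopes of psi at 0
  and 1 and from the convexity of phi off omega_0.\<close>

locale carleman_bounds =
  fixes N :: nat and h K c0 \<eta> s s1 s2 :: real and \<phi> \<zeta> :: "nat \<Rightarrow> real"
  assumes N_pos: "0 < N" and h_pos: "0 < h" and h_le: "h \<le> \<eta>"
    and K_ge: "1 \<le> K" and c0_pos: "0 < c0" and c0_le: "c0 \<le> 1"
    and eta_le: "\<eta> \<le> c0 ^ 4 / (700 * K ^ 5)"
    and s_pos: "0 < s" and s_ge: "1 \<le> \<eta> * s" and sh_le: "s * h \<le> \<eta>"
    and s1_le: "\<bar>s1\<bar> \<le> \<eta> * s\<^sup>2" and s2_le: "\<bar>s2\<bar> \<le> \<eta> * s ^ 3"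
    and phi_le: "\<And>i. i \<le> Suc N \<Longrightarrow> \<bar>\<phi> i\<bar> \<le> K"
    and q_le: "\<And>i. i \<le> N \<Longrightarrow> \<bar>\<phi> (Suc i) - \<phi> i\<bar> \<le> K * h"
    and d_le: "\<And>i. i < N \<Longrightarrow> \<bar>\<phi> (i + 2) - 2 * \<phi> (Suc i) + \<phi> i\<bar> \<le> K * h\<^sup>2"
    and dd_le: "\<And>i. Suc i < N \<Longrightarrow> \<bar>\<phi> (i + 3) - 3 * \<phi> (i + 2) + 3 * \<phi> (Suc i) - \<phi> i\<bar> \<le> K * h ^ 3"
    and zeta_nonneg: "\<And>i. i \<le> Suc N \<Longrightarrow> 0 \<le> \<zeta> i" and zeta_le: "\<And>i. i \<le> Suc N \<Longrightarrow> \<zeta> i \<le> 1"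
    and zeta_lipschitz: "\<And>i. i \<le> N \<Longrightarrow> \<bar>\<zeta> (Suc i) - \<zeta> i\<bar> \<le> K * h"
    and positivity: "\<And>i. i < N \<Longrightarrow> \<zeta> (Suc i) = 1 \<or>
        c0 * h\<^sup>2 \<le> \<phi> (i + 2) - 2 * \<phi> (Suc i) + \<phi> i \<and> c0 * h \<le> \<bar>\<phi> (i + 2) - \<phi> i\<bar>"
    and q_first: "0 \<le> \<phi> 1 - \<phi> 0" and q_last: "\<phi> (Suc N) - \<phi> N \<le> 0"
    and d_first: "0 \<le> \<phi> 2 - 2 * \<phi> 1 + \<phi> 0"
    and d_last: "0 \<le> \<phi> (Suc N) - 2 * \<phi> N + \<phi> (N - 1)"
begin

text \<open>Edge i joins the nodes i and i+1, and \<open>q\<close>, \<open>c\<close>,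
  \<open>\<sigma>\<close> are edge quantities. \<open>e i\<close> belongs to node i+1 and equals c_i
  \<sigma>_{i+1} - c_{i+1} \<sigma>_i by the subtraction formula for sinh. \<open>Sym v i\<close>,
  \<open>Asym v i\<close> and \<open>Sdot v i\<close> are likewise values at node i+1;
  \<open>Sdot\<close> is the time derivative of the coefficients of \<open>Sym\<close> with v
  frozen.\<close>

definition "q i = \<phi> (Suc i) - \<phi> i"
definition "c i = cosh (s * q i)"
definition "\<sigma> i = sinh (s * q i)"
definition "e i = sinh (s * (q (Suc i) - q i))"
definition Sym where "Sym v i = (c (Suc i) * v (i+2) + c i * v i - 2 * v (Suc i)) / h\<^sup>2 - s1 * \<phi> (Suc i) * v (Suc i)"
definition Asym where "Asym v i = - (\<sigma> (Suc i) * v (i+2) - \<sigma> i * v i) / h\<^sup>2"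
definition Sdot where "Sdot v i = s1 * (q (Suc i) * \<sigma> (Suc i) * v (i+2) + q i * \<sigma> i * v i) / h\<^sup>2 - s2 * \<phi> (Suc i) * v (Suc i)"

lemma eta_pos: "0 < \<eta>"
  using h_pos h_le by linarith

lemma K_pos: "0 < K" using K_ge by simp

lemma eta_K: "700 * K ^ 5 * \<eta> \<le> c0 ^ 4"
  using eta_le K_pos by (simp add: pos_le_divide_eq mult.commute)

lemma c0_power_le: "c0 ^ n \<le> 1"
  using c0_pos c0_le by (simp add: power_le_one)

lemma K_power_mono: "m \<le> n \<Longrightarrow> K ^ m \<le> K ^ n"
  using K_ge by (simp add: power_increasing)

lemma K_eta_le: "n \<le> 5 \<Longrightarrow> 700 * K ^ n * \<eta> \<le> 1"
proof -
  assume "n \<le> 5"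
  then have "700 * K ^ n * \<eta> \<le> 700 * K ^ 5 * \<eta>"
    using K_power_mono eta_pos by simp
  also have "\<dots> \<le> 1" using eta_K c0_power_le[of 4] by linarith
  finally show ?thesis .
qed

lemma eta_le_1: "\<eta> \<le> 1" and eta_K_le: "700 * K * \<eta> \<le> 1"
  using K_eta_le[of 0] K_eta_le[of 1] eta_pos by auto

lemma q_bound: "i \<le> N \<Longrightarrow> \<bar>s * q i\<bar> \<le> K * (s * h)"
  using q_le[of i] s_pos by (simp add: q_def abs_mult mult.left_commute)

lemma sq_le_1: "i \<le> N \<Longrightarrow> \<bar>s * q i\<bar> \<le> 1 / 4"
proof -
  assume "i \<le> N"
  have "K * (s * h) \<le> K * \<eta>" using sh_le K_pos by simp
  with q_bound[OF \<open>i \<le> N\<close>] eta_K_le show ?thesis by linarith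
qed

lemma d_eq: "q (Suc i) - q i = \<phi> (i + 2) - 2 * \<phi> (Suc i) + \<phi> i"
  by (simp add: q_def)

lemma sd_le: assumes "i < N" shows "\<bar>s * (q (Suc i) - q i)\<bar> \<le> K * s * h\<^sup>2" "\<bar>s * (q (Suc i) - q i)\<bar> \<le> 1"
proof -
  show 1: "\<bar>s * (q (Suc i) - q i)\<bar> \<le> K * s * h\<^sup>2"
    using d_le[OF assms] s_pos by (simp add: d_eq abs_mult mult.left_commute)
  show "\<bar>s * (q (Suc i) - q i)\<bar> \<le> 1"
    using sq_le_1[of i] sq_le_1[of "Suc i"] assms by (simp add: right_diff_distrib)
qed

lemma e_abs_le: "i < N \<Longrightarrow> \<bar>e i\<bar> \<le> 2 * K * s * h\<^sup>2"
  using sd_le[of i] abs_sinh_le[of "s * (q (Suc i) - q i)"] unfolding e_def by linarith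

text \<open>Off the set where the cutoff is 1, sinh x \<ge> x for x \<ge> 0 gives the main lower
  bound. Where the cutoff is 1 only |e| \<le> 2 K s h^2 is known; the 3 K in front of
  \<open>\<zeta>\<close> covers this together with c0 \<le> K.\<close>

lemma e_ge: assumes "i < N" shows "c0 * s * h\<^sup>2 - 3 * K * \<zeta> (Suc i) * s * h\<^sup>2 \<le> e i"
proof (cases "\<zeta> (Suc i) = 1")
  case True
  have "c0 * (s * h\<^sup>2) \<le> K * (s * h\<^sup>2)"
    using c0_le K_ge s_pos by (intro mult_right_mono) auto
  then show ?thesis using e_abs_le[OF assms] True by (simp add: algebra_simps abs_le_iff)
next
  case False
  then have "c0 * h\<^sup>2 \<le> q (Suc i) - q i" using positivity[OF assms] by (simp add: d_eq)
  then have 1: "c0 * h\<^sup>2 * s \<le> s * (q (Suc i) - q i)" using s_pos by (simp add: mult.commute)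
  moreover have "0 \<le> c0 * h\<^sup>2 * s" using c0_pos s_pos by simp
  ultimately have "c0 * h\<^sup>2 * s \<le> e i" unfolding e_def using sinh_ge_self by (meson order_trans)
  moreover have "0 \<le> 3 * K * \<zeta> (Suc i) * s * h\<^sup>2"
    using K_pos zeta_nonneg[of "Suc i"] assms s_pos by simp
  ultimately show ?thesis by (simp add: mult.commute mult.left_commute)
qed

lemma e_end: "0 \<le> e 0" "0 \<le> e (N - 1)"
  using d_first d_last s_pos N_pos by (simp_all add: e_def q_def numeral_2_eq_2)

text \<open>The difference of two consecutive arguments of sinh is s times a third difference of
  phi, hence the power h^3.\<close>

lemma e_diff: assumes "Suc i < N" shows "\<bar>e (Suc i) - e i\<bar> \<le> 2 * K * s * h ^ 3"
proof -
  have "\<bar>e (Suc i) - e i\<bar> \<le> 2 * \<bar>s * (q (Suc (Suc i)) - q (Suc i)) - s * (q (Suc i) - q i)\<bar>"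
    unfolding e_def using assms by (intro abs_sinh_diff_le sd_le) auto
  also have "s * (q (Suc (Suc i)) - q (Suc i)) - s * (q (Suc i) - q i)
      = s * (\<phi> (i + 3) - 3 * \<phi> (i + 2) + 3 * \<phi> (Suc i) - \<phi> i)"
    by (simp add: q_def algebra_simps numeral_3_eq_3)
  also have "2 * \<bar>\<dots>\<bar> \<le> 2 * (s * (K * h ^ 3))"
    using dd_le[OF assms] s_pos by (simp add: abs_mult)
  finally show ?thesis by (simp add: algebra_simps)
qed

text \<open>The formula cosh (x + y) sinh (x - y) = cosh x sinh x - cosh y sinh y factors the
  zero-order coefficient exactly. To leading order it is 4 s^3 h^4 phi_x^2 phi_xx: the factor cosh -
  1 yields the squared slope and \<open>e\<close> yields the second derivative.\<close>

lemma cross_term: "2 * (c (Suc i) * \<sigma> (Suc i) - c i * \<sigma> i) - 2 * e i = 2 * (cosh (s * (q (Suc i) + q i)) - 1) * e i"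
proof -
  have "cosh (s * (q (Suc i) + q i)) * e i = c (Suc i) * \<sigma> (Suc i) - c i * \<sigma> i"
  proof -
    have *: "cosh (x + y) * sinh (x - y) = cosh x * sinh x - cosh y * sinh y" for x y :: real
    proof -
      have "cosh (x + y) * sinh (x - y) = cosh x * sinh x * ((cosh y)\<^sup>2 - (sinh y)\<^sup>2) - cosh y * sinh y * ((cosh x)\<^sup>2 - (sinh x)\<^sup>2)"
        by (simp add: cosh_add sinh_diff power2_eq_square algebra_simps)
      then show ?thesis by (simp add: cosh_square_eq)
    qed
    show ?thesis unfolding e_def c_def \<sigma>_def using *[of "s * q (Suc i)" "s * q i"]
      by (simp add: algebra_simps)
  qed
  then show ?thesis by (simp add: algebra_simps)
qed

text \<open>Away from the cutoff, 2 (cosh a - 1) \<ge> a^2 with |a| \<ge> s c0 h is multiplied by e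
  \<ge> s c0 h^2. Where the cutoff is 1 the same product is bounded in absolute value by 32 K^3 s^3
  h^4, and one more K^3 covers c0^3, whence 33.\<close>

lemma cubic_term:
  assumes i: "i < N"
  shows "c0 ^ 3 * s ^ 3 * h ^ 4 - 33 * K ^ 3 * \<zeta> (Suc i) * s ^ 3 * h ^ 4 \<le> 2 * (cosh (s * (q (Suc i) + q i)) - 1) * e i"
proof -
  define a where "a = s * (q (Suc i) + q i)"
  have a1: "\<bar>a\<bar> \<le> 2 * K * (s * h)"
    using q_bound[of i] q_bound[of "Suc i"] i abs_triangle_ineq[of "s * q (Suc i)" "s * q i"]
    unfolding a_def distrib_left by linarith
  have a2: "\<bar>a\<bar> \<le> 1"
    using sq_le_1[of i] sq_le_1[of "Suc i"] i unfolding a_def distrib_left by simp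
  have ch: "0 \<le> cosh a - 1" using cosh_real_ge_1[of a] by simp
  show ?thesis
  proof (cases "\<zeta> (Suc i) = 1")
    case True
    have "cosh a - 1 \<le> 2 * (2 * K * (s * h))\<^sup>2"
      using cosh_minus_1_le[OF a2] a1 K_pos s_pos h_pos abs_le_square_iff[of a "2 * K * (s * h)"]
      by (simp add: abs_mult)
    then have "2 * (cosh a - 1) * \<bar>e i\<bar> \<le> 2 * (2 * (2 * K * (s * h))\<^sup>2) * (2 * K * s * h\<^sup>2)"
      using e_abs_le[OF i] ch by (intro mult_mono) auto
    also have "\<dots> = 32 * K ^ 3 * s ^ 3 * h ^ 4"
      by (simp add: power2_eq_square power3_eq_cube power4_eq_xxxx)
    finally have "2 * (cosh a - 1) * \<bar>e i\<bar> \<le> 32 * K ^ 3 * s ^ 3 * h ^ 4" .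
    then have "- (32 * K ^ 3 * s ^ 3 * h ^ 4) \<le> 2 * (cosh a - 1) * e i"
    proof -
      have "- (2 * (cosh a - 1) * \<bar>e i\<bar>) \<le> 2 * (cosh a - 1) * e i"
        using ch mult_left_mono[of "- \<bar>e i\<bar>" "e i" "2 * (cosh a - 1)"] by simp
      with \<open>2 * (cosh a - 1) * \<bar>e i\<bar> \<le> 32 * K ^ 3 * s ^ 3 * h ^ 4\<close> show ?thesis by linarith
    qed
    moreover have "c0 ^ 3 * (s ^ 3 * h ^ 4) \<le> K ^ 3 * (s ^ 3 * h ^ 4)"
      using c0_le c0_pos K_ge s_pos by (intro mult_right_mono power_mono) auto
    ultimately show ?thesis using True unfolding a_def by (simp add: algebra_simps)
  next
    case False
    then have *: "c0 * h\<^sup>2 \<le> q (Suc i) - q i" "c0 * h \<le> \<bar>q (Suc i) + q i\<bar>"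
      using positivity[OF i] by (simp_all add: d_eq q_def)
    have "s * (c0 * h\<^sup>2) \<le> s * (q (Suc i) - q i)" using *(1) s_pos by simp
    moreover have "0 \<le> s * (c0 * h\<^sup>2)" using c0_pos s_pos by simp
    ultimately have e: "s * (c0 * h\<^sup>2) \<le> e i" unfolding e_def using sinh_ge_self by (meson order_trans)
    have "(s * (c0 * h))\<^sup>2 \<le> a\<^sup>2"
      using *(2) s_pos h_pos c0_pos unfolding a_def
      by (subst abs_le_square_iff[symmetric]) (simp add: abs_mult)
    then have "(s * (c0 * h))\<^sup>2 \<le> 2 * (cosh a - 1)" using cosh_minus_1_ge[of a] by simp
    then have "(s * (c0 * h))\<^sup>2 * (s * (c0 * h\<^sup>2)) \<le> 2 * (cosh a - 1) * e i"
      using e c0_pos s_pos ch by (intro mult_mono) auto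
    moreover have "0 \<le> 33 * K ^ 3 * \<zeta> (Suc i) * s ^ 3 * h ^ 4"
      using K_pos zeta_nonneg[of "Suc i"] i s_pos by simp
    ultimately show ?thesis unfolding a_def
      by (simp add: power2_eq_square power3_eq_cube power4_eq_xxxx mult_ac)
  qed
qed

lemma c_minus_1: assumes "i \<le> N" shows "0 \<le> c i - 1" "c i - 1 \<le> 2 * K\<^sup>2 * s\<^sup>2 * h\<^sup>2"
proof -
  show "0 \<le> c i - 1" using cosh_real_ge_1 by (simp add: c_def)
  have "c i - 1 \<le> 2 * (s * q i)\<^sup>2" unfolding c_def
    using sq_le_1[OF assms] by (intro cosh_minus_1_le) auto
  also have "(s * q i)\<^sup>2 \<le> (K * (s * h))\<^sup>2"
    using q_bound[OF assms] K_pos s_pos h_pos by (subst abs_le_square_iff[symmetric]) (simp add: abs_mult)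
  finally show "c i - 1 \<le> 2 * K\<^sup>2 * s\<^sup>2 * h\<^sup>2" by (simp add: power_mult_distrib mult_ac)
qed

lemma q_sigma: assumes "i \<le> N" shows "\<bar>q i * \<sigma> i\<bar> \<le> 2 * K\<^sup>2 * s * h\<^sup>2"
proof -
  have "\<bar>\<sigma> i\<bar> \<le> 2 * (K * (s * h))"
    using abs_sinh_le[of "s * q i"] sq_le_1[OF assms] q_bound[OF assms] unfolding \<sigma>_def by linarith
  then have "\<bar>q i\<bar> * \<bar>\<sigma> i\<bar> \<le> (K * h) * (2 * (K * (s * h)))"
    using q_le[OF assms] K_pos h_pos unfolding q_def by (intro mult_mono) auto
  then show ?thesis by (simp add: abs_mult power2_eq_square mult_ac)
qed

end

section \<open>Error terms and the localized gradient\<close>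

context carleman_bounds
begin

text \<open>\<open>grad\<close> lives on edges, and \<open>lap v i\<close> is the discrete Laplacian
  at node i+1. \<open>locgrad\<close> weights both edges adjacent to a node by the cutoff at that
  node, which is how \<open>e\<close> meets the gradient in the commutator identity.
  \<open>mixed\<close> collects all products of v with its gradient.\<close>

definition "grad v i = (v (Suc i) - v i) / h"
definition "sq v = (\<Sum>i<N. (v (Suc i))\<^sup>2)"
definition "loc v = (\<Sum>i<N. \<zeta> (Suc i) * (v (Suc i))\<^sup>2)"
definition "gradsq v = (\<Sum>i\<le>N. (grad v i)\<^sup>2)"
definition "locgrad v = (\<Sum>i<N. \<zeta> (Suc i) * ((grad v (Suc i))\<^sup>2 + (grad v i)\<^sup>2))"
definition "lap v i = (grad v (Suc i) - grad v i) / h"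
definition "lapsq v = (\<Sum>i<N. (lap v i)\<^sup>2)"
definition "mixed v = (\<Sum>i\<le>N. \<bar>v (Suc i) + v i\<bar> * \<bar>grad v i\<bar>)"

context
  fixes v :: "nat \<Rightarrow> real"
  assumes v0: "v 0 = 0" and vN: "v (Suc N) = 0"
begin

lemma sq_nonneg: "0 \<le> sq v" by (simp add: sq_def sum_nonneg)
lemma loc_nonneg: "0 \<le> loc v" by (auto simp: loc_def intro!: sum_nonneg mult_nonneg_nonneg zeta_nonneg)
lemma gradsq_nonneg: "0 \<le> gradsq v" by (simp add: gradsq_def sum_nonneg)

lemma sq_edges: "(\<Sum>i\<le>N. (v i)\<^sup>2) = sq v" "(\<Sum>i\<le>N. (v (Suc i))\<^sup>2) = sq v"
  using sum_nodes_eq[OF v0 vN] by (simp_all add: sq_def)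

lemma sq_shift: "(\<Sum>i<N. (v i)\<^sup>2) \<le> sq v" "(\<Sum>i<N. (v (i+2))\<^sup>2) \<le> sq v"
  using sum_shift_right[of "\<lambda>i. (v i)\<^sup>2" N] sum_shift_left[of "\<lambda>i. (v (Suc i))\<^sup>2" N] sq_edges
  by simp_all

text \<open>Young's inequality with a free parameter: the gradient part must be absorbed by the main
  gradient term and the rest by s^3 v^2, so \<open>\<kappa>\<close> is fixed only in the final
  balance.\<close>

lemma mixed_le: assumes "0 < \<kappa>" shows "mixed v \<le> \<kappa> * gradsq v + sq v / \<kappa>"
proof -
  have "mixed v \<le> (\<Sum>i\<le>N. \<kappa> * (grad v i)\<^sup>2 + ((v (Suc i))\<^sup>2 + (v i)\<^sup>2) / (2 * \<kappa>))"
    unfolding mixed_def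
  proof (rule sum_mono)
    fix i
    define a b where "a = \<bar>v (Suc i) + v i\<bar>" and "b = \<bar>grad v i\<bar>"
    have "0 \<le> (2 * \<kappa> * b - a)\<^sup>2" by simp
    then have "4 * \<kappa> * (a * b) \<le> 4 * \<kappa> * (\<kappa> * b\<^sup>2) + a\<^sup>2" by (simp add: power2_eq_square algebra_simps)
    also have "a\<^sup>2 \<le> 2 * ((v (Suc i))\<^sup>2 + (v i)\<^sup>2)"
      using sum_squares_bound[of "v (Suc i)" "v i"] by (simp add: a_def power2_sum)
    finally have "4 * \<kappa> * (a * b) \<le> 4 * \<kappa> * (\<kappa> * b\<^sup>2) + 2 * ((v (Suc i))\<^sup>2 + (v i)\<^sup>2)" by simp
    also have "\<dots> = 4 * \<kappa> * (\<kappa> * b\<^sup>2 + ((v (Suc i))\<^sup>2 + (v i)\<^sup>2) / (2 * \<kappa>))"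
      using assms unfolding distrib_left[of "4 * \<kappa>"] by simp
    finally have "4 * \<kappa> * (a * b) \<le> 4 * \<kappa> * (\<kappa> * b\<^sup>2 + ((v (Suc i))\<^sup>2 + (v i)\<^sup>2) / (2 * \<kappa>))" .
    then have "a * b \<le> \<kappa> * b\<^sup>2 + ((v (Suc i))\<^sup>2 + (v i)\<^sup>2) / (2 * \<kappa>)"
      using assms by simp
    then show "\<bar>v (Suc i) + v i\<bar> * \<bar>grad v i\<bar> \<le> \<kappa> * (grad v i)\<^sup>2 + ((v (Suc i))\<^sup>2 + (v i)\<^sup>2) / (2 * \<kappa>)"
      by (simp add: a_def b_def)
  qed
  also have "\<dots> = \<kappa> * gradsq v + sq v / \<kappa>"
    by (simp add: gradsq_def sum.distrib sum_distrib_left[symmetric] sum_divide_distrib[symmetric] sq_edges field_simps)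
  finally show ?thesis .
qed

text \<open>The discrepancy between the plain Laplacian and the conjugated symmetric operator; it
  lets |S v|^2 control second differences.\<close>

definition "err i = lap v i - Sym v i"

text \<open>cosh - 1 is quadratic in s h, so division by h^2 leaves a coefficient of order s^2. No
  derivative of v appears, and the three adjacent node values suffice.\<close>

lemma err_le: assumes "i < N" shows "\<bar>err i\<bar> \<le> 2 * K\<^sup>2 * s\<^sup>2 * (\<bar>v (Suc i)\<bar> + \<bar>v (i+2)\<bar> + \<bar>v i\<bar>)"
proof -
  have eq: "err i = s1 * \<phi> (Suc i) * v (Suc i) - ((c (Suc i) - 1) / h\<^sup>2) * v (i+2) - ((c i - 1) / h\<^sup>2) * v i"
    using h_pos by (simp add: err_def lap_def grad_def Sym_def field_simps power2_eq_square)
  have 1: "\<bar>s1 * \<phi> (Suc i)\<bar> \<le> 2 * K\<^sup>2 * s\<^sup>2"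
  proof -
    have "\<bar>s1 * \<phi> (Suc i)\<bar> \<le> (\<eta> * s\<^sup>2) * K"
      unfolding abs_mult using s1_le phi_le[of "Suc i"] assms eta_pos by (intro mult_mono) auto
    also have "\<dots> \<le> (1 * s\<^sup>2) * K" using eta_le_1 K_pos by (intro mult_right_mono) auto
    also have "\<dots> \<le> s\<^sup>2 * (2 * K\<^sup>2)" using K_ge by (auto simp: power2_eq_square intro!: mult_left_mono)
    finally show ?thesis by (simp add: mult_ac)
  qed
  have c: "\<bar>(c j - 1) / h\<^sup>2\<bar> \<le> 2 * K\<^sup>2 * s\<^sup>2" if "j \<le> N" for j
    using c_minus_1[OF that] h_pos by (simp add: pos_divide_le_eq)
  have "\<bar>err i\<bar> \<le> \<bar>s1 * \<phi> (Suc i)\<bar> * \<bar>v (Suc i)\<bar> + \<bar>(c (Suc i) - 1) / h\<^sup>2\<bar> * \<bar>v (i+2)\<bar> + \<bar>(c i - 1) / h\<^sup>2\<bar> * \<bar>v i\<bar>"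
    unfolding eq abs_mult[symmetric] by linarith
  also have "\<dots> \<le> 2 * K\<^sup>2 * s\<^sup>2 * \<bar>v (Suc i)\<bar> + 2 * K\<^sup>2 * s\<^sup>2 * \<bar>v (i+2)\<bar> + 2 * K\<^sup>2 * s\<^sup>2 * \<bar>v i\<bar>"
    using 1 c[of i] c[of "Suc i"] assms by (intro add_mono mult_right_mono) auto
  finally show ?thesis by (simp add: algebra_simps)
qed

lemma err_sq: "(\<Sum>i<N. (err i)\<^sup>2) \<le> 36 * K ^ 4 * s ^ 4 * sq v"
proof -
  have "(\<Sum>i<N. (err i)\<^sup>2) \<le> (\<Sum>i<N. 12 * K ^ 4 * s ^ 4 * ((v (Suc i))\<^sup>2 + (v (i+2))\<^sup>2 + (v i)\<^sup>2))"
  proof (rule sum_mono)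
    fix i assume "i \<in> {..<N}"
    then have "(err i)\<^sup>2 \<le> (2 * K\<^sup>2 * s\<^sup>2 * (\<bar>v (Suc i)\<bar> + \<bar>v (i+2)\<bar> + \<bar>v i\<bar>))\<^sup>2"
      using err_le[of i] abs_le_square_iff[of "err i" "2 * K\<^sup>2 * s\<^sup>2 * (\<bar>v (Suc i)\<bar> + \<bar>v (i+2)\<bar> + \<bar>v i\<bar>)"]
      by (simp add: abs_mult)
    also have "\<dots> = 4 * K ^ 4 * s ^ 4 * (\<bar>v (Suc i)\<bar> + \<bar>v (i+2)\<bar> + \<bar>v i\<bar>)\<^sup>2"
      by (simp add: power_mult_distrib flip: power_mult)
    also have "\<dots> \<le> 4 * K ^ 4 * s ^ 4 * (3 * ((v (Suc i))\<^sup>2 + (v (i+2))\<^sup>2 + (v i)\<^sup>2))"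
    proof (rule mult_left_mono)
      show "(\<bar>v (Suc i)\<bar> + \<bar>v (i+2)\<bar> + \<bar>v i\<bar>)\<^sup>2 \<le> 3 * ((v (Suc i))\<^sup>2 + (v (i+2))\<^sup>2 + (v i)\<^sup>2)"
        using sum_squares_bound[of "\<bar>v (Suc i)\<bar>" "\<bar>v (i+2)\<bar>"] sum_squares_bound[of "\<bar>v (Suc i)\<bar>" "\<bar>v i\<bar>"]
          sum_squares_bound[of "\<bar>v i\<bar>" "\<bar>v (i+2)\<bar>"]
        by (simp add: power2_eq_square algebra_simps)
    qed simp
    finally show "(err i)\<^sup>2 \<le> 12 * K ^ 4 * s ^ 4 * ((v (Suc i))\<^sup>2 + (v (i+2))\<^sup>2 + (v i)\<^sup>2)"
      by (simp add: algebra_simps)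
  qed
  also have "\<dots> = 12 * K ^ 4 * s ^ 4 * (sq v + (\<Sum>i<N. (v (i+2))\<^sup>2) + (\<Sum>i<N. (v i)\<^sup>2))"
    by (simp only: sum_distrib_left[symmetric] sum.distrib sq_def)
  also have "\<dots> \<le> 12 * K ^ 4 * s ^ 4 * (3 * sq v)"
    using sq_shift by (intro mult_left_mono) auto
  finally show ?thesis by simp
qed

text \<open>The second-difference term in the commutator has no useful sign, but it carries the
  small factor s h^2. Replacing the Laplacian by S v plus the error uses s h^2 \<le> \<eta> for the
  first part and (s h)^2 \<le> \<eta> for the second. This is where the smallness of s h is
  decisive.\<close>

lemma lapsq_le: "s * h\<^sup>2 * lapsq v \<le> 2 * \<eta> * (\<Sum>i<N. (Sym v i)\<^sup>2) + 72 * K ^ 4 * \<eta> * (s ^ 3 * sq v)"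
proof -
  have "lapsq v \<le> (\<Sum>i<N. 2 * (Sym v i)\<^sup>2 + 2 * (err i)\<^sup>2)"
    unfolding lapsq_def
  proof (rule sum_mono)
    fix i
    have "lap v i = Sym v i + err i" by (simp add: err_def)
    then show "(lap v i)\<^sup>2 \<le> 2 * (Sym v i)\<^sup>2 + 2 * (err i)\<^sup>2"
      using sum_squares_bound[of "Sym v i" "err i"] by (simp add: power2_sum)
  qed
  also have "\<dots> = 2 * (\<Sum>i<N. (Sym v i)\<^sup>2) + 2 * (\<Sum>i<N. (err i)\<^sup>2)"
    by (simp add: sum.distrib sum_distrib_left)
  also have "\<dots> \<le> 2 * (\<Sum>i<N. (Sym v i)\<^sup>2) + 72 * K ^ 4 * s ^ 4 * sq v"
    using err_sq by linarith
  finally have "s * h\<^sup>2 * lapsq v \<le> s * h\<^sup>2 * (2 * (\<Sum>i<N. (Sym v i)\<^sup>2) + 72 * K ^ 4 * s ^ 4 * sq v)"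
    using s_pos by (intro mult_left_mono) auto
  also have "\<dots> = (s * h * h) * (2 * (\<Sum>i<N. (Sym v i)\<^sup>2)) + (s * h * (s * h)) * (72 * K ^ 4 * (s ^ 3 * sq v))"
    by (simp add: power2_eq_square power3_eq_cube power4_eq_xxxx algebra_simps)
  also have "\<dots> \<le> (\<eta> * 1) * (2 * (\<Sum>i<N. (Sym v i)\<^sup>2)) + (\<eta> * 1) * (72 * K ^ 4 * (s ^ 3 * sq v))"
    using sh_le h_le eta_le_1 h_pos s_pos sq_nonneg K_pos
    by (intro add_mono mult_right_mono mult_mono) (auto intro!: sum_nonneg)
  finally show ?thesis by (simp add: algebra_simps)
qed

lemma s_powers: "s * sq v \<le> \<eta> * (s ^ 3 * sq v)" "s\<^sup>2 * sq v \<le> \<eta> * (s ^ 3 * sq v)"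
proof -
  have "1 * (s\<^sup>2 * sq v) \<le> (\<eta> * s) * (s\<^sup>2 * sq v)" using s_ge sq_nonneg by (intro mult_right_mono) auto
  then show 2: "s\<^sup>2 * sq v \<le> \<eta> * (s ^ 3 * sq v)" by (simp add: power2_eq_square power3_eq_cube mult_ac)
  have "1 * s \<le> (\<eta> * s) * s" using s_ge s_pos by (intro mult_right_mono) auto
  also have "\<dots> \<le> (1 * s) * s" using eta_le_1 s_pos by (intro mult_right_mono) auto
  finally have "s * sq v \<le> s\<^sup>2 * sq v" using sq_nonneg by (intro mult_right_mono) (auto simp: power2_eq_square)
  with 2 show "s * sq v \<le> \<eta> * (s ^ 3 * sq v)" by linarith
qed

text \<open>Moving the cutoff to a neighbouring node costs K h by its Lipschitz bound; the two ends
  contribute nothing because v vanishes there.\<close>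

lemma loc_shift: "(\<Sum>i<N. \<zeta> (Suc i) * ((v (i+2))\<^sup>2 + (v i)\<^sup>2)) \<le> 2 * loc v + 2 * K * h * sq v"
proof -
  have "(\<Sum>i<N. \<zeta> (Suc i) * ((v (i+2))\<^sup>2 + (v i)\<^sup>2)) \<le>
     (\<Sum>i<N. \<zeta> (i+2) * (v (i+2))\<^sup>2 + \<zeta> i * (v i)\<^sup>2 + K * h * ((v (i+2))\<^sup>2 + (v i)\<^sup>2))"
  proof (rule sum_mono)
    fix i assume "i \<in> {..<N}"
    then have "\<zeta> (Suc i) \<le> \<zeta> (i+2) + K * h" "\<zeta> (Suc i) \<le> \<zeta> i + K * h"
      using zeta_lipschitz[of i] zeta_lipschitz[of "Suc i"] by (auto simp: abs_le_iff)
    then have "\<zeta> (Suc i) * (v (i+2))\<^sup>2 \<le> (\<zeta> (i+2) + K * h) * (v (i+2))\<^sup>2"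
       "\<zeta> (Suc i) * (v i)\<^sup>2 \<le> (\<zeta> i + K * h) * (v i)\<^sup>2"
      by (intro mult_right_mono; simp)+
    then show "\<zeta> (Suc i) * ((v (i+2))\<^sup>2 + (v i)\<^sup>2) \<le>
      \<zeta> (i+2) * (v (i+2))\<^sup>2 + \<zeta> i * (v i)\<^sup>2 + K * h * ((v (i+2))\<^sup>2 + (v i)\<^sup>2)"
      by (simp add: algebra_simps)
  qed
  also have "\<dots> = (\<Sum>i<N. \<zeta> (i+2) * (v (i+2))\<^sup>2) + (\<Sum>i<N. \<zeta> i * (v i)\<^sup>2)
      + K * h * ((\<Sum>i<N. (v (i+2))\<^sup>2) + (\<Sum>i<N. (v i)\<^sup>2))"
    by (simp only: sum.distrib sum_distrib_left[symmetric])
  also have "(\<Sum>i<N. \<zeta> i * (v i)\<^sup>2) \<le> loc v"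
    using sum_shift_left[of "\<lambda>i. \<zeta> i * (v i)\<^sup>2" N] sum_shift_right[of "\<lambda>i. \<zeta> i * (v i)\<^sup>2" N] v0 zeta_nonneg[of N]
    by (simp add: loc_def)
  also have "(\<Sum>i<N. \<zeta> (i+2) * (v (i+2))\<^sup>2) \<le> loc v"
    using sum_shift_left[of "\<lambda>i. \<zeta> (Suc i) * (v (Suc i))\<^sup>2" N] sum_shift_right[of "\<lambda>i. \<zeta> (Suc i) * (v (Suc i))\<^sup>2" N] vN zeta_nonneg[of 1]
    by (simp add: loc_def)
  also have "K * h * ((\<Sum>i<N. (v (i+2))\<^sup>2) + (\<Sum>i<N. (v i)\<^sup>2)) \<le> K * h * (sq v + sq v)"
    using sq_shift K_pos h_pos by (intro mult_left_mono add_mono) auto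
  finally show ?thesis by simp
qed

text \<open>The localized gradient is recovered by testing the Laplacian with s
  \<open>\<zeta>\<close> v. The parameter \<open>\<tau>\<close> decides how much of |S v|^2 is
  spent. The price is s^3 v^2 on the support of the cutoff, a small multiple of the global s^3 v^2,
  and a mixed term from the slope of the cutoff.\<close>

lemma locgrad_le: assumes "0 < \<tau>"
  shows "s * locgrad v \<le> \<tau> * (\<Sum>i<N. (Sym v i)\<^sup>2) + (\<eta> / \<tau> + 4 * K ^ 3 * \<eta>) * (s ^ 3 * sq v)
     + 12 * K\<^sup>2 * (s ^ 3 * loc v) + K * (s * mixed v)"
proof -
  have dd: "(v (i+2) - v (Suc i)) - (v (Suc i) - v i) = h\<^sup>2 * lap v i" for i
    using h_pos by (simp add: lap_def grad_def field_simps power2_eq_square)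
  have gr: "v (Suc i) - v i = h * grad v i" for i
    using h_pos by (simp add: grad_def)
  have "locgrad v \<le> (\<Sum>i\<le>N. (\<zeta> i + \<zeta> (Suc i)) * (grad v i)\<^sup>2)"
  proof -
    have "(\<Sum>i<N. \<zeta> (Suc i) * (grad v (Suc i))\<^sup>2) \<le> (\<Sum>i\<le>N. \<zeta> i * (grad v i)\<^sup>2)"
      using sum_shift_left[of "\<lambda>i. \<zeta> i * (grad v i)\<^sup>2" N] zeta_nonneg[of 0] by simp
    moreover have "(\<Sum>i<N. \<zeta> (Suc i) * (grad v i)\<^sup>2) \<le> (\<Sum>i\<le>N. \<zeta> (Suc i) * (grad v i)\<^sup>2)"
      using sum_shift_right[of "\<lambda>i. \<zeta> (Suc i) * (grad v i)\<^sup>2" N] zeta_nonneg[of "Suc N"] by simp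
    ultimately show ?thesis by (simp add: locgrad_def algebra_simps sum.distrib)
  qed
  also have "\<dots> = - 2 * (\<Sum>i<N. \<zeta> (Suc i) * v (Suc i) * lap v i)
      - (\<Sum>i\<le>N. (\<zeta> (Suc i) - \<zeta> i) * ((v (Suc i) + v i) * grad v i)) / h"
  proof -
    have "h\<^sup>2 * (2 * (\<Sum>i<N. \<zeta> (Suc i) * v (Suc i) * lap v i)) =
      - (h\<^sup>2 * (\<Sum>i\<le>N. (\<zeta> i + \<zeta> (Suc i)) * (grad v i)\<^sup>2))
      - h * (\<Sum>i\<le>N. (\<zeta> (Suc i) - \<zeta> i) * ((v (Suc i) + v i) * grad v i))"
      using local_gradient_identity[OF v0 vN, of \<zeta>] unfolding dd unfolding gr
      by (simp add: sum_distrib_left power_mult_distrib mult_ac)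
    then have "h\<^sup>2 * (\<Sum>i\<le>N. (\<zeta> i + \<zeta> (Suc i)) * (grad v i)\<^sup>2) = h\<^sup>2 * (- 2 * (\<Sum>i<N. \<zeta> (Suc i) * v (Suc i) * lap v i)
      - (\<Sum>i\<le>N. (\<zeta> (Suc i) - \<zeta> i) * ((v (Suc i) + v i) * grad v i)) / h)"
      using h_pos by (simp add: right_diff_distrib power2_eq_square)
    then show ?thesis using h_pos by simp
  qed
  finally have "locgrad v \<le> - 2 * (\<Sum>i<N. \<zeta> (Suc i) * v (Suc i) * lap v i)
      - (\<Sum>i\<le>N. (\<zeta> (Suc i) - \<zeta> i) * ((v (Suc i) + v i) * grad v i)) / h" .
  moreover have "- (\<Sum>i\<le>N. (\<zeta> (Suc i) - \<zeta> i) * ((v (Suc i) + v i) * grad v i)) / h \<le> K * mixed v"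
  proof -
    have "- (\<Sum>i\<le>N. (\<zeta> (Suc i) - \<zeta> i) * ((v (Suc i) + v i) * grad v i)) \<le>
       (\<Sum>i\<le>N. (K * h) * (\<bar>v (Suc i) + v i\<bar> * \<bar>grad v i\<bar>))"
      unfolding sum_negf[symmetric]
    proof (rule sum_mono)
      fix i assume "i \<in> {..N}"
      then have "\<bar>\<zeta> (Suc i) - \<zeta> i\<bar> * (\<bar>v (Suc i) + v i\<bar> * \<bar>grad v i\<bar>) \<le> (K * h) * (\<bar>v (Suc i) + v i\<bar> * \<bar>grad v i\<bar>)"
        using zeta_lipschitz[of i] by (intro mult_right_mono) auto
      then show "- ((\<zeta> (Suc i) - \<zeta> i) * ((v (Suc i) + v i) * grad v i)) \<le> (K * h) * (\<bar>v (Suc i) + v i\<bar> * \<bar>grad v i\<bar>)"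
        unfolding abs_mult[symmetric] by linarith
    qed
    also have "\<dots> = K * h * mixed v" by (simp add: mixed_def sum_distrib_left)
    finally show ?thesis using h_pos by (subst pos_divide_le_eq) (auto simp: mult_ac)
  qed
  ultimately have "locgrad v \<le> - 2 * (\<Sum>i<N. \<zeta> (Suc i) * v (Suc i) * lap v i) + K * mixed v" by simp
  then have 1: "s * locgrad v \<le> s * (- 2 * (\<Sum>i<N. \<zeta> (Suc i) * v (Suc i) * lap v i)) + K * (s * mixed v)"
  proof -
    assume "locgrad v \<le> - 2 * (\<Sum>i<N. \<zeta> (Suc i) * v (Suc i) * lap v i) + K * mixed v"
    then have "s * locgrad v \<le> s * (- 2 * (\<Sum>i<N. \<zeta> (Suc i) * v (Suc i) * lap v i) + K * mixed v)"
      using s_pos by (intro mult_left_mono) auto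
    then show ?thesis by (simp only: distrib_left mult.left_commute[of s K])
  qed
  have "s * (- 2 * (\<Sum>i<N. \<zeta> (Suc i) * v (Suc i) * lap v i))
     = (\<Sum>i<N. - 2 * s * \<zeta> (Suc i) * v (Suc i) * lap v i)"
    by (simp add: sum_distrib_left mult_ac flip: sum_negf)
  also have "\<dots> \<le> (\<Sum>i<N. \<tau> * (Sym v i)\<^sup>2 + s\<^sup>2 / \<tau> * (v (Suc i))\<^sup>2
     + 2 * K\<^sup>2 * s ^ 3 * (4 * (\<zeta> (Suc i) * (v (Suc i))\<^sup>2) + \<zeta> (Suc i) * ((v (i+2))\<^sup>2 + (v i)\<^sup>2)))"
  proof (rule sum_mono)
    fix i assume i: "i \<in> {..<N}"
    define z where "z = \<zeta> (Suc i)"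
    have z: "0 \<le> z" "z \<le> 1" using zeta_nonneg[of "Suc i"] zeta_le[of "Suc i"] i by (auto simp: z_def)
    define x where "x = v (Suc i)"
    \<comment> \<open>The two parts are treated differently: S v by Young's inequality with weight
      \<open>\<tau>\<close>, using z^2 \<le> 1, and the error while keeping the factor z, so that
      its contribution stays local.\<close>
    have "lap v i = Sym v i + err i" by (simp add: err_def)
    then have "- 2 * s * z * x * lap v i = - 2 * s * z * x * Sym v i + - 2 * s * z * x * err i"
      by (simp add: algebra_simps)
    moreover have "- 2 * s * z * x * Sym v i \<le> \<tau> * (Sym v i)\<^sup>2 + s\<^sup>2 / \<tau> * x\<^sup>2"
    proof -
      have "0 \<le> (\<tau> * Sym v i + s * z * x)\<^sup>2" by simp
      then have "\<tau> * (- 2 * s * z * x * Sym v i) \<le> \<tau> * (\<tau> * (Sym v i)\<^sup>2) + z\<^sup>2 * (s\<^sup>2 * x\<^sup>2)"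
        by (simp add: power2_eq_square algebra_simps)
      also have "z\<^sup>2 * (s\<^sup>2 * x\<^sup>2) \<le> 1 * (s\<^sup>2 * x\<^sup>2)"
        using z by (intro mult_right_mono) (auto simp: power_le_one)
      finally have "\<tau> * (- 2 * s * z * x * Sym v i) \<le> \<tau> * (\<tau> * (Sym v i)\<^sup>2 + s\<^sup>2 / \<tau> * x\<^sup>2)"
        using assms by (simp add: distrib_left)
      then show ?thesis using mult_le_cancel_left_pos[OF assms] by blast
    qed
    moreover have "- 2 * s * z * x * err i \<le> 2 * K\<^sup>2 * s ^ 3 * (4 * (z * x\<^sup>2) + z * ((v (i+2))\<^sup>2 + (v i)\<^sup>2))"
    proof -
      have "- 2 * s * z * x * err i \<le> 2 * s * z * \<bar>x\<bar> * \<bar>err i\<bar>"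
      proof -
        have "- (x * err i) \<le> \<bar>x\<bar> * \<bar>err i\<bar>" unfolding abs_mult[symmetric] by linarith
        then have "(2 * s * z) * (- (x * err i)) \<le> (2 * s * z) * (\<bar>x\<bar> * \<bar>err i\<bar>)"
          using s_pos z by (intro mult_left_mono) auto
        moreover have "- 2 * s * z * x * err i = (2 * s * z) * (- (x * err i))" by simp
        ultimately show ?thesis by (simp only: mult.assoc)
      qed
      also have "\<dots> \<le> 2 * s * z * \<bar>x\<bar> * (2 * K\<^sup>2 * s\<^sup>2 * (\<bar>x\<bar> + \<bar>v (i+2)\<bar> + \<bar>v i\<bar>))"
        using err_le[of i] i s_pos z unfolding x_def by (intro mult_left_mono) auto
      also have "\<dots> = 2 * K\<^sup>2 * s ^ 3 * z * (2 * \<bar>x\<bar> * (\<bar>x\<bar> + \<bar>v (i+2)\<bar> + \<bar>v i\<bar>))"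
        by (simp add: power2_eq_square power3_eq_cube mult_ac)
      also have "\<dots> \<le> 2 * K\<^sup>2 * s ^ 3 * z * (4 * x\<^sup>2 + (v (i+2))\<^sup>2 + (v i)\<^sup>2)"
      proof (rule mult_left_mono)
        have "2 * \<bar>x\<bar> * (\<bar>x\<bar> + \<bar>v (i+2)\<bar> + \<bar>v i\<bar>) = 2 * x\<^sup>2 + 2 * \<bar>x\<bar> * \<bar>v (i+2)\<bar> + 2 * \<bar>x\<bar> * \<bar>v i\<bar>"
          by (cases "0 \<le> x") (simp_all add: power2_eq_square algebra_simps)
        then show "2 * \<bar>x\<bar> * (\<bar>x\<bar> + \<bar>v (i+2)\<bar> + \<bar>v i\<bar>) \<le> 4 * x\<^sup>2 + (v (i+2))\<^sup>2 + (v i)\<^sup>2"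
          using sum_squares_bound[of "\<bar>x\<bar>" "\<bar>v (i+2)\<bar>"] sum_squares_bound[of "\<bar>x\<bar>" "\<bar>v i\<bar>"]
          by simp
      qed (use s_pos z in auto)
      finally show ?thesis by (simp add: algebra_simps)
    qed
    ultimately show "- 2 * s * \<zeta> (Suc i) * v (Suc i) * lap v i \<le> \<tau> * (Sym v i)\<^sup>2 + s\<^sup>2 / \<tau> * (v (Suc i))\<^sup>2
     + 2 * K\<^sup>2 * s ^ 3 * (4 * (\<zeta> (Suc i) * (v (Suc i))\<^sup>2) + \<zeta> (Suc i) * ((v (i+2))\<^sup>2 + (v i)\<^sup>2))"
      unfolding z_def x_def by linarith
  qed
  also have "\<dots> = \<tau> * (\<Sum>i<N. (Sym v i)\<^sup>2) + s\<^sup>2 / \<tau> * sq v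
     + 2 * K\<^sup>2 * s ^ 3 * (4 * loc v + (\<Sum>i<N. \<zeta> (Suc i) * ((v (i+2))\<^sup>2 + (v i)\<^sup>2)))"
    by (simp only: sum.distrib sum_distrib_left[symmetric] sq_def loc_def)
  \<comment> \<open>The term s^2 v^2 is of lower order and becomes \<open>\<eta>\<close> s^3 v^2;
    shifting the cutoff contributes 2 K \<eta>. The local coefficient is 2 K^2 (4 + 2) = 12
    K^2.\<close>
  also have "\<dots> \<le> \<tau> * (\<Sum>i<N. (Sym v i)\<^sup>2) + \<eta> * (s ^ 3 * sq v) / \<tau>
     + 2 * K\<^sup>2 * s ^ 3 * (4 * loc v + (2 * loc v + 2 * K * \<eta> * sq v))"
  proof (intro add_mono mult_left_mono order_refl)
    show "s\<^sup>2 / \<tau> * sq v \<le> \<eta> * (s ^ 3 * sq v) / \<tau>"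
      using s_powers(2) assms by (simp add: divide_right_mono)
    have "2 * K * h * sq v \<le> 2 * K * \<eta> * sq v"
      using h_le K_pos sq_nonneg by (intro mult_right_mono mult_left_mono) auto
    then show "(\<Sum>i<N. \<zeta> (Suc i) * ((v (i+2))\<^sup>2 + (v i)\<^sup>2)) \<le> 2 * loc v + 2 * K * \<eta> * sq v"
      using loc_shift by linarith
  qed (use s_pos assms in auto)
  also have "\<dots> = \<tau> * (\<Sum>i<N. (Sym v i)\<^sup>2) + (\<eta> / \<tau> + 4 * K ^ 3 * \<eta>) * (s ^ 3 * sq v) + 12 * K\<^sup>2 * (s ^ 3 * loc v)"
    by (simp add: algebra_simps power2_eq_square power3_eq_cube)
  finally show ?thesis using 1 by linarith
qed

end

end

section \<open>Commutator bound and pointwise inequality\<close>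

context carleman_bounds
begin

context
  fixes v :: "nat \<Rightarrow> real"
  assumes v0: "v 0 = 0" and vN: "v (Suc N) = 0"
begin

text \<open>Each sum of the exact commutator identity is bounded separately: the zero-order and
  gradient sums from below with a local loss, the second-difference sum and the sum with differences
  of \<open>e\<close> in absolute value. All are compared at the common scale h^4, which is divided
  out at the end.\<close>

lemma commutator_lower_bound:
  "c0 ^ 3 * (s ^ 3 * sq v) - 33 * K ^ 3 * (s ^ 3 * loc v) + 2 * c0 * (s * gradsq v) - 6 * K * (s * locgrad v)
     - 2 * K * (s * h\<^sup>2 * lapsq v) - 2 * K * (s * mixed v)
   \<le> - 2 * (\<Sum>i<N. (c (Suc i) * v (i+2) + c i * v i) * (\<sigma> (Suc i) * v (i+2) - \<sigma> i * v i)) / h ^ 4"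
proof -
  obtain n where n: "N = Suc n" using N_pos gr0_conv_Suc by auto
  have gr: "v (Suc i) - v i = h * grad v i" for i
    using h_pos by (simp add: grad_def)
  have gr': "v (i + 2) - v (Suc i) = h * grad v (Suc i)" for i
    using h_pos by (simp add: grad_def)
  have lp: "h * grad v (Suc i) - h * grad v i = h\<^sup>2 * lap v i" for i
    using h_pos by (simp add: lap_def power2_eq_square field_simps)
  have e_eq: "e i = c i * \<sigma> (Suc i) - c (Suc i) * \<sigma> i" for i
    by (simp add: e_def c_def \<sigma>_def sinh_diff right_diff_distrib)
  have sinh_pos: "0 \<le> c 0 * \<sigma> 0" "c N * \<sigma> N \<le> 0"
    using q_first q_last s_pos
    by (auto simp: c_def \<sigma>_def q_def mult_nonneg_nonpos intro!: mult_nonneg_nonneg mult_nonneg_nonpos)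
  have A: "c0 ^ 3 * s ^ 3 * h ^ 4 * sq v - 33 * K ^ 3 * s ^ 3 * h ^ 4 * loc v \<le>
     (\<Sum>i<N. 2 * (cosh (s * (q (Suc i) + q i)) - 1) * e i * (v (Suc i))\<^sup>2)"
  proof -
    have "c0 ^ 3 * s ^ 3 * h ^ 4 * sq v - 33 * K ^ 3 * s ^ 3 * h ^ 4 * loc v =
      (\<Sum>i<N. (c0 ^ 3 * s ^ 3 * h ^ 4 - 33 * K ^ 3 * \<zeta> (Suc i) * s ^ 3 * h ^ 4) * (v (Suc i))\<^sup>2)"
      unfolding sq_def loc_def sum_distrib_left sum_subtractf[symmetric]
      by (intro sum.cong) (simp_all add: algebra_simps)
    also have "\<dots> \<le> (\<Sum>i<N. 2 * (cosh (s * (q (Suc i) + q i)) - 1) * e i * (v (Suc i))\<^sup>2)"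
      by (intro sum_mono mult_right_mono cubic_term) auto
    finally show ?thesis .
  qed
  have B: "2 * c0 * s * h ^ 4 * gradsq v - 6 * K * s * h ^ 4 * locgrad v \<le>
     (\<Sum>i<N. 2 * e i * ((h * grad v (Suc i))\<^sup>2 + (h * grad v i)\<^sup>2))"
  proof -
    \<comment> \<open>Every edge is adjacent to at least one interior node; the two end edges are
      counted once and the others twice, which is why N > 0 is required.\<close>
    have "gradsq v \<le> (\<Sum>i<N. (grad v (Suc i))\<^sup>2 + (grad v i)\<^sup>2)"
      using sum_shift_left[of "\<lambda>i. (grad v i)\<^sup>2" N] member_le_sum[of 0 "{..<N}" "\<lambda>i. (grad v i)\<^sup>2"] N_pos
      by (simp add: gradsq_def sum.distrib)
    then have "2 * c0 * s * h ^ 4 * gradsq v \<le> 2 * c0 * s * h ^ 4 * (\<Sum>i<N. (grad v (Suc i))\<^sup>2 + (grad v i)\<^sup>2)"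
      using c0_pos s_pos by (intro mult_left_mono) auto
    then have "2 * c0 * s * h ^ 4 * gradsq v - 6 * K * s * h ^ 4 * locgrad v \<le>
      (\<Sum>i<N. 2 * (c0 * s * h\<^sup>2 - 3 * K * \<zeta> (Suc i) * s * h\<^sup>2) * ((h * grad v (Suc i))\<^sup>2 + (h * grad v i)\<^sup>2))"
    proof (rule order_trans[OF diff_right_mono])
      show "2 * c0 * s * h ^ 4 * (\<Sum>i<N. (grad v (Suc i))\<^sup>2 + (grad v i)\<^sup>2) - 6 * K * s * h ^ 4 * locgrad v \<le>
        (\<Sum>i<N. 2 * (c0 * s * h\<^sup>2 - 3 * K * \<zeta> (Suc i) * s * h\<^sup>2) * ((h * grad v (Suc i))\<^sup>2 + (h * grad v i)\<^sup>2))"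
        unfolding locgrad_def sum_distrib_left sum_subtractf[symmetric]
        by (intro sum_mono) (simp add: algebra_simps power2_eq_square power4_eq_xxxx)
    qed
    also have "\<dots> \<le> (\<Sum>i<N. 2 * e i * ((h * grad v (Suc i))\<^sup>2 + (h * grad v i)\<^sup>2))"
      by (intro sum_mono mult_right_mono mult_left_mono e_ge) auto
    finally show ?thesis .
  qed
  have C: "(\<Sum>i<N. e i * (h\<^sup>2 * lap v i)\<^sup>2) \<le> 2 * K * s * h ^ 6 * lapsq v"
  proof -
    have "(\<Sum>i<N. e i * (h\<^sup>2 * lap v i)\<^sup>2) \<le> (\<Sum>i<N. 2 * K * s * h\<^sup>2 * (h\<^sup>2 * lap v i)\<^sup>2)"
      using e_abs_le by (intro sum_mono mult_right_mono) (auto simp: abs_le_iff)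
    also have "\<dots> = 2 * K * s * h ^ 6 * lapsq v"
      by (simp add: lapsq_def sum_distrib_left power_mult_distrib mult_ac flip: power_add)
    finally show ?thesis .
  qed
  \<comment> \<open>\<open>e_diff\<close> supplies h^3 and the difference of v one further h, which
    again makes h^4.\<close>
  have D: "- (2 * K * s * h ^ 4 * mixed v) \<le> (\<Sum>i<n. (e (Suc i) - e i) * ((v (i+2) + v (Suc i)) * (h * grad v (Suc i))))"
  proof -
    have "- (\<Sum>i<n. (e (Suc i) - e i) * ((v (i+2) + v (Suc i)) * (h * grad v (Suc i))))
       \<le> (\<Sum>i<n. 2 * K * s * h ^ 4 * (\<bar>v (Suc (Suc i)) + v (Suc i)\<bar> * \<bar>grad v (Suc i)\<bar>))"
      unfolding sum_negf[symmetric]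
    proof (rule sum_mono)
      fix i assume "i \<in> {..<n}"
      then have "\<bar>e (Suc i) - e i\<bar> * (\<bar>v (i+2) + v (Suc i)\<bar> * \<bar>h * grad v (Suc i)\<bar>)
         \<le> 2 * K * s * h ^ 3 * (\<bar>v (i+2) + v (Suc i)\<bar> * \<bar>h * grad v (Suc i)\<bar>)"
        using e_diff[of i] n by (intro mult_right_mono) auto
      also have "\<dots> = 2 * K * s * h ^ 4 * (\<bar>v (Suc (Suc i)) + v (Suc i)\<bar> * \<bar>grad v (Suc i)\<bar>)"
        using h_pos by (simp add: abs_mult power3_eq_cube power4_eq_xxxx)
      finally show "- ((e (Suc i) - e i) * ((v (i+2) + v (Suc i)) * (h * grad v (Suc i)))) \<le>
         2 * K * s * h ^ 4 * (\<bar>v (Suc (Suc i)) + v (Suc i)\<bar> * \<bar>grad v (Suc i)\<bar>)"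
        unfolding abs_mult[symmetric] by linarith
    qed
    also have "\<dots> = 2 * K * s * h ^ 4 * (\<Sum>i<n. (\<bar>v (Suc (Suc i)) + v (Suc i)\<bar> * \<bar>grad v (Suc i)\<bar>))"
      by (simp add: sum_distrib_left)
    also have "\<dots> \<le> 2 * K * s * h ^ 4 * mixed v"
    proof (rule mult_left_mono)
      show "(\<Sum>i<n. (\<bar>v (Suc (Suc i)) + v (Suc i)\<bar> * \<bar>grad v (Suc i)\<bar>)) \<le> mixed v"
      proof -
        define f where "f i = \<bar>v (Suc i) + v i\<bar> * \<bar>grad v i\<bar>" for i
        have f0: "0 \<le> f i" for i by (simp add: f_def)
        have "(\<Sum>i<n. f (Suc i)) \<le> (\<Sum>i\<le>Suc n. f i)"
          using sum_shift_left[of f n] f0[of 0] f0[of "Suc n"] by simp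
        then show ?thesis unfolding mixed_def unfolding n f_def .
      qed
    qed (use K_pos s_pos in auto)
    finally show ?thesis by simp
  qed
  \<comment> \<open>All boundary terms are discarded by sign: phi rises on the first edge and falls
    on the last one, and its second differences at both ends are nonnegative.\<close>
  have "0 \<le> e 0 * (v 1)\<^sup>2" "0 \<le> e n * (v N)\<^sup>2" using e_end n by simp_all
  moreover have "0 \<le> 2 * c 0 * \<sigma> 0 * (v 1)\<^sup>2" "0 \<le> - (2 * c N * \<sigma> N * (v N)\<^sup>2)"
    using mult_nonneg_nonneg[OF sinh_pos(1), of "(v 1)\<^sup>2"] mult_nonpos_nonneg[OF sinh_pos(2), of "(v N)\<^sup>2"]
    by (simp_all add: mult_ac)
  ultimately have "c0 ^ 3 * s ^ 3 * h ^ 4 * sq v - 33 * K ^ 3 * s ^ 3 * h ^ 4 * loc v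
      + (2 * c0 * s * h ^ 4 * gradsq v - 6 * K * s * h ^ 4 * locgrad v) - 2 * K * s * h ^ 6 * lapsq v - 2 * K * s * h ^ 4 * mixed v
    \<le> - 2 * (\<Sum>i<N. (c (Suc i) * v (i+2) + c i * v i) * (\<sigma> (Suc i) * v (i+2) - \<sigma> i * v i))"
    unfolding commutator_identity[where c = c and \<sigma> = \<sigma> and e = e, OF v0 vN n e_eq] unfolding cross_term gr' unfolding gr unfolding lp
    using A B C D by linarith
  then have "(c0 ^ 3 * (s ^ 3 * sq v) - 33 * K ^ 3 * (s ^ 3 * loc v) + 2 * c0 * (s * gradsq v) - 6 * K * (s * locgrad v)
     - 2 * K * (s * h\<^sup>2 * lapsq v) - 2 * K * (s * mixed v)) * h ^ 4
    \<le> - 2 * (\<Sum>i<N. (c (Suc i) * v (i+2) + c i * v i) * (\<sigma> (Suc i) * v (i+2) - \<sigma> i * v i))"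
    by (simp add: algebra_simps flip: power_add)
  then show ?thesis using h_pos by (subst pos_le_divide_eq) auto
qed

text \<open>Beyond the cosh part, S contains the constant -2 / h^2 and the potential s' phi. Against
  A the constant telescopes to zero, and the potential gives -2 s' / h^2 times a sum of q sinh (s q)
  v v; \<open>Sdot\<close> contributes the same sum once more, whence the factor 4.\<close>

lemma sym_asym_identity:
  "(\<Sum>i<N. 2 * Sym v i * Asym v i) - (\<Sum>i<N. Sdot v i * v (Suc i)) =
   - 2 * (\<Sum>i<N. (c (Suc i) * v (i+2) + c i * v i) * (\<sigma> (Suc i) * v (i+2) - \<sigma> i * v i)) / h ^ 4
   - 4 * s1 / h\<^sup>2 * (\<Sum>i\<le>N. q i * \<sigma> i * v i * v (Suc i)) + s2 * (\<Sum>i<N. \<phi> (Suc i) * (v (Suc i))\<^sup>2)"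
proof -
  define t where "t i = \<sigma> i * v i * v (Suc i)" for i
  have t0: "t 0 = 0" and tN: "t N = 0" using v0 vN by (simp_all add: t_def)
  have tel: "(\<Sum>i<N. t (Suc i) - t i) = 0"
    by (simp add: sum_lessThan_telescope t0 tN)
  have ph: "(\<Sum>i<N. \<phi> (Suc i) * (t (Suc i) - t i)) = - (\<Sum>i\<le>N. q i * t i)"
    using sum_shift_left[of "\<lambda>i. \<phi> i * t i" N] sum_shift_right[of "\<lambda>i. \<phi> (Suc i) * t i" N] t0 tN
    by (simp add: right_diff_distrib left_diff_distrib sum_subtractf q_def)
  have qt: "(\<Sum>i<N. q (Suc i) * t (Suc i) + q i * t i) = 2 * (\<Sum>i\<le>N. q i * t i)"
    using sum_shift_left[of "\<lambda>i. q i * t i" N] sum_shift_right[of "\<lambda>i. q i * t i" N] t0 tN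
    by (simp add: sum.distrib)
  have 1: "(\<Sum>i<N. 2 * Sym v i * Asym v i) =
    - 2 * (\<Sum>i<N. (c (Suc i) * v (i+2) + c i * v i) * (\<sigma> (Suc i) * v (i+2) - \<sigma> i * v i)) / h ^ 4
    + 4 / h ^ 4 * (\<Sum>i<N. t (Suc i) - t i) + 2 * s1 / h\<^sup>2 * (\<Sum>i<N. \<phi> (Suc i) * (t (Suc i) - t i))"
    unfolding sum_distrib_left sum_divide_distrib sum.distrib[symmetric]
    using h_pos by (intro sum.cong) (simp_all add: Sym_def Asym_def t_def field_simps power2_eq_square power4_eq_xxxx)
  have 2: "(\<Sum>i<N. Sdot v i * v (Suc i)) = s1 / h\<^sup>2 * (\<Sum>i<N. q (Suc i) * t (Suc i) + q i * t i) - s2 * (\<Sum>i<N. \<phi> (Suc i) * (v (Suc i))\<^sup>2)"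
    unfolding sum_distrib_left sum_subtractf[symmetric]
    using h_pos by (intro sum.cong) (simp_all add: Sdot_def t_def field_simps power2_eq_square)
  have 3: "(\<Sum>i\<le>N. q i * t i) = (\<Sum>i\<le>N. q i * \<sigma> i * v i * v (Suc i))"
    by (simp add: t_def mult.assoc)
  show ?thesis unfolding 1 2 tel ph qt 3[symmetric] by (simp add: algebra_simps)
qed

text \<open>The factor q sinh (s q) is of order s h^2, so |s'| \<le> \<eta> s^2 and |s''| \<le>
  \<eta> s^3 turn both terms into small multiples of s^3 v^2.\<close>

lemma lower_order_terms:
  "\<bar>4 * s1 / h\<^sup>2 * (\<Sum>i\<le>N. q i * \<sigma> i * v i * v (Suc i))\<bar> \<le> 8 * K\<^sup>2 * \<eta> * (s ^ 3 * sq v)"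
  "\<bar>s2 * (\<Sum>i<N. \<phi> (Suc i) * (v (Suc i))\<^sup>2)\<bar> \<le> K * \<eta> * (s ^ 3 * sq v)"
proof -
  have "\<bar>\<Sum>i\<le>N. q i * \<sigma> i * v i * v (Suc i)\<bar> \<le> (\<Sum>i\<le>N. K\<^sup>2 * s * h\<^sup>2 * ((v i)\<^sup>2 + (v (Suc i))\<^sup>2))"
  proof (rule order_trans[OF sum_abs], rule sum_mono)
    fix i assume i: "i \<in> {..N}"
    have "2 * \<bar>v i * v (Suc i)\<bar> \<le> (v i)\<^sup>2 + (v (Suc i))\<^sup>2"
      using sum_squares_bound[of "\<bar>v i\<bar>" "\<bar>v (Suc i)\<bar>"] by (simp add: abs_mult)
    then have "\<bar>q i * \<sigma> i\<bar> * \<bar>v i * v (Suc i)\<bar> \<le> (2 * K\<^sup>2 * s * h\<^sup>2) * (((v i)\<^sup>2 + (v (Suc i))\<^sup>2) / 2)"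
      using q_sigma[of i] i K_pos s_pos by (intro mult_mono) auto
    then show "\<bar>q i * \<sigma> i * v i * v (Suc i)\<bar> \<le> K\<^sup>2 * s * h\<^sup>2 * ((v i)\<^sup>2 + (v (Suc i))\<^sup>2)"
      by (simp add: abs_mult mult.assoc)
  qed
  also have "\<dots> = 2 * K\<^sup>2 * s * h\<^sup>2 * sq v"
    by (simp only: sum_distrib_left[symmetric] sum.distrib sq_edges[OF v0 vN]) simp
  finally have 1: "\<bar>\<Sum>i\<le>N. q i * \<sigma> i * v i * v (Suc i)\<bar> \<le> 2 * K\<^sup>2 * s * h\<^sup>2 * sq v" .
  have "\<bar>4 * s1 / h\<^sup>2\<bar> \<le> 4 * (\<eta> * s\<^sup>2) / h\<^sup>2"
    using s1_le by (simp add: abs_mult divide_right_mono)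
  then have "\<bar>4 * s1 / h\<^sup>2\<bar> * \<bar>\<Sum>i\<le>N. q i * \<sigma> i * v i * v (Suc i)\<bar> \<le> 4 * (\<eta> * s\<^sup>2) / h\<^sup>2 * (2 * K\<^sup>2 * s * h\<^sup>2 * sq v)"
    using 1 eta_pos by (intro mult_mono) auto
  also have "\<dots> = 8 * K\<^sup>2 * \<eta> * (s ^ 3 * sq v)"
    using h_pos by (simp add: power2_eq_square power3_eq_cube)
  finally show "\<bar>4 * s1 / h\<^sup>2 * (\<Sum>i\<le>N. q i * \<sigma> i * v i * v (Suc i))\<bar> \<le> 8 * K\<^sup>2 * \<eta> * (s ^ 3 * sq v)"
    by (simp only: abs_mult)
  have "\<bar>\<Sum>i<N. \<phi> (Suc i) * (v (Suc i))\<^sup>2\<bar> \<le> (\<Sum>i<N. K * (v (Suc i))\<^sup>2)"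
    by (rule order_trans[OF sum_abs], rule sum_mono) (auto simp: abs_mult intro!: mult_right_mono phi_le)
  also have "\<dots> = K * sq v" by (simp add: sq_def sum_distrib_left)
  finally have "\<bar>s2\<bar> * \<bar>\<Sum>i<N. \<phi> (Suc i) * (v (Suc i))\<^sup>2\<bar> \<le> (\<eta> * s ^ 3) * (K * sq v)"
    using s2_le eta_pos s_pos by (intro mult_mono) auto
  then show "\<bar>s2 * (\<Sum>i<N. \<phi> (Suc i) * (v (Suc i))\<^sup>2)\<bar> \<le> K * \<eta> * (s ^ 3 * sq v)"
    by (simp add: abs_mult mult_ac)
qed

text \<open>An absorption argument: the commutator bound provides c0^3 s^3 v^2 and 2 c0 s |grad
  v|^2, and the errors may consume half of each plus one |S v|^2.\<close>

theorem pointwise_carleman: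
  "c0 ^ 3 / 2 * (s ^ 3 * sq v) + c0 * (s * gradsq v) \<le>
   (\<Sum>i<N. (Sym v i)\<^sup>2) + (\<Sum>i<N. 2 * Sym v i * Asym v i) - (\<Sum>i<N. Sdot v i * v (Suc i))
   + 105 * K ^ 3 * (s ^ 3 * loc v)"
proof -
  define V where "V = s ^ 3 * sq v"
  define G where "G = s * gradsq v"
  define L where "L = s ^ 3 * loc v"
  define Z where "Z = (\<Sum>i<N. (Sym v i)\<^sup>2)"
  have V0: "0 \<le> V" and G0: "0 \<le> G" and L0: "0 \<le> L" and Z0: "0 \<le> Z"
    using sq_nonneg[OF v0 vN] loc_nonneg[OF v0 vN] gradsq_nonneg[OF v0 vN] s_pos by (simp_all add: V_def G_def L_def Z_def sum_nonneg)
  \<comment> \<open>\<open>\<kappa>\<close> makes (2 K + 6 K^2) \<open>\<kappa>\<close> at most c0,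
    half of the available gradient. \<open>\<tau>\<close> makes 6 K \<open>\<tau>\<close> = 1/2;
    together with 4 K \<eta> \<le> 1/2 this keeps the use of |S v|^2 below one copy.\<close>
  define \<kappa> where "\<kappa> = c0 / (8 * K\<^sup>2)"
  define \<tau> where "\<tau> = 1 / (12 * K)"
  have pos: "0 < \<kappa>" "0 < \<tau>" using c0_pos K_pos by (simp_all add: \<kappa>_def \<tau>_def)
  have mx: "s * mixed v \<le> \<kappa> * G + \<eta> / \<kappa> * V"
  proof -
    have "s * mixed v \<le> s * (\<kappa> * gradsq v + sq v / \<kappa>)"
      using mixed_le[OF v0 vN pos(1)] s_pos by simp
    also have "\<dots> = \<kappa> * G + s * sq v / \<kappa>" by (simp add: G_def distrib_left)
    also have "s * sq v / \<kappa> \<le> \<eta> * V / \<kappa>"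
      using s_powers(1)[OF v0 vN] pos unfolding V_def by (intro divide_right_mono) auto
    finally show ?thesis by simp
  qed
  have lg: "s * locgrad v \<le> \<tau> * Z + (\<eta> / \<tau> + 4 * K ^ 3 * \<eta>) * V + 12 * K\<^sup>2 * L + K * (s * mixed v)"
    using locgrad_le[OF v0 vN pos(2)] by (simp add: V_def Z_def L_def)
  have lp: "s * h\<^sup>2 * lapsq v \<le> 2 * \<eta> * Z + 72 * K ^ 4 * \<eta> * V"
    using lapsq_le[OF v0 vN] by (simp add: V_def Z_def)
  have "c0 ^ 3 * V - 33 * K ^ 3 * L + 2 * c0 * G - 6 * K * (s * locgrad v)
     - 2 * K * (s * h\<^sup>2 * lapsq v) - 2 * K * (s * mixed v) - 8 * K\<^sup>2 * \<eta> * V - K * \<eta> * V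
    \<le> (\<Sum>i<N. 2 * Sym v i * Asym v i) - (\<Sum>i<N. Sdot v i * v (Suc i))"
    using commutator_lower_bound lower_order_terms unfolding sym_asym_identity V_def G_def L_def by linarith
  moreover have "6 * K * (s * locgrad v) \<le> 6 * K * (\<tau> * Z + (\<eta> / \<tau> + 4 * K ^ 3 * \<eta>) * V + 12 * K\<^sup>2 * L + K * (s * mixed v))"
    using lg K_pos by simp
  moreover have "2 * K * (s * h\<^sup>2 * lapsq v) \<le> 2 * K * (2 * \<eta> * Z + 72 * K ^ 4 * \<eta> * V)"
    using lp K_pos by simp
  moreover have "(2 * K + 6 * K\<^sup>2) * (s * mixed v) \<le> (2 * K + 6 * K\<^sup>2) * (\<kappa> * G + \<eta> / \<kappa> * V)"
    using mx K_pos by (intro mult_left_mono) auto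
  ultimately have main: "c0 ^ 3 * V + 2 * c0 * G - 33 * K ^ 3 * L
     - 6 * K * (\<tau> * Z + (\<eta> / \<tau> + 4 * K ^ 3 * \<eta>) * V + 12 * K\<^sup>2 * L)
     - 2 * K * (2 * \<eta> * Z + 72 * K ^ 4 * \<eta> * V) - (2 * K + 6 * K\<^sup>2) * (\<kappa> * G + \<eta> / \<kappa> * V)
     - 8 * K\<^sup>2 * \<eta> * V - K * \<eta> * V
    \<le> (\<Sum>i<N. 2 * Sym v i * Asym v i) - (\<Sum>i<N. Sdot v i * v (Suc i))"
    by (simp add: distrib_left distrib_right power2_eq_square mult.assoc)
  have KK: "K \<le> K\<^sup>2" using K_power_mono[of 1 2] by simp
  have "(2 * K + 6 * K\<^sup>2) * \<kappa> \<le> (8 * K\<^sup>2) * \<kappa>" using KK pos by (intro mult_right_mono) auto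
  also have "\<dots> = c0" using K_pos by (simp add: \<kappa>_def)
  finally have Gc: "(2 * K + 6 * K\<^sup>2) * \<kappa> * G \<le> c0 * G" using G0 by (rule mult_right_mono)
  have "6 * K * \<tau> + 4 * K * \<eta> \<le> 1" using eta_K_le K_pos by (simp add: \<tau>_def)
  then have Zc: "(6 * K * \<tau> + 4 * K * \<eta>) * Z \<le> 1 * Z" using Z0 by (rule mult_right_mono)
  \<comment> \<open>All error coefficients of s^3 v^2, bounded by multiples of K^5 / c0: 72 + 24 +
    144 + 64 + 8 + 1 = 313. Twice the rounded 350 is the 700 in the choice of
    \<open>\<eta>\<close>.\<close>
  have "6 * K * (1 / \<tau> + 4 * K ^ 3) + 144 * K ^ 5 + (2 * K + 6 * K\<^sup>2) / \<kappa> + 8 * K\<^sup>2 + K \<le> 350 * K ^ 5 / c0"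
  proof -
    have arith: "a + 144 * x5 + b + 8 * x2 + x1 \<le> 350 * y"
      if "0 \<le> x1" "a = 72 * x2 + 24 * x4" "b \<le> 64 * y" "x2 \<le> x5" "x4 \<le> x5" "x1 \<le> x5" "x5 \<le> y"
      for a b x1 x2 x4 x5 y :: real
      using that by linarith
    have "(2 * K + 6 * K\<^sup>2) / \<kappa> \<le> (8 * K\<^sup>2) / \<kappa>" using KK pos by (intro divide_right_mono) auto
    also have "\<dots> = 64 * (K ^ 4 / c0)"
      by (simp add: \<kappa>_def power2_eq_square power4_eq_xxxx)
    also have "\<dots> \<le> 64 * (K ^ 5 / c0)"
      using K_power_mono[of 4 5] c0_pos by (intro mult_left_mono divide_right_mono) auto
    finally have b: "(2 * K + 6 * K\<^sup>2) / \<kappa> \<le> 64 * (K ^ 5 / c0)" .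
    have a: "6 * K * (1 / \<tau> + 4 * K ^ 3) = 72 * K\<^sup>2 + 24 * K ^ 4"
      by (simp add: \<tau>_def power2_eq_square power3_eq_cube power4_eq_xxxx algebra_simps)
    have "K ^ 5 \<le> K ^ 5 / c0" using c0_pos c0_le K_pos by (simp add: pos_le_divide_eq)
    then have "6 * K * (1 / \<tau> + 4 * K ^ 3) + 144 * K ^ 5 + (2 * K + 6 * K\<^sup>2) / \<kappa> + 8 * K\<^sup>2 + K \<le> 350 * (K ^ 5 / c0)"
      using K_power_mono[of 2 5] K_power_mono[of 4 5] K_power_mono[of 1 5] K_pos by (intro arith[OF _ a b]) auto
    then show ?thesis by simp
  qed
  then have "\<eta> * (6 * K * (1 / \<tau> + 4 * K ^ 3) + 144 * K ^ 5 + (2 * K + 6 * K\<^sup>2) / \<kappa> + 8 * K\<^sup>2 + K) \<le> \<eta> * (350 * K ^ 5 / c0)"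
    using eta_pos by (intro mult_left_mono) auto
  also have "\<dots> \<le> c0 ^ 3 / 2"
  proof -
    have "350 * K ^ 5 * \<eta> \<le> c0 ^ 4 / 2" using eta_K by simp
    then have "350 * K ^ 5 * \<eta> / c0 \<le> c0 ^ 4 / 2 / c0" using c0_pos by (intro divide_right_mono) auto
    then show ?thesis using c0_pos by (simp add: power4_eq_xxxx power3_eq_cube mult_ac)
  qed
  finally have "\<eta> * (6 * K * (1 / \<tau> + 4 * K ^ 3) + 144 * K ^ 5 + (2 * K + 6 * K\<^sup>2) / \<kappa> + 8 * K\<^sup>2 + K) * V \<le> c0 ^ 3 / 2 * V"
    using V0 by (rule mult_right_mono)
  then have Vc: "6 * K * (\<eta> / \<tau> + 4 * K ^ 3 * \<eta>) * V + 144 * K ^ 5 * \<eta> * V + (2 * K + 6 * K\<^sup>2) * (\<eta> / \<kappa>) * V + 8 * K\<^sup>2 * \<eta> * V + K * \<eta> * V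
      \<le> c0 ^ 3 / 2 * V"
    by (simp add: algebra_simps add_divide_distrib)
  \<comment> \<open>The local coefficient 105 is 33 from the cubic term plus 6 * 12 from the
    localized gradient.\<close>
  have "c0 ^ 3 * V + 2 * c0 * G - 33 * K ^ 3 * L
     - 6 * K * (\<tau> * Z + (\<eta> / \<tau> + 4 * K ^ 3 * \<eta>) * V + 12 * K\<^sup>2 * L)
     - 2 * K * (2 * \<eta> * Z + 72 * K ^ 4 * \<eta> * V) - (2 * K + 6 * K\<^sup>2) * (\<kappa> * G + \<eta> / \<kappa> * V)
     - 8 * K\<^sup>2 * \<eta> * V - K * \<eta> * V
    = c0 ^ 3 * V + 2 * c0 * G - 105 * K ^ 3 * L - (6 * K * \<tau> + 4 * K * \<eta>) * Z - (2 * K + 6 * K\<^sup>2) * \<kappa> * G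
     - (6 * K * (\<eta> / \<tau> + 4 * K ^ 3 * \<eta>) * V + 144 * K ^ 5 * \<eta> * V + (2 * K + 6 * K\<^sup>2) * (\<eta> / \<kappa>) * V + 8 * K\<^sup>2 * \<eta> * V + K * \<eta> * V)"
    by (simp add: algebra_simps power_numeral_reduce)
  with main Gc Zc Vc show ?thesis unfolding V_def[symmetric] G_def[symmetric] L_def[symmetric] Z_def[symmetric] by linarith
qed

end

end

section \<open>Weight function\<close>

lemma first_difference:
  fixes f f1 :: "real \<Rightarrow> real"
  assumes f: "\<And>x. x \<in> {0..1} \<Longrightarrow> (f has_real_derivative f1 x) (at x)"
    and x: "0 \<le> x" "x + h \<le> 1" "0 < h"
  shows "\<exists>\<xi>. x < \<xi> \<and> \<xi> < x + h \<and> f (x + h) - f x = h * f1 \<xi>"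
  using MVT2[of x "x + h" f f1] f x by auto

text \<open>The mean value theorem is applied twice: to y \<mapsto> f (y + h) - f y, and then to f1
  on the resulting interval of length h. This gives one intermediate point and hence an exact
  formula, from which signs as well as sizes can be read off.\<close>

lemma second_difference:
  fixes f f1 f2 :: "real \<Rightarrow> real"
  assumes f: "\<And>x. x \<in> {0..1} \<Longrightarrow> (f has_real_derivative f1 x) (at x)"
    and f1: "\<And>x. x \<in> {0..1} \<Longrightarrow> (f1 has_real_derivative f2 x) (at x)"
    and x: "0 \<le> x" "x + 2 * h \<le> 1" "0 < h"
  shows "\<exists>\<xi>. x < \<xi> \<and> \<xi> < x + 2 * h \<and> f (x + 2 * h) - 2 * f (x + h) + f x = h\<^sup>2 * f2 \<xi>"
proof -
  have "\<exists>z. z > x \<and> z < x + h \<and> (\<lambda>y. f (y + h) - f y) (x + h) - (\<lambda>y. f (y + h) - f y) x = (x + h - x) * (f1 (z + h) - f1 z)"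
  proof (rule MVT2)
    fix y assume y: "x \<le> y" "y \<le> x + h"
    have "((\<lambda>y. f (y + h)) has_real_derivative f1 (y + h)) (at y)"
      using f[of "y + h"] y x by (simp add: DERIV_shift)
    then show "((\<lambda>y. f (y + h) - f y) has_real_derivative f1 (y + h) - f1 y) (at y)"
      using f[of y] y x by (intro DERIV_diff) auto
  qed (use x in auto)
  then obtain z where z: "x < z" "z < x + h" and e: "f (x + 2 * h) - 2 * f (x + h) + f x = h * (f1 (z + h) - f1 z)"
    by (auto simp: algebra_simps)
  obtain \<xi> where "z < \<xi>" "\<xi> < z + h" "f1 (z + h) - f1 z = h * f2 \<xi>"
    using first_difference[OF f1, of z h] z x by auto
  then show ?thesis using z e by (intro exI[of _ \<xi>]) (auto simp: power2_eq_square)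
qed

lemma third_difference:
  fixes f f1 f2 f3 :: "real \<Rightarrow> real"
  assumes f: "\<And>x. x \<in> {0..1} \<Longrightarrow> (f has_real_derivative f1 x) (at x)"
    and f1: "\<And>x. x \<in> {0..1} \<Longrightarrow> (f1 has_real_derivative f2 x) (at x)"
    and f2: "\<And>x. x \<in> {0..1} \<Longrightarrow> (f2 has_real_derivative f3 x) (at x)"
    and x: "0 \<le> x" "x + 3 * h \<le> 1" "0 < h"
  shows "\<exists>\<xi>. x < \<xi> \<and> \<xi> < x + 3 * h \<and> f (x + 3 * h) - 3 * f (x + 2 * h) + 3 * f (x + h) - f x = h ^ 3 * f3 \<xi>"
proof -
  let ?u = "\<lambda>y. f (y + 2 * h) - 2 * f (y + h) + f y"
  have "\<exists>z. z > x \<and> z < x + h \<and> ?u (x + h) - ?u x = (x + h - x) * (f1 (z + 2 * h) - 2 * f1 (z + h) + f1 z)"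
  proof (rule MVT2)
    fix y assume y: "x \<le> y" "y \<le> x + h"
    have "((\<lambda>y. f (y + h)) has_real_derivative f1 (y + h)) (at y)"
      using f[of "y + h"] y x by (simp add: DERIV_shift)
    moreover have "((\<lambda>y. f (y + 2 * h)) has_real_derivative f1 (y + 2 * h)) (at y)"
      using f[of "y + 2 * h"] y x by (simp add: DERIV_shift)
    ultimately show "(?u has_real_derivative f1 (y + 2 * h) - 2 * f1 (y + h) + f1 y) (at y)"
      using f[of y] y x by (intro DERIV_add DERIV_diff DERIV_cmult) auto
  qed (use x in auto)
  then obtain z where z: "x < z" "z < x + h"
    and e: "f (x + 3 * h) - 3 * f (x + 2 * h) + 3 * f (x + h) - f x = h * (f1 (z + 2 * h) - 2 * f1 (z + h) + f1 z)"
    by (auto simp: algebra_simps)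
  have "0 \<le> z" "z + 2 * h \<le> 1" using z x by auto
  from second_difference[OF f1 f2 this x(3)]
  have "\<exists>\<xi>. z < \<xi> \<and> \<xi> < z + 2 * h \<and> f1 (z + 2 * h) - 2 * f1 (z + h) + f1 z = h\<^sup>2 * f3 \<xi>" .
  then obtain \<xi> where "z < \<xi>" "\<xi> < z + 2 * h" "f1 (z + 2 * h) - 2 * f1 (z + h) + f1 z = h\<^sup>2 * f3 \<xi>" by blast
  then show ?thesis using z e by (intro exI[of _ \<xi>]) (auto simp: power2_eq_square power3_eq_cube)
qed

lemma continuous_compact_bounded_below:
  fixes f :: "real \<Rightarrow> real"
  assumes "compact S" "continuous_on S f" "\<And>x. x \<in> S \<Longrightarrow> 0 < f x"
  obtains m where "0 < m" "\<And>x. x \<in> S \<Longrightarrow> m \<le> f x"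
proof (cases "S = {}")
  case False
  then obtain y where y: "y \<in> S" "\<And>x. x \<in> S \<Longrightarrow> f y \<le> f x"
    using continuous_attains_inf[OF assms(1) False assms(2)] by blast
  then show ?thesis using assms(3) that by blast
qed (use that[of 1] in auto)

lemma continuous_compact_bounded_above:
  fixes f :: "real \<Rightarrow> real"
  assumes "compact S" "continuous_on S f"
  obtains m where "1 \<le> m" "\<And>x. x \<in> S \<Longrightarrow> \<bar>f x\<bar> \<le> m"
proof -
  have "bounded (f ` S)" using compact_imp_bounded compact_continuous_image assms by blast
  then obtain m where "\<And>x. x \<in> S \<Longrightarrow> \<bar>f x\<bar> \<le> m" by (auto simp: bounded_iff)
  then show ?thesis using that[of "max 1 m"] by fastforce
qed

text \<open>The bound 4 on p makes the derivatives of orders 0 to 3 differentiable; in particular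
  the third one is continuous, hence bounded on [0,1].\<close>

lemma admissible_psi_derivatives:
  assumes "admissible_psi p U0 G \<psi>" "4 \<le> p" "k < 4" "x \<in> G"
  shows "((deriv ^^ k) \<psi> has_real_derivative (deriv ^^ Suc k) \<psi> x) (at x)"
proof -
  have "(deriv ^^ k) \<psi> differentiable_on G" and o: "open G"
    using assms by (auto simp: admissible_psi_def Cp_on_def)
  then have "(deriv ^^ k) \<psi> differentiable at x"
    using assms(4) by (simp add: differentiable_on_eq_differentiable_at)
  then have "(deriv ^^ k) \<psi> field_differentiable at x"
    by (simp add: field_differentiable_def real_differentiable_def)
  then show ?thesis using DERIV_deriv_iff_field_differentiable by force
qed

text \<open>phi_xx = (mu psi'' + mu^2 psi'^2) exp (mu psi). Off omega_0 the slope of psi is bounded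
  away from 0 by compactness, so the quadratic term in mu dominates. K and c0 depend on mu but not
  on lambda, delta or h.\<close>

lemma weight_bounds:
  assumes adm: "admissible_psi p U0 G \<psi>" "4 \<le> p" and U0: "open U0" "U0 \<subseteq> {0<..<1}"
  shows "\<exists>\<mu>0>0. \<forall>\<mu>>\<mu>0. \<exists>f1 f2 f3 K c0. 1 \<le> K \<and> 0 < c0 \<and> c0 \<le> 1 \<and>
    (\<forall>x\<in>{0..1}. (phi G \<psi> \<mu> has_real_derivative f1 x) (at x) \<and> (f1 has_real_derivative f2 x) (at x) \<and>
       (f2 has_real_derivative f3 x) (at x) \<and>
       \<bar>phi G \<psi> \<mu> x\<bar> \<le> K \<and> \<bar>f1 x\<bar> \<le> K \<and> \<bar>f2 x\<bar> \<le> K \<and> \<bar>f3 x\<bar> \<le> K \<and>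
       (x \<notin> U0 \<longrightarrow> 2 * c0 \<le> f2 x \<and> 2 * c0 \<le> \<bar>f1 x\<bar>)) \<and> 0 < f1 0 \<and> f1 1 < 0"
proof -
  have G: "{0..1} \<subseteq> G" and nz: "\<And>x. x \<in> G - U0 \<Longrightarrow> \<bar>deriv \<psi> x\<bar> > 0"
    and ends: "0 < deriv \<psi> 0" "deriv \<psi> 1 < 0"
    using adm by (auto simp: admissible_psi_def)
  define p1 p2 p3 where "p1 = deriv \<psi>" and "p2 = deriv (deriv \<psi>)" and "p3 = deriv (deriv (deriv \<psi>))"
  have d: "(\<psi> has_real_derivative p1 x) (at x)" "(p1 has_real_derivative p2 x) (at x)"
    "(p2 has_real_derivative p3 x) (at x)" "(p3 has_real_derivative deriv p3 x) (at x)" if "x \<in> {0..1}" for x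
    using admissible_psi_derivatives[OF adm, of 0 x] admissible_psi_derivatives[OF adm, of 1 x]
      admissible_psi_derivatives[OF adm, of 2 x] admissible_psi_derivatives[OF adm, of 3 x] that G
    by (auto simp: p1_def p2_def p3_def eval_nat_numeral)
  have cont: "continuous_on {0..1} \<psi>" "continuous_on {0..1} p1" "continuous_on {0..1} p2" "continuous_on {0..1} p3"
    by (intro continuous_at_imp_continuous_on ballI DERIV_isCont[OF d(1)] DERIV_isCont[OF d(2)]
        DERIV_isCont[OF d(3)] DERIV_isCont[OF d(4)]; assumption)+
  define S where "S = {0..1} - U0"
  have S: "compact S" "S \<subseteq> {0..1}" using U0 by (auto simp: S_def compact_diff)
  have "0 < \<bar>p1 x\<bar>" if "x \<in> S" for x using nz that G by (auto simp: S_def p1_def)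
  then obtain m where m: "0 < m" "\<And>x. x \<in> S \<Longrightarrow> m \<le> \<bar>p1 x\<bar>"
    using continuous_compact_bounded_below[OF S(1), of "\<lambda>x. \<bar>p1 x\<bar>"]
    by (metis continuous_on_rabs continuous_on_subset[OF cont(2) S(2)])
  obtain K2 where K2: "1 \<le> K2" "\<And>x. x \<in> {0..1} \<Longrightarrow> \<bar>p2 x\<bar> \<le> K2"
    using continuous_compact_bounded_above[OF _ cont(3)] by auto
  \<comment> \<open>With |psi''| \<le> K2 on [0,1] and |psi'| \<ge> m off omega_0, this is the
    threshold beyond which psi'' + mu psi'^2 is positive there.\<close>
  define \<mu>0 where "\<mu>0 = K2 / m\<^sup>2"
  have "0 < \<mu>0" using K2 m by (simp add: \<mu>0_def)
  moreover have "\<exists>f1 f2 f3 K c0. 1 \<le> K \<and> 0 < c0 \<and> c0 \<le> 1 \<and>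
    (\<forall>x\<in>{0..1}. (phi G \<psi> \<mu> has_real_derivative f1 x) (at x) \<and> (f1 has_real_derivative f2 x) (at x) \<and>
       (f2 has_real_derivative f3 x) (at x) \<and>
       \<bar>phi G \<psi> \<mu> x\<bar> \<le> K \<and> \<bar>f1 x\<bar> \<le> K \<and> \<bar>f2 x\<bar> \<le> K \<and> \<bar>f3 x\<bar> \<le> K \<and>
       (x \<notin> U0 \<longrightarrow> 2 * c0 \<le> f2 x \<and> 2 * c0 \<le> \<bar>f1 x\<bar>)) \<and> 0 < f1 0 \<and> f1 1 < 0" if mu: "\<mu> > \<mu>0" for \<mu>
  proof -
    have mu0: "0 < \<mu>" using mu \<open>0 < \<mu>0\<close> by simp
    define f1 where "f1 x = \<mu> * p1 x * exp (\<mu> * \<psi> x)" for x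
    define f2 where "f2 x = (\<mu> * p2 x + \<mu>\<^sup>2 * (p1 x)\<^sup>2) * exp (\<mu> * \<psi> x)" for x
    define f3 where "f3 x = (\<mu> * p3 x + 3 * \<mu>\<^sup>2 * p1 x * p2 x + \<mu> ^ 3 * (p1 x) ^ 3) * exp (\<mu> * \<psi> x)" for x
    have D: "(phi G \<psi> \<mu> has_real_derivative f1 x) (at x)" "(f1 has_real_derivative f2 x) (at x)"
       "(f2 has_real_derivative f3 x) (at x)" if "x \<in> {0..1}" for x
      unfolding phi_def[abs_def] f1_def[abs_def] f2_def[abs_def] f3_def
      by (rule derivative_eq_intros d that refl | simp add: power2_eq_square power3_eq_cube algebra_simps)+
    have cf: "continuous_on {0..1} (phi G \<psi> \<mu>)" "continuous_on {0..1} f1" "continuous_on {0..1} f2" "continuous_on {0..1} f3"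
      unfolding phi_def[abs_def] f1_def[abs_def] f2_def[abs_def] f3_def[abs_def] by (intro continuous_intros cont)+
    obtain k0 where k0: "1 \<le> k0" "\<And>x. x \<in> {0..1} \<Longrightarrow> \<bar>phi G \<psi> \<mu> x\<bar> \<le> k0"
      using continuous_compact_bounded_above[OF _ cf(1)] by auto
    obtain k1 where k1: "1 \<le> k1" "\<And>x. x \<in> {0..1} \<Longrightarrow> \<bar>f1 x\<bar> \<le> k1"
      using continuous_compact_bounded_above[OF _ cf(2)] by auto
    obtain k2 where k2: "1 \<le> k2" "\<And>x. x \<in> {0..1} \<Longrightarrow> \<bar>f2 x\<bar> \<le> k2"
      using continuous_compact_bounded_above[OF _ cf(3)] by auto
    obtain k3 where k3: "1 \<le> k3" "\<And>x. x \<in> {0..1} \<Longrightarrow> \<bar>f3 x\<bar> \<le> k3"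
      using continuous_compact_bounded_above[OF _ cf(4)] by auto
    have pos2: "0 < f2 x" if "x \<in> S" for x
    proof -
      have "m\<^sup>2 \<le> (p1 x)\<^sup>2" using m(2)[OF that] m(1) by (simp add: abs_le_square_iff[symmetric])
      then have "\<mu> * m\<^sup>2 \<le> \<mu> * (p1 x)\<^sup>2" using mu0 by simp
      moreover have "K2 < \<mu> * m\<^sup>2" using mu m by (simp add: \<mu>0_def pos_divide_less_eq)
      moreover have "\<bar>p2 x\<bar> \<le> K2" using K2 S(2) that by auto
      ultimately have "0 < p2 x + \<mu> * (p1 x)\<^sup>2" by linarith
      with mu0 have "0 < \<mu> * (p2 x + \<mu> * (p1 x)\<^sup>2)" by (rule mult_pos_pos)
      then have "0 < \<mu> * (p2 x + \<mu> * (p1 x)\<^sup>2) * exp (\<mu> * \<psi> x)" by simp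
      then show ?thesis by (simp add: f2_def power2_eq_square algebra_simps)
    qed
    have pos1: "0 < \<bar>f1 x\<bar>" if "x \<in> S" for x
      using m that mu0 by (auto simp: f1_def abs_mult dest: m(2))
    obtain a where a: "0 < a" "\<And>x. x \<in> S \<Longrightarrow> a \<le> f2 x"
      using continuous_compact_bounded_below[OF S(1) continuous_on_subset[OF cf(3) S(2)] pos2] by blast
    obtain b where b: "0 < b" "\<And>x. x \<in> S \<Longrightarrow> b \<le> \<bar>f1 x\<bar>"
      using continuous_compact_bounded_below[OF S(1) continuous_on_rabs[OF continuous_on_subset[OF cf(2) S(2)]] pos1] by blast
    \<comment> \<open>The halving provides the margin 2 c0, half of which is lost when passing from
      a node to an intermediate point nearby.\<close>
    define c0 where "c0 = min 1 (min a b / 2)"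
    define K where "K = max k0 (max k1 (max k2 k3))"
    have "1 \<le> K" "0 < c0" "c0 \<le> 1" using k0 a b by (auto simp: K_def c0_def)
    moreover have "\<bar>phi G \<psi> \<mu> x\<bar> \<le> K \<and> \<bar>f1 x\<bar> \<le> K \<and> \<bar>f2 x\<bar> \<le> K \<and> \<bar>f3 x\<bar> \<le> K" if "x \<in> {0..1}" for x
      using k0(2)[OF that] k1(2)[OF that] k2(2)[OF that] k3(2)[OF that] by (auto simp: K_def le_max_iff_disj)
    moreover have "2 * c0 \<le> f2 x \<and> 2 * c0 \<le> \<bar>f1 x\<bar>" if "x \<in> {0..1}" "x \<notin> U0" for x
    proof -
      have "x \<in> S" using that by (simp add: S_def)
      moreover have "2 * c0 \<le> a" "2 * c0 \<le> b" by (auto simp: c0_def min_def)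
      ultimately show ?thesis using a(2)[of x] b(2)[of x] by linarith
    qed
    moreover have "0 < f1 0" "f1 1 < 0" using ends mu0 by (auto simp: f1_def p1_def mult_pos_neg mult_neg_pos)
    ultimately show ?thesis using D by blast
  qed
  ultimately show ?thesis by blast
qed

text \<open>A truncated distance to the closure of omega_0, scaled by the positive distance from
  this compact set to the complement of omega. Lipschitz regularity suffices because only first
  differences of the cutoff occur.\<close>

lemma lipschitz_cutoff:
  fixes U0 U :: "real set"
  assumes U: "open U" "U0 \<noteq> {}" "closure U0 \<subseteq> U" "U \<subseteq> {0<..<1}"
  obtains \<zeta> L where "\<And>x. 0 \<le> \<zeta> x" "\<And>x. \<zeta> x \<le> 1" "\<And>x y. \<bar>\<zeta> x - \<zeta> y\<bar> \<le> L * \<bar>x - y\<bar>"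
    "\<And>x. x \<in> U0 \<Longrightarrow> \<zeta> x = 1" "\<And>x. x \<notin> U \<Longrightarrow> \<zeta> x = 0" "(0::real) \<le> L"
proof -
  let ?C = "closure U0"
  have C: "compact ?C"
  proof -
    have "?C \<subseteq> {0..1}" using U by force
    then show ?thesis by (meson bounded_closed_interval bounded_subset closed_closure compact_eq_bounded_closed)
  qed
  have ne: "?C \<noteq> {}" using U by auto
  have "- U \<noteq> {}" using U by (metis Compl_eq_Diff_UNIV Diff_eq_empty_iff UNIV_I greaterThanLessThan_iff less_irrefl subset_iff)
  define r where "r = setdist ?C (- U)"
  have r: "0 < r"
    using setdist_gt_0_compact_closed[OF C, of "- U"] U ne \<open>- U \<noteq> {}\<close>
    unfolding r_def by (auto simp: closed_Compl)
  define \<zeta> where "\<zeta> x = max 0 (1 - infdist x ?C / r)" for x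
  show ?thesis
  proof (rule that[of \<zeta> "1 / r"])
    fix x y
    show "0 \<le> \<zeta> x" by (simp add: \<zeta>_def)
    show "\<zeta> x \<le> 1" using r by (simp add: \<zeta>_def infdist_nonneg)
    have "\<bar>infdist x ?C - infdist y ?C\<bar> \<le> dist x y"
      using infdist_triangle[of x ?C y] infdist_triangle[of y ?C x] by (simp add: dist_commute abs_le_iff)
    then have "\<bar>infdist x ?C / r - infdist y ?C / r\<bar> \<le> dist x y / r"
      using r by (simp add: diff_divide_distrib[symmetric] divide_right_mono)
    then show "\<bar>\<zeta> x - \<zeta> y\<bar> \<le> 1 / r * \<bar>x - y\<bar>"
      by (auto simp: \<zeta>_def dist_real_def max_def abs_if split: if_splits)
  next
    fix x assume "x \<in> U0"
    then have "x \<in> ?C" using closure_subset by blast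
    then show "\<zeta> x = 1" by (simp add: \<zeta>_def)
  next
    fix x assume x: "x \<notin> U"
    obtain c where c: "c \<in> ?C" "infdist x ?C = dist x c"
      using infdist_attains_inf[OF closed_closure ne] by metis
    have "r \<le> dist c x" unfolding r_def using c x by (intro setdist_le_dist) auto
    then have "1 \<le> infdist x ?C / r" using c r by (simp add: dist_commute)
    then show "\<zeta> x = 0" by (simp add: \<zeta>_def)
  qed (use r in auto)
qed

section \<open>Energy identity\<close>

lemma sum_edges_left:
  fixes X :: "nat \<Rightarrow> real" shows "X 0 = 0 \<Longrightarrow> (\<Sum>i<N. X (Suc i)) = (\<Sum>i\<le>N. X i)"
  using sum_shift_left[of X N] by simp

lemma sum_edges_right:
  fixes X :: "nat \<Rightarrow> real" shows "X N = 0 \<Longrightarrow> (\<Sum>i<N. X i) = (\<Sum>i\<le>N. X i)"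
  using sum_shift_right[of X N] by simp

lemma sum_inner_edges:
  fixes X :: "nat \<Rightarrow> real" assumes "0 < N" "X 0 = 0" "X N = 0"
  shows "(\<Sum>i<N - 1. X (Suc i)) = (\<Sum>i\<le>N. X i)"
proof -
  obtain n where n: "N = Suc n" using assms(1) gr0_conv_Suc by auto
  show ?thesis using sum_shift_left[of X n] assms by (simp add: n)
qed

context carleman_bounds
begin

text \<open>\<open>qform\<close> is the quadratic form of S. Written in u with v = \<open>wt\<close>
  u, its coefficients are \<open>qdiag\<close> at the nodes and \<open>qoff\<close> on the edges,
  and the primed versions are their time derivatives. In this form the coefficients are
  deterministic functions of time, so the product rule can be applied entry by entry to u.\<close>

definition "wt i = exp (s * \<phi> i)"
definition "wt2 i = exp (2 * s * \<phi> i)"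
definition "qdiag i = - (2 / h\<^sup>2 + s1 * \<phi> i) * wt2 i"
definition "qdiag' i = - s2 * \<phi> i * wt2 i - (2 / h\<^sup>2 + s1 * \<phi> i) * (2 * s1 * \<phi> i * wt2 i)"
definition "qoff i = (wt2 i + wt2 (Suc i)) / h\<^sup>2"
definition "qoff' i = 2 * s1 * (\<phi> i * wt2 i + \<phi> (Suc i) * wt2 (Suc i)) / h\<^sup>2"
definition "qform y = (\<Sum>i<N. - (2 / h\<^sup>2 + s1 * \<phi> (Suc i)) * (y (Suc i))\<^sup>2) + (\<Sum>i\<le>N. 2 * c i * (y i * y (Suc i)) / h\<^sup>2)"

text \<open>Since \<open>wt i * wt (Suc i)\<close> times exp (s q) or exp (- s q) is
  \<open>wt2\<close> at one of the two ends, the hyperbolic functions disappear in the variable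
  u.\<close>

lemma wt_products:
  "wt i * wt i = wt2 i" "wt i * wt (Suc i) * c i = (wt2 i + wt2 (Suc i)) / 2"
  "wt i * wt (Suc i) * \<sigma> i = (wt2 (Suc i) - wt2 i) / 2"
proof -
  show "wt i * wt i = wt2 i" by (simp add: wt_def wt2_def exp_add[symmetric])
  have e: "wt i * wt (Suc i) * exp (s * q i) = wt2 (Suc i)" "wt i * wt (Suc i) * exp (- (s * q i)) = wt2 i"
    unfolding wt_def wt2_def q_def by (simp_all add: exp_add[symmetric] algebra_simps)
  show "wt i * wt (Suc i) * c i = (wt2 i + wt2 (Suc i)) / 2"
    unfolding c_def cosh_field_def times_divide_eq_right distrib_left e by simp
  show "wt i * wt (Suc i) * \<sigma> i = (wt2 (Suc i) - wt2 i) / 2"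
    unfolding \<sigma>_def sinh_field_def times_divide_eq_right right_diff_distrib e by simp
qed

lemma qform_weighted:
  "(\<Sum>i<N. qdiag (Suc i) * (g (Suc i))\<^sup>2) + (\<Sum>i\<le>N. qoff i * (g i * g (Suc i))) = qform (\<lambda>i. wt i * g i)"
proof -
  have "qoff i * (g i * g (Suc i)) = 2 * c i * ((wt i * g i) * (wt (Suc i) * g (Suc i))) / h\<^sup>2" for i
  proof -
    have "2 * c i * ((wt i * g i) * (wt (Suc i) * g (Suc i))) = 2 * (wt i * wt (Suc i) * c i) * (g i * g (Suc i))"
      by (simp add: mult_ac)
    also have "\<dots> = (wt2 i + wt2 (Suc i)) * (g i * g (Suc i))" unfolding wt_products(2) by simp
    finally have eq: "2 * c i * ((wt i * g i) * (wt (Suc i) * g (Suc i))) = (wt2 i + wt2 (Suc i)) * (g i * g (Suc i))" .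
    show ?thesis unfolding eq qoff_def by simp
  qed
  moreover have "qdiag i * (g i)\<^sup>2 = - (2 / h\<^sup>2 + s1 * \<phi> i) * (wt i * g i)\<^sup>2" for i
    by (simp add: qdiag_def power2_eq_square wt_products(1)[symmetric] mult_ac)
  ultimately show ?thesis by (simp add: qform_def)
qed

text \<open>\<open>u\<close>, \<open>b\<close>, \<open>f\<close> are the solution, its drift and the
  source at one time on one path. Drift and solution are zero at the end nodes, so sums over edges
  need no special treatment.\<close>

context
  fixes u b f :: "nat \<Rightarrow> real" and v
  assumes u0: "u 0 = 0" and uN: "u (Suc N) = 0" and b0: "b 0 = 0" and bN: "b (Suc N) = 0"
    and b: "\<And>i. i < N \<Longrightarrow> b (Suc i) = f (Suc i) - (u (i + 2) - 2 * u (Suc i) + u i) / h\<^sup>2"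
  defines v_def: "v \<equiv> \<lambda>i. wt i * u i"
begin

lemma v_ends: "v 0 = 0" "v (Suc N) = 0" by (simp_all add: v_def u0 uN)

lemma sym_weighted: "wt (Suc i) * Sym v i = qdiag (Suc i) * u (Suc i) + (qoff (Suc i) * u (i + 2) + qoff i * u i) / 2"
proof -
  have "wt (Suc i) * (c (Suc i) * v (i + 2)) = (wt2 (Suc i) + wt2 (i + 2)) / 2 * u (i + 2)"
    using wt_products(2)[of "Suc i"] by (simp add: v_def mult_ac)
  moreover have "wt (Suc i) * (c i * v i) = (wt2 i + wt2 (Suc i)) / 2 * u i"
    using wt_products(2)[of i] by (simp add: v_def mult_ac)
  moreover have "wt (Suc i) * v (Suc i) = wt2 (Suc i) * u (Suc i)"
    using wt_products(1)[of "Suc i"] by (simp add: v_def mult.assoc[symmetric])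
  moreover have "wt (Suc i) * Sym v i = (wt (Suc i) * (c (Suc i) * v (i + 2)) + wt (Suc i) * (c i * v i) - 2 * (wt (Suc i) * v (Suc i))) / h\<^sup>2
      - s1 * \<phi> (Suc i) * (wt (Suc i) * v (Suc i))"
    by (simp add: Sym_def algebra_simps diff_divide_distrib add_divide_distrib)
  ultimately show ?thesis
    by (simp add: qdiag_def qoff_def algebra_simps diff_divide_distrib add_divide_distrib)
qed

text \<open>Multiplying a neighbour of node i+1 by the weight at that node produces exp of minus or
  plus s q, that is cosh minus or plus sinh. The term s' phi v appears because \<open>Sym\<close>
  already contains it with a minus sign.\<close>

lemma weighted_drift:
  assumes "i < N"
  shows "wt (Suc i) * b (Suc i) = wt (Suc i) * f (Suc i) - Sym v i - s1 * \<phi> (Suc i) * v (Suc i) - Asym v i"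
proof -
  have e1: "wt (Suc i) * u (i + 2) = (c (Suc i) - \<sigma> (Suc i)) * v (i + 2)"
  proof -
    have "c (Suc i) - \<sigma> (Suc i) = exp (- (s * q (Suc i)))"
      unfolding c_def \<sigma>_def by (rule cosh_minus_sinh)
    moreover have "exp (- (s * q (Suc i))) * wt (i + 2) = wt (Suc i)"
      by (simp add: wt_def q_def exp_add[symmetric] algebra_simps)
    ultimately show ?thesis by (simp add: v_def mult.assoc[symmetric])
  qed
  have e2: "wt (Suc i) * u i = (c i + \<sigma> i) * v i"
  proof -
    have "c i + \<sigma> i = exp (s * q i)"
      unfolding c_def \<sigma>_def by (rule cosh_plus_sinh)
    moreover have "exp (s * q i) * wt i = wt (Suc i)"
      by (simp add: wt_def q_def exp_add[symmetric] algebra_simps)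
    ultimately show ?thesis by (simp add: v_def mult.assoc[symmetric])
  qed
  have "wt (Suc i) * b (Suc i) = wt (Suc i) * f (Suc i)
     - (wt (Suc i) * u (i + 2) - 2 * v (Suc i) + wt (Suc i) * u i) / h\<^sup>2"
    unfolding b[OF assms] by (simp add: v_def algebra_simps diff_divide_distrib add_divide_distrib)
  then show ?thesis
    unfolding e1 e2 by (simp add: Sym_def Asym_def algebra_simps diff_divide_distrib add_divide_distrib)
qed

text \<open>The variation of <S v, v> along the drift: by symmetry of the form the two bilinear
  terms coincide.\<close>

lemma drift_part:
  "(\<Sum>i<N. qdiag (Suc i) * (b (Suc i) * u (Suc i) + u (Suc i) * b (Suc i)))
    + (\<Sum>i\<le>N. qoff i * (b i * u (Suc i) + u i * b (Suc i))) = (\<Sum>i<N. 2 * Sym v i * (wt (Suc i) * b (Suc i)))"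
proof -
  have "(\<Sum>i\<le>N. qoff i * (b i * u (Suc i) + u i * b (Suc i))) = (\<Sum>i\<le>N. qoff i * (b i * u (Suc i))) + (\<Sum>i\<le>N. qoff i * (u i * b (Suc i)))"
    by (simp add: distrib_left sum.distrib)
  also have "\<dots> = (\<Sum>i<N. qoff (Suc i) * (b (Suc i) * u (i + 2))) + (\<Sum>i<N. qoff i * (u i * b (Suc i)))"
    using sum_edges_left[of "\<lambda>i. qoff i * (b i * u (Suc i))" N] sum_edges_right[of "\<lambda>i. qoff i * (u i * b (Suc i))" N] b0 bN
    by simp
  finally have "(\<Sum>i<N. qdiag (Suc i) * (b (Suc i) * u (Suc i) + u (Suc i) * b (Suc i)))
    + (\<Sum>i\<le>N. qoff i * (b i * u (Suc i) + u i * b (Suc i))) =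
    (\<Sum>i<N. qdiag (Suc i) * (b (Suc i) * u (Suc i) + u (Suc i) * b (Suc i)) + qoff (Suc i) * (b (Suc i) * u (i + 2)) + qoff i * (u i * b (Suc i)))"
    by (simp add: sum.distrib)
  also have "\<dots> = (\<Sum>i<N. 2 * (wt (Suc i) * Sym v i) * b (Suc i))"
    unfolding sym_weighted by (intro sum.cong refl) (simp add: algebra_simps add_divide_distrib)
  finally show ?thesis by (simp add: mult_ac)
qed

text \<open>Differentiating the coefficients in the variable u differs from differentiating S,
  because the weight inside v = \<open>wt\<close> u also moves: v' = s' phi v for fixed u. The
  additional term cancels the s' phi v of \<open>weighted_drift\<close>.\<close>

lemma time_derivative_part:
  "(\<Sum>i<N. qdiag' (Suc i) * (u (Suc i))\<^sup>2) + (\<Sum>i\<le>N. qoff' i * (u i * u (Suc i))) =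
   (\<Sum>i<N. Sdot v i * v (Suc i)) + (\<Sum>i<N. 2 * Sym v i * (s1 * \<phi> (Suc i) * v (Suc i)))"
proof -
  define Y where "Y i = v i * v (Suc i)" for i
  have Y0: "Y 0 = 0" "Y N = 0" using v_ends by (simp_all add: Y_def)
  have 1: "(\<Sum>i<N. Sdot v i * v (Suc i)) = (\<Sum>i<N. s1 / h\<^sup>2 * (q (Suc i) * \<sigma> (Suc i) * Y (Suc i)))
      + (\<Sum>i<N. s1 / h\<^sup>2 * (q i * \<sigma> i * Y i)) - (\<Sum>i<N. s2 * \<phi> (Suc i) * (v (Suc i))\<^sup>2)"
    unfolding sum.distrib[symmetric] sum_subtractf[symmetric]
    by (intro sum.cong refl) (simp add: Sdot_def Y_def algebra_simps add_divide_distrib power2_eq_square)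
  have 2: "(\<Sum>i<N. 2 * Sym v i * (s1 * \<phi> (Suc i) * v (Suc i))) =
     (\<Sum>i<N. 2 * s1 / h\<^sup>2 * (c (Suc i) * \<phi> (Suc i) * Y (Suc i))) + (\<Sum>i<N. 2 * s1 / h\<^sup>2 * (c i * \<phi> (Suc i) * Y i))
     - (\<Sum>i<N. (2 / h\<^sup>2 + s1 * \<phi> (Suc i)) * (2 * s1 * \<phi> (Suc i)) * (v (Suc i))\<^sup>2)"
    unfolding sum.distrib[symmetric] sum_subtractf[symmetric]
    by (intro sum.cong refl) (simp add: Sym_def Y_def algebra_simps add_divide_distrib diff_divide_distrib power2_eq_square)
  have 3: "(\<Sum>i<N. qdiag' (Suc i) * (u (Suc i))\<^sup>2) = - (\<Sum>i<N. s2 * \<phi> (Suc i) * (v (Suc i))\<^sup>2)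
     - (\<Sum>i<N. (2 / h\<^sup>2 + s1 * \<phi> (Suc i)) * (2 * s1 * \<phi> (Suc i)) * (v (Suc i))\<^sup>2)"
    unfolding sum_negf[symmetric] sum_subtractf[symmetric]
    by (intro sum.cong refl) (simp add: qdiag'_def v_def power_mult_distrib power2_eq_square wt_products(1)[symmetric] algebra_simps)
  have 4: "qoff' i * (u i * u (Suc i)) = s1 / h\<^sup>2 * (q i * \<sigma> i * Y i) + s1 / h\<^sup>2 * (q i * \<sigma> i * Y i)
      + 2 * s1 / h\<^sup>2 * (c i * \<phi> i * Y i) + 2 * s1 / h\<^sup>2 * (c i * \<phi> (Suc i) * Y i)" for i
  proof -
    have cY: "c i * Y i = (wt2 i + wt2 (Suc i)) / 2 * (u i * u (Suc i))"
      using wt_products(2)[of i] by (simp add: Y_def v_def mult_ac)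
    have sY: "\<sigma> i * Y i = (wt2 (Suc i) - wt2 i) / 2 * (u i * u (Suc i))"
      using wt_products(3)[of i] by (simp add: Y_def v_def mult_ac)
    have "s1 / h\<^sup>2 * (q i * \<sigma> i * Y i) + s1 / h\<^sup>2 * (q i * \<sigma> i * Y i)
      + 2 * s1 / h\<^sup>2 * (c i * \<phi> i * Y i) + 2 * s1 / h\<^sup>2 * (c i * \<phi> (Suc i) * Y i)
      = 2 * s1 / h\<^sup>2 * (q i * (\<sigma> i * Y i) + (\<phi> i + \<phi> (Suc i)) * (c i * Y i))"
      by (simp add: algebra_simps add_divide_distrib)
    also have "\<dots> = 2 * s1 / h\<^sup>2 * ((\<phi> i * wt2 i + \<phi> (Suc i) * wt2 (Suc i)) * (u i * u (Suc i)))"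
    proof -
      have "q i * (\<sigma> i * Y i) + (\<phi> i + \<phi> (Suc i)) * (c i * Y i) = (\<phi> i * wt2 i + \<phi> (Suc i) * wt2 (Suc i)) * (u i * u (Suc i))"
        unfolding cY sY q_def by (simp add: field_simps)
      then show ?thesis by simp
    qed
    finally show ?thesis by (simp add: qoff'_def)
  qed
  have "(\<Sum>i\<le>N. qoff' i * (u i * u (Suc i))) = (\<Sum>i\<le>N. s1 / h\<^sup>2 * (q i * \<sigma> i * Y i)) + (\<Sum>i\<le>N. s1 / h\<^sup>2 * (q i * \<sigma> i * Y i))
      + (\<Sum>i\<le>N. 2 * s1 / h\<^sup>2 * (c i * \<phi> i * Y i)) + (\<Sum>i\<le>N. 2 * s1 / h\<^sup>2 * (c i * \<phi> (Suc i) * Y i))"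
    unfolding 4 sum.distrib ..
  then show ?thesis
    unfolding 1 2 3
    using sum_edges_left[of "\<lambda>i. s1 / h\<^sup>2 * (q i * \<sigma> i * Y i)" N] sum_edges_right[of "\<lambda>i. s1 / h\<^sup>2 * (q i * \<sigma> i * Y i)" N]
      sum_edges_left[of "\<lambda>i. 2 * s1 / h\<^sup>2 * (c i * \<phi> i * Y i)" N] sum_edges_right[of "\<lambda>i. 2 * s1 / h\<^sup>2 * (c i * \<phi> (Suc i) * Y i)" N] Y0
    by simp
qed

text \<open>The left side has the shape delivered by the product rule for w_i w_j: one summand per
  interior node and one per edge between interior nodes. The end edges are missing because their
  products vanish.\<close>

lemma energy_identity:
  assumes g0: "g 0 = 0" and gN: "g (Suc N) = 0"
  shows "(\<Sum>i<N. qdiag' (Suc i) * (u (Suc i) * u (Suc i)) + qdiag (Suc i) * (b (Suc i) * u (Suc i) + u (Suc i) * b (Suc i) + g (Suc i) * g (Suc i)))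
    + (\<Sum>i<N - 1. qoff' (Suc i) * (u (Suc i) * u (i + 2)) + qoff (Suc i) * (b (Suc i) * u (i + 2) + u (Suc i) * b (i + 2) + g (Suc i) * g (i + 2)))
   = (\<Sum>i<N. Sdot v i * v (Suc i)) - 2 * (\<Sum>i<N. (Sym v i)\<^sup>2) - (\<Sum>i<N. 2 * Sym v i * Asym v i)
     + (\<Sum>i<N. 2 * Sym v i * (wt (Suc i) * f (Suc i))) + qform (\<lambda>i. wt i * g i)"
proof -
  have "(\<Sum>i<N - 1. qoff' (Suc i) * (u (Suc i) * u (i + 2)) + qoff (Suc i) * (b (Suc i) * u (i + 2) + u (Suc i) * b (i + 2) + g (Suc i) * g (i + 2)))
    = (\<Sum>i\<le>N. qoff' i * (u i * u (Suc i)) + qoff i * (b i * u (Suc i) + u i * b (Suc i) + g i * g (Suc i)))"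
    using sum_inner_edges[of N "\<lambda>i. qoff' i * (u i * u (Suc i)) + qoff i * (b i * u (Suc i) + u i * b (Suc i) + g i * g (Suc i))"]
      N_pos u0 uN b0 bN g0 gN by simp
  also have "\<dots> = (\<Sum>i\<le>N. qoff' i * (u i * u (Suc i))) + (\<Sum>i\<le>N. qoff i * (b i * u (Suc i) + u i * b (Suc i))) + (\<Sum>i\<le>N. qoff i * (g i * g (Suc i)))"
    by (simp only: sum.distrib[symmetric]) (simp add: algebra_simps)
  finally have o: "(\<Sum>i<N - 1. qoff' (Suc i) * (u (Suc i) * u (i + 2)) + qoff (Suc i) * (b (Suc i) * u (i + 2) + u (Suc i) * b (i + 2) + g (Suc i) * g (i + 2))) = \<dots>" .
  have d: "(\<Sum>i<N. qdiag' (Suc i) * (u (Suc i) * u (Suc i)) + qdiag (Suc i) * (b (Suc i) * u (Suc i) + u (Suc i) * b (Suc i) + g (Suc i) * g (Suc i))) =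
    (\<Sum>i<N. qdiag' (Suc i) * (u (Suc i))\<^sup>2) + (\<Sum>i<N. qdiag (Suc i) * (b (Suc i) * u (Suc i) + u (Suc i) * b (Suc i))) + (\<Sum>i<N. qdiag (Suc i) * (g (Suc i))\<^sup>2)"
    by (simp only: sum.distrib[symmetric] power2_eq_square) (simp add: algebra_simps)
  have w: "(\<Sum>i<N. 2 * Sym v i * (wt (Suc i) * b (Suc i))) =
     (\<Sum>i<N. 2 * Sym v i * (wt (Suc i) * f (Suc i))) - 2 * (\<Sum>i<N. (Sym v i)\<^sup>2)
       - (\<Sum>i<N. 2 * Sym v i * (s1 * \<phi> (Suc i) * v (Suc i))) - (\<Sum>i<N. 2 * Sym v i * Asym v i)"
    unfolding sum_distrib_left sum_subtractf[symmetric]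
  proof (intro sum.cong refl)
    fix i assume "i \<in> {..<N}"
    then have w: "wt (Suc i) * b (Suc i) = wt (Suc i) * f (Suc i) - Sym v i - s1 * \<phi> (Suc i) * v (Suc i) - Asym v i"
      using weighted_drift by simp
    show "2 * Sym v i * (wt (Suc i) * b (Suc i)) = 2 * Sym v i * (wt (Suc i) * f (Suc i)) - 2 * (Sym v i)\<^sup>2
       - 2 * Sym v i * (s1 * \<phi> (Suc i) * v (Suc i)) - 2 * Sym v i * Asym v i"
      unfolding w by (simp add: power2_eq_square algebra_simps)
  qed
  show ?thesis
    unfolding o d using drift_part time_derivative_part qform_weighted[of g] w by linarith
qed

text \<open>Young's inequality on 2 <S v, r f> uses one of the two copies of |S v|^2; the other is
  the one required by \<open>pointwise_carleman\<close>.\<close>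

lemma energy_estimate:
  assumes g0: "g 0 = 0" and gN: "g (Suc N) = 0"
  shows "c0 ^ 3 / 2 * (s ^ 3 * sq v) + c0 * (s * gradsq v) \<le>
     - ((\<Sum>i<N. qdiag' (Suc i) * (u (Suc i) * u (Suc i)) + qdiag (Suc i) * (b (Suc i) * u (Suc i) + u (Suc i) * b (Suc i) + g (Suc i) * g (Suc i)))
    + (\<Sum>i<N - 1. qoff' (Suc i) * (u (Suc i) * u (i + 2)) + qoff (Suc i) * (b (Suc i) * u (i + 2) + u (Suc i) * b (i + 2) + g (Suc i) * g (i + 2))))
    + (\<Sum>i<N. (wt (Suc i) * f (Suc i))\<^sup>2) + qform (\<lambda>i. wt i * g i) + 105 * K ^ 3 * (s ^ 3 * loc v)"
proof -
  have "(\<Sum>i<N. 2 * Sym v i * (wt (Suc i) * f (Suc i))) \<le> (\<Sum>i<N. (Sym v i)\<^sup>2 + (wt (Suc i) * f (Suc i))\<^sup>2)"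
    by (intro sum_mono) (metis sum_squares_bound)
  then have "(\<Sum>i<N. 2 * Sym v i * (wt (Suc i) * f (Suc i))) \<le> (\<Sum>i<N. (Sym v i)\<^sup>2) + (\<Sum>i<N. (wt (Suc i) * f (Suc i))\<^sup>2)"
    by (simp add: sum.distrib)
  then show ?thesis
    unfolding energy_identity[OF g0 gN] using pointwise_carleman[OF v_ends] by linarith
qed

end

text \<open>From above the -2 / h^2 on the diagonal cancels the leading part of the cosh terms,
  leaving order s^2; this decides the weight of g. From below there is no such cancellation and the
  size is h^(-2), which is the cost of an endpoint in time.\<close>

lemma qform_bounds:
  assumes y: "y 0 = 0" "y (Suc N) = 0"
  shows "qform y \<le> 5 * K\<^sup>2 * s\<^sup>2 * sq y" "- qform y \<le> 9 * K / h\<^sup>2 * sq y"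
proof -
  have cp: "0 \<le> c i" "c i \<le> 2" if "i \<le> N" for i
  proof -
    show "0 \<le> c i" by (simp add: c_def)
    show "c i \<le> 2" unfolding c_def using sq_le_1[OF that] by (intro cosh_le_2) auto
  qed
  have ab: "2 * \<bar>y i * y (Suc i)\<bar> \<le> (y i)\<^sup>2 + (y (Suc i))\<^sup>2" for i
    using sum_squares_bound[of "\<bar>y i\<bar>" "\<bar>y (Suc i)\<bar>"] by (simp add: abs_mult)
  have edge: "\<bar>2 * c i * (y i * y (Suc i))\<bar> \<le> c i * ((y i)\<^sup>2 + (y (Suc i))\<^sup>2)" if "i \<le> N" for i
    using mult_left_mono[OF ab[of i] cp(1)[OF that]] cp(1)[OF that] by (simp add: abs_mult mult_ac)
  have E: "(\<Sum>i\<le>N. c i * ((y i)\<^sup>2 + (y (Suc i))\<^sup>2)) = (\<Sum>i<N. (c (Suc i) + c i) * (y (Suc i))\<^sup>2)"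
    using sum_edges_left[of "\<lambda>i. c i * (y i)\<^sup>2" N] sum_edges_right[of "\<lambda>i. c i * (y (Suc i))\<^sup>2" N] y
    by (simp add: distrib_left distrib_right sum.distrib)
  have absE: "\<bar>\<Sum>i\<le>N. 2 * c i * (y i * y (Suc i)) / h\<^sup>2\<bar> \<le> (\<Sum>i<N. (c (Suc i) + c i) / h\<^sup>2 * (y (Suc i))\<^sup>2)"
  proof -
    have "\<bar>\<Sum>i\<le>N. 2 * c i * (y i * y (Suc i)) / h\<^sup>2\<bar> \<le> (\<Sum>i\<le>N. c i * ((y i)\<^sup>2 + (y (Suc i))\<^sup>2) / h\<^sup>2)"
      by (rule order_trans[OF sum_abs], rule sum_mono) (use edge in \<open>auto simp: abs_divide intro!: divide_right_mono\<close>)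
    also have "\<dots> = (\<Sum>i<N. (c (Suc i) + c i) / h\<^sup>2 * (y (Suc i))\<^sup>2)"
      unfolding sum_divide_distrib[symmetric] E by (simp add: sum_divide_distrib)
    finally show ?thesis .
  qed
  have s1p: "\<bar>s1 * \<phi> (Suc i)\<bar> \<le> K * \<eta> * s\<^sup>2" if "i < N" for i
  proof -
    have "\<bar>s1 * \<phi> (Suc i)\<bar> \<le> (\<eta> * s\<^sup>2) * K"
      unfolding abs_mult using s1_le phi_le[of "Suc i"] that eta_pos by (intro mult_mono) auto
    then show ?thesis by (simp add: mult_ac)
  qed
  have Ke: "K * \<eta> * s\<^sup>2 \<le> K\<^sup>2 * s\<^sup>2"
  proof -
    have "K * \<eta> \<le> K * K" using eta_le_1 K_ge by (intro mult_left_mono) auto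
    then show ?thesis by (intro mult_right_mono) (auto simp: power2_eq_square)
  qed
  have neg: "(\<Sum>i<N. - (2 / h\<^sup>2 + s1 * \<phi> (Suc i)) * (y (Suc i))\<^sup>2) = - (\<Sum>i<N. (2 / h\<^sup>2 + s1 * \<phi> (Suc i)) * (y (Suc i))\<^sup>2)"
    by (simp only: mult_minus_left sum_negf)
  have "qform y \<le> (\<Sum>i<N. (c (Suc i) + c i) / h\<^sup>2 * (y (Suc i))\<^sup>2 - (2 / h\<^sup>2 + s1 * \<phi> (Suc i)) * (y (Suc i))\<^sup>2)"
    unfolding qform_def sum_subtractf neg using absE by linarith
  also have "\<dots> \<le> (\<Sum>i<N. 5 * K\<^sup>2 * s\<^sup>2 * (y (Suc i))\<^sup>2)"
  proof (rule sum_mono)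
    fix i assume i: "i \<in> {..<N}"
    have "(c j - 1) / h\<^sup>2 \<le> 2 * K\<^sup>2 * s\<^sup>2" if "j \<le> N" for j
      using c_minus_1(2)[OF that] h_pos by (simp add: pos_divide_le_eq)
    from this[of i] this[of "Suc i"] have "(c (Suc i) + c i) / h\<^sup>2 - (2 / h\<^sup>2 + s1 * \<phi> (Suc i)) \<le> 5 * K\<^sup>2 * s\<^sup>2"
      using i s1p[of i] Ke by (simp add: add_divide_distrib diff_divide_distrib abs_le_iff)
    then have "((c (Suc i) + c i) / h\<^sup>2 - (2 / h\<^sup>2 + s1 * \<phi> (Suc i))) * (y (Suc i))\<^sup>2 \<le> 5 * K\<^sup>2 * s\<^sup>2 * (y (Suc i))\<^sup>2"
      by (rule mult_right_mono) simp
    then show "(c (Suc i) + c i) / h\<^sup>2 * (y (Suc i))\<^sup>2 - (2 / h\<^sup>2 + s1 * \<phi> (Suc i)) * (y (Suc i))\<^sup>2 \<le> 5 * K\<^sup>2 * s\<^sup>2 * (y (Suc i))\<^sup>2"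
      by (simp add: left_diff_distrib)
  qed
  finally show "qform y \<le> 5 * K\<^sup>2 * s\<^sup>2 * sq y" by (simp add: sq_def sum_distrib_left)
  have "- qform y \<le> (\<Sum>i<N. (c (Suc i) + c i) / h\<^sup>2 * (y (Suc i))\<^sup>2 + (2 / h\<^sup>2 + s1 * \<phi> (Suc i)) * (y (Suc i))\<^sup>2)"
    unfolding qform_def sum.distrib neg using absE by linarith
  also have "\<dots> \<le> (\<Sum>i<N. 9 * K / h\<^sup>2 * (y (Suc i))\<^sup>2)"
  proof (rule sum_mono)
    fix i assume i: "i \<in> {..<N}"
    have "K * \<eta> * s\<^sup>2 \<le> K / h\<^sup>2"
    proof -
      have "s\<^sup>2 * h\<^sup>2 \<le> 1" 
        using sh_le eta_le_1 s_pos h_pos power_mono[of "s * h" 1 2] by (simp add: power_mult_distrib)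
      then have "s\<^sup>2 \<le> 1 / h\<^sup>2" using h_pos by (simp add: pos_le_divide_eq)
      then have "\<eta> * s\<^sup>2 \<le> 1 * (1 / h\<^sup>2)" using eta_le_1 eta_pos by (intro mult_mono) auto
      then have "K * (\<eta> * s\<^sup>2) \<le> K * (1 / h\<^sup>2)" using K_pos by (intro mult_left_mono) auto
      then show ?thesis by (simp add: mult.assoc)
    qed
    moreover have "(c (Suc i) + c i + 2) / h\<^sup>2 \<le> (6 * K) / h\<^sup>2"
      using cp(2)[of i] cp(2)[of "Suc i"] i K_ge by (intro divide_right_mono) auto
    moreover have "9 * K / h\<^sup>2 = 6 * K / h\<^sup>2 + 2 * (K / h\<^sup>2) + K / h\<^sup>2" by (simp add: field_simps)
    moreover have "0 \<le> K / h\<^sup>2" using K_pos by simp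
    moreover have "s1 * \<phi> (Suc i) \<le> K * \<eta> * s\<^sup>2" using s1p[of i] i by (simp add: abs_le_iff)
    ultimately have "(c (Suc i) + c i) / h\<^sup>2 + (2 / h\<^sup>2 + s1 * \<phi> (Suc i)) \<le> 9 * K / h\<^sup>2"
      by (simp add: add_divide_distrib)
    then have "((c (Suc i) + c i) / h\<^sup>2 + (2 / h\<^sup>2 + s1 * \<phi> (Suc i))) * (y (Suc i))\<^sup>2 \<le> 9 * K / h\<^sup>2 * (y (Suc i))\<^sup>2"
      by (rule mult_right_mono) simp
    then show "(c (Suc i) + c i) / h\<^sup>2 * (y (Suc i))\<^sup>2 + (2 / h\<^sup>2 + s1 * \<phi> (Suc i)) * (y (Suc i))\<^sup>2 \<le> 9 * K / h\<^sup>2 * (y (Suc i))\<^sup>2"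
      by (simp add: distrib_right)
  qed
  finally show "- qform y \<le> 9 * K / h\<^sup>2 * sq y" by (simp add: sq_def sum_distrib_left)
qed

end

lemma abs_exp_minus_1_le: "\<bar>exp x - 1\<bar> \<le> 3 * \<bar>x\<bar>" if "\<bar>x\<bar> \<le> 1" for x :: real
proof -
  have "norm (exp x - exp 0) \<le> 3 * norm (x - 0)"
  proof (rule field_differentiable_bound[of "{-1..1}" exp exp])
    fix z :: real assume "z \<in> {-1..1}"
    then have "exp z \<le> exp 1" by simp
    also have "exp (1::real) \<le> 3" by (rule exp_le)
    finally show "norm (exp z) \<le> 3" by simp
  qed (use that in \<open>auto intro!: derivative_eq_intros simp: abs_le_iff\<close>)
  then show ?thesis by simp
qed

section \<open>Return from the conjugated variable to the solution\<close>

context carleman_bounds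
begin

text \<open>The difference quotient of u = exp (- s phi) v consists of the gradient of v and a term
  of size K s |v|. Evaluating the weight at the midpoint costs a factor of at most 3, since s times
  the variation of phi over half an edge is at most 1. Squaring gives 18 = 2 * 3^2 and 162 = 2 *
  9^2.\<close>

lemma midpoint_gradient:
  assumes v: "v 0 = 0" "v (Suc N) = 0" and vu: "\<And>i. v i = exp (s * \<phi> i) * u i"
    and m: "\<And>i. i \<le> N \<Longrightarrow> \<bar>\<phi>m i - \<phi> i\<bar> \<le> K * h" "\<And>i. i \<le> N \<Longrightarrow> \<bar>\<phi>m i - \<phi> (Suc i)\<bar> \<le> K * h"
  shows "(\<Sum>i\<le>N. exp (2 * s * \<phi>m i) * ((u (Suc i) - u i) / h)\<^sup>2) \<le> 18 * gradsq v + 162 * K\<^sup>2 * s\<^sup>2 * sq v"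
proof -
  have Ksh: "K * (s * h) \<le> 1"
  proof -
    have "K * (s * h) \<le> K * \<eta>" using sh_le K_pos by simp
    then show ?thesis using eta_K_le by linarith
  qed
  have small: "\<bar>s * x\<bar> \<le> 1" if "\<bar>x\<bar> \<le> K * h" for x
  proof -
    have "\<bar>s * x\<bar> \<le> s * (K * h)" using that s_pos by (simp add: abs_mult)
    then show ?thesis using Ksh by (simp add: mult_ac)
  qed
  have e3: "exp (s * x) \<le> 3" if "\<bar>x\<bar> \<le> K * h" for x
  proof -
    have "exp (s * x) \<le> exp 1" using small[OF that] by (simp add: abs_le_iff)
    also have "exp (1::real) \<le> 3" by (rule exp_le)
    finally show ?thesis .
  qed
  have "(\<Sum>i\<le>N. exp (2 * s * \<phi>m i) * ((u (Suc i) - u i) / h)\<^sup>2) \<le> (\<Sum>i\<le>N. 18 * (grad v i)\<^sup>2 + 162 * K\<^sup>2 * s\<^sup>2 * (v i)\<^sup>2)"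
  proof (rule sum_mono)
    fix i assume "i \<in> {..N}"
    then have i: "i \<le> N" by simp
    have ui: "u j = exp (- (s * \<phi> j)) * v j" for j
      unfolding vu mult.assoc[symmetric] exp_add[symmetric] by simp
    have e1: "exp (s * \<phi>m i) * exp (- (s * \<phi> (Suc i))) = exp (s * (\<phi>m i - \<phi> (Suc i)))"
      and e2: "exp (s * \<phi>m i) * exp (- (s * \<phi> i)) = exp (s * (\<phi>m i - \<phi> i))"
      and e4: "exp (s * (\<phi>m i - \<phi> (Suc i))) = exp (s * (\<phi>m i - \<phi> i)) * exp (- (s * q i))"
      unfolding exp_add[symmetric] q_def by (simp_all add: algebra_simps)
    have "exp (s * \<phi>m i) * ((u (Suc i) - u i) / h) =
       (exp (s * (\<phi>m i - \<phi> (Suc i))) * v (Suc i) - exp (s * (\<phi>m i - \<phi> i)) * v i) / h"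
      unfolding ui e1[symmetric] e2[symmetric] by (simp add: algebra_simps)
    also have "\<dots> = exp (s * (\<phi>m i - \<phi> (Suc i))) * grad v i + exp (s * (\<phi>m i - \<phi> i)) * ((exp (- (s * q i)) - 1) / h) * v i"
      unfolding e4 by (simp add: grad_def algebra_simps add_divide_distrib diff_divide_distrib)
    finally have eq: "exp (s * \<phi>m i) * ((u (Suc i) - u i) / h) = \<dots>" .
    have a: "\<bar>exp (s * (\<phi>m i - \<phi> (Suc i))) * grad v i\<bar> \<le> 3 * \<bar>grad v i\<bar>"
      using e3[OF m(2)[OF i]] by (simp add: abs_mult mult_right_mono)
    have "\<bar>(exp (- (s * q i)) - 1) / h\<bar> \<le> 3 * (K * s)"
    proof -
      have "\<bar>exp (- (s * q i)) - 1\<bar> \<le> 3 * \<bar>- (s * q i)\<bar>" using sq_le_1[OF i] by (intro abs_exp_minus_1_le) simp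
      also have "\<dots> \<le> 3 * (K * s) * h" using q_bound[OF i] by (simp add: mult_ac)
      finally show ?thesis using h_pos by (simp add: pos_divide_le_eq)
    qed
    then have "exp (s * (\<phi>m i - \<phi> i)) * \<bar>(exp (- (s * q i)) - 1) / h\<bar> \<le> 3 * (3 * (K * s))"
      using e3[OF m(1)[OF i]] by (intro mult_mono) auto
    then have b: "\<bar>exp (s * (\<phi>m i - \<phi> i)) * ((exp (- (s * q i)) - 1) / h) * v i\<bar> \<le> 9 * (K * s) * \<bar>v i\<bar>"
      unfolding abs_mult[of _ "v i"] abs_mult[of "exp _"] by (intro mult_right_mono) auto
    have le: "\<bar>exp (s * \<phi>m i) * ((u (Suc i) - u i) / h)\<bar> \<le> 3 * \<bar>grad v i\<bar> + 9 * (K * s) * \<bar>v i\<bar>"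
      unfolding eq using a b by linarith
    then have "(exp (s * \<phi>m i) * ((u (Suc i) - u i) / h))\<^sup>2 \<le> (3 * \<bar>grad v i\<bar> + 9 * (K * s) * \<bar>v i\<bar>)\<^sup>2"
      using power_mono[OF le abs_ge_zero, of 2] unfolding power2_abs by blast
    also have "\<dots> \<le> 2 * (3 * \<bar>grad v i\<bar>)\<^sup>2 + 2 * (9 * (K * s) * \<bar>v i\<bar>)\<^sup>2"
      using sum_squares_bound[of "3 * \<bar>grad v i\<bar>" "9 * (K * s) * \<bar>v i\<bar>"] by (simp only: power2_sum)
    also have "\<dots> = 18 * (grad v i)\<^sup>2 + 162 * K\<^sup>2 * s\<^sup>2 * (v i)\<^sup>2"
      by (simp add: power_mult_distrib)
    also have "(exp (s * \<phi>m i) * ((u (Suc i) - u i) / h))\<^sup>2 = exp (2 * s * \<phi>m i) * ((u (Suc i) - u i) / h)\<^sup>2"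
      unfolding power_mult_distrib[of "exp _"] by (simp add: exp_double mult.assoc)
    finally show "exp (2 * s * \<phi>m i) * ((u (Suc i) - u i) / h)\<^sup>2 \<le> 18 * (grad v i)\<^sup>2 + 162 * K\<^sup>2 * s\<^sup>2 * (v i)\<^sup>2" .
  qed
  also have "\<dots> = 18 * gradsq v + 162 * K\<^sup>2 * s\<^sup>2 * sq v"
    by (simp add: sum.distrib sum_distrib_left[symmetric] gradsq_def sq_edges[OF v])
  finally show ?thesis .
qed

text \<open>The left side costs 1 + 162 K^2 \<le> 163 K^2 copies of s^3 v^2 and 18 of s |grad v|^2.
  The factor 326 K^2 / c0^3 produces exactly the former out of c0^3 / 2, and more than the latter
  out of c0 because c0^3 \<le> c0.\<close>

lemma pointwise_estimate:
  assumes u0: "u 0 = 0" and uN: "u (Suc N) = 0" and b0: "b 0 = 0" and bN: "b (Suc N) = 0"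
    and b: "\<And>i. i < N \<Longrightarrow> b (Suc i) = f (Suc i) - (u (i + 2) - 2 * u (Suc i) + u i) / h\<^sup>2"
    and g0: "g 0 = 0" and gN: "g (Suc N) = 0"
    and m: "\<And>i. i \<le> N \<Longrightarrow> \<bar>\<phi>m i - \<phi> i\<bar> \<le> K * h" "\<And>i. i \<le> N \<Longrightarrow> \<bar>\<phi>m i - \<phi> (Suc i)\<bar> \<le> K * h"
  shows "(\<Sum>i<N. s ^ 3 * exp (2 * s * \<phi> (Suc i)) * (u (Suc i))\<^sup>2) + (\<Sum>i\<le>N. s * exp (2 * s * \<phi>m i) * ((u (Suc i) - u i) / h)\<^sup>2)
   \<le> 326 * K\<^sup>2 / c0 ^ 3 * (105 * K ^ 3 * (\<Sum>i<N. \<zeta> (Suc i) * (s ^ 3 * exp (2 * s * \<phi> (Suc i)) * (u (Suc i))\<^sup>2))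
     + (\<Sum>i<N. exp (2 * s * \<phi> (Suc i)) * (f (Suc i))\<^sup>2) + 5 * K\<^sup>2 * (\<Sum>i<N. s\<^sup>2 * exp (2 * s * \<phi> (Suc i)) * (g (Suc i))\<^sup>2)
     - ((\<Sum>i<N. qdiag' (Suc i) * (u (Suc i) * u (Suc i)) + qdiag (Suc i) * (b (Suc i) * u (Suc i) + u (Suc i) * b (Suc i) + g (Suc i) * g (Suc i)))
    + (\<Sum>i<N - 1. qoff' (Suc i) * (u (Suc i) * u (i + 2)) + qoff (Suc i) * (b (Suc i) * u (i + 2) + u (Suc i) * b (i + 2) + g (Suc i) * g (i + 2)))))"
    (is "?A + ?B \<le> ?C1 * ?R")
proof -
  define v where "v i = wt i * u i" for i
  have v: "v 0 = 0" "v (Suc N) = 0" using u0 uN by (simp_all add: v_def)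
  have wsq: "(wt i * x)\<^sup>2 = exp (2 * s * \<phi> i) * x\<^sup>2" for i x
    by (simp add: wt_def power_mult_distrib exp_double[symmetric] mult.assoc)
  have A: "?A = s ^ 3 * sq v"
    by (simp add: sq_def v_def wsq sum_distrib_left mult.assoc)
  have L: "(\<Sum>i<N. \<zeta> (Suc i) * (s ^ 3 * exp (2 * s * \<phi> (Suc i)) * (u (Suc i))\<^sup>2)) = s ^ 3 * loc v"
    unfolding loc_def v_def wsq sum_distrib_left by (intro sum.cong refl) (simp add: mult_ac)
  have Fs: "(\<Sum>i<N. exp (2 * s * \<phi> (Suc i)) * (f (Suc i))\<^sup>2) = (\<Sum>i<N. (wt (Suc i) * f (Suc i))\<^sup>2)"
    by (simp add: wsq)
  have G: "qform (\<lambda>i. wt i * g i) \<le> 5 * K\<^sup>2 * (\<Sum>i<N. s\<^sup>2 * exp (2 * s * \<phi> (Suc i)) * (g (Suc i))\<^sup>2)"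
    using qform_bounds(1)[of "\<lambda>i. wt i * g i"] g0 gN by (simp add: sq_def wsq sum_distrib_left mult.assoc)
  have "?B \<le> s * (18 * gradsq v + 162 * K\<^sup>2 * s\<^sup>2 * sq v)"
  proof -
    have "?B = s * (\<Sum>i\<le>N. exp (2 * s * \<phi>m i) * ((u (Suc i) - u i) / h)\<^sup>2)"
      by (simp add: sum_distrib_left mult.assoc)
    also have "\<dots> \<le> s * (18 * gradsq v + 162 * K\<^sup>2 * s\<^sup>2 * sq v)"
      using s_pos by (intro mult_left_mono midpoint_gradient[OF v _ m]) (auto simp: v_def wt_def)
    finally show ?thesis .
  qed
  also have "\<dots> = 18 * (s * gradsq v) + 162 * K\<^sup>2 * (s ^ 3 * sq v)"
    by (simp add: algebra_simps power2_eq_square power3_eq_cube)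
  finally have Bb: "?B \<le> 18 * (s * gradsq v) + 162 * K\<^sup>2 * (s ^ 3 * sq v)" .
  have nn: "0 \<le> s * gradsq v" "0 \<le> s ^ 3 * sq v"
    using gradsq_nonneg[OF v] sq_nonneg[OF v] s_pos by simp_all
  have K2: "1 \<le> K\<^sup>2" using K_ge by (simp add: one_le_power)
  have C1: "?C1 * (c0 ^ 3 / 2) = 163 * K\<^sup>2" using c0_pos by simp
  have C2: "18 \<le> ?C1 * c0"
  proof -
    have "c0 ^ 3 \<le> c0" using c0_pos c0_le by (simp add: power3_eq_cube mult_le_one mult_left_le_one_le)
    then have "326 * K\<^sup>2 * 1 \<le> 326 * K\<^sup>2 * (c0 / c0 ^ 3)"
      using c0_pos by (intro mult_left_mono) (auto simp: pos_le_divide_eq)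
    then show ?thesis using K2 by simp
  qed
  have "?A + ?B \<le> 163 * K\<^sup>2 * (s ^ 3 * sq v) + 18 * (s * gradsq v)"
  proof -
    have "s ^ 3 * sq v \<le> K\<^sup>2 * (s ^ 3 * sq v)" using mult_right_mono[OF K2 nn(2)] by simp
    then show ?thesis using Bb unfolding A by linarith
  qed
  also have "\<dots> \<le> ?C1 * (c0 ^ 3 / 2 * (s ^ 3 * sq v) + c0 * (s * gradsq v))"
    using mult_right_mono[OF C2 nn(1)] unfolding distrib_left mult.assoc[symmetric] C1 by simp
  also have "\<dots> \<le> ?C1 * ?R"
  proof (rule mult_left_mono)
    show "c0 ^ 3 / 2 * (s ^ 3 * sq v) + c0 * (s * gradsq v) \<le> ?R"
      using energy_estimate[OF u0 uN b0 bN b g0 gN] G unfolding L Fs v_def[abs_def] by linarith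
    show "0 \<le> ?C1" using c0_pos by simp
  qed
  finally show ?thesis .
qed

text \<open>Both signs are needed, since the energy enters with opposite signs at the two endpoints
  in time. The upper bound of order s^2 is relaxed to h^(-2) by s h \<le> 1.\<close>

lemma energy_form_bounds:
  assumes u0: "u 0 = 0" and uN: "u (Suc N) = 0"
  defines "E \<equiv> (\<Sum>i<N. qdiag (Suc i) * (u (Suc i) * u (Suc i))) + (\<Sum>i<N - 1. qoff (Suc i) * (u (Suc i) * u (i + 2)))"
  shows "E \<le> 9 * K\<^sup>2 / h\<^sup>2 * (\<Sum>i<N. exp (2 * s * \<phi> (Suc i)) * (u (Suc i))\<^sup>2)"
    "- E \<le> 9 * K\<^sup>2 / h\<^sup>2 * (\<Sum>i<N. exp (2 * s * \<phi> (Suc i)) * (u (Suc i))\<^sup>2)"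
proof -
  define v where "v i = wt i * u i" for i
  have v: "v 0 = 0" "v (Suc N) = 0" using u0 uN by (simp_all add: v_def)
  have wsq: "(wt i * x)\<^sup>2 = exp (2 * s * \<phi> i) * x\<^sup>2" for i x
    by (simp add: wt_def power_mult_distrib exp_double[symmetric] mult.assoc)
  have sq: "sq v = (\<Sum>i<N. exp (2 * s * \<phi> (Suc i)) * (u (Suc i))\<^sup>2)"
    by (simp add: sq_def v_def wsq)
  have E: "E = qform v"
    using qform_weighted[of u] sum_inner_edges[OF N_pos, of "\<lambda>i. qoff i * (u i * u (Suc i))"] u0 uN
    by (simp add: E_def v_def[abs_def] power2_eq_square)
  have "s\<^sup>2 * h\<^sup>2 \<le> 1"
    using sh_le eta_le_1 s_pos h_pos power_mono[of "s * h" 1 2] by (simp add: power_mult_distrib)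
  then have "s\<^sup>2 \<le> 1 / h\<^sup>2" using h_pos by (simp add: pos_le_divide_eq)
  then have "5 * K\<^sup>2 * s\<^sup>2 \<le> 5 * K\<^sup>2 * (1 / h\<^sup>2)" by (intro mult_left_mono) auto
  also have "\<dots> \<le> 9 * K\<^sup>2 / h\<^sup>2" by (simp add: divide_right_mono)
  finally have "5 * K\<^sup>2 * s\<^sup>2 * sq v \<le> 9 * K\<^sup>2 / h\<^sup>2 * sq v"
    using sq_nonneg[OF v] by (rule mult_right_mono)
  then show "E \<le> 9 * K\<^sup>2 / h\<^sup>2 * (\<Sum>i<N. exp (2 * s * \<phi> (Suc i)) * (u (Suc i))\<^sup>2)"
    using qform_bounds(1)[OF v] unfolding E sq by linarith
  have "9 * K / h\<^sup>2 \<le> 9 * K\<^sup>2 / h\<^sup>2" using K_power_mono[of 1 2] by (intro divide_right_mono) auto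
  then have "9 * K / h\<^sup>2 * sq v \<le> 9 * K\<^sup>2 / h\<^sup>2 * sq v"
    using sq_nonneg[OF v] by (rule mult_right_mono)
  then show "- E \<le> 9 * K\<^sup>2 / h\<^sup>2 * (\<Sum>i<N. exp (2 * s * \<phi> (Suc i)) * (u (Suc i))\<^sup>2)"
    using qform_bounds(2)[OF v] unfolding E sq by linarith
qed

end

section \<open>Weights on the mesh\<close>

text \<open>Upper bounds come from the intermediate-point formulas for differences. For lower bounds
  the derivatives of phi change by at most c0 over a distance 2 h, so the margin 2 c0 at a node
  outside omega_0 leaves c0 at the intermediate point.\<close>

lemma carleman_bounds_mesh:
  fixes \<phi> f1 f2 f3 \<zeta> :: "real \<Rightarrow> real" and N :: nat
  assumes d: "\<And>x. x \<in> {0..1} \<Longrightarrow> (\<phi> has_real_derivative f1 x) (at x)"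
      "\<And>x. x \<in> {0..1} \<Longrightarrow> (f1 has_real_derivative f2 x) (at x)"
      "\<And>x. x \<in> {0..1} \<Longrightarrow> (f2 has_real_derivative f3 x) (at x)"
    and bd: "\<And>x. x \<in> {0..1} \<Longrightarrow> \<bar>\<phi> x\<bar> \<le> K" "\<And>x. x \<in> {0..1} \<Longrightarrow> \<bar>f1 x\<bar> \<le> K"
      "\<And>x. x \<in> {0..1} \<Longrightarrow> \<bar>f2 x\<bar> \<le> K" "\<And>x. x \<in> {0..1} \<Longrightarrow> \<bar>f3 x\<bar> \<le> K"
    and pos: "\<And>x. x \<in> {0..1} \<Longrightarrow> x \<notin> U0 \<Longrightarrow> 2 * c0 \<le> f2 x \<and> 2 * c0 \<le> \<bar>f1 x\<bar>"
    and ends: "0 < f1 0" "f1 1 < 0" and U0: "U0 \<subseteq> {0<..<1}"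
    and \<zeta>: "\<And>x. 0 \<le> \<zeta> x" "\<And>x. \<zeta> x \<le> 1" "\<And>x y. \<bar>\<zeta> x - \<zeta> y\<bar> \<le> K * \<bar>x - y\<bar>" "\<And>x. x \<in> U0 \<Longrightarrow> \<zeta> x = 1"
    and N: "0 < N" and h: "h = mesh_size N" "h \<le> \<eta>"
    and K: "1 \<le> K" and c0: "0 < c0" "c0 \<le> 1" and \<eta>: "\<eta> = c0 ^ 4 / (700 * K ^ 5)"
    and s: "0 < s" "1 \<le> \<eta> * s" "s * h \<le> \<eta>" "\<bar>s1\<bar> \<le> \<eta> * s\<^sup>2" "\<bar>s2\<bar> \<le> \<eta> * s ^ 3"
  shows "carleman_bounds N h K c0 \<eta> s s1 s2 (\<lambda>i. \<phi> (real i * h)) (\<lambda>i. \<zeta> (real i * h))"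
    "\<And>i. i \<le> N \<Longrightarrow> \<bar>\<phi> (real i * h + h / 2) - \<phi> (real i * h)\<bar> \<le> K * h"
    "\<And>i. i \<le> N \<Longrightarrow> \<bar>\<phi> (real i * h + h / 2) - \<phi> (real (Suc i) * h)\<bar> \<le> K * h"
proof -
  have h0: "0 < h" using h by (simp add: mesh_size_def)
  have hN: "real (Suc N) * h = 1" using h by (simp add: mesh_size_def)
  have x_in: "real i * h \<in> {0..1}" if "i \<le> Suc N" for i
  proof -
    have "real i * h \<le> real (Suc N) * h" using that h0 by (intro mult_right_mono) auto
    then show ?thesis unfolding hN using h0 by simp
  qed
  have hk: "K * h \<le> c0 / 2"
  proof -
    have "c0 ^ 4 \<le> c0" using c0 power_decreasing[of 1 4 c0] by simp
    moreover have "K \<le> K ^ 5" using K power_increasing[of 1 5 K] by simp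
    ultimately have "K * c0 ^ 4 \<le> K ^ 5 * c0" using K c0 by (intro mult_mono) auto
    then have "K * \<eta> \<le> c0 / 700" using K by (simp add: \<eta> field_simps)
    moreover have "K * h \<le> K * \<eta>" using h K by simp
    ultimately show ?thesis using c0 by simp
  qed
  have f_lip: "\<bar>\<phi> x - \<phi> y\<bar> \<le> K * \<bar>x - y\<bar>" if "x \<in> {0..1}" "y \<in> {0..1}" for x y
    using field_differentiable_bound[of "{0..1}" \<phi> f1 K x y] d(1) bd(2) that
    by (auto intro: DERIV_subset)
  have f1_lip: "\<bar>f1 x - f1 y\<bar> \<le> K * \<bar>x - y\<bar>" if "x \<in> {0..1}" "y \<in> {0..1}" for x y
    using field_differentiable_bound[of "{0..1}" f1 f2 K x y] d(2) bd(3) that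
    by (auto intro: DERIV_subset)
  have f2_lip: "\<bar>f2 x - f2 y\<bar> \<le> K * \<bar>x - y\<bar>" if "x \<in> {0..1}" "y \<in> {0..1}" for x y
    using field_differentiable_bound[of "{0..1}" f2 f3 K x y] d(3) bd(4) that
    by (auto intro: DERIV_subset)
  have mid: "real i * h + h / 2 \<in> {0..1}" if "i \<le> N" for i
    using x_in[of i] x_in[of "Suc i"] that h0 by (auto simp: algebra_simps)
  show "\<bar>\<phi> (real i * h + h / 2) - \<phi> (real i * h)\<bar> \<le> K * h" if "i \<le> N" for i
  proof -
    have "\<bar>\<phi> (real i * h + h / 2) - \<phi> (real i * h)\<bar> \<le> K * \<bar>real i * h + h / 2 - real i * h\<bar>"
      using that by (intro f_lip mid x_in) auto
    also have "\<dots> \<le> K * h" using h0 K by simp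
    finally show ?thesis .
  qed
  show "\<bar>\<phi> (real i * h + h / 2) - \<phi> (real (Suc i) * h)\<bar> \<le> K * h" if "i \<le> N" for i
  proof -
    have "\<bar>\<phi> (real i * h + h / 2) - \<phi> (real (Suc i) * h)\<bar> \<le> K * \<bar>real i * h + h / 2 - real (Suc i) * h\<bar>"
      using that by (intro f_lip mid x_in) auto
    also have "\<dots> = K * (h / 2)" using h0 by (simp add: algebra_simps)
    also have "\<dots> \<le> K * h" using h0 K by simp
    finally show ?thesis .
  qed
  have D2: "\<exists>\<xi>. real i * h < \<xi> \<and> \<xi> < real i * h + 2 * h \<and> \<phi> (real (i + 2) * h) - 2 * \<phi> (real (Suc i) * h) + \<phi> (real i * h) = h\<^sup>2 * f2 \<xi>"
    if "i < N" for i
    using second_difference[OF d(1,2), of "real i * h" h] x_in[of i] x_in[of "i + 2"] that h0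
    by (simp add: algebra_simps)
  have D1: "\<exists>\<xi>. real i * h < \<xi> \<and> \<xi> < real i * h + h \<and> \<phi> (real (Suc i) * h) - \<phi> (real i * h) = h * f1 \<xi>" if "i \<le> N" for i
    using first_difference[OF d(1), of "real i * h" h] x_in[of i] x_in[of "Suc i"] that h0
    by (simp add: algebra_simps)
  have D12: "\<exists>\<xi>. real i * h < \<xi> \<and> \<xi> < real i * h + 2 * h \<and> \<phi> (real (i + 2) * h) - \<phi> (real i * h) = 2 * h * f1 \<xi>" if "i < N" for i
    using first_difference[OF d(1), of "real i * h" "2 * h"] x_in[of i] x_in[of "i + 2"] that h0
    by (simp add: algebra_simps)
  have D3: "\<exists>\<xi>. real i * h < \<xi> \<and> \<xi> < real i * h + 3 * h \<and>
      \<phi> (real (i + 3) * h) - 3 * \<phi> (real (i + 2) * h) + 3 * \<phi> (real (Suc i) * h) - \<phi> (real i * h) = h ^ 3 * f3 \<xi>" if "Suc i < N" for i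
    using third_difference[OF d, of "real i * h" h] x_in[of i] x_in[of "i + 3"] that h0
    by (simp add: algebra_simps)
  have near: "\<xi> \<in> {0..1}" if "real i * h < \<xi>" "\<xi> < real j * h" "j \<le> Suc N" for \<xi> i j
    using that x_in[of j] h0 by (auto intro: order_trans[of 0 "real i * h"])
  have n2: "real i * h + 2 * h = real (i + 2) * h" and n1: "real i * h + h = real (Suc i) * h" and n3: "real i * h + 3 * h = real (i + 3) * h" for i
    by (simp_all add: algebra_simps)
  have close: "c0 \<le> f2 \<xi>" "c0 \<le> \<bar>f1 \<xi>\<bar>" if "\<xi> \<in> {0..1}" "x \<in> {0..1}" "\<bar>\<xi> - x\<bar> \<le> 2 * h" "x \<notin> U0" for \<xi> x
  proof -
    have "K * \<bar>\<xi> - x\<bar> \<le> K * (2 * h)" using that K by (intro mult_left_mono) auto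
    then have "K * \<bar>\<xi> - x\<bar> \<le> c0" using hk by simp
    then show "c0 \<le> f2 \<xi>" "c0 \<le> \<bar>f1 \<xi>\<bar>"
      using f2_lip[OF that(1,2)] f1_lip[OF that(1,2)] pos[OF that(2,4)] by auto
  qed
  have end0: "0 \<in> {0..1::real}" "0 \<notin> U0" and end1: "1 \<in> {0..1::real}" "1 \<notin> U0" using U0 by auto
  \<comment> \<open>0 lies outside omega_0, so the slope there is not merely positive but at least 2
    c0, and positivity persists on the first cells; at 1 the argument is the same with the sign
    reversed.\<close>
  have sign0: "c0 \<le> f1 \<xi>" if "\<xi> \<in> {0..1}" "\<bar>\<xi> - 0\<bar> \<le> 2 * h" for \<xi>
  proof -
    have "K * \<bar>\<xi> - 0\<bar> \<le> K * (2 * h)" using that K by (intro mult_left_mono) auto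
    then have "K * \<bar>\<xi> - 0\<bar> \<le> c0" using hk by simp
    then show ?thesis using f1_lip[OF that(1) end0(1)] pos[OF end0] ends by auto
  qed
  have sign1: "f1 \<xi> \<le> - c0" if "\<xi> \<in> {0..1}" "\<bar>\<xi> - 1\<bar> \<le> 2 * h" for \<xi>
  proof -
    have "K * \<bar>\<xi> - 1\<bar> \<le> K * (2 * h)" using that K by (intro mult_left_mono) auto
    then have "K * \<bar>\<xi> - 1\<bar> \<le> c0" using hk by simp
    then show ?thesis using f1_lip[OF that(1) end1(1)] pos[OF end1] ends by auto
  qed
  show "carleman_bounds N h K c0 \<eta> s s1 s2 (\<lambda>i. \<phi> (real i * h)) (\<lambda>i. \<zeta> (real i * h))"
  proof
    show "0 < N" "0 < h" "h \<le> \<eta>" "1 \<le> K" "0 < c0" "c0 \<le> 1" "\<eta> \<le> c0 ^ 4 / (700 * K ^ 5)" "0 < s" "1 \<le> \<eta> * s"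
      "s * h \<le> \<eta>" "\<bar>s1\<bar> \<le> \<eta> * s\<^sup>2" "\<bar>s2\<bar> \<le> \<eta> * s ^ 3"
      using N h0 h K c0 \<eta> s by auto
  next
    fix i assume "i \<le> Suc N"
    then show "\<bar>\<phi> (real i * h)\<bar> \<le> K" by (intro bd x_in)
  next
    fix i assume i: "i \<le> N"
    have "\<bar>\<phi> (real (Suc i) * h) - \<phi> (real i * h)\<bar> \<le> K * \<bar>real (Suc i) * h - real i * h\<bar>"
      using i by (intro f_lip x_in) auto
    then show "\<bar>\<phi> (real (Suc i) * h) - \<phi> (real i * h)\<bar> \<le> K * h" using h0 by (simp add: algebra_simps)
    have "\<bar>\<zeta> (real (Suc i) * h) - \<zeta> (real i * h)\<bar> \<le> K * \<bar>real (Suc i) * h - real i * h\<bar>" by (rule \<zeta>)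
    then show "\<bar>\<zeta> (real (Suc i) * h) - \<zeta> (real i * h)\<bar> \<le> K * h" using h0 by (simp add: algebra_simps)
  next
    fix i assume i: "i < N"
    obtain \<xi> where "real i * h < \<xi>" "\<xi> < real (i + 2) * h" and e: "\<phi> (real (i + 2) * h) - 2 * \<phi> (real (Suc i) * h) + \<phi> (real i * h) = h\<^sup>2 * f2 \<xi>"
      using D2[OF i] unfolding n2 by blast
    then have "\<bar>f2 \<xi>\<bar> \<le> K" using i by (intro bd near[of i _ "i + 2"]) auto
    then show "\<bar>\<phi> (real (i + 2) * h) - 2 * \<phi> (real (Suc i) * h) + \<phi> (real i * h)\<bar> \<le> K * h\<^sup>2"
      unfolding e by (simp add: abs_mult mult.commute[of "h\<^sup>2"] mult_right_mono)
  next
    fix i assume i: "Suc i < N"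
    obtain \<xi> where "real i * h < \<xi>" "\<xi> < real (i + 3) * h"
      and e: "\<phi> (real (i + 3) * h) - 3 * \<phi> (real (i + 2) * h) + 3 * \<phi> (real (Suc i) * h) - \<phi> (real i * h) = h ^ 3 * f3 \<xi>"
      using D3[OF i] unfolding n3 by blast
    then have "\<bar>f3 \<xi>\<bar> \<le> K" using i by (intro bd near[of i _ "i + 3"]) auto
    then show "\<bar>\<phi> (real (i + 3) * h) - 3 * \<phi> (real (i + 2) * h) + 3 * \<phi> (real (Suc i) * h) - \<phi> (real i * h)\<bar> \<le> K * h ^ 3"
      unfolding e using h0 by (simp add: abs_mult mult.commute[of "h ^ 3"] mult_right_mono)
  next
    fix i show "0 \<le> \<zeta> (real i * h)" "\<zeta> (real i * h) \<le> 1" by (rule \<zeta>)+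
  next
    fix i assume i: "i < N"
    show "\<zeta> (real (Suc i) * h) = 1 \<or> c0 * h\<^sup>2 \<le> \<phi> (real (i + 2) * h) - 2 * \<phi> (real (Suc i) * h) + \<phi> (real i * h) \<and>
        c0 * h \<le> \<bar>\<phi> (real (i + 2) * h) - \<phi> (real i * h)\<bar>"
    proof (cases "real (Suc i) * h \<in> U0")
      case True then show ?thesis using \<zeta>(4) by simp
    next
      case False
      have xi: "real (Suc i) * h \<in> {0..1}" using i by (intro x_in) auto
      obtain \<xi> where a: "real i * h < \<xi>" "\<xi> < real (i + 2) * h" and e: "\<phi> (real (i + 2) * h) - 2 * \<phi> (real (Suc i) * h) + \<phi> (real i * h) = h\<^sup>2 * f2 \<xi>"
        using D2[OF i] unfolding n2 by blast
      have "\<xi> \<in> {0..1}" using a i by (intro near[of i _ "i + 2"]) auto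
      moreover have "\<bar>\<xi> - real (Suc i) * h\<bar> \<le> 2 * h" using a h0 by (simp add: algebra_simps abs_le_iff)
      ultimately have "c0 \<le> f2 \<xi>" using close xi False by blast
      then have 1: "c0 * h\<^sup>2 \<le> h\<^sup>2 * f2 \<xi>" by (simp add: mult.commute[of "h\<^sup>2"] mult_right_mono)
      obtain \<xi>' where b: "real i * h < \<xi>'" "\<xi>' < real (i + 2) * h" and e': "\<phi> (real (i + 2) * h) - \<phi> (real i * h) = 2 * h * f1 \<xi>'"
        using D12[OF i] unfolding n2 by blast
      have "\<xi>' \<in> {0..1}" using b i by (intro near[of i _ "i + 2"]) auto
      moreover have "\<bar>\<xi>' - real (Suc i) * h\<bar> \<le> 2 * h" using b h0 by (simp add: algebra_simps abs_le_iff)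
      ultimately have "c0 \<le> \<bar>f1 \<xi>'\<bar>" using close xi False by blast
      then have "h * c0 \<le> h * (2 * \<bar>f1 \<xi>'\<bar>)" using h0 by (intro mult_left_mono) auto
      then show ?thesis using 1 h0 unfolding e e' by (simp add: abs_mult mult_ac)
    qed
  next
    obtain \<xi> where a: "real 0 * h < \<xi>" "\<xi> < real (Suc 0) * h" and e: "\<phi> (real (Suc 0) * h) - \<phi> (real 0 * h) = h * f1 \<xi>"
      using D1[of 0] N unfolding n1 by blast
    have "\<xi> \<in> {0..1}" using a N by (intro near[of 0 _ "Suc 0"]) auto
    then have "c0 \<le> f1 \<xi>" using a by (intro sign0) auto
    then show "0 \<le> \<phi> (real 1 * h) - \<phi> (real 0 * h)" using e h0 c0 by simp
  next
    obtain \<xi> where a: "real N * h < \<xi>" "\<xi> < real (Suc N) * h" and e: "\<phi> (real (Suc N) * h) - \<phi> (real N * h) = h * f1 \<xi>"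
      using D1[of N] unfolding n1 by blast
    have "\<xi> \<in> {0..1}" using a by (intro near[of N _ "Suc N"]) auto
    moreover have "\<bar>\<xi> - 1\<bar> \<le> 2 * h" using a h0 unfolding hN[symmetric] by (simp add: algebra_simps abs_le_iff)
    ultimately have "f1 \<xi> \<le> - c0" by (rule sign1)
    then have "h * f1 \<xi> \<le> 0" using h0 c0 by (intro mult_nonneg_nonpos) auto
    then show "\<phi> (real (Suc N) * h) - \<phi> (real N * h) \<le> 0" using e by simp
  next
    obtain \<xi> where a: "real 0 * h < \<xi>" "\<xi> < real (0 + 2) * h" and e: "\<phi> (real (0 + 2) * h) - 2 * \<phi> (real (Suc 0) * h) + \<phi> (real 0 * h) = h\<^sup>2 * f2 \<xi>"
      using D2[OF N] unfolding n2 by blast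
    have "\<xi> \<in> {0..1}" using a N by (intro near[of 0 _ "0 + 2"]) auto
    then have "c0 \<le> f2 \<xi>" using a by (intro close[of \<xi> 0] end0) auto
    then show "0 \<le> \<phi> (real 2 * h) - 2 * \<phi> (real 1 * h) + \<phi> (real 0 * h)" using e c0 by simp
  next
    obtain n where n: "N = Suc n" using N gr0_conv_Suc by auto
    have nN: "n < N" using n by simp
    obtain \<xi> where a: "real n * h < \<xi>" "\<xi> < real (n + 2) * h" and e: "\<phi> (real (n + 2) * h) - 2 * \<phi> (real (Suc n) * h) + \<phi> (real n * h) = h\<^sup>2 * f2 \<xi>"
      using D2[OF nN] unfolding n2 by blast
    have "\<xi> \<in> {0..1}" using a n by (intro near[of n _ "n + 2"]) auto
    moreover have "\<bar>\<xi> - 1\<bar> \<le> 2 * h" using a h0 unfolding hN[symmetric] n by (simp add: algebra_simps abs_le_iff)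
    ultimately have "c0 \<le> f2 \<xi>" using end1 by (intro close[of \<xi> 1])
    then show "0 \<le> \<phi> (real (Suc N) * h) - 2 * \<phi> (real N * h) + \<phi> (real (N - 1) * h)" using e c0 by (simp add: n)
  qed
qed

text \<open>theta is the reciprocal of a quadratic with derivative T - 2 t, hence theta' = (2 t - T)
  theta^2. The second derivative is of order theta^3, up to powers of T.\<close>

definition theta' :: "real \<Rightarrow> real \<Rightarrow> real \<Rightarrow> real" where
  "theta' T \<delta> t = (2 * t - T) * (theta T \<delta> t)\<^sup>2"

definition theta'' :: "real \<Rightarrow> real \<Rightarrow> real \<Rightarrow> real" where
  "theta'' T \<delta> t = 2 * (theta T \<delta> t)\<^sup>2 + 2 * (2 * t - T)\<^sup>2 * (theta T \<delta> t) ^ 3"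

text \<open>The two factors in the denominator sum to T + 2 delta T \<le> 2 T, so their product is
  at most T^2; at least delta T^2 follows by expanding it around the endpoints. The lower bound on
  theta also lets theta^2 be absorbed into T^2 theta^3.\<close>

lemma theta_facts:
  assumes T: "0 < T" and \<delta>: "0 < \<delta>" "\<delta> < 1/2" and t: "t \<in> {0..T}"
  shows "0 < theta T \<delta> t" "1 / T\<^sup>2 \<le> theta T \<delta> t" "theta T \<delta> t \<le> 1 / (\<delta> * T\<^sup>2)"
    "(theta T \<delta> has_real_derivative theta' T \<delta> t) (at t)" "(theta' T \<delta> has_real_derivative theta'' T \<delta> t) (at t)"
    "\<bar>theta' T \<delta> t\<bar> \<le> T * (theta T \<delta> t)\<^sup>2" "\<bar>theta'' T \<delta> t\<bar> \<le> 4 * T\<^sup>2 * (theta T \<delta> t) ^ 3"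
proof -
  let ?a = "t + \<delta> * T" and ?b = "T + \<delta> * T - t"
  have dT: "0 < \<delta> * T" using T \<delta> by simp
  have ab: "0 < ?a" "0 < ?b" using t dT by auto
  then show pos: "0 < theta T \<delta> t" by (simp add: theta_def)
  have "?a * ?b \<le> T\<^sup>2"
  proof -
    have "4 * (?a * ?b) = (?a + ?b)\<^sup>2 - (?a - ?b)\<^sup>2" by (simp add: power2_eq_square algebra_simps)
    also have "\<dots> \<le> (?a + ?b)\<^sup>2" by simp
    also have "\<dots> \<le> (2 * T)\<^sup>2"
    proof (rule power_mono)
      have "\<delta> * T \<le> 1/2 * T" using T \<delta> by (intro mult_right_mono) auto
      then show "?a + ?b \<le> 2 * T" by linarith
    qed (use ab in linarith)
    finally show ?thesis by (simp add: power2_eq_square)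
  qed
  then show low: "1 / T\<^sup>2 \<le> theta T \<delta> t" unfolding theta_def using ab T by (intro divide_left_mono) auto
  have "\<delta> * T\<^sup>2 \<le> ?a * ?b"
  proof -
    have "?a * ?b = \<delta> * T\<^sup>2 + (t * (T - t) + (\<delta> * T)\<^sup>2)" by (simp add: power2_eq_square algebra_simps)
    moreover have "0 \<le> t * (T - t)" using t by simp
    ultimately show ?thesis by simp
  qed
  then show "theta T \<delta> t \<le> 1 / (\<delta> * T\<^sup>2)" unfolding theta_def using ab T \<delta> by (intro divide_left_mono) auto
  show d1: "(theta T \<delta> has_real_derivative theta' T \<delta> t) (at t)"
  proof -
    have dD: "((\<lambda>t. (t + \<delta> * T) * (T + \<delta> * T - t)) has_real_derivative (T - 2 * t)) (at t)"
      by (auto intro!: derivative_eq_intros simp: algebra_simps)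
    have nz: "?a * ?b \<noteq> 0" using ab by simp
    show ?thesis unfolding theta_def[abs_def] theta'_def
      by (rule DERIV_cong[OF DERIV_divide[OF DERIV_const dD nz]]) (simp add: theta_def power2_eq_square)
  qed
  have "(theta' T \<delta> has_real_derivative 2 * (theta T \<delta> t)\<^sup>2 + (2 * t - T) * (2 * theta T \<delta> t * theta' T \<delta> t)) (at t)"
    unfolding theta'_def[abs_def] by (rule derivative_eq_intros d1 refl | simp add: theta'_def)+
  then show "(theta' T \<delta> has_real_derivative theta'' T \<delta> t) (at t)"
    by (simp add: theta'_def theta''_def power2_eq_square power3_eq_cube mult_ac)
  have T2: "\<bar>2 * t - T\<bar> \<le> T" using t by auto
  then show "\<bar>theta' T \<delta> t\<bar> \<le> T * (theta T \<delta> t)\<^sup>2"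
    by (simp add: theta'_def abs_mult mult_right_mono)
  have "(2 * t - T)\<^sup>2 \<le> T\<^sup>2" using T2 T by (simp add: abs_le_square_iff[symmetric])
  then have "(2 * t - T)\<^sup>2 * theta T \<delta> t ^ 3 \<le> T\<^sup>2 * theta T \<delta> t ^ 3" using pos by (intro mult_right_mono) auto
  moreover have "(theta T \<delta> t)\<^sup>2 \<le> T\<^sup>2 * theta T \<delta> t ^ 3"
  proof -
    have "1 \<le> T\<^sup>2 * theta T \<delta> t" using low T by (simp add: pos_divide_le_eq mult.commute)
    then have "1 * (theta T \<delta> t)\<^sup>2 \<le> (T\<^sup>2 * theta T \<delta> t) * (theta T \<delta> t)\<^sup>2" by (rule mult_right_mono) simp
    then show ?thesis by (simp add: power2_eq_square power3_eq_cube mult_ac)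
  qed
  moreover have "0 \<le> theta'' T \<delta> t" using pos by (simp add: theta''_def)
  ultimately show "\<bar>theta'' T \<delta> t\<bar> \<le> 4 * T\<^sup>2 * (theta T \<delta> t) ^ 3"
    by (simp add: theta''_def mult.assoc)
qed

text \<open>theta \<ge> 1 / T^2 converts largeness of lambda into largeness of s, and theta \<le> 1
  / (delta T^2) converts the mesh condition into s h \<le> \<eta>. Each derivative of s gains a
  power of theta but no power of lambda, so the surplus of lambda in s^2 and s^3 makes s' and s''
  small.\<close>

lemma time_weight_bounds:
  assumes T: "0 < T" and \<delta>: "0 < \<delta>" "\<delta> < 1/2" and t: "t \<in> {0..T}" and \<eta>: "0 < \<eta>" and h: "0 < h"
    and \<Lambda>: "1 \<le> \<Lambda>" "T\<^sup>2 / \<eta> \<le> \<Lambda>" "T / \<eta> \<le> \<Lambda>" "4 * T\<^sup>2 / \<eta> \<le> \<Lambda>" and small: "\<Lambda> * h / (\<delta> * T\<^sup>2) \<le> \<eta>"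
  defines "s \<equiv> \<Lambda> * theta T \<delta> t"
  shows "0 < s" "1 \<le> \<eta> * s" "s * h \<le> \<eta>" "\<bar>\<Lambda> * theta' T \<delta> t\<bar> \<le> \<eta> * s\<^sup>2" "\<bar>\<Lambda> * theta'' T \<delta> t\<bar> \<le> \<eta> * s ^ 3"
proof -
  note th = theta_facts[OF T \<delta> t]
  let ?\<theta> = "theta T \<delta> t"
  show "0 < s" using th \<Lambda> by (simp add: s_def)
  have "T\<^sup>2 \<le> \<eta> * \<Lambda>" using \<Lambda> \<eta> by (simp add: pos_divide_le_eq mult.commute)
  then have "T\<^sup>2 * (1 / T\<^sup>2) \<le> (\<eta> * \<Lambda>) * ?\<theta>" using th T \<eta> \<Lambda> by (intro mult_mono) auto
  then show "1 \<le> \<eta> * s" using T by (simp add: s_def mult_ac)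
  have "s * h \<le> \<Lambda> * (1 / (\<delta> * T\<^sup>2)) * h"
    unfolding s_def using th \<Lambda> h by (intro mult_right_mono mult_left_mono) auto
  then show "s * h \<le> \<eta>" using small by simp
  have "T \<le> \<eta> * \<Lambda>" using \<Lambda> \<eta> by (simp add: pos_divide_le_eq mult.commute)
  then have "T * ?\<theta>\<^sup>2 \<le> (\<eta> * \<Lambda>) * ?\<theta>\<^sup>2" by (rule mult_right_mono) simp
  then have "\<bar>theta' T \<delta> t\<bar> \<le> (\<eta> * \<Lambda>) * ?\<theta>\<^sup>2" using th(6) by linarith
  then have "\<Lambda> * \<bar>theta' T \<delta> t\<bar> \<le> \<Lambda> * ((\<eta> * \<Lambda>) * ?\<theta>\<^sup>2)" using \<Lambda> by (intro mult_left_mono) auto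
  then show "\<bar>\<Lambda> * theta' T \<delta> t\<bar> \<le> \<eta> * s\<^sup>2"
    using \<Lambda> by (simp add: s_def abs_mult power2_eq_square mult_ac)
  have "4 * T\<^sup>2 \<le> \<eta> * \<Lambda>" using \<Lambda> \<eta> by (simp add: pos_divide_le_eq mult.commute)
  also have "\<dots> \<le> \<eta> * \<Lambda>\<^sup>2" using \<Lambda> \<eta> by (intro mult_left_mono) (auto simp: power2_eq_square)
  finally have "4 * T\<^sup>2 * ?\<theta> ^ 3 \<le> \<eta> * \<Lambda>\<^sup>2 * ?\<theta> ^ 3" using th(1) by (intro mult_right_mono) auto
  then have "\<bar>theta'' T \<delta> t\<bar> \<le> \<eta> * \<Lambda>\<^sup>2 * ?\<theta> ^ 3" using th(7) by linarith
  then have "\<Lambda> * \<bar>theta'' T \<delta> t\<bar> \<le> \<Lambda> * (\<eta> * \<Lambda>\<^sup>2 * ?\<theta> ^ 3)" using \<Lambda> by (intro mult_left_mono) auto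
  then show "\<bar>\<Lambda> * theta'' T \<delta> t\<bar> \<le> \<eta> * s ^ 3"
    using \<Lambda> by (simp add: s_def abs_mult power2_eq_square power3_eq_cube mult_ac)
qed

section \<open>Increments of Brownian motion\<close>

context standard_brownian_motion
begin

abbreviation F where "F t \<equiv> augmented_filtration M B t"

abbreviation cylinder_gen where
  "cylinder_gen t \<equiv> {B r -` A \<inter> space M | r A. 0 \<le> r \<and> r \<le> t \<and> A \<in> sets borel} \<union> null_sets M"

lemma cylinder_gen_sub: "cylinder_gen t \<subseteq> sets M"
  using random_variable_B by (auto intro: measurable_sets)

lemma space_F [simp]: "space (F t) = space M"
  by (simp add: augmented_filtration_def space_measure_of_conv)

lemma sets_F: "sets (F t) = sigma_sets (space M) (cylinder_gen t)"
  unfolding augmented_filtration_def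
  by (rule sets_measure_of) (use cylinder_gen_sub[of t] sets.sets_into_space in blast)

lemma sets_F_sub: "sets (F t) \<subseteq> sets M"
  unfolding sets_F by (rule sets.sigma_sets_subset[OF cylinder_gen_sub])

lemma sets_F_mono: "s \<le> t \<Longrightarrow> sets (F s) \<subseteq> sets (F t)"
  unfolding sets_F by (rule sigma_sets_mono') (use order_trans in blast)

lemma measurable_F_mono: "X \<in> borel_measurable (F s) \<Longrightarrow> s \<le> t \<Longrightarrow> X \<in> borel_measurable (F t)"
  using sets_F_mono[of s t] by (auto simp: measurable_def)

lemma measurable_F_M: "X \<in> borel_measurable (F s) \<Longrightarrow> X \<in> borel_measurable M"
  using sets_F_sub[of s] by (auto simp: measurable_def)

lemma B_measurable_F: "0 \<le> r \<Longrightarrow> r \<le> t \<Longrightarrow> B r \<in> borel_measurable (F t)"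
  by (auto simp: measurable_def sets_F intro!: sigma_sets.Basic)

lemma null_measurable_F: "A \<in> null_sets M \<Longrightarrow> A \<in> sets (F t)"
  by (auto simp: sets_F intro!: sigma_sets.Basic)

lemma increments_sum:
  fixes \<tau> :: "nat \<Rightarrow> real" shows "B (\<tau> k) \<omega> = B (\<tau> 0) \<omega> + (\<Sum>l<k. B (\<tau> (Suc l)) \<omega> - B (\<tau> l) \<omega>)"
  by (simp add: sum_lessThan_telescope[of "\<lambda>l. B (\<tau> l) \<omega>" k])

text \<open>Values of B at finitely many times up to c are partial sums of increments over an
  ordered grid, and [c, d] is one further grid cell. Joint independence of all increments then
  separates the values from the last increment.\<close>

lemma indep_cylinder:
  assumes R: "finite R" "R \<subseteq> {0..c}" and c: "0 \<le> c" "c < d"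
    and A: "\<And>r. r \<in> R \<Longrightarrow> A r \<in> sets borel" and E: "E \<in> sets borel"
  shows "prob ({\<omega>\<in>space M. \<forall>r\<in>R. B r \<omega> \<in> A r} \<inter> ((\<lambda>\<omega>. B d \<omega> - B c \<omega>) -` E \<inter> space M)) =
    prob {\<omega>\<in>space M. \<forall>r\<in>R. B r \<omega> \<in> A r} * prob ((\<lambda>\<omega>. B d \<omega> - B c \<omega>) -` E \<inter> space M)"
proof -
  \<comment> \<open>0 is added so that the partial sums start from B 0, and c so that the cell
    appended below is exactly [c, d].\<close>
  define xs where "xs = sorted_list_of_set (insert 0 (insert c R))"
  have fin: "finite (insert 0 (insert c R))" using R by simp
  have set_xs: "set xs = insert 0 (insert c R)" unfolding xs_def by (rule set_sorted_list_of_set[OF fin])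
  have srt: "sorted_wrt (<) xs" unfolding xs_def by simp
  have ne: "xs \<noteq> []" using set_xs by auto
  define m where "m = length xs - 1"
  have len: "length xs = Suc m" using ne by (simp add: m_def)
  define \<tau> where "\<tau> k = (xs @ [d]) ! k" for k
  have tau_xs: "\<tau> k = xs ! k" if "k \<le> m" for k using that len by (simp add: \<tau>_def nth_append)
  have tau_d: "\<tau> (Suc m) = d" using len by (simp add: \<tau>_def nth_append)
  have srt': "xs ! i < xs ! j" if "i < j" "j \<le> m" for i j
    using sorted_wrt_nth_less[OF srt] that len by simp
  have in_xs: "x \<in> set xs \<Longrightarrow> \<exists>k\<le>m. x = \<tau> k" for x
    using tau_xs len by (auto simp: in_set_conv_nth less_Suc_eq_le)
  have range: "\<tau> k \<in> {0..c}" if "k \<le> m" for k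
  proof -
    have "xs ! k \<in> set xs" using that len by simp
    then show ?thesis using set_xs R c tau_xs[OF that] by auto
  qed
  have mono: "\<tau> i \<le> \<tau> j" if "i \<le> j" "j \<le> m" for i j
    using srt'[of i j] that tau_xs by (cases "i = j") auto
  have tau_0: "\<tau> 0 = 0"
  proof -
    obtain k where "k \<le> m" "\<tau> k = 0" using in_xs[of 0] set_xs by auto
    then show ?thesis using mono[of 0 k] range[of 0] by auto
  qed
  have tau_m: "\<tau> m = c"
  proof -
    obtain k where "k \<le> m" "\<tau> k = c" using in_xs[of c] set_xs by auto
    then show ?thesis using mono[of k m] range[of m] by auto
  qed
  define X where "X k \<omega> = B (\<tau> (Suc k)) \<omega> - B (\<tau> k) \<omega>" for k \<omega>
  have step: "\<tau> k < \<tau> (Suc k)" if "k < Suc m" for k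
    using that srt'[of k "Suc k"] tau_xs[of k] tau_xs[of "Suc k"] tau_d tau_m c
    by (cases "k = m") auto
  have "indep_vars (\<lambda>_. borel) X {..<Suc m}"
    unfolding X_def using step tau_0 by (intro indep_increments) auto
  then have "indep_var (PiM {..<m} (\<lambda>_. borel)) (\<lambda>\<omega>. restrict (\<lambda>i. X i \<omega>) {..<m})
     (PiM {m} (\<lambda>_. borel)) (\<lambda>\<omega>. restrict (\<lambda>i. X i \<omega>) {m})"
    by (rule indep_var_restrict) auto
  note indep = indep_varD[OF this]
  have "\<forall>r\<in>R. \<exists>k\<le>m. r = \<tau> k" using in_xs set_xs by auto
  then obtain k where k: "\<And>r. r \<in> R \<Longrightarrow> k r \<le> m" "\<And>r. r \<in> R \<Longrightarrow> r = \<tau> (k r)" by metis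
  define S where "S = {y \<in> space (PiM {..<m} (\<lambda>_. borel :: real measure)). \<forall>r\<in>R. (\<Sum>l<k r. y l) \<in> A r}"
  have S: "S \<in> sets (PiM {..<m} (\<lambda>_. borel))"
  proof -
    have [measurable]: "(\<lambda>y. \<Sum>l<k r. y l) \<in> borel_measurable (PiM {..<m} (\<lambda>_. borel :: real measure))" if "r \<in> R" for r
      using k(1)[OF that] by (intro borel_measurable_sum measurable_component_singleton) auto
    have "{y \<in> space (PiM {..<m} (\<lambda>_. borel :: real measure)). (\<Sum>l<k r. y l) \<in> A r} \<in> sets (PiM {..<m} (\<lambda>_. borel))" if "r \<in> R" for r
      using A[OF that] that by measurable
    then show ?thesis unfolding S_def by (intro sets.sets_Collect_finite_All R(1)) auto
  qed
  define S' where "S' = {y \<in> space (PiM {m} (\<lambda>_. borel :: real measure)). y m \<in> E}"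
  have S': "S' \<in> sets (PiM {m} (\<lambda>_. borel))"
    unfolding S'_def using E by measurable
  let ?C = "{\<omega>\<in>space M. \<forall>r\<in>R. B r \<omega> \<in> A r}"
  let ?D = "(\<lambda>\<omega>. B d \<omega> - B c \<omega>) -` E \<inter> space M"
  let ?f = "\<lambda>\<omega>. restrict (\<lambda>i. X i \<omega>) {..<m}" and ?g = "\<lambda>\<omega>. restrict (\<lambda>i. X i \<omega>) {m}"
  have RB: "r \<in> R \<Longrightarrow> B r \<in> borel_measurable M" for r using R(2) by (intro random_variable_B) auto
  have Cm: "?C \<in> sets M"
  proof -
    have "{\<omega>\<in>space M. B r \<omega> \<in> A r} \<in> sets M" if "r \<in> R" for r
      using measurable_sets[OF RB[OF that] A[OF that]] by (simp add: vimage_def Int_def conj_commute)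
    then show ?thesis by (intro sets.sets_Collect_finite_All R(1)) auto
  qed
  have "(\<lambda>\<omega>. B d \<omega> - B c \<omega>) \<in> borel_measurable M" using random_variable_B[of d] random_variable_B[of c] c by auto
  then have Dm: "?D \<in> sets M" using E by (rule measurable_sets)
  have tau_nonneg: "0 \<le> \<tau> k" if "k \<le> Suc m" for k
    using that range[of k] tau_d c by (cases "k = Suc m") auto
  have Xm: "X i \<in> borel_measurable M" if "i \<le> m" for i
    unfolding X_def using that tau_nonneg by (intro borel_measurable_diff random_variable_B) auto
  have fm: "?f \<in> measurable M (PiM {..<m} (\<lambda>_. borel))" "?g \<in> measurable M (PiM {m} (\<lambda>_. borel))"
    using Xm by (auto intro!: measurable_restrict)
  have D_eq: "?D = ?g -` S' \<inter> space M"
    by (auto simp: S'_def X_def tau_d tau_m space_PiM)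
  \<comment> \<open>Only almost everywhere, because B vanishes at time 0 only almost surely.\<close>
  have C_eq: "AE \<omega> in M. \<omega> \<in> ?C \<longleftrightarrow> \<omega> \<in> ?f -` S \<inter> space M"
    using B_zero
  proof eventually_elim
    case (elim \<omega>)
    have "B r \<omega> = (\<Sum>l<k r. ?f \<omega> l)" if "r \<in> R" for r
    proof -
      have "B r \<omega> = B (\<tau> (k r)) \<omega>" using k(2)[OF that] by simp
      also have "\<dots> = (\<Sum>l<k r. X l \<omega>)" using increments_sum[of \<tau> "k r" \<omega>] elim by (simp add: tau_0 X_def)
      also have "\<dots> = (\<Sum>l<k r. ?f \<omega> l)" using k(1)[OF that] by (intro sum.cong) auto
      finally show ?thesis .
    qed
    then show ?case by (auto simp: S_def space_PiM)
  qed
  have "prob (?C \<inter> ?D) = prob ((?f -` S \<inter> space M) \<inter> (?g -` S' \<inter> space M))"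
    using C_eq measurable_sets[OF fm(1) S] measurable_sets[OF fm(2) S'] Cm Dm
    by (intro finite_measure_eq_AE) (auto simp: D_eq)
  also have "(?f -` S \<inter> space M) \<inter> (?g -` S' \<inter> space M) = (\<lambda>x. (?f x, ?g x)) -` (S \<times> S') \<inter> space M"
    by auto
  also have "prob \<dots> = prob (?f -` S \<inter> space M) * prob (?g -` S' \<inter> space M)"
    by (rule indep[OF S S'])
  also have "prob (?f -` S \<inter> space M) = prob ?C"
    using C_eq measurable_sets[OF fm(1) S] Cm by (intro finite_measure_eq_AE) auto
  finally show ?thesis unfolding D_eq .
qed

text \<open>A generator argument: finite-dimensional cylinders together with the null sets are
  stable under intersection and generate the augmented filtration. Null sets are trivially
  independent of every event, so augmentation does not disturb independence.\<close>

lemma indep_var_increment: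
  assumes c: "0 \<le> c" "c < d" and Z: "Z \<in> borel_measurable (F c)"
  shows "indep_var borel Z borel (\<lambda>\<omega>. B d \<omega> - B c \<omega>)"
proof -
  define P where "P = {{\<omega>\<in>space M. \<forall>r\<in>R. B r \<omega> \<in> A r} | R A. finite R \<and> R \<subseteq> {0..c} \<and> (\<forall>r\<in>R. A r \<in> sets (borel :: real measure))}"
  define D where "D = {(\<lambda>\<omega>. B d \<omega> - B c \<omega>) -` E \<inter> space M | E. E \<in> sets borel}"
  have incr: "(\<lambda>\<omega>. B d \<omega> - B c \<omega>) \<in> borel_measurable M" using random_variable_B[of d] random_variable_B[of c] c by auto
  have D_sub: "D \<subseteq> sets M" using measurable_sets[OF incr] by (auto simp: D_def)
  have P_sub: "P \<subseteq> sets M"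
  proof
    fix X assume "X \<in> P"
    then obtain R A where X: "X = {\<omega>\<in>space M. \<forall>r\<in>R. B r \<omega> \<in> A r}" and R: "finite R" "R \<subseteq> {0..c}"
      and A: "\<forall>r\<in>R. A r \<in> sets (borel :: real measure)" by (auto simp: P_def)
    have "{\<omega>\<in>space M. B r \<omega> \<in> A r} \<in> sets M" if "r \<in> R" for r
    proof -
      have "B r -` A r \<inter> space M \<in> sets M"
        using that R A by (intro measurable_sets[OF random_variable_B]) auto
      then show ?thesis by (simp add: vimage_def Int_def conj_commute)
    qed
    then show "X \<in> sets M" unfolding X by (intro sets.sets_Collect_finite_All R(1)) auto
  qed
  have stable_P: "Int_stable (P \<union> null_sets M)"
  proof (rule Int_stableI)
    fix X Y assume X: "X \<in> P \<union> null_sets M" and Y: "Y \<in> P \<union> null_sets M"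
    have sub: "P \<union> null_sets M \<subseteq> sets M" using P_sub by auto
    show "X \<inter> Y \<in> P \<union> null_sets M"
    proof (cases "X \<in> null_sets M \<or> Y \<in> null_sets M")
      case True
      then have "X \<inter> Y \<in> null_sets M" using X Y sub
        by (metis Int_commute null_set_Int1 subsetD)
      then show ?thesis by simp
    next
      case False
      then obtain R A R' A' where "X = {\<omega>\<in>space M. \<forall>r\<in>R. B r \<omega> \<in> A r}" "finite R" "R \<subseteq> {0..c}"
        "\<forall>r\<in>R. A r \<in> sets (borel :: real measure)"
        "Y = {\<omega>\<in>space M. \<forall>r\<in>R'. B r \<omega> \<in> A' r}" "finite R'" "R' \<subseteq> {0..c}"
        "\<forall>r\<in>R'. A' r \<in> sets (borel :: real measure)"
        using X Y by (auto simp: P_def)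
      moreover define A'' where "A'' r = (if r \<in> R then A r else UNIV) \<inter> (if r \<in> R' then A' r else UNIV)" for r
      ultimately have "X \<inter> Y = {\<omega>\<in>space M. \<forall>r\<in>R \<union> R'. B r \<omega> \<in> A'' r}" "finite (R \<union> R')" "R \<union> R' \<subseteq> {0..c}"
        "\<forall>r\<in>R \<union> R'. A'' r \<in> sets borel"
        by (auto simp: A''_def)
      then have "X \<inter> Y \<in> P" unfolding P_def by blast
      then show ?thesis by simp
    qed
  qed
  have stable_D: "Int_stable D"
  proof (rule Int_stableI)
    fix X Y assume "X \<in> D" "Y \<in> D"
    then obtain E E' where "X = (\<lambda>\<omega>. B d \<omega> - B c \<omega>) -` E \<inter> space M" "Y = (\<lambda>\<omega>. B d \<omega> - B c \<omega>) -` E' \<inter> space M"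
      "E \<in> sets borel" "E' \<in> sets borel" by (auto simp: D_def)
    then have "X \<inter> Y = (\<lambda>\<omega>. B d \<omega> - B c \<omega>) -` (E \<inter> E') \<inter> space M" "E \<inter> E' \<in> sets borel" by auto
    then show "X \<inter> Y \<in> D" unfolding D_def by blast
  qed
  have "indep_set (P \<union> null_sets M) D"
  proof (rule indep_setI)
    fix a b assume a: "a \<in> P \<union> null_sets M" and b: "b \<in> D"
    show "prob (a \<inter> b) = prob a * prob b"
    proof (cases "a \<in> null_sets M")
      case True
      then have "a \<inter> b \<in> null_sets M" using b D_sub by (meson null_set_Int2 subsetD)
      with True show ?thesis by (simp add: measure_def null_setsD1)
    next
      case False
      with a b show ?thesis using indep_cylinder[OF _ _ c] unfolding P_def D_def by fastforce
    qed
  qed (use P_sub D_sub in auto)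
  then have ind: "indep_set (sigma_sets (space M) (P \<union> null_sets M)) (sigma_sets (space M) D)"
    by (rule indep_set_sigma_sets[OF _ stable_P stable_D])
  have "cylinder_gen c \<subseteq> P \<union> null_sets M"
  proof -
    have "B r -` A \<inter> space M \<in> P" if "0 \<le> r" "r \<le> c" "A \<in> sets borel" for r A
      unfolding P_def using that by (intro CollectI exI[of _ "{r}"] exI[of _ "\<lambda>_. A"]) auto
    then show ?thesis by auto
  qed
  then have "sets (F c) \<subseteq> sigma_sets (space M) (P \<union> null_sets M)"
    unfolding sets_F by (rule sigma_sets_mono')
  then have Zs: "sigma_sets (space M) {Z -` A \<inter> space M | A. A \<in> sets borel} \<subseteq> sigma_sets (space M) (P \<union> null_sets M)"
    using measurable_sets[OF Z] by (intro sigma_sets_mono) auto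
  show ?thesis
    unfolding indep_var_eq indep_set_def
  proof (intro conjI incr measurable_F_M[OF Z] indep_sets_mono_sets[OF ind[unfolded indep_set_def]])
    fix i :: bool
    show "case_bool (sigma_sets (space M) {Z -` A \<inter> space M |A. A \<in> sets borel})
         (sigma_sets (space M) {(\<lambda>\<omega>. B d \<omega> - B c \<omega>) -` A \<inter> space M |A. A \<in> sets borel}) i
         \<subseteq> case_bool (sigma_sets (space M) (P \<union> null_sets M)) (sigma_sets (space M) D) i"
      using Zs by (cases i) (auto simp: D_def)
  qed
qed

text \<open>The case c = d is separate because the normal density describes increments over
  intervals of positive length only.\<close>

lemma increment_moments:
  assumes c: "0 \<le> c" "c \<le> d"
  shows "integrable M (\<lambda>\<omega>. B d \<omega> - B c \<omega>)" "expectation (\<lambda>\<omega>. B d \<omega> - B c \<omega>) = 0"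
    "integrable M (\<lambda>\<omega>. (B d \<omega> - B c \<omega>)\<^sup>2)" "expectation (\<lambda>\<omega>. (B d \<omega> - B c \<omega>)\<^sup>2) = d - c"
proof -
  have "integrable M (\<lambda>\<omega>. B d \<omega> - B c \<omega>) \<and> expectation (\<lambda>\<omega>. B d \<omega> - B c \<omega>) = 0 \<and>
    integrable M (\<lambda>\<omega>. (B d \<omega> - B c \<omega>)\<^sup>2) \<and> expectation (\<lambda>\<omega>. (B d \<omega> - B c \<omega>)\<^sup>2) = d - c"
  proof (cases "c = d")
    case False
    then have cd: "c < d" using c by simp
    define \<sigma> where "\<sigma> = sqrt (d - c)"
    have \<sigma>: "0 < \<sigma>" "\<sigma>\<^sup>2 = d - c" using cd by (auto simp: \<sigma>_def)
    have D: "distributed M lborel (\<lambda>\<omega>. B d \<omega> - B c \<omega>) (normal_density 0 \<sigma>)"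
      unfolding \<sigma>_def by (rule normal_increments[OF c(1) cd])
    have nn: "0 \<le> normal_density 0 \<sigma> x" for x by simp
    have 1: "integrable lborel (\<lambda>x. normal_density 0 \<sigma> x * x)"
      using integrable_normal_moment[OF \<sigma>(1), of 0 1] by simp
    have 2: "integrable lborel (\<lambda>x. normal_density 0 \<sigma> x * x\<^sup>2)"
      using integrable_normal_moment[OF \<sigma>(1), of 0 2] by simp
    have "integrable M (\<lambda>\<omega>. B d \<omega> - B c \<omega>)"
      using distributed_integrable[OF D, of "\<lambda>x. x"] 1 by simp
    moreover have "integrable M (\<lambda>\<omega>. (B d \<omega> - B c \<omega>)\<^sup>2)"
      using distributed_integrable[OF D, of "\<lambda>x. x\<^sup>2"] 2 by simp
    moreover have "expectation (\<lambda>\<omega>. B d \<omega> - B c \<omega>) = 0"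
      using distributed_integral[OF D, of "\<lambda>x. x"] integral_normal_moment_odd[OF \<sigma>(1), of 0 0] by simp
    moreover have "expectation (\<lambda>\<omega>. (B d \<omega> - B c \<omega>)\<^sup>2) = d - c"
      using distributed_integral[OF D, of "\<lambda>x. x\<^sup>2"] integral_normal_moment_even[OF \<sigma>(1), of 0 1] \<sigma> by simp
    ultimately show ?thesis by simp
  qed simp
  then show "integrable M (\<lambda>\<omega>. B d \<omega> - B c \<omega>)" "expectation (\<lambda>\<omega>. B d \<omega> - B c \<omega>) = 0"
    "integrable M (\<lambda>\<omega>. (B d \<omega> - B c \<omega>)\<^sup>2)" "expectation (\<lambda>\<omega>. (B d \<omega> - B c \<omega>)\<^sup>2) = d - c"
    by auto
qed

lemma expectation_times_increment:
  assumes c: "0 \<le> c" "c \<le> d" and Z: "Z \<in> borel_measurable (F c)" "integrable M Z"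
  shows "integrable M (\<lambda>\<omega>. Z \<omega> * (B d \<omega> - B c \<omega>))" "expectation (\<lambda>\<omega>. Z \<omega> * (B d \<omega> - B c \<omega>)) = 0"
    "integrable M (\<lambda>\<omega>. Z \<omega> * (B d \<omega> - B c \<omega>)\<^sup>2)" "expectation (\<lambda>\<omega>. Z \<omega> * (B d \<omega> - B c \<omega>)\<^sup>2) = expectation Z * (d - c)"
proof -
  have "integrable M (\<lambda>\<omega>. Z \<omega> * (B d \<omega> - B c \<omega>)) \<and> expectation (\<lambda>\<omega>. Z \<omega> * (B d \<omega> - B c \<omega>)) = 0 \<and>
    integrable M (\<lambda>\<omega>. Z \<omega> * (B d \<omega> - B c \<omega>)\<^sup>2) \<and> expectation (\<lambda>\<omega>. Z \<omega> * (B d \<omega> - B c \<omega>)\<^sup>2) = expectation Z * (d - c)"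
  proof (cases "c = d")
    case False
    then have cd: "c < d" using c by simp
    note ind = indep_var_increment[OF c(1) cd Z(1)]
    have ind2: "indep_var borel Z borel (\<lambda>\<omega>. (B d \<omega> - B c \<omega>)\<^sup>2)"
      using indep_var_compose[OF ind, of id borel "\<lambda>x. x\<^sup>2" borel] by (simp add: o_def)
    show ?thesis
      using indep_var_integrable[OF ind Z(2) increment_moments(1)[OF c]]
        indep_var_lebesgue_integral[OF ind Z(2) increment_moments(1)[OF c]]
        indep_var_integrable[OF ind2 Z(2) increment_moments(3)[OF c]]
        indep_var_lebesgue_integral[OF ind2 Z(2) increment_moments(3)[OF c]]
        increment_moments(2,4)[OF c] by simp
  qed simp
  then show "integrable M (\<lambda>\<omega>. Z \<omega> * (B d \<omega> - B c \<omega>))" "expectation (\<lambda>\<omega>. Z \<omega> * (B d \<omega> - B c \<omega>)) = 0"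
    "integrable M (\<lambda>\<omega>. Z \<omega> * (B d \<omega> - B c \<omega>)\<^sup>2)" "expectation (\<lambda>\<omega>. Z \<omega> * (B d \<omega> - B c \<omega>)\<^sup>2) = expectation Z * (d - c)"
    by auto
qed

end

section \<open>Square integrable functions\<close>

definition sq_integrable :: "'a measure \<Rightarrow> ('a \<Rightarrow> real) \<Rightarrow> bool" where
  "sq_integrable N f \<longleftrightarrow> f \<in> borel_measurable N \<and> integrable N (\<lambda>x. (f x)\<^sup>2)"

lemma sq_integrable_measurable: "sq_integrable N f \<Longrightarrow> f \<in> borel_measurable N"
  and sq_integrable_square: "sq_integrable N f \<Longrightarrow> integrable N (\<lambda>x. (f x)\<^sup>2)"
  by (simp_all add: sq_integrable_def)

lemma sq_integrable_mult:
  assumes "sq_integrable N f" "sq_integrable N g" shows "integrable N (\<lambda>x. f x * g x)"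
proof (rule Bochner_Integration.integrable_bound)
  show "integrable N (\<lambda>x. (f x)\<^sup>2 + (g x)\<^sup>2)" using assms by (auto simp: sq_integrable_def)
  show "(\<lambda>x. f x * g x) \<in> borel_measurable N" using assms by (auto simp: sq_integrable_def)
  show "AE x in N. norm (f x * g x) \<le> norm ((f x)\<^sup>2 + (g x)\<^sup>2)"
  proof (rule AE_I2)
    fix x
    have "2 * (\<bar>f x\<bar> * \<bar>g x\<bar>) \<le> \<bar>f x\<bar>\<^sup>2 + \<bar>g x\<bar>\<^sup>2"
      using sum_squares_bound[of "\<bar>f x\<bar>" "\<bar>g x\<bar>"] by simp
    moreover have "0 \<le> \<bar>f x\<bar> * \<bar>g x\<bar>" by simp
    ultimately show "norm (f x * g x) \<le> norm ((f x)\<^sup>2 + (g x)\<^sup>2)"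
      unfolding real_norm_def abs_mult power2_abs by linarith
  qed
qed

lemma sq_integrable_add:
  assumes "sq_integrable N f" "sq_integrable N g" shows "sq_integrable N (\<lambda>x. f x + g x)"
  using assms sq_integrable_mult[OF assms]
  by (auto simp: sq_integrable_def power2_sum mult.assoc intro!: Bochner_Integration.integrable_add)

lemma sq_integrable_cmult: "sq_integrable N f \<Longrightarrow> sq_integrable N (\<lambda>x. c * f x)"
  by (auto simp: sq_integrable_def power_mult_distrib)

lemma sq_integrable_diff:
  assumes "sq_integrable N f" "sq_integrable N g" shows "sq_integrable N (\<lambda>x. f x - g x)"
  using sq_integrable_add[OF assms(1) sq_integrable_cmult[OF assms(2), of "-1"]] by simp

lemma sq_integrable_bounded:
  assumes "sq_integrable N f" "g \<in> borel_measurable N" "AE x in N. \<bar>g x\<bar> \<le> 1"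
  shows "sq_integrable N (\<lambda>x. g x * f x)"
  unfolding sq_integrable_def
proof
  show m: "(\<lambda>x. g x * f x) \<in> borel_measurable N" using assms by (auto simp: sq_integrable_def)
  show "integrable N (\<lambda>x. (g x * f x)\<^sup>2)"
  proof (rule Bochner_Integration.integrable_bound[OF sq_integrable_square[OF assms(1)]])
    show "AE x in N. norm ((g x * f x)\<^sup>2) \<le> norm ((f x)\<^sup>2)"
      using assms(3)
    proof eventually_elim
      case (elim x)
      then have "(g x)\<^sup>2 \<le> 1" by (simp add: abs_square_le_1)
      then have "(g x)\<^sup>2 * (f x)\<^sup>2 \<le> 1 * (f x)\<^sup>2" by (rule mult_right_mono) simp
      then show ?case by (simp add: power_mult_distrib)
    qed
  qed (use m in auto)
qed

lemma sq_integrable_imp_integrable: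
  assumes "finite_measure N" "sq_integrable N f" shows "integrable N f"
proof -
  interpret finite_measure N by fact
  have "sq_integrable N (\<lambda>_. 1)" by (simp add: sq_integrable_def)
  from sq_integrable_mult[OF assms(2) this] show ?thesis by simp
qed

text \<open>Expand the nonnegative integral of (c f - a g)^2 with a = |f|^2 and c = <f, g>; if a = 0
  then f vanishes almost everywhere.\<close>

lemma L2_Cauchy_Schwarz:
  assumes "sq_integrable N f" "sq_integrable N g"
  shows "(\<integral>x. f x * g x \<partial>N)\<^sup>2 \<le> (\<integral>x. (f x)\<^sup>2 \<partial>N) * (\<integral>x. (g x)\<^sup>2 \<partial>N)"
proof (cases "(\<integral>x. (f x)\<^sup>2 \<partial>N) = 0")
  case True
  then have "AE x in N. (f x)\<^sup>2 = 0"
    using integral_nonneg_eq_0_iff_AE[OF sq_integrable_square[OF assms(1)]] by simp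
  then have "(\<integral>x. f x * g x \<partial>N) = 0" by (intro integral_eq_zero_AE) auto
  then show ?thesis by (simp add: True)
next
  case False
  define a b c where "a = (\<integral>x. (f x)\<^sup>2 \<partial>N)" and "b = (\<integral>x. (g x)\<^sup>2 \<partial>N)" and "c = (\<integral>x. f x * g x \<partial>N)"
  have "0 \<le> a" unfolding a_def by (rule integral_nonneg_AE) simp
  with False have a: "0 < a" unfolding a_def by linarith
  note i = sq_integrable_square[OF assms(1)] sq_integrable_square[OF assms(2)] sq_integrable_mult[OF assms]
  have "0 \<le> (\<integral>x. (c * f x - a * g x)\<^sup>2 \<partial>N)" by (rule integral_nonneg_AE) simp
  also have "(\<integral>x. (c * f x - a * g x)\<^sup>2 \<partial>N) = (\<integral>x. c\<^sup>2 * (f x)\<^sup>2 + a\<^sup>2 * (g x)\<^sup>2 - 2 * c * a * (f x * g x) \<partial>N)"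
    by (intro Bochner_Integration.integral_cong) (auto simp: power2_eq_square algebra_simps)
  also have "\<dots> = c\<^sup>2 * a + a\<^sup>2 * b - 2 * c * a * c"
    using i by (simp add: a_def b_def c_def)
  also have "\<dots> = a * (a * b - c\<^sup>2)" by (simp add: power2_eq_square algebra_simps)
  finally have "0 \<le> a * b - c\<^sup>2" using a by (simp add: zero_le_mult_iff)
  then show ?thesis by (simp add: a_def b_def c_def)
qed

text \<open>A norm that converges against a norm that vanishes; each cross term in the continuity of
  the inner product has this form.\<close>

lemma L2_small_product:
  assumes f: "\<And>m. sq_integrable N (f m)" and g: "\<And>m. sq_integrable N (g m)"
    and f0: "(\<lambda>m. \<integral>x. (f m x)\<^sup>2 \<partial>N) \<longlonglongrightarrow> a" and g0: "(\<lambda>m. \<integral>x. (g m x)\<^sup>2 \<partial>N) \<longlonglongrightarrow> 0"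
  shows "(\<lambda>m. \<integral>x. f m x * g m x \<partial>N) \<longlonglongrightarrow> 0"
proof -
  have "(\<lambda>m. (\<integral>x. (f m x)\<^sup>2 \<partial>N) * (\<integral>x. (g m x)\<^sup>2 \<partial>N)) \<longlonglongrightarrow> a * 0"
    by (intro tendsto_mult f0 g0)
  then have lim: "(\<lambda>m. (\<integral>x. (f m x)\<^sup>2 \<partial>N) * (\<integral>x. (g m x)\<^sup>2 \<partial>N)) \<longlonglongrightarrow> 0" by simp
  have "(\<lambda>m. (\<integral>x. f m x * g m x \<partial>N)\<^sup>2) \<longlonglongrightarrow> 0"
    by (rule tendsto_sandwich[OF _ _ tendsto_const lim]) (use L2_Cauchy_Schwarz[OF f g] in auto)
  then have "(\<lambda>m. sqrt ((\<integral>x. f m x * g m x \<partial>N)\<^sup>2)) \<longlonglongrightarrow> sqrt 0" by (rule tendsto_real_sqrt)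
  then show ?thesis by (simp add: tendsto_rabs_zero_iff)
qed

lemma L2_product_tendsto:
  assumes "\<And>m. sq_integrable N (f m)" "\<And>m. sq_integrable N (g m)" "sq_integrable N f'" "sq_integrable N g'"
    and f0: "(\<lambda>m. \<integral>x. (f m x - f' x)\<^sup>2 \<partial>N) \<longlonglongrightarrow> 0" and g0: "(\<lambda>m. \<integral>x. (g m x - g' x)\<^sup>2 \<partial>N) \<longlonglongrightarrow> 0"
  shows "(\<lambda>m. \<integral>x. f m x * g m x \<partial>N) \<longlonglongrightarrow> (\<integral>x. f' x * g' x \<partial>N)"
proof -
  let ?df = "\<lambda>m x. f m x - f' x" and ?dg = "\<lambda>m x. g m x - g' x"
  have d: "sq_integrable N (?df m)" "sq_integrable N (?dg m)" for m
    using assms by (auto intro: sq_integrable_diff)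
  have "(\<integral>x. f m x * g m x \<partial>N) = (\<integral>x. ?df m x * ?dg m x \<partial>N) + (\<integral>x. f' x * ?dg m x \<partial>N)
      + (\<integral>x. g' x * ?df m x \<partial>N) + (\<integral>x. f' x * g' x \<partial>N)" for m
  proof -
    have "(\<integral>x. f m x * g m x \<partial>N) = (\<integral>x. ?df m x * ?dg m x + f' x * ?dg m x + g' x * ?df m x + f' x * g' x \<partial>N)"
      by (intro Bochner_Integration.integral_cong) (auto simp: algebra_simps)
    also have "\<dots> = (\<integral>x. ?df m x * ?dg m x \<partial>N) + (\<integral>x. f' x * ?dg m x \<partial>N)
      + (\<integral>x. g' x * ?df m x \<partial>N) + (\<integral>x. f' x * g' x \<partial>N)"
      using sq_integrable_mult[OF d(1)[of m] d(2)[of m]] sq_integrable_mult[OF assms(3) d(2)[of m]]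
        sq_integrable_mult[OF assms(4) d(1)[of m]] sq_integrable_mult[OF assms(3,4)]
      by simp
    finally show ?thesis .
  qed
  moreover have "(\<lambda>m. (\<integral>x. ?df m x * ?dg m x \<partial>N) + (\<integral>x. f' x * ?dg m x \<partial>N)
      + (\<integral>x. g' x * ?df m x \<partial>N) + (\<integral>x. f' x * g' x \<partial>N)) \<longlonglongrightarrow> 0 + 0 + 0 + (\<integral>x. f' x * g' x \<partial>N)"
    by (intro tendsto_add tendsto_const L2_small_product[OF d f0 g0] L2_small_product[OF assms(3) d(2) tendsto_const g0]
      L2_small_product[OF assms(4) d(1) tendsto_const f0])
  ultimately show ?thesis by simp
qed

lemma L2_limit_of_nn_integral:
  assumes f: "\<And>m. sq_integrable N (f m)" and f': "f' \<in> borel_measurable N"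
    and lim: "(\<lambda>m. \<integral>\<^sup>+x. ennreal ((f m x - f' x)\<^sup>2) \<partial>N) \<longlonglongrightarrow> 0"
  shows "sq_integrable N f'" "(\<lambda>m. \<integral>x. (f m x - f' x)\<^sup>2 \<partial>N) \<longlonglongrightarrow> 0"
proof -
  have m: "(\<lambda>x. f m x - f' x) \<in> borel_measurable N" for m
    using f[of m] f' by (auto simp: sq_integrable_def)
  have "eventually (\<lambda>m. (\<integral>\<^sup>+x. ennreal ((f m x - f' x)\<^sup>2) \<partial>N) < 1) sequentially"
    using lim by (rule order_tendstoD) simp
  then obtain m where "(\<integral>\<^sup>+x. ennreal ((f m x - f' x)\<^sup>2) \<partial>N) < 1"
    by (auto simp: eventually_sequentially)
  then have "integrable N (\<lambda>x. (f m x - f' x)\<^sup>2)"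
    using m[of m] by (intro integrableI_nonneg) (auto intro: less_trans)
  then have "sq_integrable N (\<lambda>x. f m x - f' x)" using m by (simp add: sq_integrable_def)
  from sq_integrable_diff[OF f[of m] this] show f'2: "sq_integrable N f'" by simp
  have "(\<integral>x. (f m x - f' x)\<^sup>2 \<partial>N) = enn2real (\<integral>\<^sup>+x. ennreal ((f m x - f' x)\<^sup>2) \<partial>N)" for m
    using m by (intro integral_eq_nn_integral) auto
  then show "(\<lambda>m. \<integral>x. (f m x - f' x)\<^sup>2 \<partial>N) \<longlonglongrightarrow> 0"
    using tendsto_enn2real[of "\<lambda>m. \<integral>\<^sup>+x. ennreal ((f m x - f' x)\<^sup>2) \<partial>N" 0] lim by simp
qed

text \<open>Restricting Lebesgue measure to [0,T] gives a finite measure, so square integrability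
  implies integrability and Fubini applies to the product with the probability space.\<close>

abbreviation time_measure :: "real \<Rightarrow> real measure" where
  "time_measure T \<equiv> restrict_space lborel {0..T}"

lemma finite_time_measure: "finite_measure (time_measure T)"
  by (rule finite_measureI) (simp add: emeasure_restrict_space emeasure_lborel_Icc_eq space_restrict_space)

lemma space_time_measure [simp]: "space (time_measure T) = {0..T}"
  by (simp add: space_restrict_space)

lemma set_lebesgue_integral_time_measure:
  fixes f :: "real \<Rightarrow> real"
  assumes "t \<le> T"
  shows "(LINT r:{0..t}|lborel. f r) = (\<integral>r. indicator {0..t} r * f r \<partial>time_measure T)"
  unfolding set_lebesgue_integral_def
  by (subst integral_restrict_space)
     (use assms in \<open>auto intro!: Bochner_Integration.integral_cong simp: indicator_def\<close>)

lemma indicator_interval_measurable [measurable]: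
  "(\<lambda>(s, r). indicator {0..r} s :: real) \<in> borel_measurable (time_measure T \<Otimes>\<^sub>M time_measure T)"
  "(\<lambda>(r, s). indicator {0..r} s :: real) \<in> borel_measurable (time_measure T \<Otimes>\<^sub>M time_measure T)"
proof -
  have [measurable]: "(\<lambda>x. x) \<in> borel_measurable (time_measure T)"
    by (simp add: measurable_restrict_space1)
  show "(\<lambda>(s, r). indicator {0..r} s :: real) \<in> borel_measurable (time_measure T \<Otimes>\<^sub>M time_measure T)"
    unfolding indicator_def atLeastAtMost_iff by measurable
  show "(\<lambda>(r, s). indicator {0..r} s :: real) \<in> borel_measurable (time_measure T \<Otimes>\<^sub>M time_measure T)"
    unfolding indicator_def atLeastAtMost_iff by measurable
qed

lemma indicator_time_measurable [measurable]:
  "(indicator {0..t} :: real \<Rightarrow> real) \<in> borel_measurable (time_measure T)"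
  by (intro measurable_restrict_space1) simp

lemma AE_time_measure_neq: "AE s in time_measure T. s \<noteq> r"
proof -
  have "AE s in lborel. s \<noteq> r" by (rule AE_lborel_singleton)
  then show ?thesis by (subst AE_restrict_space_iff) auto
qed

text \<open>Integration by parts without differentiability: the product of the integrals is a double
  integral over the square [0,t]^2, split along its diagonal.\<close>

lemma indefinite_integral_product:
  fixes u v :: "real \<Rightarrow> real"
  assumes u: "integrable (time_measure T) u" and v: "integrable (time_measure T) v" and t: "t \<le> T"
  shows "(\<integral>s. indicator {0..t} s * u s \<partial>time_measure T) * (\<integral>s. indicator {0..t} s * v s \<partial>time_measure T) =
    (\<integral>s. indicator {0..t} s * (u s * (\<integral>r. indicator {0..s} r * v r \<partial>time_measure T)) \<partial>time_measure T)
    + (\<integral>s. indicator {0..t} s * ((\<integral>r. indicator {0..s} r * u r \<partial>time_measure T) * v s) \<partial>time_measure T)"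
    (is "?U * ?V = ?R1 + ?R2")
  and "integrable (time_measure T) (\<lambda>s. indicator {0..t} s * (u s * (\<integral>r. indicator {0..s} r * v r \<partial>time_measure T)))"
    (is ?I1)
  and "integrable (time_measure T) (\<lambda>s. indicator {0..t} s * ((\<integral>r. indicator {0..s} r * u r \<partial>time_measure T) * v s))"
    (is ?I2)
proof -
  let ?L = "time_measure T"
  interpret L: finite_measure ?L by (rule finite_time_measure)
  interpret LL: pair_sigma_finite ?L ?L ..
  have [measurable]: "u \<in> borel_measurable ?L" "v \<in> borel_measurable ?L"
    using u v by auto
  define p where "p = (\<lambda>(s, r). (indicator {0..t} s * u s) * (indicator {0..t} r * v r))"
  have iu: "integrable ?L (\<lambda>s. indicator {0..t} s * u s)"
    by (rule Bochner_Integration.integrable_bound[OF u]) (measurable, simp add: indicator_def)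
  have iv: "integrable ?L (\<lambda>s. indicator {0..t} s * v s)"
    by (rule Bochner_Integration.integrable_bound[OF v]) (measurable, simp add: indicator_def)
  have p: "integrable (?L \<Otimes>\<^sub>M ?L) p"
  proof (rule LL.Fubini_integrable)
    show "p \<in> borel_measurable (?L \<Otimes>\<^sub>M ?L)" unfolding p_def by measurable
    show "integrable ?L (\<lambda>x. \<integral>y. norm (p (x, y)) \<partial>?L)"
      using Bochner_Integration.integrable_abs[OF iu] by (simp add: p_def abs_mult)
    show "AE x in ?L. integrable ?L (\<lambda>y. p (x, y))"
      using iv by (simp add: p_def)
  qed
  define a where "a = (\<lambda>(s, r). indicator {0..s} r * p (s, r))"
  define b where "b = (\<lambda>(s, r). (1 - indicator {0..s} r) * p (s, r))"
  have ma: "a \<in> borel_measurable (?L \<Otimes>\<^sub>M ?L)" and mb: "b \<in> borel_measurable (?L \<Otimes>\<^sub>M ?L)"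
    unfolding a_def b_def p_def by measurable
  have ia: "integrable (?L \<Otimes>\<^sub>M ?L) a" and ib: "integrable (?L \<Otimes>\<^sub>M ?L) b"
    by (auto intro!: Bochner_Integration.integrable_bound[OF p] ma mb) (auto simp: a_def b_def indicator_def split_beta)
  have "?U * ?V = (\<integral>x. p x \<partial>(?L \<Otimes>\<^sub>M ?L))"
    using LL.integral_fst'[of p] p by (simp add: p_def mult.commute)
  also have "\<dots> = (\<integral>x. a x + b x \<partial>(?L \<Otimes>\<^sub>M ?L))"
    by (intro Bochner_Integration.integral_cong) (auto simp: a_def b_def algebra_simps)
  also have "\<dots> = (\<integral>x. a x \<partial>(?L \<Otimes>\<^sub>M ?L)) + (\<integral>x. b x \<partial>(?L \<Otimes>\<^sub>M ?L))"
    using ia ib by simp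
  finally have 1: "?U * ?V = (\<integral>x. a x \<partial>(?L \<Otimes>\<^sub>M ?L)) + (\<integral>x. b x \<partial>(?L \<Otimes>\<^sub>M ?L))" .
  have a': "(\<integral>r. a (s, r) \<partial>?L) = indicator {0..t} s * (u s * (\<integral>r. indicator {0..s} r * v r \<partial>?L))" for s
  proof -
    have "(\<integral>r. a (s, r) \<partial>?L) = (\<integral>r. (indicator {0..t} s * u s) * (indicator {0..s} r * v r) \<partial>?L)"
      by (intro Bochner_Integration.integral_cong) (auto simp: a_def p_def indicator_def)
    then show ?thesis by (simp add: mult.assoc)
  qed
  have b': "(\<integral>s. b (s, r) \<partial>?L) = indicator {0..t} r * ((\<integral>s. indicator {0..r} s * u s \<partial>?L) * v r)" if "r \<in> {0..T}" for r
  proof -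
    have "(\<integral>s. b (s, r) \<partial>?L) = (\<integral>s. (indicator {0..t} r * v r) * (indicator {0..r} s * u s) \<partial>?L)"
    proof (rule integral_cong_AE)
      \<comment> \<open>The triangles are r \<le> s and r > s, whereas the formula has s \<le> r;
        they differ only at s = r, a null set.\<close>
      show "(\<lambda>s. b (s, r)) \<in> borel_measurable ?L"
        using mb that by (intro measurable_Pair2'[THEN measurable_compose] measurable_compose[OF measurable_Pair1']) auto
      show "AE s in ?L. b (s, r) = indicator {0..t} r * v r * (indicator {0..r} s * u s)"
        using AE_time_measure_neq[of r T] AE_space
        by eventually_elim (use that in \<open>auto simp: b_def p_def indicator_def\<close>)
    qed measurable
    also have "\<dots> = (indicator {0..t} r * v r) * (\<integral>s. indicator {0..r} s * u s \<partial>?L)"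
      by (rule integral_mult_right_zero)
    finally show ?thesis by (simp only: mult_ac)
  qed
  have R1: "(\<integral>x. a x \<partial>(?L \<Otimes>\<^sub>M ?L)) = ?R1"
    using LL.integral_fst'[OF ia] by (simp add: a')
  have R2: "(\<integral>x. b x \<partial>(?L \<Otimes>\<^sub>M ?L)) = ?R2"
  proof -
    have "(\<integral>x. b x \<partial>(?L \<Otimes>\<^sub>M ?L)) = (\<integral>r. (\<integral>s. b (s, r) \<partial>?L) \<partial>?L)"
      using LL.integral_snd[of "\<lambda>s r. b (s, r)"] ib by simp
    also have "\<dots> = ?R2" by (intro Bochner_Integration.integral_cong) (auto simp: b')
    finally show ?thesis .
  qed
  show "?U * ?V = ?R1 + ?R2" using 1 R1 R2 by simp
  show ?I1 using LL.integrable_fst'[OF ia] by (simp add: a')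
  have "integrable ?L (\<lambda>r. \<integral>s. b (s, r) \<partial>?L)"
    using LL.integrable_snd[of "\<lambda>s r. b (s, r)"] ib by simp
  then show ?I2 by (rule Bochner_Integration.integrable_cong[THEN iffD1, rotated -1]) (auto simp: b')
qed

section \<open>Ito integral\<close>

lemma integral_time_intervals:
  assumes "0 \<le> \<tau>" "0 \<le> \<sigma>" "t \<le> T"
  shows "integrable (time_measure T) (\<lambda>s. indicator {0..t} s * (indicator {\<tau><..\<tau>'} s * indicator {\<sigma><..\<sigma>'} s :: real))"
    "(\<integral>s. indicator {0..t} s * (indicator {\<tau><..\<tau>'} s * indicator {\<sigma><..\<sigma>'} s :: real) \<partial>time_measure T)
       = max 0 (min t (min \<tau>' \<sigma>') - max \<tau> \<sigma>)"
proof -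
  let ?I = "{max \<tau> \<sigma><..min t (min \<tau>' \<sigma>')}"
  interpret L: finite_measure "time_measure T" by (rule finite_time_measure)
  have eq: "(\<lambda>s. indicator {0..t} s * (indicator {\<tau><..\<tau>'} s * indicator {\<sigma><..\<sigma>'} s :: real)) = indicator ?I"
    using assms by (auto simp: indicator_def fun_eq_iff)
  have sub: "?I \<subseteq> {0..T}" using assms by auto
  have s: "?I \<in> sets (time_measure T)" using sub by (simp add: sets_restrict_space_iff)
  show "integrable (time_measure T) (\<lambda>s. indicator {0..t} s * (indicator {\<tau><..\<tau>'} s * indicator {\<sigma><..\<sigma>'} s :: real))"
    unfolding eq using s L.emeasure_finite by (intro integrable_real_indicator) (simp_all add: top.not_eq_extremum[symmetric])
  have "measure (time_measure T) ?I = measure lborel ?I"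
    using sub by (simp add: measure_restrict_space)
  also have "\<dots> = max 0 (min t (min \<tau>' \<sigma>') - max \<tau> \<sigma>)"
    by (cases "max \<tau> \<sigma> \<le> min t (min \<tau>' \<sigma>')") (auto simp: measure_def emeasure_lborel_Ioc simp del: max_less_iff_conj)
  finally show "(\<integral>s. indicator {0..t} s * (indicator {\<tau><..\<tau>'} s * indicator {\<sigma><..\<sigma>'} s :: real) \<partial>time_measure T)
       = max 0 (min t (min \<tau>' \<sigma>') - max \<tau> \<sigma>)"
    unfolding eq using s sub by (simp add: Int_absorb2)
qed

lemma (in pair_sigma_finite) integral_product_measure:
  fixes u :: "'a \<Rightarrow> real" and y :: "'b \<Rightarrow> real"
  assumes u: "integrable M1 u" and y: "integrable M2 y"
  shows "integrable (M1 \<Otimes>\<^sub>M M2) (\<lambda>(s, \<omega>). u s * y \<omega>)"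
    "(\<integral>(s, \<omega>). u s * y \<omega> \<partial>(M1 \<Otimes>\<^sub>M M2)) = (\<integral>s. u s \<partial>M1) * (\<integral>\<omega>. y \<omega> \<partial>M2)"
proof -
  have [measurable]: "u \<in> borel_measurable M1" "y \<in> borel_measurable M2" using u y by auto
  show i: "integrable (M1 \<Otimes>\<^sub>M M2) (\<lambda>(s, \<omega>). u s * y \<omega>)"
  proof (rule Fubini_integrable)
    show "integrable M1 (\<lambda>x. \<integral>\<omega>. norm (case (x, \<omega>) of (s, \<omega>) \<Rightarrow> u s * y \<omega>) \<partial>M2)"
      using Bochner_Integration.integrable_abs[OF u] by (simp add: abs_mult)
  qed (use y in \<open>simp_all, measurable\<close>)
  show "(\<integral>(s, \<omega>). u s * y \<omega> \<partial>(M1 \<Otimes>\<^sub>M M2)) = (\<integral>s. u s \<partial>M1) * (\<integral>\<omega>. y \<omega> \<partial>M2)"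
    using integral_fst'[OF i] by (simp add: mult.commute)
qed

section \<open>Isometry and orthogonality for simple integrands\<close>

context standard_brownian_motion
begin

abbreviation PT where "PT T \<equiv> time_measure T \<Otimes>\<^sub>M M"

lemma pair_PT: "pair_sigma_finite (time_measure T) M"
proof -
  interpret L: finite_measure "time_measure T" by (rule finite_time_measure)
  show ?thesis ..
qed

lemma integrable_mult_bounded:
  fixes Z Y :: "'a \<Rightarrow> real"
  assumes Z: "Z \<in> borel_measurable M" "bounded (Z ` space M)" and Y: "integrable M Y"
  shows "integrable M (\<lambda>\<omega>. Z \<omega> * Y \<omega>)"
proof -
  obtain C where C: "\<And>\<omega>. \<omega> \<in> space M \<Longrightarrow> \<bar>Z \<omega>\<bar> \<le> C"
    using Z(2) by (auto simp: bounded_iff)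
  show ?thesis
  proof (rule Bochner_Integration.integrable_bound)
    show "integrable M (\<lambda>\<omega>. C * \<bar>Y \<omega>\<bar>)" using Y by simp
    show "AE \<omega> in M. norm (Z \<omega> * Y \<omega>) \<le> norm (C * \<bar>Y \<omega>\<bar>)"
    proof (rule AE_I2)
      fix \<omega> assume "\<omega> \<in> space M"
      then have "\<bar>Z \<omega>\<bar> \<le> \<bar>C\<bar>" using C by fastforce
      then show "norm (Z \<omega> * Y \<omega>) \<le> norm (C * \<bar>Y \<omega>\<bar>)"
        by (simp add: abs_mult mult_right_mono)
    qed
  qed (use Z Y in auto)
qed

lemma bounded_mult_image:
  fixes Z Y :: "'a \<Rightarrow> real"
  assumes "bounded (Z ` space M)" "bounded (Y ` space M)"
  shows "bounded ((\<lambda>\<omega>. Z \<omega> * Y \<omega>) ` space M)"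
proof -
  obtain C D where "\<And>\<omega>. \<omega> \<in> space M \<Longrightarrow> \<bar>Z \<omega>\<bar> \<le> C" "\<And>\<omega>. \<omega> \<in> space M \<Longrightarrow> \<bar>Y \<omega>\<bar> \<le> D"
    using assms by (auto simp: bounded_iff)
  then have "\<bar>Z \<omega> * Y \<omega>\<bar> \<le> C * D" if "\<omega> \<in> space M" for \<omega>
    unfolding abs_mult using that by (intro mult_mono) (auto intro: order_trans[OF abs_ge_zero])
  then show ?thesis by (auto simp: bounded_iff)
qed

lemma bounded_integrable:
  fixes Z :: "'a \<Rightarrow> real"
  assumes "Z \<in> borel_measurable M" "bounded (Z ` space M)" shows "integrable M Z"
  using integrable_mult_bounded[OF assms, of "\<lambda>_. 1"] by simp

text \<open>The overlap of the two time intervals is cut out. The piece of the first increment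
  before c is known at time c and meets an increment of mean zero; pieces over disjoint intervals
  also have mean zero; the square over the overlap gives its length.\<close>

lemma increment_product:
  fixes Z :: "'a \<Rightarrow> real"
  assumes ord: "0 \<le> a" "a \<le> b" "a \<le> c" "c \<le> d" and Z: "Z \<in> borel_measurable (F c)" "bounded (Z ` space M)"
  shows "integrable M (\<lambda>\<omega>. Z \<omega> * ((B b \<omega> - B a \<omega>) * (B d \<omega> - B c \<omega>)))"
   "expectation (\<lambda>\<omega>. Z \<omega> * ((B b \<omega> - B a \<omega>) * (B d \<omega> - B c \<omega>))) = expectation Z * max 0 (min b d - c)"
proof -
  have iZ: "integrable M Z" using Z measurable_F_M bounded_integrable by blast
  have incr: "(\<lambda>\<omega>. Z \<omega> * (B y \<omega> - B x \<omega>)) \<in> borel_measurable (F (max c y))"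
      "integrable M (\<lambda>\<omega>. Z \<omega> * (B y \<omega> - B x \<omega>))" if "0 \<le> x" "x \<le> y" for x y
  proof -
    show "(\<lambda>\<omega>. Z \<omega> * (B y \<omega> - B x \<omega>)) \<in> borel_measurable (F (max c y))"
      using that ord by (intro borel_measurable_times borel_measurable_diff B_measurable_F measurable_F_mono[OF Z(1)]) auto
    show "integrable M (\<lambda>\<omega>. Z \<omega> * (B y \<omega> - B x \<omega>))"
      using increment_moments(1)[OF that] measurable_F_M[OF Z(1)] Z(2) by (intro integrable_mult_bounded)
  qed
  have "integrable M (\<lambda>\<omega>. Z \<omega> * ((B b \<omega> - B a \<omega>) * (B d \<omega> - B c \<omega>))) \<and>
   expectation (\<lambda>\<omega>. Z \<omega> * ((B b \<omega> - B a \<omega>) * (B d \<omega> - B c \<omega>))) = expectation Z * max 0 (min b d - c)"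
  proof (cases "b \<le> c")
    case True
    then have "(\<lambda>\<omega>. Z \<omega> * (B b \<omega> - B a \<omega>)) \<in> borel_measurable (F c)"
      using incr(1)[OF ord(1,2)] by (simp add: max_def)
    from expectation_times_increment(1,2)[OF _ ord(4) this incr(2)[OF ord(1,2)]] True ord
    show ?thesis by (simp add: mult.assoc)
  next
    case False
    then have cb: "c \<le> b" by simp
    have c0: "0 \<le> c" using ord by simp
    have "(\<lambda>\<omega>. Z \<omega> * (B c \<omega> - B a \<omega>)) \<in> borel_measurable (F c)"
      using incr(1)[OF ord(1,3)] by simp
    note 1 = expectation_times_increment(1,2)[OF c0 ord(4) this incr(2)[OF ord(1,3)]]
    show ?thesis
    proof (cases "b \<le> d")
      case True
      note 2 = expectation_times_increment(3,4)[OF c0 cb Z(1) iZ]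
      have b0: "0 \<le> b" using c0 cb by simp
      have "(\<lambda>\<omega>. Z \<omega> * (B b \<omega> - B c \<omega>)) \<in> borel_measurable (F b)"
        using incr(1)[OF c0 cb] cb by (simp add: max_def)
      note 3 = expectation_times_increment(1,2)[OF b0 True this incr(2)[OF c0 cb]]
      have eq: "(\<lambda>\<omega>. Z \<omega> * ((B b \<omega> - B a \<omega>) * (B d \<omega> - B c \<omega>))) =
        (\<lambda>\<omega>. Z \<omega> * (B c \<omega> - B a \<omega>) * (B d \<omega> - B c \<omega>) + Z \<omega> * (B b \<omega> - B c \<omega>)\<^sup>2
           + Z \<omega> * (B b \<omega> - B c \<omega>) * (B d \<omega> - B b \<omega>))"
        by (simp add: fun_eq_iff power2_eq_square algebra_simps)
      show ?thesis unfolding eq using 1 2 3 True cb by (simp add: max_def)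
    next
      case False
      then have db: "d \<le> b" by simp
      note 2 = expectation_times_increment(3,4)[OF c0 ord(4) Z(1) iZ]
      have d0: "0 \<le> d" using c0 ord by simp
      have "(\<lambda>\<omega>. Z \<omega> * (B d \<omega> - B c \<omega>)) \<in> borel_measurable (F d)"
        using incr(1)[OF c0 ord(4)] ord(4) by (simp add: max_def)
      note 3 = expectation_times_increment(1,2)[OF d0 db this incr(2)[OF c0 ord(4)]]
      have eq: "(\<lambda>\<omega>. Z \<omega> * ((B b \<omega> - B a \<omega>) * (B d \<omega> - B c \<omega>))) =
        (\<lambda>\<omega>. Z \<omega> * (B c \<omega> - B a \<omega>) * (B d \<omega> - B c \<omega>) + Z \<omega> * (B d \<omega> - B c \<omega>)\<^sup>2
           + Z \<omega> * (B d \<omega> - B c \<omega>) * (B b \<omega> - B d \<omega>))"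
        by (simp add: fun_eq_iff power2_eq_square algebra_simps)
      show ?thesis unfolding eq using 1 2 3 db ord by (simp add: max_def min_def)
    qed
  qed
  then show "integrable M (\<lambda>\<omega>. Z \<omega> * ((B b \<omega> - B a \<omega>) * (B d \<omega> - B c \<omega>)))"
   "expectation (\<lambda>\<omega>. Z \<omega> * ((B b \<omega> - B a \<omega>) * (B d \<omega> - B c \<omega>))) = expectation Z * max 0 (min b d - c)"
    by auto
qed

text \<open>The covariance of one summand from each of two simple integrals stopped at t. The later
  of the two starting times takes the role of c, since both coefficients are known then.\<close>

lemma stopped_increment_product:
  fixes \<xi> \<eta> :: "'a \<Rightarrow> real"
  assumes ord: "0 \<le> \<tau>" "\<tau> \<le> \<tau>'" "0 \<le> \<sigma>" "\<sigma> \<le> \<sigma>'" "0 \<le> t"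
    and xi: "\<xi> \<in> borel_measurable (F \<tau>)" "bounded (\<xi> ` space M)"
    and eta: "\<eta> \<in> borel_measurable (F \<sigma>)" "bounded (\<eta> ` space M)"
  defines "I \<equiv> \<lambda>\<omega>. (\<xi> \<omega> * (B (min t \<tau>') \<omega> - B (min t \<tau>) \<omega>)) * (\<eta> \<omega> * (B (min t \<sigma>') \<omega> - B (min t \<sigma>) \<omega>))"
  shows "integrable M I" "expectation I = expectation (\<lambda>\<omega>. \<xi> \<omega> * \<eta> \<omega>) * max 0 (min t (min \<tau>' \<sigma>') - max \<tau> \<sigma>)"
proof -
  have "integrable M I \<and> expectation I = expectation (\<lambda>\<omega>. \<xi> \<omega> * \<eta> \<omega>) * max 0 (min t (min \<tau>' \<sigma>') - max \<tau> \<sigma>)"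
  proof (cases "t \<le> \<tau> \<or> t \<le> \<sigma>")
    case True
    then have "I = (\<lambda>_. 0)" using ord by (auto simp: I_def fun_eq_iff min_def)
    moreover have "max 0 (min t (min \<tau>' \<sigma>') - max \<tau> \<sigma>) = 0" using True by auto
    ultimately show ?thesis by simp
  next
    case False
    define \<zeta> where "\<zeta> \<omega> = \<xi> \<omega> * \<eta> \<omega>" for \<omega>
    have zz: "\<zeta> = (\<lambda>\<omega>. \<xi> \<omega> * \<eta> \<omega>)" by (simp add: \<zeta>_def fun_eq_iff)
    have b: "bounded (\<zeta> ` space M)" unfolding \<zeta>_def using xi eta by (intro bounded_mult_image)
    have m: "\<zeta> \<in> borel_measurable (F u)" if "\<tau> \<le> u" "\<sigma> \<le> u" for u
      unfolding \<zeta>_def using that by (intro borel_measurable_times measurable_F_mono[OF xi(1)] measurable_F_mono[OF eta(1)])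
    have mins: "min t \<tau> = \<tau>" "min t \<sigma> = \<sigma>" using False by auto
    show ?thesis
    proof (cases "\<tau> \<le> \<sigma>")
      case True
      have eq: "I = (\<lambda>\<omega>. \<zeta> \<omega> * ((B (min t \<tau>') \<omega> - B \<tau> \<omega>) * (B (min t \<sigma>') \<omega> - B \<sigma> \<omega>)))"
        by (simp add: I_def \<zeta>_def mins fun_eq_iff)
      have mn: "min (min t \<tau>') (min t \<sigma>') = min t (min \<tau>' \<sigma>')" "max \<tau> \<sigma> = \<sigma>" using True by auto
      have le: "\<tau> \<le> min t \<tau>'" "\<sigma> \<le> min t \<sigma>'" using ord False by auto
      show ?thesis
        using increment_product[OF ord(1) le(1) True le(2) m[OF True order_refl] b]
        unfolding eq mn zz by simp
    next
      case F: False
      have eq: "I = (\<lambda>\<omega>. \<zeta> \<omega> * ((B (min t \<sigma>') \<omega> - B \<sigma> \<omega>) * (B (min t \<tau>') \<omega> - B \<tau> \<omega>)))"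
        by (simp add: I_def \<zeta>_def mins fun_eq_iff)
      have mn: "min (min t \<sigma>') (min t \<tau>') = min t (min \<tau>' \<sigma>')" "max \<tau> \<sigma> = \<tau>" using F by auto
      have le: "\<tau> \<le> min t \<tau>'" "\<sigma> \<le> min t \<sigma>'" "\<sigma> \<le> \<tau>" using ord False F by auto
      show ?thesis
        using increment_product[OF ord(3) le(2,3,1) m[OF order_refl le(3)] b]
        unfolding eq mn zz by simp
    qed
  qed
  then show "integrable M I" "expectation I = expectation (\<lambda>\<omega>. \<xi> \<omega> * \<eta> \<omega>) * max 0 (min t (min \<tau>' \<sigma>') - max \<tau> \<sigma>)"
    by auto
qed

lemma simple_adapted_times:
  assumes "simple_adapted M B T n \<tau> \<xi>" "k \<le> n" shows "0 \<le> \<tau> k"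
  using assms(2)
proof (induction k)
  case 0 then show ?case using assms(1) by (simp add: simple_adapted_def)
next
  case (Suc k)
  then have "0 \<le> \<tau> k" "\<tau> k \<le> \<tau> (Suc k)" using assms(1) by (auto simp: simple_adapted_def)
  then show ?case by simp
qed

lemma simple_adaptedD:
  assumes "simple_adapted M B T n \<tau> \<xi>" "k < n"
  shows "0 \<le> \<tau> k" "\<tau> k \<le> \<tau> (Suc k)" "\<xi> k \<in> borel_measurable (F (\<tau> k))" "bounded (\<xi> k ` space M)"
    "\<xi> k \<in> borel_measurable M"
  using assms simple_adapted_times[OF assms(1), of k] measurable_F_M by (auto simp: simple_adapted_def)

text \<open>The isometry is stated in polarised form, for two simple processes with unrelated
  partitions. Summand by summand both sides equal the expectation of the product of coefficients
  times the length of the overlap of the two intervals before t.\<close>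

lemma simple_isometry:
  assumes s1: "simple_adapted M B T n \<tau> \<xi>" and s2: "simple_adapted M B T n' \<tau>' \<xi>'" and t: "0 \<le> t" "t \<le> T"
  shows "integrable M (\<lambda>\<omega>. simple_ito B n \<tau> \<xi> t \<omega> * simple_ito B n' \<tau>' \<xi>' t \<omega>)"
    "integrable (PT T) (\<lambda>(s, \<omega>). indicator {0..t} s * (simple_process n \<tau> \<xi> s \<omega> * simple_process n' \<tau>' \<xi>' s \<omega>))"
    "expectation (\<lambda>\<omega>. simple_ito B n \<tau> \<xi> t \<omega> * simple_ito B n' \<tau>' \<xi>' t \<omega>) =
     (\<integral>(s, \<omega>). indicator {0..t} s * (simple_process n \<tau> \<xi> s \<omega> * simple_process n' \<tau>' \<xi>' s \<omega>) \<partial>PT T)"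
proof -
  interpret P: pair_sigma_finite "time_measure T" M by (rule pair_PT)
  define I where "I k l \<omega> = (\<xi> k \<omega> * (B (min t (\<tau> (Suc k))) \<omega> - B (min t (\<tau> k)) \<omega>)) *
     (\<xi>' l \<omega> * (B (min t (\<tau>' (Suc l))) \<omega> - B (min t (\<tau>' l)) \<omega>))" for k l \<omega>
  define u where "u k l s = (indicator {0..t} s * (indicator {\<tau> k<..\<tau> (Suc k)} s * indicator {\<tau>' l<..\<tau>' (Suc l)} s) :: real)" for k l s
  have eq1: "(\<lambda>\<omega>. simple_ito B n \<tau> \<xi> t \<omega> * simple_ito B n' \<tau>' \<xi>' t \<omega>) = (\<lambda>\<omega>. \<Sum>k<n. \<Sum>l<n'. I k l \<omega>)"
    by (simp add: simple_ito_def sum_product I_def)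
  have eq2: "(\<lambda>(s, \<omega>). indicator {0..t} s * (simple_process n \<tau> \<xi> s \<omega> * simple_process n' \<tau>' \<xi>' s \<omega>)) =
     (\<lambda>z. \<Sum>k<n. \<Sum>l<n'. (case z of (s, \<omega>) \<Rightarrow> u k l s * (\<xi> k \<omega> * \<xi>' l \<omega>)))"
  proof (rule ext)
    fix z :: "real \<times> 'a"
    obtain s \<omega> where z: "z = (s, \<omega>)" by (cases z)
    have "simple_process n \<tau> \<xi> s \<omega> * simple_process n' \<tau>' \<xi>' s \<omega> =
      (\<Sum>k<n. \<Sum>l<n'. (\<xi> k \<omega> * indicator {\<tau> k<..\<tau> (Suc k)} s) * (\<xi>' l \<omega> * indicator {\<tau>' l<..\<tau>' (Suc l)} s))"
      by (simp only: simple_process_def sum_product)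
    then show "(case z of (s, \<omega>) \<Rightarrow> indicator {0..t} s * (simple_process n \<tau> \<xi> s \<omega> * simple_process n' \<tau>' \<xi>' s \<omega>)) =
      (\<Sum>k<n. \<Sum>l<n'. (case z of (s, \<omega>) \<Rightarrow> u k l s * (\<xi> k \<omega> * \<xi>' l \<omega>)))"
      by (simp add: z sum_distrib_left u_def mult_ac)
  qed
  have I: "integrable M (I k l)" "expectation (I k l) = expectation (\<lambda>\<omega>. \<xi> k \<omega> * \<xi>' l \<omega>) * (\<integral>s. u k l s \<partial>time_measure T)"
    "integrable (PT T) (\<lambda>(s, \<omega>). u k l s * (\<xi> k \<omega> * \<xi>' l \<omega>))"
    "(\<integral>(s, \<omega>). u k l s * (\<xi> k \<omega> * \<xi>' l \<omega>) \<partial>PT T) = expectation (I k l)"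
    if k: "k < n" and l: "l < n'" for k l
  proof -
    note a = simple_adaptedD[OF s1 k] and b = simple_adaptedD[OF s2 l]
    note u = integral_time_intervals[OF a(1) b(1) t(2), of "\<tau> (Suc k)" "\<tau>' (Suc l)", folded u_def]
    have i: "integrable M (\<lambda>\<omega>. \<xi> k \<omega> * \<xi>' l \<omega>)"
      using a b by (intro bounded_integrable bounded_mult_image) auto
    show 1: "integrable M (I k l)" "expectation (I k l) = expectation (\<lambda>\<omega>. \<xi> k \<omega> * \<xi>' l \<omega>) * (\<integral>s. u k l s \<partial>time_measure T)"
      using stopped_increment_product[OF a(1,2) b(1,2) t(1) a(3,4) b(3,4)] unfolding I_def u(2)[unfolded u_def[symmetric]] by auto
    show "integrable (PT T) (\<lambda>(s, \<omega>). u k l s * (\<xi> k \<omega> * \<xi>' l \<omega>))"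
      by (rule P.integral_product_measure(1)[OF u(1) i])
    show "(\<integral>(s, \<omega>). u k l s * (\<xi> k \<omega> * \<xi>' l \<omega>) \<partial>PT T) = expectation (I k l)"
      unfolding 1 using P.integral_product_measure(2)[OF u(1) i] by (simp add: mult.commute)
  qed
  show "integrable M (\<lambda>\<omega>. simple_ito B n \<tau> \<xi> t \<omega> * simple_ito B n' \<tau>' \<xi>' t \<omega>)"
    unfolding eq1 using I(1) by (intro Bochner_Integration.integrable_sum) auto
  show "integrable (PT T) (\<lambda>(s, \<omega>). indicator {0..t} s * (simple_process n \<tau> \<xi> s \<omega> * simple_process n' \<tau>' \<xi>' s \<omega>))"
    unfolding eq2 using I(3) by (intro Bochner_Integration.integrable_sum) auto
  have "expectation (\<lambda>\<omega>. simple_ito B n \<tau> \<xi> t \<omega> * simple_ito B n' \<tau>' \<xi>' t \<omega>) = (\<Sum>k<n. \<Sum>l<n'. expectation (I k l))"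
    unfolding eq1 using I(1) by (subst Bochner_Integration.integral_sum; (intro Bochner_Integration.integrable_sum sum.cong refl)?) auto
  also have "\<dots> = (\<Sum>k<n. \<Sum>l<n'. \<integral>(s, \<omega>). u k l s * (\<xi> k \<omega> * \<xi>' l \<omega>) \<partial>PT T)"
    using I(4) by (intro sum.cong refl) auto
  also have "\<dots> = (\<integral>(s, \<omega>). indicator {0..t} s * (simple_process n \<tau> \<xi> s \<omega> * simple_process n' \<tau>' \<xi>' s \<omega>) \<partial>PT T)"
    unfolding eq2 using I(3) by (subst Bochner_Integration.integral_sum; (intro Bochner_Integration.integrable_sum sum.cong refl)?) auto
  finally show "expectation (\<lambda>\<omega>. simple_ito B n \<tau> \<xi> t \<omega> * simple_ito B n' \<tau>' \<xi>' t \<omega>) =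
     (\<integral>(s, \<omega>). indicator {0..t} s * (simple_process n \<tau> \<xi> s \<omega> * simple_process n' \<tau>' \<xi>' s \<omega>) \<partial>PT T)" .
qed

lemma simple_sq_integrable:
  assumes s: "simple_adapted M B T n \<tau> \<xi>"
  shows "0 \<le> t \<Longrightarrow> t \<le> T \<Longrightarrow> sq_integrable M (simple_ito B n \<tau> \<xi> t)"
    "0 \<le> T \<Longrightarrow> sq_integrable (PT T) (\<lambda>(s, \<omega>). simple_process n \<tau> \<xi> s \<omega>)"
proof -
  assume t: "0 \<le> t" "t \<le> T"
  have "simple_ito B n \<tau> \<xi> t \<in> borel_measurable M"
    unfolding simple_ito_def[abs_def]
    using simple_adaptedD[OF s] simple_adapted_times[OF s] t
    by (intro borel_measurable_sum borel_measurable_times borel_measurable_diff random_variable_B) auto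
  then show "sq_integrable M (simple_ito B n \<tau> \<xi> t)"
    using simple_isometry(1)[OF s s t] by (simp add: sq_integrable_def power2_eq_square)
next
  assume T: "0 \<le> T"
  have [measurable]: "(\<lambda>x. x) \<in> borel_measurable (time_measure T)"
    by (simp add: measurable_restrict_space1)
  have "(\<lambda>(s, \<omega>). \<xi> k \<omega> * indicator {\<tau> k<..\<tau> (Suc k)} s) \<in> borel_measurable (PT T)" if "k < n" for k
  proof -
    have [measurable]: "\<xi> k \<in> borel_measurable M" using simple_adaptedD[OF s that] by simp
    show ?thesis by measurable
  qed
  then have "(\<lambda>(s, \<omega>). simple_process n \<tau> \<xi> s \<omega>) \<in> borel_measurable (PT T)"
    unfolding simple_process_def split_beta' by (intro borel_measurable_sum) auto
  moreover have "integrable (PT T) (\<lambda>x. (case x of (s, \<omega>) \<Rightarrow> simple_process n \<tau> \<xi> s \<omega>)\<^sup>2)"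
    by (rule Bochner_Integration.integrable_cong[THEN iffD1, OF refl _ simple_isometry(2)[OF s s T order_refl]])
       (auto simp: space_pair_measure power2_eq_square)
  ultimately show "sq_integrable (PT T) (\<lambda>(s, \<omega>). simple_process n \<tau> \<xi> s \<omega>)" by (simp add: sq_integrable_def)
qed

text \<open>Only the part of each interval between r and t survives. There both Z and the
  coefficient are known at the left end p, so the expectation vanishes.\<close>

lemma simple_ito_orthogonal:
  assumes s: "simple_adapted M B T n \<tau> \<xi>" and rt: "0 \<le> r" "r \<le> t" "t \<le> T"
    and Z: "Z \<in> borel_measurable (F r)" "integrable M Z"
  shows "expectation (\<lambda>\<omega>. Z \<omega> * (simple_ito B n \<tau> \<xi> t \<omega> - simple_ito B n \<tau> \<xi> r \<omega>)) = 0"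
proof -
  define I where "I k \<omega> = Z \<omega> * (\<xi> k \<omega> * ((B (min t (\<tau> (Suc k))) \<omega> - B (min t (\<tau> k)) \<omega>)
     - (B (min r (\<tau> (Suc k))) \<omega> - B (min r (\<tau> k)) \<omega>)))" for k \<omega>
  have I: "integrable M (I k) \<and> expectation (I k) = 0" if k: "k < n" for k
  proof (cases "\<tau> (Suc k) \<le> r \<or> t \<le> \<tau> k")
    case True
    then have "min t (\<tau> (Suc k)) = \<tau> (Suc k) \<and> min t (\<tau> k) = \<tau> k \<and> min r (\<tau> (Suc k)) = \<tau> (Suc k) \<and> min r (\<tau> k) = \<tau> k
      \<or> min t (\<tau> (Suc k)) = t \<and> min t (\<tau> k) = t \<and> min r (\<tau> (Suc k)) = r \<and> min r (\<tau> k) = r"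
      using rt simple_adaptedD(2)[OF s k] by auto
    then have "I k = (\<lambda>_. 0)" by (auto simp: I_def fun_eq_iff)
    then show ?thesis by simp
  next
    case False
    note a = simple_adaptedD[OF s k]
    define p q where "p = max r (\<tau> k)" and "q = min t (\<tau> (Suc k))"
    have pq: "0 \<le> p" "p \<le> q" using False a rt by (auto simp: p_def q_def)
    have eq: "I k = (\<lambda>\<omega>. (Z \<omega> * \<xi> k \<omega>) * (B q \<omega> - B p \<omega>))"
      using False rt a(2) by (auto simp: I_def p_def q_def fun_eq_iff min_def max_def)
    have m: "(\<lambda>\<omega>. Z \<omega> * \<xi> k \<omega>) \<in> borel_measurable (F p)"
      by (intro borel_measurable_times measurable_F_mono[OF Z(1)] measurable_F_mono[OF a(3)]) (auto simp: p_def)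
    have i: "integrable M (\<lambda>\<omega>. Z \<omega> * \<xi> k \<omega>)"
      using integrable_mult_bounded[OF a(5,4) Z(2)] by (simp add: mult.commute)
    show ?thesis unfolding eq using expectation_times_increment(1,2)[OF pq m i] by simp
  qed
  have "(\<lambda>\<omega>. Z \<omega> * (simple_ito B n \<tau> \<xi> t \<omega> - simple_ito B n \<tau> \<xi> r \<omega>)) = (\<lambda>\<omega>. \<Sum>k<n. I k \<omega>)"
    by (simp add: simple_ito_def I_def fun_eq_iff right_diff_distrib sum_subtractf sum_distrib_left)
  then show ?thesis using I by simp
qed

end

section \<open>Passage to general integrands\<close>

context standard_brownian_motion
begin

text \<open>Both sides are limits of the simple identity by continuity of the L^2 inner product. The
  two integrals may have different approximating sequences, which is why the polarised form for
  unrelated partitions is needed.\<close>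

lemma has_ito_integral_isometry:
  assumes T: "0 < T" and ito: "has_ito_integral M B T g J" "has_ito_integral M B T g' J'"
    and gm: "(\<lambda>(s, \<omega>). g s \<omega>) \<in> borel_measurable (PT T)" "(\<lambda>(s, \<omega>). g' s \<omega>) \<in> borel_measurable (PT T)"
    and t: "0 \<le> t" "t \<le> T"
  shows "expectation (\<lambda>\<omega>. J t \<omega> * J' t \<omega>) = (\<integral>(s, \<omega>). indicator {0..t} s * (g s \<omega> * g' s \<omega>) \<partial>PT T)"
    "sq_integrable M (J t)" "sq_integrable (PT T) (\<lambda>(s, \<omega>). g s \<omega>)"
proof -
  interpret P: pair_sigma_finite "time_measure T" M by (rule pair_PT)
  have lim: "\<exists>n \<tau> \<xi>. (\<forall>m. simple_adapted M B T (n m) (\<tau> m) (\<xi> m)) \<and>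
      (\<lambda>m. \<integral>z. ((case z of (s, \<omega>) \<Rightarrow> simple_process (n m) (\<tau> m) (\<xi> m) s \<omega>) - (case z of (s, \<omega>) \<Rightarrow> g s \<omega>))\<^sup>2 \<partial>PT T) \<longlonglongrightarrow> 0 \<and>
      (\<lambda>m. \<integral>\<omega>. (simple_ito B (n m) (\<tau> m) (\<xi> m) t \<omega> - J t \<omega>)\<^sup>2 \<partial>M) \<longlonglongrightarrow> 0 \<and>
      sq_integrable (PT T) (\<lambda>(s, \<omega>). g s \<omega>) \<and> sq_integrable M (J t)"
    if ito: "has_ito_integral M B T g J" and gm: "(\<lambda>(s, \<omega>). g s \<omega>) \<in> borel_measurable (PT T)" for g J
  proof -
    obtain n \<tau> \<xi> where s: "\<forall>m. simple_adapted M B T (n m) (\<tau> m) (\<xi> m)"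
      and l1: "(\<lambda>m. \<integral>\<^sup>+\<omega>. (\<integral>\<^sup>+t\<in>{0..T}. ennreal ((simple_process (n m) (\<tau> m) (\<xi> m) t \<omega> - g t \<omega>)\<^sup>2) \<partial>lborel) \<partial>M) \<longlonglongrightarrow> 0"
      and l2: "(\<lambda>m. \<integral>\<^sup>+\<omega>. ennreal ((simple_ito B (n m) (\<tau> m) (\<xi> m) t \<omega> - J t \<omega>)\<^sup>2) \<partial>M) \<longlonglongrightarrow> 0"
      using ito t unfolding has_ito_integral_def by auto
    have Jm: "J t \<in> borel_measurable M" using ito t by (auto simp: has_ito_integral_def)
    let ?H = "\<lambda>m (s, \<omega>). simple_process (n m) (\<tau> m) (\<xi> m) s \<omega>"
    have H: "sq_integrable (PT T) (?H m)" for m using simple_sq_integrable(2)[OF s[rule_format]] T by simp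
    have I: "sq_integrable M (simple_ito B (n m) (\<tau> m) (\<xi> m) t)" for m by (intro simple_sq_integrable(1)[OF s[rule_format]] t)
    have "(\<integral>\<^sup>+\<omega>. (\<integral>\<^sup>+t\<in>{0..T}. ennreal ((simple_process (n m) (\<tau> m) (\<xi> m) t \<omega> - g t \<omega>)\<^sup>2) \<partial>lborel) \<partial>M)
       = (\<integral>\<^sup>+z. ennreal ((?H m z - (case z of (s, \<omega>) \<Rightarrow> g s \<omega>))\<^sup>2) \<partial>PT T)" for m
    proof -
      have meas: "(\<lambda>z. ennreal ((?H m z - (case z of (s, \<omega>) \<Rightarrow> g s \<omega>))\<^sup>2)) \<in> borel_measurable (PT T)"
        using sq_integrable_measurable[OF H[of m]] gm by measurable
      have "(\<integral>\<^sup>+z. ennreal ((?H m z - (case z of (s, \<omega>) \<Rightarrow> g s \<omega>))\<^sup>2) \<partial>PT T) =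
        (\<integral>\<^sup>+\<omega>. \<integral>\<^sup>+s. ennreal ((simple_process (n m) (\<tau> m) (\<xi> m) s \<omega> - g s \<omega>)\<^sup>2) \<partial>time_measure T \<partial>M)"
        using P.nn_integral_snd[OF meas] by simp
      also have "\<dots> = (\<integral>\<^sup>+\<omega>. (\<integral>\<^sup>+t\<in>{0..T}. ennreal ((simple_process (n m) (\<tau> m) (\<xi> m) t \<omega> - g t \<omega>)\<^sup>2) \<partial>lborel) \<partial>M)"
        by (simp add: nn_integral_restrict_space)
      finally show ?thesis by simp
    qed
    with l1 have l1': "(\<lambda>m. \<integral>\<^sup>+z. ennreal ((?H m z - (case z of (s, \<omega>) \<Rightarrow> g s \<omega>))\<^sup>2) \<partial>PT T) \<longlonglongrightarrow> 0" by simp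
    show ?thesis
      using s L2_limit_of_nn_integral[OF H gm l1'] L2_limit_of_nn_integral[OF I Jm l2] by blast
  qed
  obtain n \<tau> \<xi> where a: "\<And>m. simple_adapted M B T (n m) (\<tau> m) (\<xi> m)"
      "(\<lambda>m. \<integral>z. ((case z of (s, \<omega>) \<Rightarrow> simple_process (n m) (\<tau> m) (\<xi> m) s \<omega>) - (case z of (s, \<omega>) \<Rightarrow> g s \<omega>))\<^sup>2 \<partial>PT T) \<longlonglongrightarrow> 0"
      "(\<lambda>m. \<integral>\<omega>. (simple_ito B (n m) (\<tau> m) (\<xi> m) t \<omega> - J t \<omega>)\<^sup>2 \<partial>M) \<longlonglongrightarrow> 0"
      "sq_integrable (PT T) (\<lambda>(s, \<omega>). g s \<omega>)" "sq_integrable M (J t)"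
    using lim[OF ito(1) gm(1)] by blast
  obtain n' \<tau>' \<xi>' where b: "\<And>m. simple_adapted M B T (n' m) (\<tau>' m) (\<xi>' m)"
      "(\<lambda>m. \<integral>z. ((case z of (s, \<omega>) \<Rightarrow> simple_process (n' m) (\<tau>' m) (\<xi>' m) s \<omega>) - (case z of (s, \<omega>) \<Rightarrow> g' s \<omega>))\<^sup>2 \<partial>PT T) \<longlonglongrightarrow> 0"
      "(\<lambda>m. \<integral>\<omega>. (simple_ito B (n' m) (\<tau>' m) (\<xi>' m) t \<omega> - J' t \<omega>)\<^sup>2 \<partial>M) \<longlonglongrightarrow> 0"
      "sq_integrable (PT T) (\<lambda>(s, \<omega>). g' s \<omega>)" "sq_integrable M (J' t)"
    using lim[OF ito(2) gm(2)] by blast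
  show "sq_integrable M (J t)" "sq_integrable (PT T) (\<lambda>(s, \<omega>). g s \<omega>)" by fact+
  let ?H = "\<lambda>m (s, \<omega>). simple_process (n m) (\<tau> m) (\<xi> m) s \<omega>"
  let ?H' = "\<lambda>m (s, \<omega>). simple_process (n' m) (\<tau>' m) (\<xi>' m) s \<omega>"
  let ?i = "\<lambda>z. indicator {0..t} (fst z) :: real"
  have im: "?i \<in> borel_measurable (PT T)" by measurable
  have ib: "AE z in PT T. \<bar>?i z\<bar> \<le> 1" by (simp add: indicator_def)
  have H: "sq_integrable (PT T) (?H m)" "sq_integrable (PT T) (?H' m)" for m
    using simple_sq_integrable(2)[OF a(1)] simple_sq_integrable(2)[OF b(1)] T by simp_all
  have I: "sq_integrable M (simple_ito B (n m) (\<tau> m) (\<xi> m) t)" "sq_integrable M (simple_ito B (n' m) (\<tau>' m) (\<xi>' m) t)" for m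
    using simple_sq_integrable(1)[OF a(1)] simple_sq_integrable(1)[OF b(1)] t by simp_all
  \<comment> \<open>Multiplication by the indicator of [0,t] does not increase the L^2 norm, so
    convergence on [0,T] restricts to every t.\<close>
  have lim0: "(\<lambda>m. \<integral>z. (?i z * ?H m z - ?i z * (case z of (s, \<omega>) \<Rightarrow> g s \<omega>))\<^sup>2 \<partial>PT T) \<longlonglongrightarrow> 0"
  proof (rule tendsto_sandwich[OF _ _ tendsto_const a(2)])
    show "\<forall>\<^sub>F m in sequentially. 0 \<le> (\<integral>z. (?i z * ?H m z - ?i z * (case z of (s, \<omega>) \<Rightarrow> g s \<omega>))\<^sup>2 \<partial>PT T)"
      by (intro always_eventually allI integral_nonneg_AE) simp
    show "\<forall>\<^sub>F m in sequentially. (\<integral>z. (?i z * ?H m z - ?i z * (case z of (s, \<omega>) \<Rightarrow> g s \<omega>))\<^sup>2 \<partial>PT T) \<le>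
       (\<integral>z. (?H m z - (case z of (s, \<omega>) \<Rightarrow> g s \<omega>))\<^sup>2 \<partial>PT T)"
    proof (intro always_eventually allI, rule integral_mono_AE)
      fix m
      have d: "sq_integrable (PT T) (\<lambda>z. ?H m z - (case z of (s, \<omega>) \<Rightarrow> g s \<omega>))"
        by (rule sq_integrable_diff[OF H(1) a(4)])
      then show "integrable (PT T) (\<lambda>z. (?H m z - (case z of (s, \<omega>) \<Rightarrow> g s \<omega>))\<^sup>2)"
        by (rule sq_integrable_square)
      show "integrable (PT T) (\<lambda>z. (?i z * ?H m z - ?i z * (case z of (s, \<omega>) \<Rightarrow> g s \<omega>))\<^sup>2)"
        using sq_integrable_square[OF sq_integrable_bounded[OF d im ib]] by (simp add: right_diff_distrib split_beta')
      show "AE z in PT T. (?i z * ?H m z - ?i z * (case z of (s, \<omega>) \<Rightarrow> g s \<omega>))\<^sup>2 \<le> (?H m z - (case z of (s, \<omega>) \<Rightarrow> g s \<omega>))\<^sup>2"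
        by (rule AE_I2) (simp add: indicator_def split: prod.split)
    qed
  qed
  have "(\<lambda>m. \<integral>z. (?i z * ?H m z) * ?H' m z \<partial>PT T) \<longlonglongrightarrow>
     (\<integral>z. (?i z * (case z of (s, \<omega>) \<Rightarrow> g s \<omega>)) * (case z of (s, \<omega>) \<Rightarrow> g' s \<omega>) \<partial>PT T)"
    by (rule L2_product_tendsto[OF sq_integrable_bounded[OF H(1) im ib] H(2) sq_integrable_bounded[OF a(4) im ib] b(4) lim0 b(2)])
  moreover have "(\<integral>z. (?i z * ?H m z) * ?H' m z \<partial>PT T) =
      expectation (\<lambda>\<omega>. simple_ito B (n m) (\<tau> m) (\<xi> m) t \<omega> * simple_ito B (n' m) (\<tau>' m) (\<xi>' m) t \<omega>)" for m
    unfolding simple_isometry(3)[OF a(1) b(1) t]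
    by (intro Bochner_Integration.integral_cong) (auto simp: mult.assoc)
  ultimately have 1: "(\<lambda>m. expectation (\<lambda>\<omega>. simple_ito B (n m) (\<tau> m) (\<xi> m) t \<omega> * simple_ito B (n' m) (\<tau>' m) (\<xi>' m) t \<omega>)) \<longlonglongrightarrow>
     (\<integral>z. (?i z * (case z of (s, \<omega>) \<Rightarrow> g s \<omega>)) * (case z of (s, \<omega>) \<Rightarrow> g' s \<omega>) \<partial>PT T)" by simp
  have 2: "(\<lambda>m. expectation (\<lambda>\<omega>. simple_ito B (n m) (\<tau> m) (\<xi> m) t \<omega> * simple_ito B (n' m) (\<tau>' m) (\<xi>' m) t \<omega>)) \<longlonglongrightarrow>
     expectation (\<lambda>\<omega>. J t \<omega> * J' t \<omega>)"
    by (rule L2_product_tendsto[OF I a(5) b(5) a(3) b(3)])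
  have "expectation (\<lambda>\<omega>. J t \<omega> * J' t \<omega>) = (\<integral>z. (?i z * (case z of (s, \<omega>) \<Rightarrow> g s \<omega>)) * (case z of (s, \<omega>) \<Rightarrow> g' s \<omega>) \<partial>PT T)"
    by (rule LIMSEQ_unique[OF 2 1])
  also have "\<dots> = (\<integral>(s, \<omega>). indicator {0..t} s * (g s \<omega> * g' s \<omega>) \<partial>PT T)"
    by (intro Bochner_Integration.integral_cong) (auto simp: mult.assoc)
  finally show "expectation (\<lambda>\<omega>. J t \<omega> * J' t \<omega>) = (\<integral>(s, \<omega>). indicator {0..t} s * (g s \<omega> * g' s \<omega>) \<partial>PT T)" .
qed

lemma has_ito_integral_orthogonal:
  assumes ito: "has_ito_integral M B T g J" and rt: "0 \<le> r" "r \<le> t" "t \<le> T"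
    and Z: "Z \<in> borel_measurable (F r)" "sq_integrable M Z"
  shows "expectation (\<lambda>\<omega>. Z \<omega> * (J t \<omega> - J r \<omega>)) = 0"
proof -
  obtain n \<tau> \<xi> where s: "\<And>m. simple_adapted M B T (n m) (\<tau> m) (\<xi> m)"
      and l: "\<And>t. t \<in> {0..T} \<Longrightarrow> (\<lambda>m. \<integral>\<^sup>+\<omega>. ennreal ((simple_ito B (n m) (\<tau> m) (\<xi> m) t \<omega> - J t \<omega>)\<^sup>2) \<partial>M) \<longlonglongrightarrow> 0"
      and Jm: "\<And>t. t \<in> {0..T} \<Longrightarrow> J t \<in> borel_measurable M"
    using ito unfolding has_ito_integral_def by blast
  from finite_measure_axioms have iZ: "integrable M Z" using Z(2) by (rule sq_integrable_imp_integrable)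
  have I: "sq_integrable M (simple_ito B (n m) (\<tau> m) (\<xi> m) u)" if "u \<in> {0..T}" for m u
    using simple_sq_integrable(1)[OF s] that by simp
  have J: "sq_integrable M (J u)" "(\<lambda>m. \<integral>\<omega>. (simple_ito B (n m) (\<tau> m) (\<xi> m) u \<omega> - J u \<omega>)\<^sup>2 \<partial>M) \<longlonglongrightarrow> 0"
    if u: "u \<in> {0..T}" for u
    using L2_limit_of_nn_integral[OF I[OF u] Jm[OF u] l[OF u]] by auto
  have lim: "(\<lambda>m. \<integral>\<omega>. Z \<omega> * simple_ito B (n m) (\<tau> m) (\<xi> m) u \<omega> \<partial>M) \<longlonglongrightarrow> (\<integral>\<omega>. Z \<omega> * J u \<omega> \<partial>M)"
    if u: "u \<in> {0..T}" for u
    by (rule L2_product_tendsto[OF Z(2) I[OF u] Z(2) J(1)[OF u] _ J(2)[OF u]]) simp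
  have t: "t \<in> {0..T}" and r: "r \<in> {0..T}" using rt by auto
  have "(\<integral>\<omega>. Z \<omega> * simple_ito B (n m) (\<tau> m) (\<xi> m) t \<omega> \<partial>M) = (\<integral>\<omega>. Z \<omega> * simple_ito B (n m) (\<tau> m) (\<xi> m) r \<omega> \<partial>M)" for m
    using simple_ito_orthogonal[OF s rt Z(1) iZ] sq_integrable_mult[OF Z(2) I[OF t]] sq_integrable_mult[OF Z(2) I[OF r]]
    by (simp add: right_diff_distrib)
  with lim[OF t] have "(\<lambda>m. \<integral>\<omega>. Z \<omega> * simple_ito B (n m) (\<tau> m) (\<xi> m) r \<omega> \<partial>M) \<longlonglongrightarrow> (\<integral>\<omega>. Z \<omega> * J t \<omega> \<partial>M)" by simp
  then have "(\<integral>\<omega>. Z \<omega> * J t \<omega> \<partial>M) = (\<integral>\<omega>. Z \<omega> * J r \<omega> \<partial>M)"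
    using lim[OF r] by (rule LIMSEQ_unique)
  then show ?thesis
    using sq_integrable_mult[OF Z(2) J(1)[OF t]] sq_integrable_mult[OF Z(2) J(1)[OF r]]
    by (simp add: right_diff_distrib)
qed

end

section \<open>Product rule\<close>

lemma borel_measurable_time_measure:
  "f \<in> measurable N (time_measure T) \<Longrightarrow> f \<in> borel_measurable N"
  by (erule measurable_compose[where g = "\<lambda>x. x"]) (simp add: measurable_restrict_space1)

context standard_brownian_motion
begin

text \<open>The equation is required almost surely for each fixed t, not simultaneously for all t.
  This matches the use made of it, namely expectations at fixed times followed by integration in
  time.\<close>

definition ito_process :: "real \<Rightarrow> (real \<Rightarrow> 'a \<Rightarrow> real) \<Rightarrow> (real \<Rightarrow> 'a \<Rightarrow> real) \<Rightarrow> (real \<Rightarrow> 'a \<Rightarrow> real) \<Rightarrow> (real \<Rightarrow> 'a \<Rightarrow> real) \<Rightarrow> bool" where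
  "ito_process T X b g J \<longleftrightarrow>
     sq_integrable (PT T) (\<lambda>(t, \<omega>). X t \<omega>) \<and> (\<forall>t\<in>{0..T}. sq_integrable M (X t)) \<and> X 0 \<in> borel_measurable (F 0) \<and>
     sq_integrable (PT T) (\<lambda>(t, \<omega>). b t \<omega>) \<and> (\<forall>t\<in>{0..T}. b t \<in> borel_measurable (F t)) \<and>
     (\<lambda>(t, \<omega>). g t \<omega>) \<in> borel_measurable (PT T) \<and> has_ito_integral M B T g J \<and>
     (\<forall>t\<in>{0..T}. AE \<omega> in M. X t \<omega> = X 0 \<omega> + (\<integral>s. indicator {0..t} s * b s \<omega> \<partial>time_measure T) + J t \<omega>)"

lemma sq_integrable_PT:
  assumes m: "(\<lambda>(t, \<omega>). X t \<omega>) \<in> borel_measurable (PT T)"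
    and sq: "\<And>t. t \<in> {0..T} \<Longrightarrow> sq_integrable M (X t)"
    and bd: "\<And>t. t \<in> {0..T} \<Longrightarrow> expectation (\<lambda>\<omega>. (X t \<omega>)\<^sup>2) \<le> C"
  shows "sq_integrable (PT T) (\<lambda>(t, \<omega>). X t \<omega>)"
  unfolding sq_integrable_def
proof (intro conjI m)
  interpret L: finite_measure "time_measure T" by (rule finite_time_measure)
  interpret P: pair_sigma_finite "time_measure T" M by (rule pair_PT)
  have m2: "(\<lambda>z. (case z of (t, \<omega>) \<Rightarrow> X t \<omega>)\<^sup>2) \<in> borel_measurable (PT T)" using m by measurable
  show "integrable (PT T) (\<lambda>z. (case z of (t, \<omega>) \<Rightarrow> X t \<omega>)\<^sup>2)"
  proof (rule P.Fubini_integrable[OF m2])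
    have "(\<lambda>t. \<integral>\<omega>. (X t \<omega>)\<^sup>2 \<partial>M) \<in> borel_measurable (time_measure T)"
      using m2 by (intro borel_measurable_lebesgue_integral) (simp add: split_beta')
    moreover have "norm (\<integral>\<omega>. (X t \<omega>)\<^sup>2 \<partial>M) \<le> C" if "t \<in> {0..T}" for t
      using bd[OF that] integral_nonneg_AE[of "\<lambda>\<omega>. (X t \<omega>)\<^sup>2" M] by simp
    ultimately have "integrable (time_measure T) (\<lambda>t. \<integral>\<omega>. (X t \<omega>)\<^sup>2 \<partial>M)"
      by (intro L.integrable_const_bound[of _ C]) auto
    then show "integrable (time_measure T) (\<lambda>x. \<integral>y. norm ((case (x, y) of (t, \<omega>) \<Rightarrow> X t \<omega>)\<^sup>2) \<partial>M)" by simp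
    show "AE x in time_measure T. integrable M (\<lambda>y. (case (x, y) of (t, \<omega>) \<Rightarrow> X t \<omega>)\<^sup>2)"
      using sq by (intro AE_I2) (auto simp: sq_integrable_def)
  qed
qed

lemma sq_integrable_PT_const:
  assumes "sq_integrable M Z" shows "sq_integrable (PT T) (\<lambda>(t, \<omega>). Z \<omega>)"
  by (rule sq_integrable_PT[where C = "expectation (\<lambda>\<omega>. (Z \<omega>)\<^sup>2)"])
     (use assms in \<open>auto simp: sq_integrable_def\<close>)

lemma sq_integrable_PT_fst:
  assumes "sq_integrable (PT T) (\<lambda>(t, \<omega>). b t \<omega>)"
  shows "AE t in time_measure T. sq_integrable M (b t)"
proof -
  interpret P: pair_sigma_finite "time_measure T" M by (rule pair_PT)
  have 1: "AE t in time_measure T. integrable M (\<lambda>\<omega>. (b t \<omega>)\<^sup>2)"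
    using P.AE_integrable_fst'[OF sq_integrable_square[OF assms]] by simp
  have 2: "b t \<in> borel_measurable M" if "t \<in> {0..T}" for t
    using measurable_Pair2[OF sq_integrable_measurable[OF assms], of t] that by simp
  show ?thesis
    using 1 AE_space by eventually_elim (simp add: sq_integrable_def 2)
qed

lemma sq_integrable_PT_snd:
  assumes "sq_integrable (PT T) (\<lambda>(t, \<omega>). b t \<omega>)"
  shows "AE \<omega> in M. sq_integrable (time_measure T) (\<lambda>t. b t \<omega>)"
proof -
  interpret P: pair_sigma_finite "time_measure T" M by (rule pair_PT)
  have 1: "AE \<omega> in M. integrable (time_measure T) (\<lambda>t. (b t \<omega>)\<^sup>2)"
    using P.AE_integrable_snd[of "\<lambda>t \<omega>. (b t \<omega>)\<^sup>2"] sq_integrable_square[OF assms] by (simp add: split_beta')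
  have 2: "(\<lambda>t. b t \<omega>) \<in> borel_measurable (time_measure T)" if "\<omega> \<in> space M" for \<omega>
    using measurable_Pair1[OF sq_integrable_measurable[OF assms], of \<omega>] that by simp
  show ?thesis
    using 1 AE_space by eventually_elim (simp add: sq_integrable_def 2)
qed

text \<open>Cauchy-Schwarz in time bounds the square of the integral by T times the integral of b^2,
  uniformly in the upper limit; this is an integrable majorant on the probability space.\<close>

lemma drift_sq_integrable:
  assumes b: "sq_integrable (PT T) (\<lambda>(t, \<omega>). b t \<omega>)" and T: "0 < T"
  defines "A \<equiv> \<lambda>t \<omega>. \<integral>s. indicator {0..t} s * b s \<omega> \<partial>time_measure T"
  shows "sq_integrable (PT T) (\<lambda>(t, \<omega>). A t \<omega>)" "t \<in> {0..T} \<Longrightarrow> sq_integrable M (A t)"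
proof -
  interpret L: finite_measure "time_measure T" by (rule finite_time_measure)
  interpret P: pair_sigma_finite "time_measure T" M by (rule pair_PT)
  note bm = sq_integrable_measurable[OF b]
  have Am: "(\<lambda>(t, \<omega>). A t \<omega>) \<in> borel_measurable (PT T)"
  proof -
    let ?N = "PT T \<Otimes>\<^sub>M time_measure T"
    have 1: "(\<lambda>z. fst (fst z)) \<in> borel_measurable ?N" "snd \<in> borel_measurable ?N"
      by (rule borel_measurable_time_measure[where T = T], simp)+
    have 2: "(\<lambda>z. b (snd z) (snd (fst z))) \<in> borel_measurable ?N"
      using measurable_compose[of "\<lambda>z. (snd z, snd (fst z))" ?N "PT T", OF _ bm] by simp
    have "(\<lambda>z. indicator {0..fst (fst z)} (snd z) * b (snd z) (snd (fst z))) \<in> borel_measurable ?N"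
      unfolding indicator_def atLeastAtMost_iff using 1 2 by measurable
    then have "(\<lambda>z. \<integral>s. indicator {0..fst z} s * b s (snd z) \<partial>time_measure T) \<in> borel_measurable (PT T)"
      by (intro L.borel_measurable_lebesgue_integral) (simp add: split_beta')
    then show ?thesis by (simp add: A_def split_beta')
  qed
  have bound: "AE \<omega> in M. \<forall>t\<in>{0..T}. (A t \<omega>)\<^sup>2 \<le> T * (\<integral>s. (b s \<omega>)\<^sup>2 \<partial>time_measure T)"
    using sq_integrable_PT_snd[OF b]
  proof eventually_elim
    case (elim \<omega>)
    show ?case
    proof
      fix t assume t: "t \<in> {0..T}"
      have i: "sq_integrable (time_measure T) (indicator {0..t})"
      proof -
        have "(\<lambda>s. (indicator {0..t} s :: real)\<^sup>2) \<in> borel_measurable (time_measure T)" by measurable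
        then have "integrable (time_measure T) (\<lambda>s. (indicator {0..t} s :: real)\<^sup>2)"
          by (intro L.integrable_const_bound[of _ 1]) (auto simp: indicator_def)
        then show ?thesis by (simp add: sq_integrable_def)
      qed
      have "(A t \<omega>)\<^sup>2 \<le> (\<integral>s. (indicator {0..t} s)\<^sup>2 \<partial>time_measure T) * (\<integral>s. (b s \<omega>)\<^sup>2 \<partial>time_measure T)"
        unfolding A_def by (rule L2_Cauchy_Schwarz[OF i elim])
      also have "(\<integral>s. (indicator {0..t} s :: real)\<^sup>2 \<partial>time_measure T) = t"
      proof -
        have "(\<lambda>s. (indicator {0..t} s :: real)\<^sup>2) = indicator {0..t}"
          by (auto simp: indicator_def fun_eq_iff)
        then have "(\<integral>s. (indicator {0..t} s :: real)\<^sup>2 \<partial>time_measure T) = measure (time_measure T) ({0..t} \<inter> space (time_measure T))"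
          by (simp only: Bochner_Integration.integral_indicator)
        also have "\<dots> = measure (time_measure T) {0..t}" using t by (simp add: Int_absorb2)
        also have "\<dots> = t" using t by (simp add: measure_restrict_space)
        finally show ?thesis .
      qed
      also have "t * (\<integral>s. (b s \<omega>)\<^sup>2 \<partial>time_measure T) \<le> T * (\<integral>s. (b s \<omega>)\<^sup>2 \<partial>time_measure T)"
        using t by (intro mult_right_mono integral_nonneg_AE) auto
      finally show "(A t \<omega>)\<^sup>2 \<le> T * (\<integral>s. (b s \<omega>)\<^sup>2 \<partial>time_measure T)" .
    qed
  qed
  have i: "integrable M (\<lambda>\<omega>. T * (\<integral>s. (b s \<omega>)\<^sup>2 \<partial>time_measure T))"
    using P.integrable_snd[of "\<lambda>t \<omega>. (b t \<omega>)\<^sup>2"] sq_integrable_square[OF b] by (simp add: split_beta')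
  show A: "sq_integrable M (A t)" if t: "t \<in> {0..T}" for t
  proof -
    have m: "A t \<in> borel_measurable M" using measurable_Pair2[OF Am, of t] t by simp
    have "integrable M (\<lambda>\<omega>. (A t \<omega>)\<^sup>2)"
    proof (rule Bochner_Integration.integrable_bound[OF i])
      show "AE \<omega> in M. norm ((A t \<omega>)\<^sup>2) \<le> norm (T * (\<integral>s. (b s \<omega>)\<^sup>2 \<partial>time_measure T))"
        using bound by eventually_elim (use t in \<open>auto intro: order_trans[OF _ abs_ge_self]\<close>)
    qed (use m in auto)
    with m show ?thesis by (simp add: sq_integrable_def)
  qed
  show "sq_integrable (PT T) (\<lambda>(t, \<omega>). A t \<omega>)"
  proof (rule sq_integrable_PT[OF Am A])
    fix t assume t: "t \<in> {0..T}"
    show "expectation (\<lambda>\<omega>. (A t \<omega>)\<^sup>2) \<le> expectation (\<lambda>\<omega>. T * (\<integral>s. (b s \<omega>)\<^sup>2 \<partial>time_measure T))"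
      by (rule integral_mono_AE[OF sq_integrable_square[OF A[OF t]] i]) (use bound in eventually_elim, use t in auto)
  qed
qed

text \<open>b_s is known at time s, so orthogonality replaces J_t by J_s under the expectation, and
  the product with the drift integral becomes a time integral of E (b_s J_s). The initial value is
  handled in the same way at time 0.\<close>

lemma drift_martingale_product:
  assumes T: "0 < T" and Y: "ito_process T Y c g J"
    and b: "sq_integrable (PT T) (\<lambda>(t, \<omega>). b t \<omega>)" "\<And>t. t \<in> {0..T} \<Longrightarrow> b t \<in> borel_measurable (F t)"
    and X0: "X0 \<in> borel_measurable (F 0)" "sq_integrable M X0" and t: "t \<in> {0..T}"
  shows "expectation (\<lambda>\<omega>. (X0 \<omega> + (\<integral>s. indicator {0..t} s * b s \<omega> \<partial>time_measure T)) * J t \<omega>) =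
    (\<integral>(s, \<omega>). indicator {0..t} s * (b s \<omega> * (Y s \<omega> - Y 0 \<omega> - (\<integral>r. indicator {0..s} r * c r \<omega> \<partial>time_measure T))) \<partial>PT T)"
proof -
  interpret L: finite_measure "time_measure T" by (rule finite_time_measure)
  interpret P: pair_sigma_finite "time_measure T" M by (rule pair_PT)
  define A where "A t \<omega> = (\<integral>s. indicator {0..t} s * b s \<omega> \<partial>time_measure T)" for t \<omega>
  define C where "C t \<omega> = (\<integral>s. indicator {0..t} s * c s \<omega> \<partial>time_measure T)" for t \<omega>
  \<comment> \<open>A jointly measurable substitute for J, equal to it almost surely at every fixed
    time; J itself cannot be placed under the time integral.\<close>
  define J' where "J' t \<omega> = Y t \<omega> - Y 0 \<omega> - C t \<omega>" for t \<omega>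
  from Y have Y1: "sq_integrable (PT T) (\<lambda>(t, \<omega>). Y t \<omega>)" and Yt: "\<And>t. t \<in> {0..T} \<Longrightarrow> sq_integrable M (Y t)"
    and c: "sq_integrable (PT T) (\<lambda>(t, \<omega>). c t \<omega>)"
    and gm: "(\<lambda>(t, \<omega>). g t \<omega>) \<in> borel_measurable (PT T)" and ito: "has_ito_integral M B T g J"
    and eq: "\<And>t. t \<in> {0..T} \<Longrightarrow> AE \<omega> in M. Y t \<omega> = Y 0 \<omega> + C t \<omega> + J t \<omega>"
    by (auto simp: ito_process_def C_def)
  have J_eq: "AE \<omega> in M. J s \<omega> = J' s \<omega>" if "s \<in> {0..T}" for s
    using eq[OF that] by eventually_elim (simp add: J'_def)
  have J: "sq_integrable M (J s)" if "s \<in> {0..T}" for s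
    using has_ito_integral_isometry(2)[OF T ito ito gm gm] that by simp
  note A = drift_sq_integrable[OF b(1) T, folded A_def]
  note Cs = drift_sq_integrable[OF c T, folded C_def]
  have t0: "0 \<in> {0..T}" using T by simp
  have J'sq: "sq_integrable (PT T) (\<lambda>(s, \<omega>). J' s \<omega>)"
    using sq_integrable_diff[OF sq_integrable_diff[OF Y1 sq_integrable_PT_const[OF Yt[OF t0]]] Cs(1)]
    by (simp add: J'_def split_beta')
  have J0: "AE \<omega> in M. J 0 \<omega> = 0"
  proof -
    have "C 0 \<omega> = 0" for \<omega>
      unfolding C_def by (rule integral_eq_zero_AE) (use AE_time_measure_neq[of 0 T] in eventually_elim, auto simp: indicator_def)
    then show ?thesis using J_eq[OF t0] by (simp add: J'_def)
  qed
  have EX0: "expectation (\<lambda>\<omega>. X0 \<omega> * J t \<omega>) = 0"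
  proof -
    have "expectation (\<lambda>\<omega>. X0 \<omega> * J t \<omega>) = expectation (\<lambda>\<omega>. X0 \<omega> * (J t \<omega> - J 0 \<omega>))"
      using J0 sq_integrable_measurable[OF X0(2)] sq_integrable_measurable[OF J[OF t]] sq_integrable_measurable[OF J[OF t0]]
      by (intro integral_cong_AE) auto
    also have "\<dots> = 0" using t T by (intro has_ito_integral_orthogonal[OF ito _ _ _ X0]) auto
    finally show ?thesis .
  qed
  let ?i = "\<lambda>z. indicator {0..t} (fst z) :: real"
  have im: "?i \<in> borel_measurable (PT T)" by measurable
  have ib: "AE z in PT T. \<bar>?i z\<bar> \<le> 1" by (simp add: indicator_def)
  note ibs = sq_integrable_bounded[OF b(1) im ib]
  have i1: "integrable (PT T) (\<lambda>(s, \<omega>). indicator {0..t} s * (b s \<omega> * J t \<omega>))"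
    using sq_integrable_mult[OF ibs sq_integrable_PT_const[OF J[OF t]]] by (simp add: split_beta' mult.assoc)
  have i2: "integrable (PT T) (\<lambda>(s, \<omega>). indicator {0..t} s * (b s \<omega> * J' s \<omega>))"
    using sq_integrable_mult[OF ibs J'sq] by (simp add: split_beta' mult.assoc)
  have "expectation (\<lambda>\<omega>. A t \<omega> * J t \<omega>) = (\<integral>\<omega>. \<integral>s. indicator {0..t} s * (b s \<omega> * J t \<omega>) \<partial>time_measure T \<partial>M)"
  proof (intro Bochner_Integration.integral_cong refl)
    fix \<omega>
    have "A t \<omega> * J t \<omega> = (\<integral>s. (indicator {0..t} s * b s \<omega>) * J t \<omega> \<partial>time_measure T)"
      unfolding A_def by simp
    then show "A t \<omega> * J t \<omega> = (\<integral>s. indicator {0..t} s * (b s \<omega> * J t \<omega>) \<partial>time_measure T)"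
      by (simp only: mult.assoc)
  qed
  also have "\<dots> = (\<integral>(s, \<omega>). indicator {0..t} s * (b s \<omega> * J t \<omega>) \<partial>PT T)"
    by (rule P.integral_snd[OF i1])
  also have "\<dots> = (\<integral>s. \<integral>\<omega>. indicator {0..t} s * (b s \<omega> * J t \<omega>) \<partial>M \<partial>time_measure T)"
    by (rule P.integral_fst[OF i1, symmetric])
  also have "\<dots> = (\<integral>s. \<integral>\<omega>. indicator {0..t} s * (b s \<omega> * J' s \<omega>) \<partial>M \<partial>time_measure T)"
  proof (rule integral_cong_AE)
    show "(\<lambda>s. \<integral>\<omega>. indicator {0..t} s * (b s \<omega> * J t \<omega>) \<partial>M) \<in> borel_measurable (time_measure T)"
      using i1 by (intro borel_measurable_lebesgue_integral) auto
    show "(\<lambda>s. \<integral>\<omega>. indicator {0..t} s * (b s \<omega> * J' s \<omega>) \<partial>M) \<in> borel_measurable (time_measure T)"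
      using i2 by (intro borel_measurable_lebesgue_integral) auto
    show "AE s in time_measure T. (\<integral>\<omega>. indicator {0..t} s * (b s \<omega> * J t \<omega>) \<partial>M) = (\<integral>\<omega>. indicator {0..t} s * (b s \<omega> * J' s \<omega>) \<partial>M)"
      \<comment> \<open>b_s belongs to L^2 of the probability space only for almost every s, which
        is enough inside the integral.\<close>
      using sq_integrable_PT_fst[OF b(1)] AE_space
    proof eventually_elim
      case (elim s)
      then have s: "s \<in> {0..T}" by simp
      show ?case
      proof (cases "s \<le> t")
        case True
        have "expectation (\<lambda>\<omega>. b s \<omega> * (J t \<omega> - J s \<omega>)) = 0"
          using s t True by (intro has_ito_integral_orthogonal[OF ito _ _ _ b(2)[OF s] elim(1)]) auto
        then have "expectation (\<lambda>\<omega>. b s \<omega> * J t \<omega>) = expectation (\<lambda>\<omega>. b s \<omega> * J s \<omega>)"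
          using sq_integrable_mult[OF elim(1) J[OF t]] sq_integrable_mult[OF elim(1) J[OF s]]
          by (simp add: right_diff_distrib)
        also have "\<dots> = expectation (\<lambda>\<omega>. b s \<omega> * J' s \<omega>)"
        proof (rule integral_cong_AE)
          show "AE \<omega> in M. b s \<omega> * J s \<omega> = b s \<omega> * J' s \<omega>" using J_eq[OF s] by eventually_elim simp
          have "J' s \<in> borel_measurable M"
            using measurable_Pair2[OF sq_integrable_measurable[OF J'sq], of s] s by simp
          then show "(\<lambda>\<omega>. b s \<omega> * J' s \<omega>) \<in> borel_measurable M"
            using sq_integrable_measurable[OF elim(1)] by auto
        qed (use sq_integrable_measurable[OF elim(1)] sq_integrable_measurable[OF J[OF s]] in auto)
        finally show ?thesis by simp
      qed simp
    qed
  qed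
  also have "\<dots> = (\<integral>(s, \<omega>). indicator {0..t} s * (b s \<omega> * J' s \<omega>) \<partial>PT T)"
    by (rule P.integral_fst[OF i2])
  finally have EA: "expectation (\<lambda>\<omega>. A t \<omega> * J t \<omega>) = (\<integral>(s, \<omega>). indicator {0..t} s * (b s \<omega> * J' s \<omega>) \<partial>PT T)" .
  have "expectation (\<lambda>\<omega>. (X0 \<omega> + A t \<omega>) * J t \<omega>) = expectation (\<lambda>\<omega>. X0 \<omega> * J t \<omega>) + expectation (\<lambda>\<omega>. A t \<omega> * J t \<omega>)"
    using sq_integrable_mult[OF X0(2) J[OF t]] sq_integrable_mult[OF A(2)[OF t] J[OF t]] by (simp add: distrib_right)
  then show ?thesis unfolding EX0 EA by (simp add: A_def J'_def C_def)
qed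

text \<open>Split X and Y into start plus drift plus stochastic integral. The two smooth parts
  multiply pathwise by integration by parts, the cross terms are
  \<open>drift_martingale_product\<close>, and the product of the stochastic integrals is the
  isometry. No Ito formula along paths is needed, since only expectations are claimed.\<close>

theorem ito_product_rule:
  assumes T: "0 < T" and X: "ito_process T X b g J" and Y: "ito_process T Y c g' J'" and t: "t \<in> {0..T}"
  shows "integrable (PT T) (\<lambda>(s, \<omega>). indicator {0..t} s * (b s \<omega> * Y s \<omega> + X s \<omega> * c s \<omega> + g s \<omega> * g' s \<omega>))"
    "expectation (\<lambda>\<omega>. X t \<omega> * Y t \<omega>) = expectation (\<lambda>\<omega>. X 0 \<omega> * Y 0 \<omega>)
     + (\<integral>(s, \<omega>). indicator {0..t} s * (b s \<omega> * Y s \<omega> + X s \<omega> * c s \<omega> + g s \<omega> * g' s \<omega>) \<partial>PT T)"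
proof -
  interpret L: finite_measure "time_measure T" by (rule finite_time_measure)
  interpret P: pair_sigma_finite "time_measure T" M by (rule pair_PT)
  define A where "A t \<omega> = (\<integral>s. indicator {0..t} s * b s \<omega> \<partial>time_measure T)" for t \<omega>
  define C where "C t \<omega> = (\<integral>s. indicator {0..t} s * c s \<omega> \<partial>time_measure T)" for t \<omega>
  define I' where "I' t \<omega> = X t \<omega> - X 0 \<omega> - A t \<omega>" for t \<omega>
  define J'' where "J'' t \<omega> = Y t \<omega> - Y 0 \<omega> - C t \<omega>" for t \<omega>
  have t0: "0 \<in> {0..T}" using T by simp
  from X have X1: "sq_integrable (PT T) (\<lambda>(t, \<omega>). X t \<omega>)" and Xt: "\<And>t. t \<in> {0..T} \<Longrightarrow> sq_integrable M (X t)"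
    and X0: "X 0 \<in> borel_measurable (F 0)"
    and b: "sq_integrable (PT T) (\<lambda>(t, \<omega>). b t \<omega>)" "\<And>t. t \<in> {0..T} \<Longrightarrow> b t \<in> borel_measurable (F t)"
    and gm: "(\<lambda>(t, \<omega>). g t \<omega>) \<in> borel_measurable (PT T)" and ito: "has_ito_integral M B T g J"
    and eqX: "\<And>t. t \<in> {0..T} \<Longrightarrow> AE \<omega> in M. X t \<omega> = X 0 \<omega> + A t \<omega> + J t \<omega>"
    by (auto simp: ito_process_def A_def)
  from Y have Y1: "sq_integrable (PT T) (\<lambda>(t, \<omega>). Y t \<omega>)" and Yt: "\<And>t. t \<in> {0..T} \<Longrightarrow> sq_integrable M (Y t)"
    and Y0: "Y 0 \<in> borel_measurable (F 0)"
    and c: "sq_integrable (PT T) (\<lambda>(t, \<omega>). c t \<omega>)" "\<And>t. t \<in> {0..T} \<Longrightarrow> c t \<in> borel_measurable (F t)"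
    and gm': "(\<lambda>(t, \<omega>). g' t \<omega>) \<in> borel_measurable (PT T)" and ito': "has_ito_integral M B T g' J'"
    and eqY: "\<And>t. t \<in> {0..T} \<Longrightarrow> AE \<omega> in M. Y t \<omega> = Y 0 \<omega> + C t \<omega> + J' t \<omega>"
    by (auto simp: ito_process_def C_def)
  have t': "0 \<le> t" "t \<le> T" using t by auto
  note iso = has_ito_integral_isometry[OF T ito ito' gm gm' t']
  note iso' = has_ito_integral_isometry(2,3)[OF T ito' ito gm' gm t']
  note A = drift_sq_integrable[OF b(1) T, folded A_def]
  note Cs = drift_sq_integrable[OF c(1) T, folded C_def]
  note XA = sq_integrable_add[OF Xt[OF t0] A(2)[OF t]]
  note YC = sq_integrable_add[OF Yt[OF t0] Cs(2)[OF t]]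
  note X0P = sq_integrable_PT_const[OF Xt[OF t0]] and Y0P = sq_integrable_PT_const[OF Yt[OF t0]]
  let ?i = "\<lambda>z. indicator {0..t} (fst z) :: real"
  have im: "?i \<in> borel_measurable (PT T)" by measurable
  have ib: "AE z in PT T. \<bar>?i z\<bar> \<le> 1" by (simp add: indicator_def)
  have prod: "integrable (PT T) (\<lambda>(s, \<omega>). indicator {0..t} s * (u s \<omega> * v s \<omega>))"
    if "sq_integrable (PT T) (\<lambda>(s, \<omega>). u s \<omega>)" "sq_integrable (PT T) (\<lambda>(s, \<omega>). v s \<omega>)" for u v :: "real \<Rightarrow> 'a \<Rightarrow> real"
    using sq_integrable_mult[OF sq_integrable_bounded[OF that(1) im ib] that(2)] by (simp add: split_beta' mult.assoc)
  have I'sq: "sq_integrable (PT T) (\<lambda>(s, \<omega>). I' s \<omega>)"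
    using sq_integrable_diff[OF sq_integrable_diff[OF X1 X0P] A(1)] by (simp add: I'_def split_beta')
  have J''sq: "sq_integrable (PT T) (\<lambda>(s, \<omega>). J'' s \<omega>)"
    using sq_integrable_diff[OF sq_integrable_diff[OF Y1 Y0P] Cs(1)] by (simp add: J''_def split_beta')
  have U: "sq_integrable (PT T) (\<lambda>(s, \<omega>). X 0 \<omega> + A s \<omega>)"
    using sq_integrable_add[OF X0P A(1)] by (simp add: split_beta')
  have V: "sq_integrable (PT T) (\<lambda>(s, \<omega>). Y 0 \<omega> + C s \<omega>)"
    using sq_integrable_add[OF Y0P Cs(1)] by (simp add: split_beta')
  note p1 = prod[OF b(1) V] and p2 = prod[OF c(1) U] and p3 = prod[OF b(1) J''sq] and p4 = prod[OF c(1) I'sq]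
    and p5 = prod[OF iso(3) iso'(2)]
  have pathwise: "AE \<omega> in M. (X 0 \<omega> + A t \<omega>) * (Y 0 \<omega> + C t \<omega>) = X 0 \<omega> * Y 0 \<omega> +
     ((\<integral>s. indicator {0..t} s * (b s \<omega> * (Y 0 \<omega> + C s \<omega>)) \<partial>time_measure T)
    + (\<integral>s. indicator {0..t} s * (c s \<omega> * (X 0 \<omega> + A s \<omega>)) \<partial>time_measure T))"
    using sq_integrable_PT_snd[OF b(1)] sq_integrable_PT_snd[OF c(1)]
  proof eventually_elim
    case (elim \<omega>)
    have ib: "integrable (time_measure T) (\<lambda>s. b s \<omega>)" and ic: "integrable (time_measure T) (\<lambda>s. c s \<omega>)"
      using elim sq_integrable_imp_integrable[OF finite_time_measure] by blast+
    note ibp = indefinite_integral_product[OF ib ic t'(2), folded A_def C_def]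
    have mi: "(indicator {0..t} :: real \<Rightarrow> real) \<in> borel_measurable (time_measure T)" by measurable
    have i1: "integrable (time_measure T) (\<lambda>s. indicator {0..t} s * b s \<omega>)" and i2: "integrable (time_measure T) (\<lambda>s. indicator {0..t} s * c s \<omega>)"
      by (rule Bochner_Integration.integrable_bound[OF ib], use ib mi in auto, simp add: indicator_def)
         (rule Bochner_Integration.integrable_bound[OF ic], use ic mi in auto, simp add: indicator_def)
    have "(\<integral>s. indicator {0..t} s * (b s \<omega> * (Y 0 \<omega> + C s \<omega>)) \<partial>time_measure T) =
       (\<integral>s. Y 0 \<omega> * (indicator {0..t} s * b s \<omega>) + indicator {0..t} s * (b s \<omega> * C s \<omega>) \<partial>time_measure T)"
      by (intro Bochner_Integration.integral_cong) (auto simp: algebra_simps)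
    also have "\<dots> = Y 0 \<omega> * A t \<omega> + (\<integral>s. indicator {0..t} s * (b s \<omega> * C s \<omega>) \<partial>time_measure T)"
      using i1 ibp(2) by (simp add: A_def)
    finally have e1: "(\<integral>s. indicator {0..t} s * (b s \<omega> * (Y 0 \<omega> + C s \<omega>)) \<partial>time_measure T) =
       Y 0 \<omega> * A t \<omega> + (\<integral>s. indicator {0..t} s * (b s \<omega> * C s \<omega>) \<partial>time_measure T)" .
    have "(\<integral>s. indicator {0..t} s * (c s \<omega> * (X 0 \<omega> + A s \<omega>)) \<partial>time_measure T) =
       (\<integral>s. X 0 \<omega> * (indicator {0..t} s * c s \<omega>) + indicator {0..t} s * (A s \<omega> * c s \<omega>) \<partial>time_measure T)"
      by (intro Bochner_Integration.integral_cong) (auto simp: algebra_simps)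
    also have "\<dots> = X 0 \<omega> * C t \<omega> + (\<integral>s. indicator {0..t} s * (A s \<omega> * c s \<omega>) \<partial>time_measure T)"
      using i2 ibp(3) by (simp add: C_def)
    finally have e2: "(\<integral>s. indicator {0..t} s * (c s \<omega> * (X 0 \<omega> + A s \<omega>)) \<partial>time_measure T) =
       X 0 \<omega> * C t \<omega> + (\<integral>s. indicator {0..t} s * (A s \<omega> * c s \<omega>) \<partial>time_measure T)" .
    have "(X 0 \<omega> + A t \<omega>) * (Y 0 \<omega> + C t \<omega>) = X 0 \<omega> * Y 0 \<omega> + Y 0 \<omega> * A t \<omega> + X 0 \<omega> * C t \<omega> + A t \<omega> * C t \<omega>"
      by (simp add: algebra_simps)
    then show ?case unfolding e1 e2 ibp(1) by simp
  qed
  have q1: "integrable M (\<lambda>\<omega>. \<integral>s. indicator {0..t} s * (b s \<omega> * (Y 0 \<omega> + C s \<omega>)) \<partial>time_measure T)"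
    using P.integrable_snd[OF p1] .
  have q2: "integrable M (\<lambda>\<omega>. \<integral>s. indicator {0..t} s * (c s \<omega> * (X 0 \<omega> + A s \<omega>)) \<partial>time_measure T)"
    using P.integrable_snd[OF p2] .
  have "expectation (\<lambda>\<omega>. (X 0 \<omega> + A t \<omega>) * (Y 0 \<omega> + C t \<omega>)) = expectation (\<lambda>\<omega>. X 0 \<omega> * Y 0 \<omega> +
     ((\<integral>s. indicator {0..t} s * (b s \<omega> * (Y 0 \<omega> + C s \<omega>)) \<partial>time_measure T)
    + (\<integral>s. indicator {0..t} s * (c s \<omega> * (X 0 \<omega> + A s \<omega>)) \<partial>time_measure T)))"
    using pathwise sq_integrable_measurable[OF XA] sq_integrable_measurable[OF YC]
      sq_integrable_measurable[OF Xt[OF t0]] sq_integrable_measurable[OF Yt[OF t0]] borel_measurable_integrable[OF q1] borel_measurable_integrable[OF q2]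
    by (intro integral_cong_AE) auto
  also have "\<dots> = expectation (\<lambda>\<omega>. X 0 \<omega> * Y 0 \<omega>) +
     (expectation (\<lambda>\<omega>. \<integral>s. indicator {0..t} s * (b s \<omega> * (Y 0 \<omega> + C s \<omega>)) \<partial>time_measure T)
    + expectation (\<lambda>\<omega>. \<integral>s. indicator {0..t} s * (c s \<omega> * (X 0 \<omega> + A s \<omega>)) \<partial>time_measure T))"
    using q1 q2 sq_integrable_mult[OF Xt[OF t0] Yt[OF t0]] by simp
  finally have E1: "expectation (\<lambda>\<omega>. (X 0 \<omega> + A t \<omega>) * (Y 0 \<omega> + C t \<omega>)) = expectation (\<lambda>\<omega>. X 0 \<omega> * Y 0 \<omega>)
     + ((\<integral>(s, \<omega>). indicator {0..t} s * (b s \<omega> * (Y 0 \<omega> + C s \<omega>)) \<partial>PT T)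
     + (\<integral>(s, \<omega>). indicator {0..t} s * (c s \<omega> * (X 0 \<omega> + A s \<omega>)) \<partial>PT T))"
    unfolding P.integral_snd[OF p1] P.integral_snd[OF p2] .
  have E2: "expectation (\<lambda>\<omega>. (X 0 \<omega> + A t \<omega>) * J' t \<omega>) = (\<integral>(s, \<omega>). indicator {0..t} s * (b s \<omega> * J'' s \<omega>) \<partial>PT T)"
    using drift_martingale_product[OF T Y b X0 Xt[OF t0] t] by (simp only: A_def C_def J''_def)
  have E3: "expectation (\<lambda>\<omega>. (Y 0 \<omega> + C t \<omega>) * J t \<omega>) = (\<integral>(s, \<omega>). indicator {0..t} s * (c s \<omega> * I' s \<omega>) \<partial>PT T)"
    using drift_martingale_product[OF T X c Y0 Yt[OF t0] t] by (simp only: A_def C_def I'_def)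
  have "expectation (\<lambda>\<omega>. X t \<omega> * Y t \<omega>) = expectation (\<lambda>\<omega>. (X 0 \<omega> + A t \<omega>) * (Y 0 \<omega> + C t \<omega>)
      + (X 0 \<omega> + A t \<omega>) * J' t \<omega> + (Y 0 \<omega> + C t \<omega>) * J t \<omega> + J t \<omega> * J' t \<omega>)"
  proof (rule integral_cong_AE)
    show "AE \<omega> in M. X t \<omega> * Y t \<omega> = (X 0 \<omega> + A t \<omega>) * (Y 0 \<omega> + C t \<omega>)
      + (X 0 \<omega> + A t \<omega>) * J' t \<omega> + (Y 0 \<omega> + C t \<omega>) * J t \<omega> + J t \<omega> * J' t \<omega>"
      using eqX[OF t] eqY[OF t] by eventually_elim (simp add: algebra_simps)
  qed (use sq_integrable_measurable[OF XA] sq_integrable_measurable[OF YC] sq_integrable_measurable[OF iso(2)]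
      sq_integrable_measurable[OF iso'(1)] sq_integrable_measurable[OF Xt[OF t]] sq_integrable_measurable[OF Yt[OF t]] in auto)
  also have "\<dots> = expectation (\<lambda>\<omega>. (X 0 \<omega> + A t \<omega>) * (Y 0 \<omega> + C t \<omega>)) + expectation (\<lambda>\<omega>. (X 0 \<omega> + A t \<omega>) * J' t \<omega>)
      + expectation (\<lambda>\<omega>. (Y 0 \<omega> + C t \<omega>) * J t \<omega>) + expectation (\<lambda>\<omega>. J t \<omega> * J' t \<omega>)"
    using sq_integrable_mult[OF XA YC] sq_integrable_mult[OF XA iso'(1)] sq_integrable_mult[OF YC iso(2)] sq_integrable_mult[OF iso(2) iso'(1)]
    by simp
  also have "\<dots> = expectation (\<lambda>\<omega>. X 0 \<omega> * Y 0 \<omega>) +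
     (((\<integral>(s, \<omega>). indicator {0..t} s * (b s \<omega> * (Y 0 \<omega> + C s \<omega>)) \<partial>PT T)
     + (\<integral>(s, \<omega>). indicator {0..t} s * (c s \<omega> * (X 0 \<omega> + A s \<omega>)) \<partial>PT T)
     + (\<integral>(s, \<omega>). indicator {0..t} s * (b s \<omega> * J'' s \<omega>) \<partial>PT T)
     + (\<integral>(s, \<omega>). indicator {0..t} s * (c s \<omega> * I' s \<omega>) \<partial>PT T))
     + (\<integral>(s, \<omega>). indicator {0..t} s * (g s \<omega> * g' s \<omega>) \<partial>PT T))"
    unfolding E1 E2 E3 iso(1) by simp
  finally have fin: "expectation (\<lambda>\<omega>. X t \<omega> * Y t \<omega>) = \<dots>" .
  \<comment> \<open>Regrouping: Y 0 + C + J'' is Y again, and X 0 + A + I' is X.\<close>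
  have split: "(\<lambda>(s, \<omega>). indicator {0..t} s * (b s \<omega> * Y s \<omega> + X s \<omega> * c s \<omega> + g s \<omega> * g' s \<omega>)) =
    (\<lambda>z. (case z of (s, \<omega>) \<Rightarrow> indicator {0..t} s * (b s \<omega> * (Y 0 \<omega> + C s \<omega>)))
     + (case z of (s, \<omega>) \<Rightarrow> indicator {0..t} s * (c s \<omega> * (X 0 \<omega> + A s \<omega>)))
     + (case z of (s, \<omega>) \<Rightarrow> indicator {0..t} s * (b s \<omega> * J'' s \<omega>))
     + (case z of (s, \<omega>) \<Rightarrow> indicator {0..t} s * (c s \<omega> * I' s \<omega>))
     + (case z of (s, \<omega>) \<Rightarrow> indicator {0..t} s * (g s \<omega> * g' s \<omega>)))"
    by (auto simp: fun_eq_iff I'_def J''_def algebra_simps)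
  show "integrable (PT T) (\<lambda>(s, \<omega>). indicator {0..t} s * (b s \<omega> * Y s \<omega> + X s \<omega> * c s \<omega> + g s \<omega> * g' s \<omega>))"
    unfolding split using p1 p2 p3 p4 p5 by (intro Bochner_Integration.integrable_add)
  show "expectation (\<lambda>\<omega>. X t \<omega> * Y t \<omega>) = expectation (\<lambda>\<omega>. X 0 \<omega> * Y 0 \<omega>)
     + (\<integral>(s, \<omega>). indicator {0..t} s * (b s \<omega> * Y s \<omega> + X s \<omega> * c s \<omega> + g s \<omega> * g' s \<omega>) \<partial>PT T)"
    unfolding fin split using p1 p2 p3 p4 p5 by simp
qed

end

section \<open>Joint measurability and time-dependent coefficients\<close>

lemma continuous_function_jointly_measurable:
  fixes X :: "real \<Rightarrow> 'a \<Rightarrow> real"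
  assumes T: "0 \<le> T" and m: "\<And>t. t \<in> {0..T} \<Longrightarrow> X t \<in> borel_measurable M"
    and c: "\<And>\<omega>. \<omega> \<in> space M \<Longrightarrow> continuous_on {0..T} (\<lambda>t. X t \<omega>)"
  shows "(\<lambda>(t, \<omega>). X t \<omega>) \<in> borel_measurable (time_measure T \<Otimes>\<^sub>M M)"
proof -
  let ?N = "time_measure T \<Otimes>\<^sub>M M"
  \<comment> \<open>Dyadic-style rounding down to a grid of step 1/(n+1). Rounding down keeps the
    grid point inside [0,T], where X is measurable and continuous.\<close>
  define d where "d n t = of_int \<lfloor>t * real (Suc n)\<rfloor> / real (Suc n)" for n t
  have dle: "d n t \<le> t" and dge: "t - 1 / real (Suc n) \<le> d n t" for n t
    unfolding d_def by (simp_all add: pos_divide_le_eq pos_le_divide_eq left_diff_distrib; linarith)+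
  have d0: "0 \<le> d n t" if "0 \<le> t" for n t
    using that unfolding d_def by simp
  have dlim: "(\<lambda>n. d n t) \<longlonglongrightarrow> t" for t
  proof (rule tendsto_sandwich[where f = "\<lambda>n. t - 1 / real (Suc n)" and h = "\<lambda>_. t"])
    have "(\<lambda>n. t - 1 / real (Suc n)) \<longlonglongrightarrow> t - 0"
      by (intro tendsto_diff tendsto_const LIMSEQ_inverse_real_of_nat[unfolded inverse_eq_divide])
    then show "(\<lambda>n. t - 1 / real (Suc n)) \<longlonglongrightarrow> t" by simp
  qed (use dle dge in \<open>auto intro!: always_eventually\<close>)
  have meas: "(\<lambda>z. X (d n (fst z)) (snd z)) \<in> borel_measurable ?N" for n
  proof -
    let ?k = "\<lambda>z. \<lfloor>fst z * real (Suc n)\<rfloor>"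
    define Y where "Y k z = (if 0 \<le> real_of_int k / real (Suc n) \<and> real_of_int k / real (Suc n) \<le> T then X (real_of_int k / real (Suc n)) (snd z) else 0)" for k and z :: "real \<times> 'a"
    have "fst \<in> borel_measurable ?N" by (rule borel_measurable_time_measure[where T = T]) simp
    then have k: "?k \<in> measurable ?N (count_space UNIV)" by measurable
    have Y: "Y k \<in> borel_measurable ?N" for k
    proof (cases "0 \<le> real_of_int k / real (Suc n) \<and> real_of_int k / real (Suc n) \<le> T")
      case True
      then have "X (real_of_int k / real (Suc n)) \<in> borel_measurable M" by (intro m) auto
      then have "(\<lambda>z. X (real_of_int k / real (Suc n)) (snd z)) \<in> borel_measurable ?N"
        by (rule measurable_compose[OF measurable_snd])
      then show ?thesis unfolding Y_def using True by simp
    next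
      case False
      then show ?thesis unfolding Y_def if_not_P[OF False] by simp
    qed
    have "(\<lambda>z. Y (?k z) z) \<in> borel_measurable ?N"
      by (rule measurable_compose_countable[OF Y k])
    moreover have "Y (?k z) z = X (d n (fst z)) (snd z)" if "z \<in> space ?N" for z
      using that d0[of "fst z" n] dle[of n "fst z"] unfolding Y_def d_def by (auto simp: space_pair_measure)
    ultimately show ?thesis by (simp cong: measurable_cong)
  qed
  have "(\<lambda>z. X (fst z) (snd z)) \<in> borel_measurable ?N"
  proof (rule borel_measurable_LIMSEQ_real[OF _ meas])
    fix z assume "z \<in> space ?N"
    then have z: "fst z \<in> {0..T}" "snd z \<in> space M" by (auto simp: space_pair_measure)
    have "continuous (at (fst z) within {0..T}) (\<lambda>t. X t (snd z))"
      using c[OF z(2)] z(1) by (simp add: continuous_on_eq_continuous_within)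
    moreover have "d n (fst z) \<in> {0..T}" for n using d0[of "fst z" n] dle[of n "fst z"] z by auto
    ultimately show "(\<lambda>n. X (d n (fst z)) (snd z)) \<longlonglongrightarrow> X (fst z) (snd z)"
      using dlim[of "fst z"] unfolding continuous_within_sequentially o_def
      by (elim allE[of _ "\<lambda>n. d n (fst z)"]) simp
  qed
  then show ?thesis by (simp add: split_beta')
qed

lemma integral_derivative_time_measure:
  fixes a a' :: "real \<Rightarrow> real"
  assumes T: "0 < T" and a: "\<And>t. t \<in> {0..T} \<Longrightarrow> (a has_real_derivative a' t) (at t within {0..T})"
    and a'c: "continuous_on {0..T} a'" and t: "t \<in> {0..T}"
  shows "integrable (time_measure T) a'" "(\<integral>s. indicator {0..t} s * a' s \<partial>time_measure T) = a t - a 0"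
proof -
  have "set_integrable lborel {0..T} a'"
    using borel_integrable_compact[of "{0..T}" a'] a'c by (simp add: set_integrable_def)
  then show "integrable (time_measure T) a'"
    by (subst integrable_restrict_space) (auto simp: set_integrable_def)
  have "has_bochner_integral lborel (\<lambda>x. indicator {0..t} x *\<^sub>R a' x) (a t - a 0)"
  proof (rule has_bochner_integral_FTC_Icc)
    fix x assume x: "0 \<le> x" "x \<le> t"
    have "(a has_real_derivative a' x) (at x within {0..t})"
      by (rule DERIV_subset[OF a]) (use x t in auto)
    then show "(a has_vector_derivative a' x) (at x within {0..t})"
      by (simp add: has_real_derivative_iff_has_vector_derivative)
  next
    show "0 \<le> t" using t by simp
    show "continuous_on {0..t} a'" using t by (intro continuous_on_subset[OF a'c]) auto
  qed
  then have "(LINT r:{0..t}|lborel. a' r) = a t - a 0"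
    unfolding set_lebesgue_integral_def by (rule has_bochner_integral_integral_eq)
  then show "(\<integral>s. indicator {0..t} s * a' s \<partial>time_measure T) = a t - a 0"
    using t by (subst set_lebesgue_integral_time_measure[symmetric]) auto
qed

context standard_brownian_motion
begin

lemma integrable_PT_times_continuous:
  fixes a :: "real \<Rightarrow> real"
  assumes a: "continuous_on {0..T} a" and f: "integrable (PT T) (\<lambda>(s, \<omega>). f s \<omega> :: real)"
  shows "integrable (PT T) (\<lambda>(s, \<omega>). a s * f s \<omega>)"
proof -
  have "bounded (a ` {0..T})" by (rule compact_imp_bounded[OF compact_continuous_image[OF a compact_Icc]])
  then obtain m where m: "\<forall>x\<in>{0..T}. \<bar>a x\<bar> \<le> m" by (auto simp: bounded_iff)
  have am: "a \<in> borel_measurable (time_measure T)"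
    using borel_measurable_continuous_on_restrict[OF a] by (simp cong: measurable_cong_sets sets_restrict_space_cong)
  show ?thesis
  proof (rule Bochner_Integration.integrable_bound)
    show "integrable (PT T) (\<lambda>z. m * (case z of (s, \<omega>) \<Rightarrow> f s \<omega>))" using f by simp
    show "(\<lambda>(s, \<omega>). a s * f s \<omega>) \<in> borel_measurable (PT T)"
      using am borel_measurable_integrable[OF f] by measurable
    show "AE z in PT T. norm (case z of (s, \<omega>) \<Rightarrow> a s * f s \<omega>) \<le> norm (m * (case z of (s, \<omega>) \<Rightarrow> f s \<omega>))"
    proof (rule AE_I2)
      fix z assume "z \<in> space (PT T)"
      then obtain s \<omega> where z: "z = (s, \<omega>)" "s \<in> {0..T}" by (auto simp: space_pair_measure)
      have "\<bar>a s\<bar> \<le> \<bar>m\<bar>" using m z(2) by force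
      then show "norm (case z of (s, \<omega>) \<Rightarrow> a s * f s \<omega>) \<le> norm (m * (case z of (s, \<omega>) \<Rightarrow> f s \<omega>))"
        by (simp add: z abs_mult mult_right_mono)
    qed
  qed
qed

text \<open>The moment m(t) = E (X_t Y_t) and the coefficient a are both indefinite integrals, so
  \<open>indefinite_integral_product\<close> applied to a - a(0) and m - m(0) gives the product
  formula; the initial values are then restored.\<close>

theorem weighted_product_rule:
  assumes T: "0 < T" and X: "ito_process T X b g J" and Y: "ito_process T Y c g' J'"
    and a: "\<And>t. t \<in> {0..T} \<Longrightarrow> (a has_real_derivative a' t) (at t within {0..T})" and a'c: "continuous_on {0..T} a'"
  shows "integrable (PT T) (\<lambda>(s, \<omega>). a' s * (X s \<omega> * Y s \<omega>) + a s * (b s \<omega> * Y s \<omega> + X s \<omega> * c s \<omega> + g s \<omega> * g' s \<omega>))"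
    "a T * expectation (\<lambda>\<omega>. X T \<omega> * Y T \<omega>) - a 0 * expectation (\<lambda>\<omega>. X 0 \<omega> * Y 0 \<omega>) =
     (\<integral>(s, \<omega>). a' s * (X s \<omega> * Y s \<omega>) + a s * (b s \<omega> * Y s \<omega> + X s \<omega> * c s \<omega> + g s \<omega> * g' s \<omega>) \<partial>PT T)"
proof -
  interpret L: finite_measure "time_measure T" by (rule finite_time_measure)
  interpret P: pair_sigma_finite "time_measure T" M by (rule pair_PT)
  define k where "k s \<omega> = b s \<omega> * Y s \<omega> + X s \<omega> * c s \<omega> + g s \<omega> * g' s \<omega>" for s \<omega>
  define \<kappa> where "\<kappa> s = expectation (k s)" for s
  define m where "m s = expectation (\<lambda>\<omega>. X s \<omega> * Y s \<omega>)" for s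
  have tT: "T \<in> {0..T}" using T by simp
  have ac: "continuous_on {0..T} a"
    unfolding continuous_on_eq_continuous_within using DERIV_continuous[OF a] by blast
  note rule = ito_product_rule[OF T X Y, folded k_def]
  have k: "integrable (PT T) (\<lambda>(s, \<omega>). k s \<omega>)"
    by (rule Bochner_Integration.integrable_cong[THEN iffD1, OF refl _ rule(1)[OF tT]]) (auto simp: space_pair_measure)
  have XY: "integrable (PT T) (\<lambda>(s, \<omega>). X s \<omega> * Y s \<omega>)"
    using sq_integrable_mult[of "PT T" "\<lambda>(t, \<omega>). X t \<omega>" "\<lambda>(t, \<omega>). Y t \<omega>"] X Y by (simp add: ito_process_def split_beta')
  have \<kappa>: "integrable (time_measure T) \<kappa>"
    unfolding \<kappa>_def[abs_def] using P.integrable_fst[of k] k by simp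
  have m_eq: "m t - m 0 = (\<integral>s. indicator {0..t} s * \<kappa> s \<partial>time_measure T)" if t: "t \<in> {0..T}" for t
  proof -
    have "m t - m 0 = (\<integral>(s, \<omega>). indicator {0..t} s * k s \<omega> \<partial>PT T)"
      using rule(2)[OF t] by (simp add: m_def)
    also have "\<dots> = (\<integral>s. \<integral>\<omega>. indicator {0..t} s * k s \<omega> \<partial>M \<partial>time_measure T)"
      by (rule P.integral_fst[symmetric, OF rule(1)[OF t]])
    finally show ?thesis by (simp add: \<kappa>_def)
  qed
  have i_a': "integrable (time_measure T) a'"
    by (rule integral_derivative_time_measure(1)[OF T _ a'c tT]) (rule a)
  have FT: "(\<integral>s. indicator {0..t} s * a' s \<partial>time_measure T) = a t - a 0" if "t \<in> {0..T}" for t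
    by (rule integral_derivative_time_measure(2)[OF T _ a'c that]) (rule a)
  have ind_T: "(\<integral>s. indicator {0..T} s * f s \<partial>time_measure T) = (\<integral>s. f s \<partial>time_measure T)" for f :: "real \<Rightarrow> real"
    by (intro Bochner_Integration.integral_cong) auto
  note ibp = indefinite_integral_product[OF i_a' \<kappa>, of T]
  have cong1: "(\<integral>s. indicator {0..T} s * (a' s * (\<integral>r. indicator {0..s} r * \<kappa> r \<partial>time_measure T)) \<partial>time_measure T) =
      (\<integral>s. a' s * (m s - m 0) \<partial>time_measure T)"
    by (intro Bochner_Integration.integral_cong) (auto simp: m_eq)
  have cong2: "(\<integral>s. indicator {0..T} s * ((\<integral>r. indicator {0..s} r * a' r \<partial>time_measure T) * \<kappa> s) \<partial>time_measure T) =
      (\<integral>s. (a s - a 0) * \<kappa> s \<partial>time_measure T)"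
    by (intro Bochner_Integration.integral_cong) (auto simp: FT)
  have i1: "integrable (PT T) (\<lambda>(s, \<omega>). a' s * (X s \<omega> * Y s \<omega>))"
    by (rule integrable_PT_times_continuous[OF a'c XY])
  have i2: "integrable (PT T) (\<lambda>(s, \<omega>). a s * k s \<omega>)"
    by (rule integrable_PT_times_continuous[OF ac k])
  have j1: "integrable (time_measure T) (\<lambda>s. a' s * m s)"
    unfolding m_def using P.integrable_fst[OF i1] by simp
  have j2: "integrable (time_measure T) (\<lambda>s. a s * \<kappa> s)"
    unfolding \<kappa>_def using P.integrable_fst[OF i2] by simp
  have e0: "(a T - a 0) * (m T - m 0) = (\<integral>s. a' s * (m s - m 0) \<partial>time_measure T) + (\<integral>s. (a s - a 0) * \<kappa> s \<partial>time_measure T)"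
    using ibp(1) FT[OF tT] m_eq[OF tT] unfolding cong1 cong2 by simp
  have e1: "(\<integral>s. a' s * (m s - m 0) \<partial>time_measure T) = (\<integral>s. a' s * m s \<partial>time_measure T) - (a T - a 0) * m 0"
    using j1 i_a' FT[OF tT] by (simp add: right_diff_distrib ind_T)
  have e2: "(\<integral>s. (a s - a 0) * \<kappa> s \<partial>time_measure T) = (\<integral>s. a s * \<kappa> s \<partial>time_measure T) - a 0 * (m T - m 0)"
    using j2 \<kappa> m_eq[OF tT] by (simp add: left_diff_distrib ind_T)
  have "a T * m T - a 0 * m 0 = (\<integral>s. a' s * m s \<partial>time_measure T) + (\<integral>s. a s * \<kappa> s \<partial>time_measure T)"
    using e0 unfolding e1 e2 by (simp add: algebra_simps)
  also have "(\<integral>s. a' s * m s \<partial>time_measure T) = (\<integral>(s, \<omega>). a' s * (X s \<omega> * Y s \<omega>) \<partial>PT T)"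
    using P.integral_fst[OF i1] by (simp add: m_def)
  also have "(\<integral>s. a s * \<kappa> s \<partial>time_measure T) = (\<integral>(s, \<omega>). a s * k s \<omega> \<partial>PT T)"
    using P.integral_fst[OF i2] by (simp add: \<kappa>_def)
  finally have fin: "a T * m T - a 0 * m 0 = (\<integral>(s, \<omega>). a' s * (X s \<omega> * Y s \<omega>) \<partial>PT T) + (\<integral>(s, \<omega>). a s * k s \<omega> \<partial>PT T)" .
  have split: "(\<lambda>(s, \<omega>). a' s * (X s \<omega> * Y s \<omega>) + a s * k s \<omega>) =
     (\<lambda>z. (case z of (s, \<omega>) \<Rightarrow> a' s * (X s \<omega> * Y s \<omega>)) + (case z of (s, \<omega>) \<Rightarrow> a s * k s \<omega>))"
    by auto
  show "integrable (PT T) (\<lambda>(s, \<omega>). a' s * (X s \<omega> * Y s \<omega>) + a s * (b s \<omega> * Y s \<omega> + X s \<omega> * c s \<omega> + g s \<omega> * g' s \<omega>))"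
    unfolding k_def[symmetric] split using i1 i2 by simp
  show "a T * expectation (\<lambda>\<omega>. X T \<omega> * Y T \<omega>) - a 0 * expectation (\<lambda>\<omega>. X 0 \<omega> * Y 0 \<omega>) =
     (\<integral>(s, \<omega>). a' s * (X s \<omega> * Y s \<omega>) + a s * (b s \<omega> * Y s \<omega> + X s \<omega> * c s \<omega> + g s \<omega> * g' s \<omega>) \<partial>PT T)"
    unfolding k_def[symmetric] split using i1 i2 fin by (simp add: m_def)
qed

end

section \<open>Carleman estimate\<close>

text \<open>Raw path functionals of w are controlled only off a null set. Completeness makes them
  measurable, so that their integrals equal those of the modified process.\<close>

lemma (in complete_measure) measurable_cong_AE_complete:
  fixes f g :: "'a \<Rightarrow> real"
  assumes g: "g \<in> borel_measurable M" and eq: "AE x in M. f x = g x"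
  shows "f \<in> borel_measurable M"
proof (rule measurableI)
  fix A :: "real set" assume A: "A \<in> sets borel"
  obtain N where N: "{x \<in> space M. f x \<noteq> g x} \<subseteq> N" "N \<in> null_sets M"
    using eq unfolding eventually_ae_filter by blast
  have "f -` A \<inter> space M = (g -` A \<inter> space M - N) \<union> (f -` A \<inter> space M \<inter> N)"
    using N(1) by auto
  moreover have "f -` A \<inter> space M \<inter> N \<in> sets M" using complete[OF _ N(2)] by auto
  moreover have "g -` A \<inter> space M - N \<in> sets M" using measurable_sets[OF g A] N(2) by auto
  ultimately show "f -` A \<inter> space M \<in> sets M" by (metis sets.Un)
qed simp

lemma (in complete_measure) integral_cong_AE_complete:
  fixes f g :: "'a \<Rightarrow> real"
  assumes "g \<in> borel_measurable M" "AE x in M. f x = g x"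
  shows "(\<integral>x. f x \<partial>M) = (\<integral>x. g x \<partial>M)"
  using measurable_cong_AE_complete[OF assms] assms by (intro integral_cong_AE) auto

lemma sets_PT: "sets (restrict_space borel {0..T} \<Otimes>\<^sub>M M) = sets (time_measure T \<Otimes>\<^sub>M M)"
  by (intro sets_pair_measure_cong sets_restrict_space_cong) simp_all

lemma mesh_mem: "i < N \<Longrightarrow> real (Suc i) * mesh_size N \<in> mesh N"
  unfolding mesh_def by (rule image_eqI[of _ _ "Suc i"]) auto

lemma closed_mesh_mem: "i \<le> Suc N \<Longrightarrow> real i * mesh_size N \<in> closed_mesh N"
  unfolding closed_mesh_def by (rule image_eqI[of _ _ i]) auto

lemma finite_meshes: "finite (mesh N)" "finite (closed_mesh N)" "finite (dual_mesh N)"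
  by (simp_all add: mesh_def closed_mesh_def dual_mesh_def)

lemma mesh_size_pos: "0 < mesh_size N" by (simp add: mesh_size_def)

lemma sum_mesh: "(\<Sum>x\<in>mesh N. u x) = (\<Sum>i<N. u (real (Suc i) * mesh_size N))"
proof -
  have "mesh N = (\<lambda>i. real (Suc i) * mesh_size N) ` {..<N}"
    unfolding mesh_def by (auto simp: image_iff Bex_def gr0_conv_Suc Suc_le_eq) (metis Suc_le_eq Suc_pred' Suc_le_lessD of_nat_Suc)+
  moreover have "inj_on (\<lambda>i. real (Suc i) * mesh_size N) {..<N}"
    using mesh_size_pos[of N] by (auto simp: inj_on_def)
  ultimately show ?thesis by (simp add: sum.reindex)
qed

lemma sum_dual_mesh: "(\<Sum>x\<in>dual_mesh N. u x) = (\<Sum>i\<le>N. u (real i * mesh_size N + mesh_size N / 2))"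
proof -
  have "inj_on (\<lambda>i. real i * mesh_size N + mesh_size N / 2) {0..N}"
    using mesh_size_pos[of N] by (auto simp: inj_on_def)
  then show ?thesis by (simp add: dual_mesh_def sum.reindex atLeast0AtMost)
qed

context standard_brownian_motion
begin

text \<open>Connects the iterated integral in the statement, taken of the original process, with the
  product-measure integral of a well-behaved representative.\<close>

lemma expected_time_integral_eq:
  assumes "complete_measure M" and G: "integrable (PT T) (\<lambda>(t, \<omega>). G t \<omega>)"
    and eq: "AE \<omega> in M. \<forall>t\<in>{0..T}. Fn t \<omega> = G t \<omega>"
  shows "expected_time_integral M T Fn = (\<integral>(t, \<omega>). G t \<omega> \<partial>PT T)"
proof -
  interpret C: complete_measure M by fact
  interpret P: pair_sigma_finite "time_measure T" M by (rule pair_PT)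
  have inner: "(LINT t:{0..T}|lborel. Fn t \<omega>) = (\<integral>t. G t \<omega> \<partial>time_measure T)" if "\<forall>t\<in>{0..T}. Fn t \<omega> = G t \<omega>" for \<omega>
    unfolding set_lebesgue_integral_time_measure[OF order_refl]
    using that by (intro Bochner_Integration.integral_cong) auto
  have "AE \<omega> in M. (LINT t:{0..T}|lborel. Fn t \<omega>) = (\<integral>t. G t \<omega> \<partial>time_measure T)"
    using eq by eventually_elim (rule inner)
  then have "expected_time_integral M T Fn = (\<integral>\<omega>. \<integral>t. G t \<omega> \<partial>time_measure T \<partial>M)"
    unfolding expected_time_integral_def
    by (intro C.integral_cong_AE_complete borel_measurable_integrable[OF P.integrable_snd[OF G]])
  also have "\<dots> = (\<integral>(t, \<omega>). G t \<omega> \<partial>PT T)"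
    by (rule P.integral_snd[OF G])
  finally show ?thesis .
qed

lemma L2F_sq_integrable:
  assumes f: "f \<in> L2F M B T h W" and W: "finite W" "x \<in> W" and h: "0 < h"
  shows "sq_integrable (PT T) (\<lambda>(t, \<omega>). f t \<omega> x)"
proof -
  interpret P: pair_sigma_finite "time_measure T" M by (rule pair_PT)
  have m: "(\<lambda>(t, \<omega>). f t \<omega> x) \<in> borel_measurable (PT T)"
    using f W(2) unfolding L2F_def by (simp add: measurable_cong_sets[OF sets_PT refl])
  have m2: "(\<lambda>z. ennreal (h * (case z of (t, \<omega>) \<Rightarrow> f t \<omega> x)\<^sup>2)) \<in> borel_measurable (PT T)"
    using m by measurable
  have "(\<integral>\<^sup>+z. ennreal (h * (case z of (t, \<omega>) \<Rightarrow> f t \<omega> x)\<^sup>2) \<partial>PT T)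
      = (\<integral>\<^sup>+\<omega>. (\<integral>\<^sup>+t. ennreal (h * (f t \<omega> x)\<^sup>2) \<partial>time_measure T) \<partial>M)"
    using P.nn_integral_snd[OF m2] by simp
  also have "\<dots> \<le> (\<integral>\<^sup>+\<omega>. (\<integral>\<^sup>+t\<in>{0..T}. ennreal (mesh_integral h W (\<lambda>x. (f t \<omega> x)\<^sup>2)) \<partial>lborel) \<partial>M)"
    unfolding nn_integral_restrict_space[of "{0..T}" lborel, simplified]
  proof (intro nn_integral_mono mult_right_mono ennreal_leI)
    fix t \<omega>
    have "(f t \<omega> x)\<^sup>2 \<le> (\<Sum>x\<in>W. (f t \<omega> x)\<^sup>2)" using W by (intro member_le_sum) auto
    then show "h * (f t \<omega> x)\<^sup>2 \<le> mesh_integral h W (\<lambda>x. (f t \<omega> x)\<^sup>2)"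
      using h by (simp add: mesh_integral_def)
  qed auto
  also have "\<dots> < \<infinity>" using f by (simp add: L2F_def)
  finally have "integrable (PT T) (\<lambda>z. h * (case z of (t, \<omega>) \<Rightarrow> f t \<omega> x)\<^sup>2)"
    using m h by (intro integrableI_nonneg) auto
  then have "integrable (PT T) (\<lambda>z. (case z of (t, \<omega>) \<Rightarrow> f t \<omega> x)\<^sup>2)"
    using h by (simp add: integrable_mult_left_iff)
  with m show ?thesis by (simp add: sq_integrable_def)
qed

text \<open>W is a representative of w indexed by nodes: it has continuous paths and vanishes at
  both ends for every path, not just almost every one. Continuity of all paths gives joint
  measurability.\<close>

lemma solution_processes:
  assumes T: "0 < T" and N: "0 < N" and h: "h = mesh_size N"
    and w: "w \<in> L2F_C M B T h (closed_mesh N)" and f: "f \<in> L2F M B T h (mesh N)" and g: "g \<in> L2F M B T h (mesh N)"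
    and sol: "solves_equation M B T N w f g"
    and bc: "AE \<omega> in M. \<forall>t\<in>{0..T}. w t \<omega> 0 = 0 \<and> w t \<omega> 1 = 0"
  shows "\<exists>(W :: nat \<Rightarrow> real \<Rightarrow> 'a \<Rightarrow> real) J.
    (AE \<omega> in M. \<forall>t\<in>{0..T}. \<forall>i\<le>Suc N. w t \<omega> (real i * h) = W i t \<omega>) \<and>
    (\<forall>t \<omega>. W 0 t \<omega> = 0 \<and> W (Suc N) t \<omega> = 0) \<and>
    (\<forall>i\<le>Suc N. sq_integrable (PT T) (\<lambda>(t, \<omega>). W i t \<omega>) \<and> (\<forall>t\<in>{0..T}. sq_integrable M (W i t))) \<and>
    (\<forall>i<N. ito_process T (W (Suc i))
        (\<lambda>t \<omega>. f t \<omega> (real (Suc i) * h) - (W (i + 2) t \<omega> - 2 * W (Suc i) t \<omega> + W i t \<omega>) / h\<^sup>2)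
        (\<lambda>t \<omega>. g t \<omega> (real (Suc i) * h)) (J i))"
proof -
  have h0: "0 < h" using h mesh_size_pos by simp
  have hN: "real (Suc N) * h = 1" using h by (simp add: mesh_size_def)
  have cm: "real i * h \<in> closed_mesh N" if "i \<le> Suc N" for i using closed_mesh_mem[OF that] h by simp
  have mm: "real (Suc i) * h \<in> mesh N" if "i < N" for i using mesh_mem[OF that] h by simp
  have "AE \<omega> in M. (\<forall>x\<in>closed_mesh N. continuous_on {0..T} (\<lambda>t. w t \<omega> x)) \<and> (\<forall>t\<in>{0..T}. w t \<omega> 0 = 0 \<and> w t \<omega> 1 = 0)"
    using w bc by (auto simp: L2F_C_def)
  then obtain E where E0: "{\<omega> \<in> space M. \<not> ((\<forall>x\<in>closed_mesh N. continuous_on {0..T} (\<lambda>t. w t \<omega> x)) \<and> (\<forall>t\<in>{0..T}. w t \<omega> 0 = 0 \<and> w t \<omega> 1 = 0))} \<subseteq> E"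
    and E: "E \<in> null_sets M"
    unfolding eventually_ae_filter by blast
  have wc: "continuous_on {0..T} (\<lambda>t. w t \<omega> (real i * h))" if "\<omega> \<in> space M" "\<omega> \<notin> E" "i \<le> Suc N" for \<omega> i
    using E0 that cm by blast
  have wb: "w t \<omega> 0 = 0" "w t \<omega> 1 = 0" if "\<omega> \<in> space M" "\<omega> \<notin> E" "t \<in> {0..T}" for \<omega> t
    using E0 that by blast+
  have wm: "(\<lambda>\<omega>. w t \<omega> (real i * h)) \<in> borel_measurable (F t)" if "i \<le> Suc N" "t \<in> {0..T}" for i t
    using w cm[OF that(1)] that(2) by (simp add: L2F_C_def)
  \<comment> \<open>On the exceptional null set the process is set to zero. It stays adapted because
    the augmented filtration contains all null sets at every time.\<close>
  define W where "W i t \<omega> = (if \<omega> \<in> E \<or> i = 0 \<or> i = Suc N then 0 else w t \<omega> (real i * h))" for i t \<omega>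
  have W_eq: "w t \<omega> (real i * h) = W i t \<omega>" if "\<omega> \<in> space M" "\<omega> \<notin> E" "t \<in> {0..T}" "i \<le> Suc N" for i t \<omega>
    using wb[OF that(1-3)] that hN by (auto simp: W_def)
  have AE_E: "AE \<omega> in M. \<omega> \<in> space M \<and> \<omega> \<notin> E" using AE_not_in[OF E] AE_space by eventually_elim simp
  have Wm: "W i t \<in> borel_measurable (F t)" if "i \<le> Suc N" "t \<in> {0..T}" for i t
  proof (cases "i = 0 \<or> i = Suc N")
    case True then show ?thesis by (auto simp: W_def[abs_def])
  next
    case False
    have "{\<omega> \<in> space (F t). \<omega> \<in> E} = E" using E sets.sets_into_space by (auto simp: null_sets_def)
    then have "{\<omega> \<in> space (F t). \<omega> \<in> E} \<in> sets (F t)" using null_measurable_F[OF E] by simp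
    moreover have "W i t = (\<lambda>\<omega>. if \<omega> \<in> E then 0 else w t \<omega> (real i * h))"
      using False by (auto simp: W_def[abs_def])
    ultimately show ?thesis using wm[OF that] by (auto intro!: measurable_If)
  qed
  have WM: "W i t \<in> borel_measurable M" if "i \<le> Suc N" "t \<in> {0..T}" for i t
    using measurable_F_M[OF Wm[OF that]] .
  have Wj: "(\<lambda>(t, \<omega>). W i t \<omega>) \<in> borel_measurable (PT T)" if i: "i \<le> Suc N" for i
  proof (rule continuous_function_jointly_measurable)
    show "0 \<le> T" using T by simp
    show "W i t \<in> borel_measurable M" if "t \<in> {0..T}" for t by (rule WM[OF i that])
    show "continuous_on {0..T} (\<lambda>t. W i t \<omega>)" if "\<omega> \<in> space M" for \<omega>
    proof (cases "\<omega> \<in> E")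
      case False
      from wc[OF that False i] show ?thesis
        by (rule continuous_on_eq) (use W_eq[OF that False] i in auto)
    qed (simp add: W_def)
  qed
  define S where "S = (\<integral>\<^sup>+\<omega>. (SUP t\<in>{0..T}. ennreal (mesh_integral h (closed_mesh N) (\<lambda>x. (w t \<omega> x)\<^sup>2))) \<partial>M)"
  have S: "S < \<infinity>" using w by (simp add: L2F_C_def S_def)
  have nn: "(\<integral>\<^sup>+\<omega>. ennreal (h * (W i t \<omega>)\<^sup>2) \<partial>M) \<le> S" if i: "i \<le> Suc N" and t: "t \<in> {0..T}" for i t
    unfolding S_def
  proof (rule nn_integral_mono)
    fix \<omega>
    have "(W i t \<omega>)\<^sup>2 \<le> (w t \<omega> (real i * h))\<^sup>2" by (simp add: W_def)
    also have "\<dots> \<le> (\<Sum>x\<in>closed_mesh N. (w t \<omega> x)\<^sup>2)"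
      using cm[OF i] finite_meshes by (intro member_le_sum) auto
    finally have "h * (W i t \<omega>)\<^sup>2 \<le> mesh_integral h (closed_mesh N) (\<lambda>x. (w t \<omega> x)\<^sup>2)"
      using h0 by (simp add: mesh_integral_def)
    then have "ennreal (h * (W i t \<omega>)\<^sup>2) \<le> ennreal (mesh_integral h (closed_mesh N) (\<lambda>x. (w t \<omega> x)\<^sup>2))"
      by (rule ennreal_leI)
    also have "\<dots> \<le> (SUP t\<in>{0..T}. ennreal (mesh_integral h (closed_mesh N) (\<lambda>x. (w t \<omega> x)\<^sup>2)))"
      by (rule SUP_upper[OF t])
    finally show "ennreal (h * (W i t \<omega>)\<^sup>2) \<le> \<dots>" .
  qed
  have Wh: "integrable M (\<lambda>\<omega>. h * (W i t \<omega>)\<^sup>2)" if i: "i \<le> Suc N" and t: "t \<in> {0..T}" for i t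
    using WM[OF i t] h0 le_less_trans[OF nn[OF i t] S] by (intro integrableI_nonneg) auto
  have Wsq: "sq_integrable M (W i t)" if i: "i \<le> Suc N" and t: "t \<in> {0..T}" for i t
    using Wh[OF i t] h0 WM[OF i t] by (simp add: sq_integrable_def integrable_mult_left_iff)
  have Wbd: "expectation (\<lambda>\<omega>. (W i t \<omega>)\<^sup>2) \<le> enn2real S / h" if i: "i \<le> Suc N" and t: "t \<in> {0..T}" for i t
  proof -
    have "h * expectation (\<lambda>\<omega>. (W i t \<omega>)\<^sup>2) = expectation (\<lambda>\<omega>. h * (W i t \<omega>)\<^sup>2)" by simp
    also have "\<dots> = enn2real (\<integral>\<^sup>+\<omega>. ennreal (h * (W i t \<omega>)\<^sup>2) \<partial>M)"
      using WM[OF i t] h0 by (intro integral_eq_nn_integral) auto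
    also have "\<dots> \<le> enn2real S" using nn[OF i t] S by (intro enn2real_mono) auto
    finally show ?thesis using h0 by (simp add: pos_le_divide_eq mult.commute)
  qed
  have WP: "sq_integrable (PT T) (\<lambda>(t, \<omega>). W i t \<omega>)" if "i \<le> Suc N" for i
    by (rule sq_integrable_PT[OF Wj[OF that] Wsq[OF that] Wbd[OF that]])
  let ?b = "\<lambda>i t \<omega>. f t \<omega> (real (Suc i) * h) - (W (i + 2) t \<omega> - 2 * W (Suc i) t \<omega> + W i t \<omega>) / h\<^sup>2"
  have ex: "\<exists>J. ito_process T (W (Suc i)) (?b i) (\<lambda>t \<omega>. g t \<omega> (real (Suc i) * h)) J" if i: "i < N" for i
  proof -
    have le: "Suc i \<le> Suc N" "i + 2 \<le> Suc N" "i \<le> Suc N" using i by auto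
    obtain J where ito: "has_ito_integral M B T (\<lambda>t \<omega>. g t \<omega> (real (Suc i) * h)) J"
      and eq: "\<And>t. t \<in> {0..T} \<Longrightarrow> AE \<omega> in M. w t \<omega> (real (Suc i) * h) = w 0 \<omega> (real (Suc i) * h)
          + (LINT r:{0..t}|lborel. f r \<omega> (real (Suc i) * h) - Dh2 h (w r \<omega>) (real (Suc i) * h)) + J t \<omega>"
      using sol mm[OF i] h unfolding solves_equation_def by blast
    have fP: "sq_integrable (PT T) (\<lambda>(t, \<omega>). f t \<omega> (real (Suc i) * h))"
      by (rule L2F_sq_integrable[OF f finite_meshes(1) mm[OF i] h0])
    have bP: "sq_integrable (PT T) (\<lambda>(t, \<omega>). ?b i t \<omega>)"
    proof -
      have "sq_integrable (PT T) (\<lambda>z. (case z of (t, \<omega>) \<Rightarrow> f t \<omega> (real (Suc i) * h)) - (1 / h\<^sup>2) * (((case z of (t, \<omega>) \<Rightarrow> W (i + 2) t \<omega>)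
         - 2 * (case z of (t, \<omega>) \<Rightarrow> W (Suc i) t \<omega>)) + (case z of (t, \<omega>) \<Rightarrow> W i t \<omega>)))"
        by (intro sq_integrable_diff sq_integrable_add sq_integrable_cmult fP WP le)
      then show ?thesis by (simp add: split_beta')
    qed
    have bm: "?b i t \<in> borel_measurable (F t)" if t: "t \<in> {0..T}" for t
    proof -
      have "(\<lambda>\<omega>. f t \<omega> (real (Suc i) * h)) \<in> borel_measurable (F t)"
        using f mm[OF i] t by (simp add: L2F_def)
      then show ?thesis using Wm[OF le(1) t] Wm[OF le(2) t] Wm[OF le(3) t] by measurable
    qed
    have gm: "(\<lambda>(t, \<omega>). g t \<omega> (real (Suc i) * h)) \<in> borel_measurable (PT T)"
      using g mm[OF i] unfolding L2F_def by (simp add: measurable_cong_sets[OF sets_PT refl])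
    have Weq: "AE \<omega> in M. W (Suc i) t \<omega> = W (Suc i) 0 \<omega> + (\<integral>s. indicator {0..t} s * ?b i s \<omega> \<partial>time_measure T) + J t \<omega>"
      if t: "t \<in> {0..T}" for t
      using eq[OF t] AE_E
    proof eventually_elim
      case (elim \<omega>)
      have "Dh2 h (w r \<omega>) (real (Suc i) * h) = (W (i + 2) r \<omega> - 2 * W (Suc i) r \<omega> + W i r \<omega>) / h\<^sup>2" if r: "r \<in> {0..T}" for r
      proof -
        have "real (Suc i) * h + h = real (i + 2) * h" "real (Suc i) * h - h = real i * h"
          by (simp_all add: algebra_simps)
        moreover have "w r \<omega> (real (i + 2) * h) = W (i + 2) r \<omega>" "w r \<omega> (real (Suc i) * h) = W (Suc i) r \<omega>"
          "w r \<omega> (real i * h) = W i r \<omega>"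
          using W_eq elim(2) r le by blast+
        ultimately show ?thesis by (simp only: Dh2_def)
      qed
      then have "(LINT r:{0..t}|lborel. f r \<omega> (real (Suc i) * h) - Dh2 h (w r \<omega>) (real (Suc i) * h)) =
        (\<integral>s. indicator {0..t} s * ?b i s \<omega> \<partial>time_measure T)"
        using t by (subst set_lebesgue_integral_time_measure[of t T]) (auto intro!: Bochner_Integration.integral_cong)
      then show ?case using elim W_eq[of \<omega> t "Suc i"] W_eq[of \<omega> 0 "Suc i"] le t T by auto
    qed
    have "ito_process T (W (Suc i)) (?b i) (\<lambda>t \<omega>. g t \<omega> (real (Suc i) * h)) J"
      unfolding ito_process_def
      using WP[OF le(1)] Wsq[OF le(1)] Wm[OF le(1), of 0] T bP bm gm ito Weq by auto
    then show ?thesis by (intro exI[of _ J])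
  qed
  \<comment> \<open>The equation provides one stochastic integral per node; a choice turns these
    into a family.\<close>
  define J where "J i = (SOME J. ito_process T (W (Suc i)) (?b i) (\<lambda>t \<omega>. g t \<omega> (real (Suc i) * h)) J)" for i
  have J: "ito_process T (W (Suc i)) (?b i) (\<lambda>t \<omega>. g t \<omega> (real (Suc i) * h)) (J i)" if "i < N" for i
    unfolding J_def by (rule someI_ex[OF ex[OF that]])
  show ?thesis
  proof (rule exI[of _ W], rule exI[of _ J], intro conjI allI ballI impI)
    show "AE \<omega> in M. \<forall>t\<in>{0..T}. \<forall>i\<le>Suc N. w t \<omega> (real i * h) = W i t \<omega>"
      using AE_E by eventually_elim (use W_eq in blast)
    show "W 0 t \<omega> = 0" "W (Suc N) t \<omega> = 0" for t \<omega> by (simp_all add: W_def)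
    show "sq_integrable (PT T) (\<lambda>(t, \<omega>). W i t \<omega>)" if "i \<le> Suc N" for i by (rule WP[OF that])
    show "sq_integrable M (W i t)" if "i \<le> Suc N" "t \<in> {0..T}" for i t by (rule Wsq[OF that])
    show "ito_process T (W (Suc i)) (?b i) (\<lambda>t \<omega>. g t \<omega> (real (Suc i) * h)) (J i)" if "i < N" for i by (rule J[OF that])
  qed
qed

end

section \<open>Integration of the pointwise estimate\<close>

context standard_brownian_motion
begin

text \<open>The pointwise estimate is integrated over time and paths. Its energy term is the
  integral of the product-rule densities, which equals the difference of the expected energies at T
  and 0.\<close>

lemma expected_carleman_estimate:
  fixes \<phi> \<phi>m \<zeta> :: "nat \<Rightarrow> real" and s s1 s2 :: "real \<Rightarrow> real" and W b f g :: "nat \<Rightarrow> real \<Rightarrow> 'a \<Rightarrow> real"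
  assumes T: "0 < T" and cb: "\<And>t. t \<in> {0..T} \<Longrightarrow> carleman_bounds N h K c0 \<eta> (s t) (s1 t) (s2 t) \<phi> \<zeta>"
    and ds: "\<And>t. t \<in> {0..T} \<Longrightarrow> (s has_real_derivative s1 t) (at t)" "\<And>t. t \<in> {0..T} \<Longrightarrow> (s1 has_real_derivative s2 t) (at t)"
    and cs: "continuous_on {0..T} s2"
    and m: "\<And>i. i \<le> N \<Longrightarrow> \<bar>\<phi>m i - \<phi> i\<bar> \<le> K * h" "\<And>i. i \<le> N \<Longrightarrow> \<bar>\<phi>m i - \<phi> (Suc i)\<bar> \<le> K * h"
    and W0: "\<And>t \<omega>. W 0 t \<omega> = 0" "\<And>t \<omega>. W (Suc N) t \<omega> = 0"
    and WP: "\<And>i. i \<le> Suc N \<Longrightarrow> sq_integrable (PT T) (\<lambda>(t, \<omega>). W i t \<omega>)"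
    and WM: "\<And>i t. i \<le> Suc N \<Longrightarrow> t \<in> {0..T} \<Longrightarrow> sq_integrable M (W i t)"
    and fP: "\<And>i. i < N \<Longrightarrow> sq_integrable (PT T) (\<lambda>(t, \<omega>). f (Suc i) t \<omega>)"
    and gP: "\<And>i. i < N \<Longrightarrow> sq_integrable (PT T) (\<lambda>(t, \<omega>). g (Suc i) t \<omega>)"
    and b0: "\<And>t \<omega>. b 0 t \<omega> = 0" "\<And>t \<omega>. b (Suc N) t \<omega> = 0" and g0: "\<And>t \<omega>. g 0 t \<omega> = 0" "\<And>t \<omega>. g (Suc N) t \<omega> = 0"
    and b: "\<And>i t \<omega>. i < N \<Longrightarrow> b (Suc i) t \<omega> = f (Suc i) t \<omega> - (W (i + 2) t \<omega> - 2 * W (Suc i) t \<omega> + W i t \<omega>) / h\<^sup>2"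
    and ito: "\<And>i. i < N \<Longrightarrow> ito_process T (W (Suc i)) (b (Suc i)) (g (Suc i)) (J i)"
  defines "A \<equiv> \<lambda>t \<omega>. \<Sum>i<N. s t ^ 3 * exp (2 * s t * \<phi> (Suc i)) * (W (Suc i) t \<omega>)\<^sup>2"
    and "D \<equiv> \<lambda>t \<omega>. \<Sum>i\<le>N. s t * exp (2 * s t * \<phi>m i) * ((W (Suc i) t \<omega> - W i t \<omega>) / h)\<^sup>2"
    and "L \<equiv> \<lambda>t \<omega>. \<Sum>i<N. \<zeta> (Suc i) * (s t ^ 3 * exp (2 * s t * \<phi> (Suc i)) * (W (Suc i) t \<omega>)\<^sup>2)"
    and "Ff \<equiv> \<lambda>t \<omega>. \<Sum>i<N. exp (2 * s t * \<phi> (Suc i)) * (f (Suc i) t \<omega>)\<^sup>2"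
    and "Gg \<equiv> \<lambda>t \<omega>. \<Sum>i<N. (s t)\<^sup>2 * exp (2 * s t * \<phi> (Suc i)) * (g (Suc i) t \<omega>)\<^sup>2"
    and "E \<equiv> \<lambda>t. expectation (\<lambda>\<omega>. \<Sum>i<N. exp (2 * s t * \<phi> (Suc i)) * (W (Suc i) t \<omega>)\<^sup>2)"
  shows "integrable (PT T) (\<lambda>(t, \<omega>). A t \<omega>)" "integrable (PT T) (\<lambda>(t, \<omega>). D t \<omega>)" "integrable (PT T) (\<lambda>(t, \<omega>). L t \<omega>)"
    "integrable (PT T) (\<lambda>(t, \<omega>). Ff t \<omega>)" "integrable (PT T) (\<lambda>(t, \<omega>). Gg t \<omega>)"
    "(\<integral>(t, \<omega>). A t \<omega> \<partial>PT T) + (\<integral>(t, \<omega>). D t \<omega> \<partial>PT T) \<le> 326 * K\<^sup>2 / c0 ^ 3 *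
      (105 * K ^ 3 * (\<integral>(t, \<omega>). L t \<omega> \<partial>PT T) + (\<integral>(t, \<omega>). Ff t \<omega> \<partial>PT T) + 5 * K\<^sup>2 * (\<integral>(t, \<omega>). Gg t \<omega> \<partial>PT T)
       + 9 * K\<^sup>2 / h\<^sup>2 * E 0 + 9 * K\<^sup>2 / h\<^sup>2 * E T)"
proof -
  have t0: "0 \<in> {0..T}" and tT: "T \<in> {0..T}" using T by auto
  interpret c0: carleman_bounds N h K c0 \<eta> "s 0" "s1 0" "s2 0" \<phi> \<zeta> by (rule cb[OF t0])
  have N: "0 < N" and h: "0 < h" and c0: "0 < c0" by (rule c0.N_pos c0.h_pos c0.c0_pos)+
  have ct: "continuous_on {0..T} s" "continuous_on {0..T} s1"
    by (intro continuous_at_imp_continuous_on ballI DERIV_isCont[OF ds(1)] DERIV_isCont[OF ds(2)]; assumption)+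
  have sqi: "integrable (PT T) (\<lambda>(t, \<omega>). a t * (u t \<omega>)\<^sup>2)"
    if "continuous_on {0..T} a" "sq_integrable (PT T) (\<lambda>(t, \<omega>). u t \<omega>)" for a and u :: "real \<Rightarrow> 'a \<Rightarrow> real"
    using integrable_PT_times_continuous[OF that(1), of "\<lambda>t \<omega>. (u t \<omega>)\<^sup>2"] sq_integrable_square[OF that(2)]
    by (simp add: split_beta')
  show iA: "integrable (PT T) (\<lambda>(t, \<omega>). A t \<omega>)"
    unfolding A_def split_beta'
    by (intro Bochner_Integration.integrable_sum sqi[unfolded split_beta'] continuous_intros ct WP[unfolded split_beta']) auto
  show iL: "integrable (PT T) (\<lambda>(t, \<omega>). L t \<omega>)"
    unfolding L_def split_beta'
    by (intro Bochner_Integration.integrable_sum integrable_mult_right sqi[unfolded split_beta'] continuous_intros ct WP[unfolded split_beta']) auto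
  show iF: "integrable (PT T) (\<lambda>(t, \<omega>). Ff t \<omega>)"
    unfolding Ff_def split_beta'
    by (intro Bochner_Integration.integrable_sum sqi[unfolded split_beta'] continuous_intros ct fP[unfolded split_beta']) auto
  show iG: "integrable (PT T) (\<lambda>(t, \<omega>). Gg t \<omega>)"
    unfolding Gg_def split_beta'
    by (intro Bochner_Integration.integrable_sum sqi[unfolded split_beta'] continuous_intros ct gP[unfolded split_beta']) auto
  have iD': "integrable (PT T) (\<lambda>(t, \<omega>). s t * exp (2 * s t * \<phi>m i) * ((W (Suc i) t \<omega> - W i t \<omega>) / h)\<^sup>2)" if "i \<le> N" for i
  proof (rule sqi)
    have "sq_integrable (PT T) (\<lambda>z. (1 / h) * ((case z of (t, \<omega>) \<Rightarrow> W (Suc i) t \<omega>) - (case z of (t, \<omega>) \<Rightarrow> W i t \<omega>)))"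
      using that by (intro sq_integrable_cmult sq_integrable_diff WP) auto
    then show "sq_integrable (PT T) (\<lambda>(t, \<omega>). (W (Suc i) t \<omega> - W i t \<omega>) / h)" by (simp add: split_beta')
  qed (intro continuous_intros ct)
  show iD: "integrable (PT T) (\<lambda>(t, \<omega>). D t \<omega>)"
    unfolding D_def split_beta' by (intro Bochner_Integration.integrable_sum iD'[unfolded split_beta']) auto
  \<comment> \<open>The locale fixes one time, so its coefficients are restated as functions of t in
    order to be differentiated; \<open>coeffs\<close> identifies the two versions at each
    time.\<close>
  define \<alpha> where "\<alpha> i t = - (2 / h\<^sup>2 + s1 t * \<phi> i) * exp (2 * s t * \<phi> i)" for i t
  define \<alpha>' where "\<alpha>' i t = - s2 t * \<phi> i * exp (2 * s t * \<phi> i) - (2 / h\<^sup>2 + s1 t * \<phi> i) * (2 * s1 t * \<phi> i * exp (2 * s t * \<phi> i))" for i t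
  define \<beta> where "\<beta> i t = (exp (2 * s t * \<phi> i) + exp (2 * s t * \<phi> (Suc i))) / h\<^sup>2" for i t
  define \<beta>' where "\<beta>' i t = 2 * s1 t * (\<phi> i * exp (2 * s t * \<phi> i) + \<phi> (Suc i) * exp (2 * s t * \<phi> (Suc i))) / h\<^sup>2" for i t
  have d\<alpha>: "(\<alpha> i has_real_derivative \<alpha>' i t) (at t within {0..T})" if t: "t \<in> {0..T}" for i t
  proof -
    have "(\<alpha> i has_real_derivative \<alpha>' i t) (at t)"
      unfolding \<alpha>_def[abs_def] \<alpha>'_def
      by (rule derivative_eq_intros ds t refl | simp add: algebra_simps)+
    then show ?thesis by (rule has_field_derivative_at_within)
  qed
  have d\<beta>: "(\<beta> i has_real_derivative \<beta>' i t) (at t within {0..T})" if t: "t \<in> {0..T}" for i t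
  proof -
    have "(\<beta> i has_real_derivative \<beta>' i t) (at t)"
      unfolding \<beta>_def[abs_def] \<beta>'_def
      by (rule DERIV_cong[OF DERIV_cdivide]) (rule derivative_eq_intros ds t refl | simp add: algebra_simps)+
    then show ?thesis by (rule has_field_derivative_at_within)
  qed
  have c\<alpha>: "continuous_on {0..T} (\<alpha>' i)" and c\<beta>: "continuous_on {0..T} (\<beta>' i)" for i
    unfolding \<alpha>'_def[abs_def] \<beta>'_def[abs_def] using h by (intro continuous_intros ct cs; simp)+
  define X where "X i t \<omega> = \<alpha>' (Suc i) t * (W (Suc i) t \<omega> * W (Suc i) t \<omega>) + \<alpha> (Suc i) t *
     (b (Suc i) t \<omega> * W (Suc i) t \<omega> + W (Suc i) t \<omega> * b (Suc i) t \<omega> + g (Suc i) t \<omega> * g (Suc i) t \<omega>)" for i t \<omega>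
  define Y where "Y i t \<omega> = \<beta>' (Suc i) t * (W (Suc i) t \<omega> * W (i + 2) t \<omega>) + \<beta> (Suc i) t *
     (b (Suc i) t \<omega> * W (i + 2) t \<omega> + W (Suc i) t \<omega> * b (i + 2) t \<omega> + g (Suc i) t \<omega> * g (i + 2) t \<omega>)" for i t \<omega>
  have X: "integrable (PT T) (\<lambda>(t, \<omega>). X i t \<omega>)"
    "\<alpha> (Suc i) T * expectation (\<lambda>\<omega>. W (Suc i) T \<omega> * W (Suc i) T \<omega>) - \<alpha> (Suc i) 0 * expectation (\<lambda>\<omega>. W (Suc i) 0 \<omega> * W (Suc i) 0 \<omega>)
      = (\<integral>(t, \<omega>). X i t \<omega> \<partial>PT T)" if i: "i < N" for i
    unfolding X_def by (rule weighted_product_rule[OF T ito[OF i] ito[OF i] d\<alpha> c\<alpha>]; assumption)+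
  have Y: "integrable (PT T) (\<lambda>(t, \<omega>). Y i t \<omega>)"
    "\<beta> (Suc i) T * expectation (\<lambda>\<omega>. W (Suc i) T \<omega> * W (i + 2) T \<omega>) - \<beta> (Suc i) 0 * expectation (\<lambda>\<omega>. W (Suc i) 0 \<omega> * W (i + 2) 0 \<omega>)
      = (\<integral>(t, \<omega>). Y i t \<omega> \<partial>PT T)" if i: "i < N - 1" for i
  proof -
    have i1: "i < N" and i2: "Suc i < N" using i by auto
    have ito2: "ito_process T (W (i + 2)) (b (i + 2)) (g (i + 2)) (J (Suc i))" using ito[OF i2] by simp
    show "integrable (PT T) (\<lambda>(t, \<omega>). Y i t \<omega>)"
      "\<beta> (Suc i) T * expectation (\<lambda>\<omega>. W (Suc i) T \<omega> * W (i + 2) T \<omega>) - \<beta> (Suc i) 0 * expectation (\<lambda>\<omega>. W (Suc i) 0 \<omega> * W (i + 2) 0 \<omega>)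
      = (\<integral>(t, \<omega>). Y i t \<omega> \<partial>PT T)"
      unfolding Y_def by (rule weighted_product_rule[OF T ito[OF i1] ito2 d\<beta> c\<beta>]; assumption)+
  qed
  define \<Psi> where "\<Psi> t \<omega> = (\<Sum>i<N. X i t \<omega>) + (\<Sum>i<N - 1. Y i t \<omega>)" for t \<omega>
  define Q where "Q t \<omega> = (\<Sum>i<N. \<alpha> (Suc i) t * (W (Suc i) t \<omega> * W (Suc i) t \<omega>)) + (\<Sum>i<N - 1. \<beta> (Suc i) t * (W (Suc i) t \<omega> * W (i + 2) t \<omega>))" for t \<omega>
  have iX: "integrable (PT T) (\<lambda>z. \<Sum>i<N. case z of (t, \<omega>) \<Rightarrow> X i t \<omega>)" and iY: "integrable (PT T) (\<lambda>z. \<Sum>i<N - 1. case z of (t, \<omega>) \<Rightarrow> Y i t \<omega>)"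
    using X(1) Y(1) by (intro Bochner_Integration.integrable_sum; simp)+
  have \<Psi>_eq: "(\<lambda>(t, \<omega>). \<Psi> t \<omega>) = (\<lambda>z. (\<Sum>i<N. case z of (t, \<omega>) \<Rightarrow> X i t \<omega>) + (\<Sum>i<N - 1. case z of (t, \<omega>) \<Rightarrow> Y i t \<omega>))"
    by (auto simp: \<Psi>_def fun_eq_iff)
  have i\<Psi>: "integrable (PT T) (\<lambda>(t, \<omega>). \<Psi> t \<omega>)"
    unfolding \<Psi>_eq by (intro Bochner_Integration.integrable_add iX iY)
  have WW: "integrable M (\<lambda>\<omega>. W i t \<omega> * W j t \<omega>)" if "i \<le> Suc N" "j \<le> Suc N" "t \<in> {0..T}" for i j t
    using WM[OF that(1,3)] WM[OF that(2,3)] by (rule sq_integrable_mult)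
  have Qi: "integrable M (Q t)" and QE: "expectation (Q t) = (\<Sum>i<N. \<alpha> (Suc i) t * expectation (\<lambda>\<omega>. W (Suc i) t \<omega> * W (Suc i) t \<omega>))
     + (\<Sum>i<N - 1. \<beta> (Suc i) t * expectation (\<lambda>\<omega>. W (Suc i) t \<omega> * W (i + 2) t \<omega>))" if t: "t \<in> {0..T}" for t
  proof -
    have a: "integrable M (\<lambda>\<omega>. \<alpha> (Suc i) t * (W (Suc i) t \<omega> * W (Suc i) t \<omega>))" if "i < N" for i
      using WW[of "Suc i" "Suc i" t] that t by simp
    have bb: "integrable M (\<lambda>\<omega>. \<beta> (Suc i) t * (W (Suc i) t \<omega> * W (i + 2) t \<omega>))" if "i < N - 1" for i
      using WW[of "Suc i" "i + 2" t] that t by simp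
    have s1: "integrable M (\<lambda>\<omega>. \<Sum>i<N. \<alpha> (Suc i) t * (W (Suc i) t \<omega> * W (Suc i) t \<omega>))"
      and s2: "integrable M (\<lambda>\<omega>. \<Sum>i<N - 1. \<beta> (Suc i) t * (W (Suc i) t \<omega> * W (i + 2) t \<omega>))"
      using a bb by (intro Bochner_Integration.integrable_sum; simp)+
    show "integrable M (Q t)" unfolding Q_def by (intro Bochner_Integration.integrable_add s1 s2)
    show "expectation (Q t) = (\<Sum>i<N. \<alpha> (Suc i) t * expectation (\<lambda>\<omega>. W (Suc i) t \<omega> * W (Suc i) t \<omega>))
     + (\<Sum>i<N - 1. \<beta> (Suc i) t * expectation (\<lambda>\<omega>. W (Suc i) t \<omega> * W (i + 2) t \<omega>))"
      unfolding Q_def Bochner_Integration.integral_add[OF s1 s2]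
      using a bb by (subst (1 2) Bochner_Integration.integral_sum) auto
  qed
  have int\<Psi>: "(\<integral>(t, \<omega>). \<Psi> t \<omega> \<partial>PT T) = expectation (Q T) - expectation (Q 0)"
  proof -
    have "(\<integral>(t, \<omega>). \<Psi> t \<omega> \<partial>PT T) = (\<Sum>i<N. \<integral>(t, \<omega>). X i t \<omega> \<partial>PT T) + (\<Sum>i<N - 1. \<integral>(t, \<omega>). Y i t \<omega> \<partial>PT T)"
      unfolding \<Psi>_eq Bochner_Integration.integral_add[OF iX iY]
      using X(1) Y(1) by (subst (1 2) Bochner_Integration.integral_sum) auto
    also have "\<dots> = expectation (Q T) - expectation (Q 0)"
      unfolding QE[OF tT] QE[OF t0] using X(2) Y(2)
      by (simp add: sum_subtractf[symmetric] algebra_simps) (simp add: sum.distrib)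
    finally show ?thesis .
  qed
  have coeffs: "\<alpha> i t = carleman_bounds.qdiag h (s t) (s1 t) \<phi> i" "\<alpha>' i t = carleman_bounds.qdiag' h (s t) (s1 t) (s2 t) \<phi> i"
    "\<beta> i t = carleman_bounds.qoff h (s t) \<phi> i" "\<beta>' i t = carleman_bounds.qoff' h (s t) (s1 t) \<phi> i" if t: "t \<in> {0..T}" for i t
  proof -
    interpret c: carleman_bounds N h K c0 \<eta> "s t" "s1 t" "s2 t" \<phi> \<zeta> by (rule cb[OF t])
    show "\<alpha> i t = c.qdiag i" "\<alpha>' i t = c.qdiag' i" "\<beta> i t = c.qoff i" "\<beta>' i t = c.qoff' i"
      by (simp_all add: \<alpha>_def \<alpha>'_def \<beta>_def \<beta>'_def c.qdiag_def c.qdiag'_def c.qoff_def c.qoff'_def c.wt2_def)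
  qed
  have pw: "A t \<omega> + D t \<omega> \<le> 326 * K\<^sup>2 / c0 ^ 3 * (105 * K ^ 3 * L t \<omega> + Ff t \<omega> + 5 * K\<^sup>2 * Gg t \<omega> - \<Psi> t \<omega>)"
    if t: "t \<in> {0..T}" for t \<omega>
  proof -
    interpret c: carleman_bounds N h K c0 \<eta> "s t" "s1 t" "s2 t" \<phi> \<zeta> by (rule cb[OF t])
    show ?thesis
      using c.pointwise_estimate[of "\<lambda>i. W i t \<omega>" "\<lambda>i. b i t \<omega>" "\<lambda>i. f i t \<omega>" "\<lambda>i. g i t \<omega>" \<phi>m] W0 b0 g0 b m
      unfolding A_def D_def L_def Ff_def Gg_def \<Psi>_def X_def Y_def coeffs[OF t] by simp
  qed
  have Eint: "integrable M (\<lambda>\<omega>. \<Sum>i<N. exp (2 * s t * \<phi> (Suc i)) * (W (Suc i) t \<omega>)\<^sup>2)" if t: "t \<in> {0..T}" for t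
    using WM t by (intro Bochner_Integration.integrable_sum integrable_mult_right sq_integrable_square) auto
  \<comment> \<open>The energy at T enters negatively and that at 0 positively, so the lower bound
    on the form is used here and the upper bound for \<open>Q0\<close>.\<close>
  have QT: "- expectation (Q T) \<le> 9 * K\<^sup>2 / h\<^sup>2 * E T"
  proof -
    interpret c: carleman_bounds N h K c0 \<eta> "s T" "s1 T" "s2 T" \<phi> \<zeta> by (rule cb[OF tT])
    have "- expectation (Q T) = expectation (\<lambda>\<omega>. - Q T \<omega>)" by simp
    also have "\<dots> \<le> expectation (\<lambda>\<omega>. 9 * K\<^sup>2 / h\<^sup>2 * (\<Sum>i<N. exp (2 * s T * \<phi> (Suc i)) * (W (Suc i) T \<omega>)\<^sup>2))"
    proof (rule integral_mono)
      fix \<omega>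
      show "- Q T \<omega> \<le> 9 * K\<^sup>2 / h\<^sup>2 * (\<Sum>i<N. exp (2 * s T * \<phi> (Suc i)) * (W (Suc i) T \<omega>)\<^sup>2)"
        using c.energy_form_bounds(2)[of "\<lambda>i. W i T \<omega>"] W0 unfolding Q_def coeffs[OF tT] by simp
    qed (use Qi[OF tT] Eint[OF tT] in auto)
    finally show ?thesis by (simp add: E_def)
  qed
  have Q0: "expectation (Q 0) \<le> 9 * K\<^sup>2 / h\<^sup>2 * E 0"
  proof -
    have "expectation (Q 0) \<le> expectation (\<lambda>\<omega>. 9 * K\<^sup>2 / h\<^sup>2 * (\<Sum>i<N. exp (2 * s 0 * \<phi> (Suc i)) * (W (Suc i) 0 \<omega>)\<^sup>2))"
    proof (rule integral_mono)
      fix \<omega>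
      show "Q 0 \<omega> \<le> 9 * K\<^sup>2 / h\<^sup>2 * (\<Sum>i<N. exp (2 * s 0 * \<phi> (Suc i)) * (W (Suc i) 0 \<omega>)\<^sup>2)"
        using c0.energy_form_bounds(1)[of "\<lambda>i. W i 0 \<omega>"] W0 unfolding Q_def coeffs[OF t0] by simp
    qed (use Qi[OF t0] Eint[OF t0] in auto)
    then show ?thesis by (simp add: E_def)
  qed
  let ?C1 = "326 * K\<^sup>2 / c0 ^ 3"
  have "(\<integral>(t, \<omega>). A t \<omega> \<partial>PT T) + (\<integral>(t, \<omega>). D t \<omega> \<partial>PT T) = (\<integral>z. (case z of (t, \<omega>) \<Rightarrow> A t \<omega>) + (case z of (t, \<omega>) \<Rightarrow> D t \<omega>) \<partial>PT T)"
    using iA iD by simp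
  also have "\<dots> \<le> (\<integral>z. ?C1 * (105 * K ^ 3 * (case z of (t, \<omega>) \<Rightarrow> L t \<omega>) + (case z of (t, \<omega>) \<Rightarrow> Ff t \<omega>)
      + 5 * K\<^sup>2 * (case z of (t, \<omega>) \<Rightarrow> Gg t \<omega>) - (case z of (t, \<omega>) \<Rightarrow> \<Psi> t \<omega>)) \<partial>PT T)"
  proof (rule integral_mono)
    show "integrable (PT T) (\<lambda>z. (case z of (t, \<omega>) \<Rightarrow> A t \<omega>) + (case z of (t, \<omega>) \<Rightarrow> D t \<omega>))" using iA iD by simp
    show "integrable (PT T) (\<lambda>z. ?C1 * (105 * K ^ 3 * (case z of (t, \<omega>) \<Rightarrow> L t \<omega>) + (case z of (t, \<omega>) \<Rightarrow> Ff t \<omega>)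
      + 5 * K\<^sup>2 * (case z of (t, \<omega>) \<Rightarrow> Gg t \<omega>) - (case z of (t, \<omega>) \<Rightarrow> \<Psi> t \<omega>)))"
      by (intro integrable_mult_right Bochner_Integration.integrable_diff Bochner_Integration.integrable_add iL iF iG i\<Psi>)
    fix z assume "z \<in> space (PT T)"
    then obtain t \<omega> where z: "z = (t, \<omega>)" "t \<in> {0..T}" by (auto simp: space_pair_measure)
    show "(case z of (t, \<omega>) \<Rightarrow> A t \<omega>) + (case z of (t, \<omega>) \<Rightarrow> D t \<omega>) \<le> ?C1 * (105 * K ^ 3 * (case z of (t, \<omega>) \<Rightarrow> L t \<omega>) + (case z of (t, \<omega>) \<Rightarrow> Ff t \<omega>)
      + 5 * K\<^sup>2 * (case z of (t, \<omega>) \<Rightarrow> Gg t \<omega>) - (case z of (t, \<omega>) \<Rightarrow> \<Psi> t \<omega>))"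
      unfolding z(1) prod.case by (rule pw[OF z(2)])
  qed
  also have "\<dots> = ?C1 * (105 * K ^ 3 * (\<integral>(t, \<omega>). L t \<omega> \<partial>PT T) + (\<integral>(t, \<omega>). Ff t \<omega> \<partial>PT T) + 5 * K\<^sup>2 * (\<integral>(t, \<omega>). Gg t \<omega> \<partial>PT T)
       - (\<integral>(t, \<omega>). \<Psi> t \<omega> \<partial>PT T))"
    unfolding integral_mult_right_zero
    using iL iF iG i\<Psi> by (simp add: Bochner_Integration.integral_diff Bochner_Integration.integral_add)
  also have "\<dots> \<le> ?C1 * (105 * K ^ 3 * (\<integral>(t, \<omega>). L t \<omega> \<partial>PT T) + (\<integral>(t, \<omega>). Ff t \<omega> \<partial>PT T) + 5 * K\<^sup>2 * (\<integral>(t, \<omega>). Gg t \<omega> \<partial>PT T)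
       + 9 * K\<^sup>2 / h\<^sup>2 * E 0 + 9 * K\<^sup>2 / h\<^sup>2 * E T)"
    unfolding int\<Psi> using Q0 QT c0 by (intro mult_left_mono) auto
  finally show "(\<integral>(t, \<omega>). A t \<omega> \<partial>PT T) + (\<integral>(t, \<omega>). D t \<omega> \<partial>PT T) \<le> ?C1 *
      (105 * K ^ 3 * (\<integral>(t, \<omega>). L t \<omega> \<partial>PT T) + (\<integral>(t, \<omega>). Ff t \<omega> \<partial>PT T) + 5 * K\<^sup>2 * (\<integral>(t, \<omega>). Gg t \<omega> \<partial>PT T)
       + 9 * K\<^sup>2 / h\<^sup>2 * E 0 + 9 * K\<^sup>2 / h\<^sup>2 * E T)" .
qed

end

text \<open>The single factor 105 K^3 dominates the four different coefficients 105 K^3, 1, 5 K^2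
  and 9 K^2, which allows one constant in front of the whole right side.\<close>

lemma (in standard_brownian_motion) carleman_estimate:
  fixes \<phi> f1 f2 f3 \<zeta> :: "real \<Rightarrow> real" and s :: "real \<Rightarrow> real"
  assumes cM: "complete_measure M" and T: "0 < T"
    and d: "\<And>x. x \<in> {0..1} \<Longrightarrow> (\<phi> has_real_derivative f1 x) (at x)"
      "\<And>x. x \<in> {0..1} \<Longrightarrow> (f1 has_real_derivative f2 x) (at x)"
      "\<And>x. x \<in> {0..1} \<Longrightarrow> (f2 has_real_derivative f3 x) (at x)"
    and bd: "\<And>x. x \<in> {0..1} \<Longrightarrow> \<bar>\<phi> x\<bar> \<le> K" "\<And>x. x \<in> {0..1} \<Longrightarrow> \<bar>f1 x\<bar> \<le> K"
      "\<And>x. x \<in> {0..1} \<Longrightarrow> \<bar>f2 x\<bar> \<le> K" "\<And>x. x \<in> {0..1} \<Longrightarrow> \<bar>f3 x\<bar> \<le> K"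
    and pos: "\<And>x. x \<in> {0..1} \<Longrightarrow> x \<notin> U0 \<Longrightarrow> 2 * c0 \<le> f2 x \<and> 2 * c0 \<le> \<bar>f1 x\<bar>"
    and ends: "0 < f1 0" "f1 1 < 0" and U0: "U0 \<subseteq> {0<..<1}"
    and \<zeta>: "\<And>x. 0 \<le> \<zeta> x" "\<And>x. \<zeta> x \<le> 1" "\<And>x y. \<bar>\<zeta> x - \<zeta> y\<bar> \<le> K * \<bar>x - y\<bar>" "\<And>x. x \<in> U0 \<Longrightarrow> \<zeta> x = 1"
      "\<And>x. x \<notin> U \<Longrightarrow> \<zeta> x = 0"
    and K: "1 \<le> K" and c0: "0 < c0" "c0 \<le> 1" and \<eta>: "\<eta> = c0 ^ 4 / (700 * K ^ 5)"
    and N: "0 < N" and h: "h = mesh_size N" "h \<le> \<eta>"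
    and \<Lambda>: "1 \<le> \<Lambda>" "T\<^sup>2 / \<eta> \<le> \<Lambda>" "T / \<eta> \<le> \<Lambda>" "4 * T\<^sup>2 / \<eta> \<le> \<Lambda>"
    and \<delta>: "0 < \<delta>" "\<delta> < 1/2" and small: "\<Lambda> * h / (\<delta> * T\<^sup>2) \<le> \<eta>"
    and s: "s = (\<lambda>t. \<Lambda> * theta T \<delta> t)"
    and w: "w \<in> L2F_C M B T h (closed_mesh N)" and f: "f \<in> L2F M B T h (mesh N)" and g: "g \<in> L2F M B T h (mesh N)"
    and sol: "solves_equation M B T N w f g"
    and bc: "AE \<omega> in M. \<forall>t\<in>{0..T}. w t \<omega> 0 = 0 \<and> w t \<omega> 1 = 0"
  shows "expected_time_integral M T (\<lambda>t \<omega>. mesh_integral h (mesh N)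
               (\<lambda>x. s t ^ 3 * exp (2 * s t * \<phi> x) * (w t \<omega> x)\<^sup>2))
           + expected_time_integral M T (\<lambda>t \<omega>. mesh_integral h (dual_mesh N)
               (\<lambda>x. s t * exp (2 * s t * \<phi> x) * \<bar>Dh h (w t \<omega>) x\<bar>\<^sup>2))
           \<le> (326 * K\<^sup>2 / c0 ^ 3 * (105 * K ^ 3)) *
            (expected_time_integral M T (\<lambda>t \<omega>. mesh_integral h (U \<inter> mesh N)
               (\<lambda>x. s t ^ 3 * exp (2 * s t * \<phi> x) * (w t \<omega> x)\<^sup>2))
           + expected_time_integral M T (\<lambda>t \<omega>. mesh_integral h (mesh N)
               (\<lambda>x. (s t)\<^sup>2 * exp (2 * s t * \<phi> x) * \<bar>g t \<omega> x\<bar>\<^sup>2))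
           + expected_time_integral M T (\<lambda>t \<omega>. mesh_integral h (mesh N)
               (\<lambda>x. exp (2 * s t * \<phi> x) * \<bar>f t \<omega> x\<bar>\<^sup>2))
           + 1 / h\<^sup>2 * (\<integral>\<omega>. mesh_integral h (mesh N)
               (\<lambda>x. exp (2 * s 0 * \<phi> x) * \<bar>w 0 \<omega> x\<bar>\<^sup>2) \<partial>M)
           + 1 / h\<^sup>2 * (\<integral>\<omega>. mesh_integral h (mesh N)
               (\<lambda>x. exp (2 * s T * \<phi> x) * \<bar>w T \<omega> x\<bar>\<^sup>2) \<partial>M))"
proof -
  interpret C: complete_measure M by (rule cM)
  have h0: "0 < h" using h mesh_size_pos by simp
  have \<eta>0: "0 < \<eta>" using c0 K by (simp add: \<eta>)
  have t0: "0 \<in> {0..T}" and tT: "T \<in> {0..T}" using T by auto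
  define x where "x i = real i * h" for i
  define s1 where "s1 t = \<Lambda> * theta' T \<delta> t" for t
  define s2 where "s2 t = \<Lambda> * theta'' T \<delta> t" for t
  define \<phi>i where "\<phi>i i = \<phi> (x i)" for i
  define \<phi>m where "\<phi>m i = \<phi> (x i + h / 2)" for i
  define \<zeta>i where "\<zeta>i i = \<zeta> (x i)" for i
  have tw: "0 < s t" "1 \<le> \<eta> * s t" "s t * h \<le> \<eta>" "\<bar>s1 t\<bar> \<le> \<eta> * (s t)\<^sup>2" "\<bar>s2 t\<bar> \<le> \<eta> * s t ^ 3" if "t \<in> {0..T}" for t
    using time_weight_bounds[OF T \<delta> that \<eta>0 h0 \<Lambda> small] by (simp_all add: s s1_def s2_def)
  have cb: "carleman_bounds N h K c0 \<eta> (s t) (s1 t) (s2 t) \<phi>i \<zeta>i" if "t \<in> {0..T}" for t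
    unfolding \<phi>i_def[abs_def] \<zeta>i_def[abs_def] x_def
    by (rule carleman_bounds_mesh(1)[where ?f1.0 = f1 and ?f2.0 = f2 and ?f3.0 = f3 and ?U0.0 = U0];
        (rule d bd ends U0 \<zeta> N h K c0 \<eta> tw[OF that] pos)?; assumption?)
  have m: "\<bar>\<phi>m i - \<phi>i i\<bar> \<le> K * h" "\<bar>\<phi>m i - \<phi>i (Suc i)\<bar> \<le> K * h" if "i \<le> N" for i
    unfolding \<phi>i_def \<phi>m_def x_def
    by (rule carleman_bounds_mesh(2,3)[where ?f1.0 = f1 and ?f2.0 = f2 and ?f3.0 = f3 and ?U0.0 = U0 and \<zeta> = \<zeta> and N = N and ?c0.0 = c0
            and \<eta> = \<eta> and s = "s 0" and ?s1.0 = "s1 0" and ?s2.0 = "s2 0"];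
        (rule d bd ends U0 \<zeta> N h K c0 \<eta> tw[OF t0] pos that)?; assumption?)+
  note th = theta_facts(4,5)[OF T \<delta>]
  have ds: "(s has_real_derivative s1 t) (at t)" "(s1 has_real_derivative s2 t) (at t)" if "t \<in> {0..T}" for t
    unfolding s s1_def[abs_def] s2_def using th[OF that] by (auto intro: DERIV_cmult)
  have cs: "continuous_on {0..T} s2"
  proof -
    have "continuous_on {0..T} (theta T \<delta>)"
      by (intro continuous_at_imp_continuous_on ballI DERIV_isCont[OF th(1)])
    then show ?thesis unfolding s2_def[abs_def] theta''_def by (intro continuous_intros)
  qed
  obtain W J where W: "AE \<omega> in M. \<forall>t\<in>{0..T}. \<forall>i\<le>Suc N. w t \<omega> (real i * h) = W i t \<omega>"
    and W_ends: "\<forall>t \<omega>. W 0 t \<omega> = 0 \<and> W (Suc N) t \<omega> = 0"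
    and W_sq: "\<forall>i\<le>Suc N. sq_integrable (PT T) (\<lambda>(t, \<omega>). W i t \<omega>) \<and> (\<forall>t\<in>{0..T}. sq_integrable M (W i t))"
    and W_ito: "\<forall>i<N. ito_process T (W (Suc i))
        (\<lambda>t \<omega>. f t \<omega> (real (Suc i) * h) - (W (i + 2) t \<omega> - 2 * W (Suc i) t \<omega> + W i t \<omega>) / h\<^sup>2)
        (\<lambda>t \<omega>. g t \<omega> (real (Suc i) * h)) (J i)"
    using solution_processes[OF T N h(1) w f g sol bc] by (elim exE conjE) (rule that)
  have W0: "W 0 t \<omega> = 0" "W (Suc N) t \<omega> = 0" for t \<omega> using W_ends by auto
  have WP: "sq_integrable (PT T) (\<lambda>(t, \<omega>). W i t \<omega>)" if "i \<le> Suc N" for i using W_sq that by auto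
  have WM: "sq_integrable M (W i t)" if "i \<le> Suc N" "t \<in> {0..T}" for i t using W_sq that by auto
  note ito = W_ito[rule_format]
  define fi where "fi i t \<omega> = f t \<omega> (x i)" for i t \<omega>
  \<comment> \<open>g is given on the interior mesh only; the values 0 at the end nodes are those
    required by the energy identity, and \<open>b\<close> is extended in the same way.\<close>
  define gi where "gi i t \<omega> = (if i = 0 \<or> i = Suc N then 0 else g t \<omega> (x i))" for i t \<omega>
  define b where "b i t \<omega> = (if i = 0 \<or> i = Suc N then 0 else fi i t \<omega> - (W (i + 1) t \<omega> - 2 * W i t \<omega> + W (i - 1) t \<omega>) / h\<^sup>2)" for i t \<omega>
  have mm: "x (Suc i) \<in> mesh N" if "i < N" for i using mesh_mem[OF that] h by (simp add: x_def)
  have fP: "sq_integrable (PT T) (\<lambda>(t, \<omega>). fi (Suc i) t \<omega>)" if "i < N" for i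
    unfolding fi_def by (rule L2F_sq_integrable[OF f finite_meshes(1) mm[OF that] h0])
  have gP: "sq_integrable (PT T) (\<lambda>(t, \<omega>). gi (Suc i) t \<omega>)" if "i < N" for i
    using L2F_sq_integrable[OF g finite_meshes(1) mm[OF that] h0] that by (simp add: gi_def)
  have ito': "ito_process T (W (Suc i)) (b (Suc i)) (gi (Suc i)) (J i)" if "i < N" for i
  proof -
    have "b (Suc i) = (\<lambda>t \<omega>. f t \<omega> (real (Suc i) * h) - (W (i + 2) t \<omega> - 2 * W (Suc i) t \<omega> + W i t \<omega>) / h\<^sup>2)"
      "gi (Suc i) = (\<lambda>t \<omega>. g t \<omega> (real (Suc i) * h))"
      using that by (auto simp: b_def fi_def gi_def x_def fun_eq_iff)
    then show ?thesis using ito[OF that] by simp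
  qed
  have b_eq: "b (Suc i) t \<omega> = fi (Suc i) t \<omega> - (W (i + 2) t \<omega> - 2 * W (Suc i) t \<omega> + W i t \<omega>) / h\<^sup>2" if "i < N" for i t \<omega>
    using that by (simp add: b_def)
  have b0: "b 0 t \<omega> = 0" "b (Suc N) t \<omega> = 0" and g0: "gi 0 t \<omega> = 0" "gi (Suc N) t \<omega> = 0" for t \<omega>
    by (simp_all add: b_def gi_def)
  define A where "A t \<omega> = (\<Sum>i<N. s t ^ 3 * exp (2 * s t * \<phi>i (Suc i)) * (W (Suc i) t \<omega>)\<^sup>2)" for t \<omega>
  define D where "D t \<omega> = (\<Sum>i\<le>N. s t * exp (2 * s t * \<phi>m i) * ((W (Suc i) t \<omega> - W i t \<omega>) / h)\<^sup>2)" for t \<omega>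
  define L where "L t \<omega> = (\<Sum>i<N. \<zeta>i (Suc i) * (s t ^ 3 * exp (2 * s t * \<phi>i (Suc i)) * (W (Suc i) t \<omega>)\<^sup>2))" for t \<omega>
  define Ff where "Ff t \<omega> = (\<Sum>i<N. exp (2 * s t * \<phi>i (Suc i)) * (fi (Suc i) t \<omega>)\<^sup>2)" for t \<omega>
  define Gg where "Gg t \<omega> = (\<Sum>i<N. (s t)\<^sup>2 * exp (2 * s t * \<phi>i (Suc i)) * (gi (Suc i) t \<omega>)\<^sup>2)" for t \<omega>
  define E where "E t = expectation (\<lambda>\<omega>. \<Sum>i<N. exp (2 * s t * \<phi>i (Suc i)) * (W (Suc i) t \<omega>)\<^sup>2)" for t
  have est: "integrable (PT T) (\<lambda>(t, \<omega>). A t \<omega>)" "integrable (PT T) (\<lambda>(t, \<omega>). D t \<omega>)" "integrable (PT T) (\<lambda>(t, \<omega>). L t \<omega>)"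
    "integrable (PT T) (\<lambda>(t, \<omega>). Ff t \<omega>)" "integrable (PT T) (\<lambda>(t, \<omega>). Gg t \<omega>)"
    unfolding A_def D_def L_def Ff_def Gg_def E_def
    by (rule expected_carleman_estimate(1-5)[where W = W and b = b and f = fi and g = gi and J = J and ?s1.0 = s1 and ?s2.0 = s2 and \<phi>m = \<phi>m
          and N = N and h = h and K = K and ?c0.0 = c0 and \<eta> = \<eta> and \<zeta> = \<zeta>i and \<phi> = \<phi>i and s = s];
        (rule T cb ds cs m W0 WP WM fP gP b0 g0 b_eq ito')?; assumption?)+
  have est_main: "(\<integral>(t, \<omega>). A t \<omega> \<partial>PT T) + (\<integral>(t, \<omega>). D t \<omega> \<partial>PT T) \<le> 326 * K\<^sup>2 / c0 ^ 3 *
      (105 * K ^ 3 * (\<integral>(t, \<omega>). L t \<omega> \<partial>PT T) + (\<integral>(t, \<omega>). Ff t \<omega> \<partial>PT T) + 5 * K\<^sup>2 * (\<integral>(t, \<omega>). Gg t \<omega> \<partial>PT T)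
       + 9 * K\<^sup>2 / h\<^sup>2 * E 0 + 9 * K\<^sup>2 / h\<^sup>2 * E T)"
    unfolding A_def D_def L_def Ff_def Gg_def E_def
    by (rule expected_carleman_estimate(6)[where W = W and b = b and f = fi and g = gi and J = J and ?s1.0 = s1 and ?s2.0 = s2 and \<phi>m = \<phi>m
          and N = N and h = h and K = K and ?c0.0 = c0 and \<eta> = \<eta> and \<zeta> = \<zeta>i and \<phi> = \<phi>i and s = s];
        (rule T cb ds cs m W0 WP WM fP gP b0 g0 b_eq ito')?; assumption?)+
  \<comment> \<open>The observation integrand: the cutoff is at most 1 and vanishes outside omega,
    so it may be replaced by the indicator of omega.\<close>
  define Ob where "Ob t \<omega> = (\<Sum>i<N. if x (Suc i) \<in> U then s t ^ 3 * exp (2 * s t * \<phi>i (Suc i)) * (W (Suc i) t \<omega>)\<^sup>2 else 0)" for t \<omega>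
  have cont_s: "continuous_on {0..T} s"
    by (intro continuous_at_imp_continuous_on ballI DERIV_isCont[OF ds(1)])
  have iO: "integrable (PT T) (\<lambda>(t, \<omega>). Ob t \<omega>)"
  proof -
    have "integrable (PT T) (\<lambda>(t, \<omega>). s t ^ 3 * exp (2 * s t * \<phi>i (Suc i)) * (W (Suc i) t \<omega>)\<^sup>2)" if "i < N" for i
      using that sq_integrable_square[OF WP[of "Suc i"]]
      by (intro integrable_PT_times_continuous continuous_intros cont_s) (simp_all add: split_beta')
    then have "integrable (PT T) (\<lambda>z. if x (Suc i) \<in> U then (case z of (t, \<omega>) \<Rightarrow> s t ^ 3 * exp (2 * s t * \<phi>i (Suc i)) * (W (Suc i) t \<omega>)\<^sup>2) else 0)" if "i < N" for i
      using that by (cases "x (Suc i) \<in> U") simp_all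
    then show ?thesis unfolding Ob_def split_beta' by (intro Bochner_Integration.integrable_sum) auto
  qed
  have LO: "(\<integral>(t, \<omega>). L t \<omega> \<partial>PT T) \<le> (\<integral>(t, \<omega>). Ob t \<omega> \<partial>PT T)"
  proof (rule integral_mono[OF est(3) iO])
    fix z assume "z \<in> space (PT T)"
    then obtain t \<omega> where z: "z = (t, \<omega>)" "t \<in> {0..T}" by (auto simp: space_pair_measure)
    have "L t \<omega> \<le> Ob t \<omega>" unfolding L_def Ob_def
    proof (rule sum_mono)
      fix i
      have "0 \<le> s t ^ 3 * exp (2 * s t * \<phi>i (Suc i)) * (W (Suc i) t \<omega>)\<^sup>2" using tw(1)[OF z(2)] by simp
      then show "\<zeta>i (Suc i) * (s t ^ 3 * exp (2 * s t * \<phi>i (Suc i)) * (W (Suc i) t \<omega>)\<^sup>2)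
         \<le> (if x (Suc i) \<in> U then s t ^ 3 * exp (2 * s t * \<phi>i (Suc i)) * (W (Suc i) t \<omega>)\<^sup>2 else 0)"
        using \<zeta>(1,2,5)[of "x (Suc i)"] by (auto simp: \<zeta>i_def mult_left_le_one_le)
    qed
    then show "(case z of (t, \<omega>) \<Rightarrow> L t \<omega>) \<le> (case z of (t, \<omega>) \<Rightarrow> Ob t \<omega>)" by (simp add: z)
  qed
  have on_mesh: "(\<Sum>y\<in>mesh N. u y) = (\<Sum>i<N. u (x (Suc i)))" for u :: "real \<Rightarrow> real"
    unfolding sum_mesh x_def h(1) ..
  have on_dual_mesh: "(\<Sum>y\<in>dual_mesh N. u y) = (\<Sum>i\<le>N. u (x i + h / 2))" for u :: "real \<Rightarrow> real"
    unfolding sum_dual_mesh x_def h(1) ..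
  \<comment> \<open>Every mesh integral carries the same factor h, so the estimate for plain sums
    only has to be multiplied by h once.\<close>
  have eti: "expected_time_integral M T Fn = h * (\<integral>(t, \<omega>). G t \<omega> \<partial>PT T)"
    if i: "integrable (PT T) (\<lambda>(t, \<omega>). G t \<omega>)" and eq: "\<And>t \<omega>. t \<in> {0..T} \<Longrightarrow> \<forall>i\<le>Suc N. w t \<omega> (x i) = W i t \<omega> \<Longrightarrow> Fn t \<omega> = h * G t \<omega>" for Fn G
  proof -
    have "integrable (PT T) (\<lambda>(t, \<omega>). h * G t \<omega>)" using i by (simp add: split_beta')
    moreover have "AE \<omega> in M. \<forall>t\<in>{0..T}. Fn t \<omega> = h * G t \<omega>"
      using W by eventually_elim (simp add: eq x_def)
    ultimately have "expected_time_integral M T Fn = (\<integral>(t, \<omega>). h * G t \<omega> \<partial>PT T)"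
      by (rule expected_time_integral_eq[OF cM])
    then show ?thesis by (simp add: split_beta')
  qed
  have 1: "expected_time_integral M T (\<lambda>t \<omega>. mesh_integral h (mesh N) (\<lambda>x. s t ^ 3 * exp (2 * s t * \<phi> x) * (w t \<omega> x)\<^sup>2)) = h * (\<integral>(t, \<omega>). A t \<omega> \<partial>PT T)"
    by (rule eti[OF est(1)]) (simp add: mesh_integral_def on_mesh A_def \<phi>i_def)
  have 2: "expected_time_integral M T (\<lambda>t \<omega>. mesh_integral h (dual_mesh N) (\<lambda>x. s t * exp (2 * s t * \<phi> x) * \<bar>Dh h (w t \<omega>) x\<bar>\<^sup>2)) = h * (\<integral>(t, \<omega>). D t \<omega> \<partial>PT T)"
  proof (rule eti[OF est(2)])
    fix t \<omega> assume eq: "\<forall>i\<le>Suc N. w t \<omega> (x i) = W i t \<omega>"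
    have "Dh h (w t \<omega>) (x i + h / 2) = (W (Suc i) t \<omega> - W i t \<omega>) / h" if "i \<le> N" for i
    proof -
      have "x i + h / 2 + h / 2 = x (Suc i)" "x i + h / 2 - h / 2 = x i" by (simp_all add: x_def algebra_simps)
      then show ?thesis using eq that by (simp add: Dh_def)
    qed
    then show "mesh_integral h (dual_mesh N) (\<lambda>x. s t * exp (2 * s t * \<phi> x) * \<bar>Dh h (w t \<omega>) x\<bar>\<^sup>2) = h * D t \<omega>"
      by (simp add: mesh_integral_def on_dual_mesh D_def \<phi>m_def)
  qed
  have 3: "expected_time_integral M T (\<lambda>t \<omega>. mesh_integral h (U \<inter> mesh N) (\<lambda>x. s t ^ 3 * exp (2 * s t * \<phi> x) * (w t \<omega> x)\<^sup>2)) = h * (\<integral>(t, \<omega>). Ob t \<omega> \<partial>PT T)"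
  proof (rule eti[OF iO])
    fix t \<omega> assume eq: "\<forall>i\<le>Suc N. w t \<omega> (x i) = W i t \<omega>"
    have "(\<Sum>y\<in>U \<inter> mesh N. s t ^ 3 * exp (2 * s t * \<phi> y) * (w t \<omega> y)\<^sup>2) =
       (\<Sum>y\<in>mesh N. if y \<in> U then s t ^ 3 * exp (2 * s t * \<phi> y) * (w t \<omega> y)\<^sup>2 else 0)"
      by (subst Int_commute) (rule sum.inter_restrict[OF finite_meshes(1)])
    also have "\<dots> = Ob t \<omega>" using eq by (auto simp: on_mesh Ob_def \<phi>i_def intro!: sum.cong)
    finally show "mesh_integral h (U \<inter> mesh N) (\<lambda>x. s t ^ 3 * exp (2 * s t * \<phi> x) * (w t \<omega> x)\<^sup>2) = h * Ob t \<omega>"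
      by (simp add: mesh_integral_def)
  qed
  have 4: "expected_time_integral M T (\<lambda>t \<omega>. mesh_integral h (mesh N) (\<lambda>x. (s t)\<^sup>2 * exp (2 * s t * \<phi> x) * \<bar>g t \<omega> x\<bar>\<^sup>2)) = h * (\<integral>(t, \<omega>). Gg t \<omega> \<partial>PT T)"
    by (rule eti[OF est(5)]) (simp add: mesh_integral_def on_mesh Gg_def \<phi>i_def gi_def)
  have 5: "expected_time_integral M T (\<lambda>t \<omega>. mesh_integral h (mesh N) (\<lambda>x. exp (2 * s t * \<phi> x) * \<bar>f t \<omega> x\<bar>\<^sup>2)) = h * (\<integral>(t, \<omega>). Ff t \<omega> \<partial>PT T)"
    by (rule eti[OF est(4)]) (simp add: mesh_integral_def on_mesh Ff_def \<phi>i_def fi_def)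
  have 6: "(\<integral>\<omega>. mesh_integral h (mesh N) (\<lambda>x. exp (2 * s t * \<phi> x) * \<bar>w t \<omega> x\<bar>\<^sup>2) \<partial>M) = h * E t" if t: "t \<in> {0..T}" for t
  proof -
    have "(\<integral>\<omega>. mesh_integral h (mesh N) (\<lambda>x. exp (2 * s t * \<phi> x) * \<bar>w t \<omega> x\<bar>\<^sup>2) \<partial>M) =
      (\<integral>\<omega>. h * (\<Sum>i<N. exp (2 * s t * \<phi>i (Suc i)) * (W (Suc i) t \<omega>)\<^sup>2) \<partial>M)"
    proof (rule C.integral_cong_AE_complete)
      show "(\<lambda>\<omega>. h * (\<Sum>i<N. exp (2 * s t * \<phi>i (Suc i)) * (W (Suc i) t \<omega>)\<^sup>2)) \<in> borel_measurable M"
        using sq_integrable_measurable[OF WM] t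
        by (intro borel_measurable_times borel_measurable_sum borel_measurable_const borel_measurable_power) auto
      show "AE \<omega> in M. mesh_integral h (mesh N) (\<lambda>x. exp (2 * s t * \<phi> x) * \<bar>w t \<omega> x\<bar>\<^sup>2) = h * (\<Sum>i<N. exp (2 * s t * \<phi>i (Suc i)) * (W (Suc i) t \<omega>)\<^sup>2)"
        using W
      proof eventually_elim
        case (elim \<omega>)
        have "w t \<omega> (x (Suc i)) = W (Suc i) t \<omega>" if "i < N" for i
          using elim[rule_format, OF t, of "Suc i"] that by (simp add: x_def)
        then show ?case by (simp add: mesh_integral_def on_mesh \<phi>i_def)
      qed
    qed
    then show ?thesis by (simp add: E_def)
  qed
  let ?C1 = "326 * K\<^sup>2 / c0 ^ 3"
  have C1: "0 \<le> ?C1" using c0 by simp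
  have nn: "0 \<le> (\<integral>(t, \<omega>). Ff t \<omega> \<partial>PT T)" "0 \<le> (\<integral>(t, \<omega>). Gg t \<omega> \<partial>PT T)"
    by (auto intro!: integral_nonneg_AE AE_I2 sum_nonneg simp: Ff_def Gg_def)
  have En: "0 \<le> E t" for t unfolding E_def by (intro integral_nonneg_AE AE_I2 sum_nonneg) simp
  have K3: "1 \<le> K ^ 3" "K\<^sup>2 \<le> K ^ 3" using K by (simp_all add: one_le_power power_increasing)
  have "(\<integral>(t, \<omega>). A t \<omega> \<partial>PT T) + (\<integral>(t, \<omega>). D t \<omega> \<partial>PT T) \<le> ?C1 *
      (105 * K ^ 3 * (\<integral>(t, \<omega>). L t \<omega> \<partial>PT T) + (\<integral>(t, \<omega>). Ff t \<omega> \<partial>PT T) + 5 * K\<^sup>2 * (\<integral>(t, \<omega>). Gg t \<omega> \<partial>PT T)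
       + 9 * K\<^sup>2 / h\<^sup>2 * E 0 + 9 * K\<^sup>2 / h\<^sup>2 * E T)"
    by (rule est_main)
  also have "\<dots> \<le> ?C1 * (105 * K ^ 3 * (\<integral>(t, \<omega>). Ob t \<omega> \<partial>PT T) + 105 * K ^ 3 * (\<integral>(t, \<omega>). Ff t \<omega> \<partial>PT T)
       + 105 * K ^ 3 * (\<integral>(t, \<omega>). Gg t \<omega> \<partial>PT T) + 105 * K ^ 3 * (1 / h\<^sup>2 * E 0) + 105 * K ^ 3 * (1 / h\<^sup>2 * E T))"
  proof (intro mult_left_mono add_mono C1 LO)
    show "(\<integral>(t, \<omega>). Ff t \<omega> \<partial>PT T) \<le> 105 * K ^ 3 * (\<integral>(t, \<omega>). Ff t \<omega> \<partial>PT T)"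
      using mult_right_mono[OF _ nn(1), of 1 "105 * K ^ 3"] K3 by simp
    show "5 * K\<^sup>2 * (\<integral>(t, \<omega>). Gg t \<omega> \<partial>PT T) \<le> 105 * K ^ 3 * (\<integral>(t, \<omega>). Gg t \<omega> \<partial>PT T)"
      using K3 nn(2) by (intro mult_right_mono) auto
    have "9 * K\<^sup>2 / h\<^sup>2 * E t \<le> 105 * K ^ 3 * (1 / h\<^sup>2 * E t)" for t
    proof -
      have "9 * K\<^sup>2 * (1 / h\<^sup>2 * E t) \<le> 105 * K ^ 3 * (1 / h\<^sup>2 * E t)"
        using K3 En[of t] by (intro mult_right_mono) auto
      then show ?thesis by simp
    qed
    then show "9 * K\<^sup>2 / h\<^sup>2 * E 0 \<le> 105 * K ^ 3 * (1 / h\<^sup>2 * E 0)" "9 * K\<^sup>2 / h\<^sup>2 * E T \<le> 105 * K ^ 3 * (1 / h\<^sup>2 * E T)" by blast+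
  qed (use K in auto)
  finally have "h * ((\<integral>(t, \<omega>). A t \<omega> \<partial>PT T) + (\<integral>(t, \<omega>). D t \<omega> \<partial>PT T)) \<le> h * (?C1 * (105 * K ^ 3 * (\<integral>(t, \<omega>). Ob t \<omega> \<partial>PT T) + 105 * K ^ 3 * (\<integral>(t, \<omega>). Ff t \<omega> \<partial>PT T)
       + 105 * K ^ 3 * (\<integral>(t, \<omega>). Gg t \<omega> \<partial>PT T) + 105 * K ^ 3 * (1 / h\<^sup>2 * E 0) + 105 * K ^ 3 * (1 / h\<^sup>2 * E T)))"
    using h0 by (intro mult_left_mono) auto
  then show ?thesis
    unfolding 1 2 3 4 5 6[OF t0] 6[OF tT] by (simp add: algebra_simps add_divide_distrib)
qed

theorem theorem3p1:
  "\<exists>p\<^sub>0 :: nat. \<forall>p\<ge>p\<^sub>0.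
    \<forall>(M :: 'a measure) (B :: real \<Rightarrow> 'a \<Rightarrow> real) (T :: real)
      (U :: real set) (U\<^sub>0 :: real set) (G :: real set) (\<psi> :: real \<Rightarrow> real).
    complete_measure M \<and> standard_brownian_motion M B \<and> T > 0 \<and>
    open U \<and> U \<noteq> {} \<and> U \<subseteq> {0<..<1} \<and>
    open U\<^sub>0 \<and> U\<^sub>0 \<noteq> {} \<and> closure U\<^sub>0 \<subseteq> U \<and>
    admissible_psi p U\<^sub>0 G \<psi> \<longrightarrow>
    (\<exists>\<mu>\<^sub>0 > 0. \<forall>\<mu>. \<mu> > \<mu>\<^sub>0 \<and> \<mu> > 1 \<longrightarrow>
      (\<exists>\<epsilon>\<^sub>0 h\<^sub>0 \<Lambda>\<^sub>0 C :: real. 0 < \<epsilon>\<^sub>0 \<and> \<epsilon>\<^sub>0 \<le> 1 \<and> 0 < h\<^sub>0 \<and> 1 \<le> \<Lambda>\<^sub>0 \<and> 0 < C \<and>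
        (\<forall>(\<Lambda> :: real) (\<delta> :: real) (N :: nat) h w f g s.
           \<Lambda> \<ge> \<Lambda>\<^sub>0 \<and> \<Lambda> > 1 \<and> 0 < \<delta> \<and> \<delta> < 1/2 \<and>
           N \<ge> 1 \<and> h = mesh_size N \<and> h \<le> h\<^sub>0 \<and> \<Lambda> * h / (\<delta> * T\<^sup>2) \<le> \<epsilon>\<^sub>0 \<and>
           s = (\<lambda>t. \<Lambda> * theta T \<delta> t) \<and>
           w \<in> L2F_C M B T h (closed_mesh N) \<and>
           f \<in> L2F M B T h (mesh N) \<and> g \<in> L2F M B T h (mesh N) \<and>
           solves_equation M B T N w f g \<and>
           (AE \<omega> in M. \<forall>t\<in>{0..T}. w t \<omega> 0 = 0 \<and> w t \<omega> 1 = 0) \<longrightarrow>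
           expected_time_integral M T (\<lambda>t \<omega>. mesh_integral h (mesh N)
               (\<lambda>x. s t ^ 3 * exp (2 * s t * phi G \<psi> \<mu> x) * (w t \<omega> x)\<^sup>2))
           + expected_time_integral M T (\<lambda>t \<omega>. mesh_integral h (dual_mesh N)
               (\<lambda>x. s t * exp (2 * s t * phi G \<psi> \<mu> x) * \<bar>Dh h (w t \<omega>) x\<bar>\<^sup>2))
           \<le> C *
            (expected_time_integral M T (\<lambda>t \<omega>. mesh_integral h (U \<inter> mesh N)
               (\<lambda>x. s t ^ 3 * exp (2 * s t * phi G \<psi> \<mu> x) * (w t \<omega> x)\<^sup>2))
           + expected_time_integral M T (\<lambda>t \<omega>. mesh_integral h (mesh N)
               (\<lambda>x. (s t)\<^sup>2 * exp (2 * s t * phi G \<psi> \<mu> x) * \<bar>g t \<omega> x\<bar>\<^sup>2))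
           + expected_time_integral M T (\<lambda>t \<omega>. mesh_integral h (mesh N)
               (\<lambda>x. exp (2 * s t * phi G \<psi> \<mu> x) * \<bar>f t \<omega> x\<bar>\<^sup>2))
           + 1 / h\<^sup>2 * (\<integral>\<omega>. mesh_integral h (mesh N)
               (\<lambda>x. exp (2 * s 0 * phi G \<psi> \<mu> x) * \<bar>w 0 \<omega> x\<bar>\<^sup>2) \<partial>M)
           + 1 / h\<^sup>2 * (\<integral>\<omega>. mesh_integral h (mesh N)
               (\<lambda>x. exp (2 * s T * phi G \<psi> \<mu> x) * \<bar>w T \<omega> x\<bar>\<^sup>2) \<partial>M)))))"
\<comment> \<open>Four derivatives of psi make its third derivative continuous, which bounds the
  third differences of phi.\<close>
proof (rule exI[of _ 4], intro allI impI, elim conjE)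
  fix p :: nat and M :: "'a measure" and B :: "real \<Rightarrow> 'a \<Rightarrow> real" and T :: real and U U\<^sub>0 G :: "real set" and \<psi> :: "real \<Rightarrow> real"
  assume p: "4 \<le> p" and cM: "complete_measure M" and BM: "standard_brownian_motion M B" and T: "0 < T"
    and U: "open U" "U \<noteq> {}" "U \<subseteq> {0<..<1}" and U0: "open U\<^sub>0" "U\<^sub>0 \<noteq> {}" "closure U\<^sub>0 \<subseteq> U"
    and adm: "admissible_psi p U\<^sub>0 G \<psi>"
  interpret standard_brownian_motion M B by (rule BM)
  have U01: "U\<^sub>0 \<subseteq> {0<..<1}" using U U0 closure_subset by blast
  obtain \<zeta> L where \<zeta>: "\<And>x. 0 \<le> \<zeta> x" "\<And>x. \<zeta> x \<le> 1" "\<And>x y. \<bar>\<zeta> x - \<zeta> y\<bar> \<le> L * \<bar>x - y\<bar>"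
    "\<And>x. x \<in> U\<^sub>0 \<Longrightarrow> \<zeta> x = 1" "\<And>x. x \<notin> U \<Longrightarrow> \<zeta> x = 0" and L: "(0::real) \<le> L"
    using lipschitz_cutoff[OF U(1) U0(2,3) U(3)] by metis
  obtain \<mu>\<^sub>0 where mu0: "0 < \<mu>\<^sub>0" and wb: "\<forall>\<mu>>\<mu>\<^sub>0. \<exists>f1 f2 f3 K c0. 1 \<le> K \<and> 0 < c0 \<and> c0 \<le> 1 \<and>
    (\<forall>x\<in>{0..1}. (phi G \<psi> \<mu> has_real_derivative f1 x) (at x) \<and> (f1 has_real_derivative f2 x) (at x) \<and>
       (f2 has_real_derivative f3 x) (at x) \<and>
       \<bar>phi G \<psi> \<mu> x\<bar> \<le> K \<and> \<bar>f1 x\<bar> \<le> K \<and> \<bar>f2 x\<bar> \<le> K \<and> \<bar>f3 x\<bar> \<le> K \<and>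
       (x \<notin> U\<^sub>0 \<longrightarrow> 2 * c0 \<le> f2 x \<and> 2 * c0 \<le> \<bar>f1 x\<bar>)) \<and> 0 < f1 0 \<and> f1 1 < 0"
    using weight_bounds[OF adm p U0(1) U01] by blast
  show "\<exists>\<mu>\<^sub>0 > 0. \<forall>\<mu>. \<mu> > \<mu>\<^sub>0 \<and> \<mu> > 1 \<longrightarrow>
      (\<exists>\<epsilon>\<^sub>0 h\<^sub>0 \<Lambda>\<^sub>0 C :: real. 0 < \<epsilon>\<^sub>0 \<and> \<epsilon>\<^sub>0 \<le> 1 \<and> 0 < h\<^sub>0 \<and> 1 \<le> \<Lambda>\<^sub>0 \<and> 0 < C \<and>
        (\<forall>(\<Lambda> :: real) (\<delta> :: real) (N :: nat) h w f g s.
           \<Lambda> \<ge> \<Lambda>\<^sub>0 \<and> \<Lambda> > 1 \<and> 0 < \<delta> \<and> \<delta> < 1/2 \<and>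
           N \<ge> 1 \<and> h = mesh_size N \<and> h \<le> h\<^sub>0 \<and> \<Lambda> * h / (\<delta> * T\<^sup>2) \<le> \<epsilon>\<^sub>0 \<and>
           s = (\<lambda>t. \<Lambda> * theta T \<delta> t) \<and>
           w \<in> L2F_C M B T h (closed_mesh N) \<and>
           f \<in> L2F M B T h (mesh N) \<and> g \<in> L2F M B T h (mesh N) \<and>
           solves_equation M B T N w f g \<and>
           (AE \<omega> in M. \<forall>t\<in>{0..T}. w t \<omega> 0 = 0 \<and> w t \<omega> 1 = 0) \<longrightarrow>
           expected_time_integral M T (\<lambda>t \<omega>. mesh_integral h (mesh N)
               (\<lambda>x. s t ^ 3 * exp (2 * s t * phi G \<psi> \<mu> x) * (w t \<omega> x)\<^sup>2))
           + expected_time_integral M T (\<lambda>t \<omega>. mesh_integral h (dual_mesh N)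
               (\<lambda>x. s t * exp (2 * s t * phi G \<psi> \<mu> x) * \<bar>Dh h (w t \<omega>) x\<bar>\<^sup>2))
           \<le> C *
            (expected_time_integral M T (\<lambda>t \<omega>. mesh_integral h (U \<inter> mesh N)
               (\<lambda>x. s t ^ 3 * exp (2 * s t * phi G \<psi> \<mu> x) * (w t \<omega> x)\<^sup>2))
           + expected_time_integral M T (\<lambda>t \<omega>. mesh_integral h (mesh N)
               (\<lambda>x. (s t)\<^sup>2 * exp (2 * s t * phi G \<psi> \<mu> x) * \<bar>g t \<omega> x\<bar>\<^sup>2))
           + expected_time_integral M T (\<lambda>t \<omega>. mesh_integral h (mesh N)
               (\<lambda>x. exp (2 * s t * phi G \<psi> \<mu> x) * \<bar>f t \<omega> x\<bar>\<^sup>2))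
           + 1 / h\<^sup>2 * (\<integral>\<omega>. mesh_integral h (mesh N)
               (\<lambda>x. exp (2 * s 0 * phi G \<psi> \<mu> x) * \<bar>w 0 \<omega> x\<bar>\<^sup>2) \<partial>M)
           + 1 / h\<^sup>2 * (\<integral>\<omega>. mesh_integral h (mesh N)
               (\<lambda>x. exp (2 * s T * phi G \<psi> \<mu> x) * \<bar>w T \<omega> x\<bar>\<^sup>2) \<partial>M))))"
  proof (rule exI[of _ \<mu>\<^sub>0], rule conjI[OF mu0], intro allI impI)
    fix \<mu> assume "\<mu>\<^sub>0 < \<mu> \<and> 1 < \<mu>"
    then obtain f1 f2 f3 K0 c0 where K0: "1 \<le> K0" and c0: "0 < c0" "c0 \<le> 1"
      and wx: "\<forall>x\<in>{0..1}. (phi G \<psi> \<mu> has_real_derivative f1 x) (at x) \<and> (f1 has_real_derivative f2 x) (at x) \<and>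
       (f2 has_real_derivative f3 x) (at x) \<and>
       \<bar>phi G \<psi> \<mu> x\<bar> \<le> K0 \<and> \<bar>f1 x\<bar> \<le> K0 \<and> \<bar>f2 x\<bar> \<le> K0 \<and> \<bar>f3 x\<bar> \<le> K0 \<and>
       (x \<notin> U\<^sub>0 \<longrightarrow> 2 * c0 \<le> f2 x \<and> 2 * c0 \<le> \<bar>f1 x\<bar>)" and ends: "0 < f1 0" "f1 1 < 0"
      using wb by blast
    \<comment> \<open>One constant must bound both the derivatives of phi, which depend on mu, and
      the slope of the cutoff, which depends only on omega and omega_0.\<close>
    define K where "K = max K0 L"
    have K: "1 \<le> K" "K0 \<le> K" "L \<le> K" using K0 by (auto simp: K_def)
    have zl: "\<bar>\<zeta> x - \<zeta> y\<bar> \<le> K * \<bar>x - y\<bar>" for x y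
      using \<zeta>(3)[of x y] mult_right_mono[OF K(3), of "\<bar>x - y\<bar>"] by simp
    have d: "(phi G \<psi> \<mu> has_real_derivative f1 x) (at x)" "(f1 has_real_derivative f2 x) (at x)"
      "(f2 has_real_derivative f3 x) (at x)" if "x \<in> {0..1}" for x
      using wx that by blast+
    have bd: "\<bar>phi G \<psi> \<mu> x\<bar> \<le> K" "\<bar>f1 x\<bar> \<le> K" "\<bar>f2 x\<bar> \<le> K" "\<bar>f3 x\<bar> \<le> K" if "x \<in> {0..1}" for x
      using wx that K(2) by (meson order_trans)+
    have pos: "2 * c0 \<le> f2 x \<and> 2 * c0 \<le> \<bar>f1 x\<bar>" if "x \<in> {0..1}" "x \<notin> U\<^sub>0" for x
      using wx that by blast
    define \<eta> where "\<eta> = c0 ^ 4 / (700 * K ^ 5)"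
    have \<eta>: "0 < \<eta>" using c0 K by (simp add: \<eta>_def)
    have \<eta>1: "\<eta> \<le> 1"
    proof -
      have "c0 ^ 4 \<le> 1" using c0 by (simp add: power_le_one)
      moreover have "1 \<le> K ^ 5" using K by (simp add: one_le_power)
      ultimately have "c0 ^ 4 \<le> 1 * (700 * K ^ 5)" by linarith
      then show ?thesis unfolding \<eta>_def using K by (subst pos_divide_le_eq) auto
    qed
    \<comment> \<open>The thresholds making s' and s'' small; the third requirement, T^2 / \<eta>,
      is implied by 4 T^2 / \<eta>. They depend on T and mu but not on delta or h.\<close>
    define \<Lambda>\<^sub>0 where "\<Lambda>\<^sub>0 = max 1 (max (T / \<eta>) (4 * T\<^sup>2 / \<eta>))"
    define C where "C = 326 * K\<^sup>2 / c0 ^ 3 * (105 * K ^ 3)"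
    show "\<exists>\<epsilon>\<^sub>0 h\<^sub>0 \<Lambda>\<^sub>0 C :: real. 0 < \<epsilon>\<^sub>0 \<and> \<epsilon>\<^sub>0 \<le> 1 \<and> 0 < h\<^sub>0 \<and> 1 \<le> \<Lambda>\<^sub>0 \<and> 0 < C \<and>
        (\<forall>(\<Lambda> :: real) (\<delta> :: real) (N :: nat) h w f g s.
           \<Lambda> \<ge> \<Lambda>\<^sub>0 \<and> \<Lambda> > 1 \<and> 0 < \<delta> \<and> \<delta> < 1/2 \<and>
           N \<ge> 1 \<and> h = mesh_size N \<and> h \<le> h\<^sub>0 \<and> \<Lambda> * h / (\<delta> * T\<^sup>2) \<le> \<epsilon>\<^sub>0 \<and>
           s = (\<lambda>t. \<Lambda> * theta T \<delta> t) \<and>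
           w \<in> L2F_C M B T h (closed_mesh N) \<and>
           f \<in> L2F M B T h (mesh N) \<and> g \<in> L2F M B T h (mesh N) \<and>
           solves_equation M B T N w f g \<and>
           (AE \<omega> in M. \<forall>t\<in>{0..T}. w t \<omega> 0 = 0 \<and> w t \<omega> 1 = 0) \<longrightarrow>
           expected_time_integral M T (\<lambda>t \<omega>. mesh_integral h (mesh N)
               (\<lambda>x. s t ^ 3 * exp (2 * s t * phi G \<psi> \<mu> x) * (w t \<omega> x)\<^sup>2))
           + expected_time_integral M T (\<lambda>t \<omega>. mesh_integral h (dual_mesh N)
               (\<lambda>x. s t * exp (2 * s t * phi G \<psi> \<mu> x) * \<bar>Dh h (w t \<omega>) x\<bar>\<^sup>2))
           \<le> C *
            (expected_time_integral M T (\<lambda>t \<omega>. mesh_integral h (U \<inter> mesh N)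
               (\<lambda>x. s t ^ 3 * exp (2 * s t * phi G \<psi> \<mu> x) * (w t \<omega> x)\<^sup>2))
           + expected_time_integral M T (\<lambda>t \<omega>. mesh_integral h (mesh N)
               (\<lambda>x. (s t)\<^sup>2 * exp (2 * s t * phi G \<psi> \<mu> x) * \<bar>g t \<omega> x\<bar>\<^sup>2))
           + expected_time_integral M T (\<lambda>t \<omega>. mesh_integral h (mesh N)
               (\<lambda>x. exp (2 * s t * phi G \<psi> \<mu> x) * \<bar>f t \<omega> x\<bar>\<^sup>2))
           + 1 / h\<^sup>2 * (\<integral>\<omega>. mesh_integral h (mesh N)
               (\<lambda>x. exp (2 * s 0 * phi G \<psi> \<mu> x) * \<bar>w 0 \<omega> x\<bar>\<^sup>2) \<partial>M)
           + 1 / h\<^sup>2 * (\<integral>\<omega>. mesh_integral h (mesh N)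
               (\<lambda>x. exp (2 * s T * phi G \<psi> \<mu> x) * \<bar>w T \<omega> x\<bar>\<^sup>2) \<partial>M)))"
    \<comment> \<open>The same \<open>\<eta>\<close> serves as the bound on the mesh condition and
      as the bound on h.\<close>
    proof (rule exI[of _ \<eta>], rule exI[of _ \<eta>], rule exI[of _ \<Lambda>\<^sub>0], rule exI[of _ C], intro conjI allI impI)
      show "0 < \<eta>" "\<eta> \<le> 1" "0 < \<eta>" "1 \<le> \<Lambda>\<^sub>0" "0 < C"
        using \<eta> \<eta>1 c0 K by (auto simp: \<Lambda>\<^sub>0_def C_def)
      fix \<Lambda> \<delta> :: real and N :: nat and h w f g and s :: "real \<Rightarrow> real"
      assume hyp: "\<Lambda> \<ge> \<Lambda>\<^sub>0 \<and> \<Lambda> > 1 \<and> 0 < \<delta> \<and> \<delta> < 1/2 \<and>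
           N \<ge> 1 \<and> h = mesh_size N \<and> h \<le> \<eta> \<and> \<Lambda> * h / (\<delta> * T\<^sup>2) \<le> \<eta> \<and>
           s = (\<lambda>t. \<Lambda> * theta T \<delta> t) \<and>
           w \<in> L2F_C M B T h (closed_mesh N) \<and>
           f \<in> L2F M B T h (mesh N) \<and> g \<in> L2F M B T h (mesh N) \<and>
           solves_equation M B T N w f g \<and>
           (AE \<omega> in M. \<forall>t\<in>{0..T}. w t \<omega> 0 = 0 \<and> w t \<omega> 1 = 0)"
      then have a: "\<Lambda>\<^sub>0 \<le> \<Lambda>" "0 < \<delta>" "\<delta> < 1/2" "1 \<le> N" "h = mesh_size N" "h \<le> \<eta>" "\<Lambda> * h / (\<delta> * T\<^sup>2) \<le> \<eta>"
        "s = (\<lambda>t. \<Lambda> * theta T \<delta> t)" "w \<in> L2F_C M B T h (closed_mesh N)" "f \<in> L2F M B T h (mesh N)"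
        "g \<in> L2F M B T h (mesh N)" "solves_equation M B T N w f g"
        "AE \<omega> in M. \<forall>t\<in>{0..T}. w t \<omega> 0 = 0 \<and> w t \<omega> 1 = 0"
        by blast+
      have lam: "1 \<le> \<Lambda>" "T / \<eta> \<le> \<Lambda>" "4 * T\<^sup>2 / \<eta> \<le> \<Lambda>" using a(1) by (auto simp: \<Lambda>\<^sub>0_def)
      have "T\<^sup>2 / \<eta> \<le> 4 * T\<^sup>2 / \<eta>" using \<eta> by (intro divide_right_mono) auto
      then have lam2: "T\<^sup>2 / \<eta> \<le> \<Lambda>" using lam by linarith
      have N: "0 < N" using a by simp
      show "expected_time_integral M T (\<lambda>t \<omega>. mesh_integral h (mesh N)
               (\<lambda>x. s t ^ 3 * exp (2 * s t * phi G \<psi> \<mu> x) * (w t \<omega> x)\<^sup>2))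
           + expected_time_integral M T (\<lambda>t \<omega>. mesh_integral h (dual_mesh N)
               (\<lambda>x. s t * exp (2 * s t * phi G \<psi> \<mu> x) * \<bar>Dh h (w t \<omega>) x\<bar>\<^sup>2))
           \<le> C *
            (expected_time_integral M T (\<lambda>t \<omega>. mesh_integral h (U \<inter> mesh N)
               (\<lambda>x. s t ^ 3 * exp (2 * s t * phi G \<psi> \<mu> x) * (w t \<omega> x)\<^sup>2))
           + expected_time_integral M T (\<lambda>t \<omega>. mesh_integral h (mesh N)
               (\<lambda>x. (s t)\<^sup>2 * exp (2 * s t * phi G \<psi> \<mu> x) * \<bar>g t \<omega> x\<bar>\<^sup>2))
           + expected_time_integral M T (\<lambda>t \<omega>. mesh_integral h (mesh N)
               (\<lambda>x. exp (2 * s t * phi G \<psi> \<mu> x) * \<bar>f t \<omega> x\<bar>\<^sup>2))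
           + 1 / h\<^sup>2 * (\<integral>\<omega>. mesh_integral h (mesh N)
               (\<lambda>x. exp (2 * s 0 * phi G \<psi> \<mu> x) * \<bar>w 0 \<omega> x\<bar>\<^sup>2) \<partial>M)
           + 1 / h\<^sup>2 * (\<integral>\<omega>. mesh_integral h (mesh N)
               (\<lambda>x. exp (2 * s T * phi G \<psi> \<mu> x) * \<bar>w T \<omega> x\<bar>\<^sup>2) \<partial>M))"
        unfolding C_def
        by (rule carleman_estimate[OF cM T, where ?f1.0 = f1 and ?f2.0 = f2 and ?f3.0 = f3 and ?U0.0 = U\<^sub>0 and \<zeta> = \<zeta> and \<eta> = \<eta> and \<Lambda> = \<Lambda> and \<delta> = \<delta>];
            (rule d bd pos ends U01 \<zeta>(1,2) zl \<zeta>(4,5) K(1) c0 \<eta>_def N lam lam2 a)?; assumption?)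
    qed
  qed
qed

end
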